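(* Let $k$ be a finite field of characteristic $p$ and $G$ a compact $p$-adic analytic group with finite radical $\Delta^+$. Let $\mathfrak{M}$ be a minimal prime ideal of $kG$, let $\mathfrak{p}$ be a minimal prime ideal of $k\Delta^+$ containing $\mathfrak{M}\cap k\Delta^+$, let $G_1$ be the open subgroup of $G$ stabilising $\mathfrak{p}$, and let $\mathfrak{N}\lhd kG_1$ and $\widetilde{\mu}: kG/\mathfrak{M} \to M_{r}(kG_1/\mathfrak{N})$ be the minimal prime (with $\mathfrak{N}\cap k\Delta^+=\mathfrak{p}$) and the isomorphism described in the context. Let $P$ be an ideal of $kG$ containing $\mathfrak{M}$, and write $Q$ for the ideal of $kG_1$ containing $\mathfrak{N}$ such that $\widetilde{\mu}(P/\mathfrak{M}) = M_r(Q/\mathfrak{N})$. Let $H$ be any closed normal subgroup of $G$ containing $\Delta^+$, and let $H_1 = H\cap G_1$. Then: (i) $P$ is prime if and only if $Q$ is prime; (ii) $P$ is controlled by $H$ if and only if $Q$ is controlled by $H_1$; (iii) $\displaystyle P^\dagger = \bigcap_{g\in G} \left(Q^\dagger\right)^g$.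
   Context: Completed group rings: $kG=k[[G]]=\varprojlim_N k[G/N]$ over open normal subgroups $N$. Finite radical: $\Delta^+=\{x\in G: o(x)<\infty,\ [G:\mathbf{C}_G(x)]<\infty\}$, the largest finite normal subgroup of $G$. For an ideal $I$ of $kG$: $I^\dagger=\{x\in G:x-1\in I\}$; and $I$ is controlled by a closed normal subgroup $H$ if $(I\cap kH)kG=I$. (For $Q\lhd kG_1$ these are taken with respect to $G_1$.) For a subgroup $K$, $K^g=g^{-1}Kg$. Construction of $\widetilde\mu$ and $\mathfrak{N}$. $J(-)$ is the Jacobson radical; $J(k\Delta^+)kG$ is a two-sided ideal of $kG$, and $\overline{(-)}$ denotes images in $kG/J(k\Delta^+)kG$ (similarly for $kG_1$; $\overline{kG_1}\subseteq\overline{kG}$). A centrally primitive idempotent is a central idempotent that is not a sum of two nonzero orthogonal central idempotents. There is a centrally primitive idempotent $e$ of $\overline{k\Delta^+}$ such that $\mathfrak{p}$ is the full preimage in $k\Delta^+$ of $(1-e)\overline{k\Delta^+}$, and $G_1$ is the centraliser of $e$ in $G$. Let $e=e_1,\dots,e_r$ be the (finite) $G$-orbit of $e$ under conjugation, a set of mutually orthogonal idempotents, and $f=e_1+\dots+e_r$; then $\mathfrak{M}$ is the full preimage in $kG$ of $(1-f)\overline{kG}$, so $kG/\mathfrak{M}\cong f\cdot\overline{kG}=:R$. Let $\mathfrak{N}$ be the full preimage in $kG_1$ of $(1-e)\overline{kG_1}$, a minimal prime of $kG_1$, so $kG_1/\mathfrak{N}\cong e\cdot\overline{kG_1}=e\cdot\overline{kG}\cdot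 e$. Choose $1=g_1,\dots,g_r\in G$ with $g_ie_1=e_ig_i$. Then $R=\bigoplus_{i,j}e_iRe_j$, and $\mu:R\to M_r(e_1Re_1)$ is the ring isomorphism which sends $x\in e_iRe_j$ to the matrix with $(i,j)$-entry $g_i^{-1}xg_j$ and all other entries $0$. The isomorphism $\widetilde\mu$ is the composite $kG/\mathfrak{M}\cong R\xrightarrow{\mu}M_r(e\cdot\overline{kG}\cdot e)=M_r(e\cdot\overline{kG_1})\cong M_r(kG_1/\mathfrak{N})$.
   Formalization: Part (iii) is stated only for proper ideals P: for P = kG one has Q = kG₁, so P† = G while the intersection of the conjugates of Q† = G₁ is smaller than G whenever r > 1. *)

theory Defs
  imports
    "HOL-Analysis.Analysis"
    "HOL-Algebra.QuotRing"
    "HOL-Algebra.Ideal_Product"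
begin

section \<open>The field of p-adic numbers\<close>

text \<open>The \<open>p\<close>-adic absolute value on the rationals, normalised by \<open>|p| = 1/p\<close>.\<close>

definition padic_abs :: "nat \<Rightarrow> rat \<Rightarrow> real" where
  "padic_abs p q = (if q = 0 then 0 else
     (case quotient_of q of (a, b) \<Rightarrow>
        real p powi (int (multiplicity (int p) b) - int (multiplicity (int p) a))))"

lemma padic_abs_0 [simp]: "padic_abs p 0 = 0"
  by (simp add: padic_abs_def)

lemma padic_abs_frac:
  assumes "prime p" "a \<noteq> 0" "b \<noteq> 0"
  shows "padic_abs p (of_int a / of_int b) =
    real p powi (int (multiplicity (int p) b) - int (multiplicity (int p) a))"
proof -
  obtain a' b' where q: "quotient_of (of_int a / of_int b) = (a', b')" by fastforce
  have b': "b' > 0" using quotient_of_denom_pos[OF q] .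
  have e: "(of_int a / of_int b :: rat) = of_int a' / of_int b'" using quotient_of_div[OF q] .
  hence "(of_int a * of_int b' :: rat) = of_int a' * of_int b"
    using assms b' by (simp add: field_simps)
  hence m: "a * b' = a' * b" by (metis of_int_eq_iff of_int_mult)
  have a': "a' \<noteq> 0" using m assms b' by auto
  have p: "prime_elem (int p)" using assms by auto
  have "multiplicity (int p) (a * b') = multiplicity (int p) (a' * b)" using m by simp
  hence "multiplicity (int p) a + multiplicity (int p) b' = multiplicity (int p) a' + multiplicity (int p) b"
    using p assms a' b' by (simp add: prime_elem_multiplicity_mult_distrib)
  hence "int (multiplicity (int p) b) - int (multiplicity (int p) a) =
         int (multiplicity (int p) b') - int (multiplicity (int p) a')" by linarith
  thus ?thesis using assms q by (simp add: padic_abs_def)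
qed

lemma padic_abs_pos:
  assumes "prime p" "q \<noteq> 0" shows "padic_abs p q > 0"
proof -
  have "real p > 0" using assms(1) prime_gt_0_nat by simp
  thus ?thesis using assms(2) by (simp add: padic_abs_def split: prod.split)
qed

lemma padic_abs_nonneg: "prime p \<Longrightarrow> padic_abs p q \<ge> 0"
  by (cases "q = 0") (auto simp: less_imp_le padic_abs_pos)

lemma padic_abs_mult:
  assumes "prime p" shows "padic_abs p (x * y) = padic_abs p x * padic_abs p y"
proof (cases "x = 0 \<or> y = 0")
  case False
  obtain a b where x: "x = of_int a / of_int b" "b \<noteq> 0"
    by (metis less_numeral_extra(3) quotient_of_denom_pos quotient_of_div surj_pair)
  obtain c d where y: "y = of_int c / of_int d" "d \<noteq> 0"
    by (metis less_numeral_extra(3) quotient_of_denom_pos quotient_of_div surj_pair)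
  have nz: "a \<noteq> 0" "c \<noteq> 0" using x y False by auto
  have p: "prime_elem (int p)" "real p \<noteq> 0" using assms by auto
  have "x * y = of_int (a * c) / of_int (b * d)" using x y by simp
  hence "padic_abs p (x * y) = real p powi (int (multiplicity (int p) (b * d)) - int (multiplicity (int p) (a * c)))"
    using padic_abs_frac[OF assms, of "a*c" "b*d"] nz x y by simp
  also have "\<dots> = real p powi ((int (multiplicity (int p) b) - int (multiplicity (int p) a)) +
                                 (int (multiplicity (int p) d) - int (multiplicity (int p) c)))"
    using p nz x y by (simp add: prime_elem_multiplicity_mult_distrib algebra_simps)
  also have "\<dots> = padic_abs p x * padic_abs p y"
    using p padic_abs_frac[OF assms] nz x y by (simp add: power_int_add)
  finally show ?thesis .
qed auto

lemma padic_abs_1 [simp]: "prime p \<Longrightarrow> padic_abs p 1 = 1"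
  using padic_abs_frac[of p 1 1] by simp

lemma padic_abs_minus [simp]: "prime p \<Longrightarrow> padic_abs p (- x) = padic_abs p x"
proof -
  assume p: "prime p"
  have "padic_abs p (-1) = 1" using padic_abs_frac[OF p, of "-1" 1] multiplicity_unit_right[of "-1" "int p"] by simp
  thus ?thesis using padic_abs_mult[OF p, of "-1" x] by simp
qed

lemma padic_abs_add:
  assumes p: "prime p" shows "padic_abs p (x + y) \<le> max (padic_abs p x) (padic_abs p y)"
proof (cases "x = 0 \<or> y = 0 \<or> x + y = 0")
  case False
  obtain a b where x: "x = of_int a / of_int b" "b \<noteq> 0"
    by (metis less_numeral_extra(3) quotient_of_denom_pos quotient_of_div surj_pair)
  obtain c d where y: "y = of_int c / of_int d" "d \<noteq> 0"
    by (metis less_numeral_extra(3) quotient_of_denom_pos quotient_of_div surj_pair)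
  let ?v = "multiplicity (int p)"
  have nz: "a \<noteq> 0" "c \<noteq> 0" using x y False by auto
  have pe: "prime_elem (int p)" "real p \<ge> 1" using p prime_ge_1_nat[of p] by auto
  have X: "x = of_int (a * d) / of_int (b * d)" and Y: "y = of_int (c * b) / of_int (b * d)"
    using x y by auto
  hence S: "x + y = of_int (a * d + c * b) / of_int (b * d)" by (simp add: add_divide_distrib)
  hence s: "a * d + c * b \<noteq> 0" using False by (metis div_0 of_int_0)
  have "\<not> is_unit (int p)" using prime_gt_1_nat[OF p] by simp
  hence m: "?v (a * d + c * b) \<ge> min (?v (a * d)) (?v (c * b))"
    using s by (intro multiplicity_geI) (simp_all add: dvd_add multiplicity_dvd')
  have fx: "padic_abs p x = real p powi (int (?v (b * d)) - int (?v (a * d)))"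
    unfolding X by (rule padic_abs_frac[OF p]) (use nz x y in simp_all)
  have fy: "padic_abs p y = real p powi (int (?v (b * d)) - int (?v (c * b)))"
    unfolding Y by (rule padic_abs_frac[OF p]) (use nz x y in simp_all)
  have fs: "padic_abs p (x + y) = real p powi (int (?v (b * d)) - int (?v (a * d + c * b)))"
    unfolding S by (rule padic_abs_frac[OF p]) (use s x y in simp_all)
  show ?thesis
  proof (cases "?v (a * d) \<le> ?v (c * b)")
    case True
    hence "padic_abs p (x + y) \<le> padic_abs p x"
      unfolding fx fs using m pe by (intro power_int_increasing) auto
    thus ?thesis by simp
  next
    case False
    hence "padic_abs p (x + y) \<le> padic_abs p y"
      unfolding fy fs using m pe by (intro power_int_increasing) auto
    thus ?thesis by simp
  qed
qed (auto simp: padic_abs_nonneg[OF p] eq_neg_iff_add_eq_0 max_def)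

lemma padic_abs_triangle:
  assumes "prime p" shows "padic_abs p (x + y) \<le> padic_abs p x + padic_abs p y"
  using padic_abs_add[OF assms, of x y] padic_abs_nonneg[OF assms, of x] padic_abs_nonneg[OF assms, of y]
  by linarith

lemma padic_abs_triangle_diff:
  assumes "prime p" shows "\<bar>padic_abs p x - padic_abs p y\<bar> \<le> padic_abs p (x - y)"
  using padic_abs_triangle[OF assms, of "x - y" y] padic_abs_triangle[OF assms, of "y - x" x]
    padic_abs_minus[OF assms, of "x - y"] by simp

definition padic_Cauchy :: "nat \<Rightarrow> (nat \<Rightarrow> rat) \<Rightarrow> bool" where
  "padic_Cauchy p X \<longleftrightarrow> (\<forall>\<epsilon>>0. \<exists>M. \<forall>m\<ge>M. \<forall>n\<ge>M. padic_abs p (X m - X n) < \<epsilon>)"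

definition padic_rel :: "nat \<Rightarrow> (nat \<Rightarrow> rat) \<Rightarrow> (nat \<Rightarrow> rat) \<Rightarrow> bool" where
  "padic_rel p X Y \<longleftrightarrow> padic_Cauchy p X \<and> padic_Cauchy p Y \<and>
     (\<lambda>n. padic_abs p (X n - Y n)) \<longlonglongrightarrow> 0"

lemma padic_Cauchy_const: "padic_Cauchy p (\<lambda>_. q)"
  by (simp add: padic_Cauchy_def)

lemma padic_null_le:
  assumes "prime p" "Y \<longlonglongrightarrow> 0" "\<And>n. padic_abs p (X n) \<le> Y n"
  shows "(\<lambda>n. padic_abs p (X n)) \<longlonglongrightarrow> 0"
  using assms by (intro tendsto_sandwich[OF _ _ tendsto_const assms(2)]) (auto simp: padic_abs_nonneg)

lemma padic_Cauchy_Cauchy: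
  assumes p: "prime p" and X: "padic_Cauchy p X"
  shows "Cauchy (\<lambda>n. padic_abs p (X n))"
  unfolding Cauchy_def dist_real_def
proof (intro allI impI)
  fix e :: real assume "e > 0"
  then obtain M where "\<forall>m\<ge>M. \<forall>n\<ge>M. padic_abs p (X m - X n) < e" using X by (auto simp: padic_Cauchy_def)
  thus "\<exists>M. \<forall>m\<ge>M. \<forall>n\<ge>M. \<bar>padic_abs p (X m) - padic_abs p (X n)\<bar> < e"
    using padic_abs_triangle_diff[OF p] by (meson le_less_trans)
qed

lemma padic_Cauchy_bounded:
  assumes p: "prime p" and X: "padic_Cauchy p X"
  obtains B where "B > 0" "\<And>n. padic_abs p (X n) \<le> B"
proof -
  have "Bseq (\<lambda>n. padic_abs p (X n))" using padic_Cauchy_Cauchy[OF assms] by (simp add: Cauchy_Bseq)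
  thus ?thesis using that padic_abs_nonneg[OF p] by (auto simp: Bseq_def)
qed

lemma padic_Cauchy_add:
  assumes p: "prime p" and X: "padic_Cauchy p X" and Y: "padic_Cauchy p Y"
  shows "padic_Cauchy p (\<lambda>n. X n + Y n)"
  unfolding padic_Cauchy_def
proof (intro allI impI)
  fix e :: real assume e: "e > 0"
  obtain M where M: "\<forall>m\<ge>M. \<forall>n\<ge>M. padic_abs p (X m - X n) < e" using X e by (auto simp: padic_Cauchy_def)
  obtain N where N: "\<forall>m\<ge>N. \<forall>n\<ge>N. padic_abs p (Y m - Y n) < e" using Y e by (auto simp: padic_Cauchy_def)
  have "padic_abs p (X m + Y m - (X n + Y n)) < e" if "m \<ge> max M N" "n \<ge> max M N" for m n
  proof -
    have eq: "X m + Y m - (X n + Y n) = (X m - X n) + (Y m - Y n)" by (rule add_diff_add)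
    have "padic_abs p (X m - X n) < e" "padic_abs p (Y m - Y n) < e" using M N that by auto
    hence lt: "max (padic_abs p (X m - X n)) (padic_abs p (Y m - Y n)) < e" by simp
    show ?thesis unfolding eq by (rule le_less_trans[OF padic_abs_add[OF p] lt])
  qed
  thus "\<exists>M. \<forall>m\<ge>M. \<forall>n\<ge>M. padic_abs p (X m + Y m - (X n + Y n)) < e" by blast
qed

lemma padic_Cauchy_minus:
  assumes p: "prime p" and X: "padic_Cauchy p X"
  shows "padic_Cauchy p (\<lambda>n. - X n)"
proof -
  have "padic_abs p (- X m - - X n) = padic_abs p (X m - X n)" for m n
    using padic_abs_minus[OF p, of "X m - X n"] by (metis minus_diff_minus)
  thus ?thesis using X by (simp add: padic_Cauchy_def)
qed

lemma padic_Cauchy_mult: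
  assumes p: "prime p" and X: "padic_Cauchy p X" and Y: "padic_Cauchy p Y"
  shows "padic_Cauchy p (\<lambda>n. X n * Y n)"
  unfolding padic_Cauchy_def
proof (intro allI impI)
  fix e :: real assume e: "e > 0"
  obtain B where B: "B > 0" "\<And>n. padic_abs p (X n) \<le> B" using padic_Cauchy_bounded[OF p X] by blast
  obtain C where C: "C > 0" "\<And>n. padic_abs p (Y n) \<le> C" using padic_Cauchy_bounded[OF p Y] by blast
  have e1: "e / (2 * C) > 0" and e2: "e / (2 * B) > 0" using e B C by auto
  obtain M where M: "\<forall>m\<ge>M. \<forall>n\<ge>M. padic_abs p (X m - X n) < e / (2 * C)"
    using X e1 unfolding padic_Cauchy_def by blast
  obtain N where N: "\<forall>m\<ge>N. \<forall>n\<ge>N. padic_abs p (Y m - Y n) < e / (2 * B)"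
    using Y e2 unfolding padic_Cauchy_def by blast
  have "padic_abs p (X m * Y m - X n * Y n) < e" if "m \<ge> max M N" "n \<ge> max M N" for m n
  proof -
    have "X m * Y m - X n * Y n = (X m - X n) * Y m + X n * (Y m - Y n)" by (simp add: algebra_simps)
    hence "padic_abs p (X m * Y m - X n * Y n) \<le>
      padic_abs p (X m - X n) * padic_abs p (Y m) + padic_abs p (X n) * padic_abs p (Y m - Y n)"
      using padic_abs_triangle[OF p, of "(X m - X n) * Y m" "X n * (Y m - Y n)"]
      by (simp only: padic_abs_mult[OF p])
    moreover have "padic_abs p (X m - X n) * padic_abs p (Y m) \<le> padic_abs p (X m - X n) * C"
      using C padic_abs_nonneg[OF p] by (intro mult_left_mono) auto
    moreover have "padic_abs p (X m - X n) * C < e / (2 * C) * C"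
      using M that C by (intro mult_strict_right_mono) auto
    moreover have "padic_abs p (X n) * padic_abs p (Y m - Y n) \<le> B * padic_abs p (Y m - Y n)"
      using B padic_abs_nonneg[OF p] by (intro mult_right_mono) auto
    moreover have "B * padic_abs p (Y m - Y n) < B * (e / (2 * B))"
      using N that B by (intro mult_strict_left_mono) auto
    moreover have "e / (2 * C) * C = e / 2" "B * (e / (2 * B)) = e / 2" using B C by auto
    ultimately show ?thesis by linarith
  qed
  thus "\<exists>M. \<forall>m\<ge>M. \<forall>n\<ge>M. padic_abs p (X m * Y m - X n * Y n) < e" by blast
qed

lemma padic_not_null_bound:
  assumes p: "prime p" and X: "padic_Cauchy p X" and nz: "\<not> (\<lambda>n. padic_abs p (X n)) \<longlonglongrightarrow> 0"
  obtains b M where "b > 0" "\<And>n. n \<ge> M \<Longrightarrow> padic_abs p (X n) > b"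
proof -
  obtain L where L: "(\<lambda>n. padic_abs p (X n)) \<longlonglongrightarrow> L"
    using padic_Cauchy_Cauchy[OF p X] by (meson Cauchy_convergent_iff convergent_def)
  have "L \<ge> 0" using L padic_abs_nonneg[OF p] by (meson LIMSEQ_le_const)
  hence "L / 2 > 0" "L / 2 < L" using nz L by (cases "L = 0"; simp)+
  moreover have "eventually (\<lambda>n. padic_abs p (X n) > L / 2) sequentially"
    using order_tendstoD(1)[OF L \<open>L / 2 < L\<close>] .
  ultimately obtain M where "L / 2 > 0" "\<forall>n\<ge>M. padic_abs p (X n) > L / 2"
    unfolding eventually_sequentially by blast
  thus ?thesis by (intro that[of "L / 2" M]) simp_all
qed

lemma padic_abs_inverse:
  assumes p: "prime p" shows "padic_abs p (inverse x) = inverse (padic_abs p x)"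
proof (cases "x = 0")
  case False
  hence "inverse x * x = 1" by simp
  hence "padic_abs p (inverse x) * padic_abs p x = 1"
    by (simp only: padic_abs_mult[OF p, symmetric] padic_abs_1[OF p])
  thus ?thesis
    using inverse_unique[of "padic_abs p x" "padic_abs p (inverse x)"] by (simp only: mult.commute)
qed auto

lemma padic_Cauchy_inverse:
  assumes p: "prime p" and X: "padic_Cauchy p X" and nz: "\<not> (\<lambda>n. padic_abs p (X n)) \<longlonglongrightarrow> 0"
  shows "padic_Cauchy p (\<lambda>n. inverse (X n))"
  unfolding padic_Cauchy_def
proof (intro allI impI)
  fix e :: real assume e: "e > 0"
  obtain b M where b: "b > 0" and M: "\<And>n. n \<ge> M \<Longrightarrow> padic_abs p (X n) > b"
    using padic_not_null_bound[OF p X nz] by blast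
  have "e * (b * b) > 0" using e b by simp
  then obtain N where N: "\<forall>m\<ge>N. \<forall>n\<ge>N. padic_abs p (X m - X n) < e * (b * b)"
    using X unfolding padic_Cauchy_def by blast
  have "padic_abs p (inverse (X m) - inverse (X n)) < e" if "m \<ge> max M N" "n \<ge> max M N" for m n
  proof -
    have gt: "padic_abs p (X m) > b" "padic_abs p (X n) > b" using M that by auto
    hence n0: "X m \<noteq> 0" "X n \<noteq> 0" using b by auto
    hence "inverse (X m) - inverse (X n) = (X n - X m) * inverse (X m * X n)"
      by (simp add: field_simps)
    hence "padic_abs p (inverse (X m) - inverse (X n)) =
        padic_abs p (X n - X m) / (padic_abs p (X m) * padic_abs p (X n))"
      by (simp only: padic_abs_mult[OF p] padic_abs_inverse[OF p] divide_inverse)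
    moreover have "b * b \<le> padic_abs p (X m) * padic_abs p (X n)"
      using gt b by (intro mult_mono) auto
    moreover have "padic_abs p (X n - X m) < e * (b * b)" using N that by auto
    moreover have "e * (b * b) \<le> e * (padic_abs p (X m) * padic_abs p (X n))"
      using calculation(2) e by (intro mult_left_mono) auto
    moreover have "padic_abs p (X m) * padic_abs p (X n) > 0"
      using calculation(2) b by (smt (verit) mult_pos_pos)
    ultimately show ?thesis by (simp add: pos_divide_less_eq)
  qed
  thus "\<exists>M. \<forall>m\<ge>M. \<forall>n\<ge>M. padic_abs p (inverse (X m) - inverse (X n)) < e" by blast
qed

lemma padic_relI:
  assumes "padic_Cauchy p X" "padic_Cauchy p Y" "(\<lambda>n. padic_abs p (X n - Y n)) \<longlonglongrightarrow> 0"
  shows "padic_rel p X Y"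
  using assms unfolding padic_rel_def by (intro conjI)

lemma padic_relD:
  assumes "padic_rel p X Y"
  shows "padic_Cauchy p X" "padic_Cauchy p Y" "(\<lambda>n. padic_abs p (X n - Y n)) \<longlonglongrightarrow> 0"
  using assms unfolding padic_rel_def by simp_all

lemma padic_rel_refl: "padic_rel p X X \<longleftrightarrow> padic_Cauchy p X"
  by (simp add: padic_rel_def)

lemma part_equivp_padic_rel:
  assumes p: "prime p" shows "part_equivp (padic_rel p)"
proof (rule part_equivpI)
  show "\<exists>X. padic_rel p X X"
    unfolding padic_rel_refl by (rule exI[of _ "\<lambda>_. 0"]) (rule padic_Cauchy_const)
  show "symp (padic_rel p)"
  proof (rule sympI)
    fix X Y assume A: "padic_rel p X Y"
    have eq: "padic_abs p (Y n - X n) = padic_abs p (X n - Y n)" for n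
      using padic_abs_minus[OF p, of "X n - Y n"] unfolding minus_diff_eq .
    have lim: "(\<lambda>n. padic_abs p (Y n - X n)) \<longlonglongrightarrow> 0"
      unfolding eq by (rule padic_relD(3)[OF A])
    show "padic_rel p Y X"
      by (rule padic_relI[OF padic_relD(2)[OF A] padic_relD(1)[OF A] lim])
  qed
  show "transp (padic_rel p)"
  proof (rule transpI)
    fix X Y Z assume A: "padic_rel p X Y" and B: "padic_rel p Y Z"
    have lim: "(\<lambda>n. padic_abs p (X n - Y n) + padic_abs p (Y n - Z n)) \<longlonglongrightarrow> 0"
      by (rule tendsto_add_zero[OF padic_relD(3)[OF A] padic_relD(3)[OF B]])
    have eq: "X n - Z n = (X n - Y n) + (Y n - Z n)" for n by simp
    have le: "padic_abs p (X n - Z n) \<le> padic_abs p (X n - Y n) + padic_abs p (Y n - Z n)" for n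
      by (subst eq) (rule padic_abs_triangle[OF p])
    show "padic_rel p X Z"
      by (rule padic_relI[OF padic_relD(1)[OF A] padic_relD(2)[OF B] padic_null_le[OF p lim le]])
  qed
qed

text \<open>
  The type \<open>'k padic\<close> is the field of \<open>p\<close>-adic numbers, where \<open>p\<close> is the characteristic of the
  type \<open>'k\<close>: the completion of the rationals, as classes of Cauchy sequences modulo null
  sequences. (The type \<open>'k\<close> only carries the prime \<open>p\<close>; the command for quotient types does not
  accept a relation depending on such a parameter.)
\<close>
typedef (overloaded) ('k :: semiring_prime_char) padic =
  "{C. \<exists>X. padic_rel CHAR('k) X X \<and> C = Collect (padic_rel CHAR('k) X)}"
proof
  show "Collect (padic_rel CHAR('k) (\<lambda>_. 0)) \<in> {C. \<exists>X. padic_rel CHAR('k) X X \<and> C = Collect (padic_rel CHAR('k) X)}"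
    using padic_rel_refl[of "CHAR('k)" "\<lambda>_. 0"] padic_Cauchy_const[of "CHAR('k)" 0] by blast
qed

definition padic_of :: "(nat \<Rightarrow> rat) \<Rightarrow> 'k :: semiring_prime_char padic" where
  "padic_of X = Abs_padic (Collect (padic_rel CHAR('k) X))"

definition padic_rep :: "'k :: semiring_prime_char padic \<Rightarrow> nat \<Rightarrow> rat" where
  "padic_rep x = (SOME X. X \<in> Rep_padic x)"

definition cr_padic :: "(nat \<Rightarrow> rat) \<Rightarrow> 'k :: semiring_prime_char padic \<Rightarrow> bool" where
  "cr_padic X x \<longleftrightarrow> padic_rel CHAR('k) X X \<and> padic_of X = x"

lemma Quotient_padic:
  "Quotient (padic_rel CHAR('k)) padic_of (padic_rep :: 'k :: semiring_prime_char padic \<Rightarrow> _) cr_padic"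
proof -
  interpret quot_type "padic_rel CHAR('k)" "Abs_padic :: _ \<Rightarrow> 'k padic" Rep_padic
  proof
    show "part_equivp (padic_rel CHAR('k))" using part_equivp_padic_rel by simp
    show "\<exists>X. padic_rel CHAR('k) X X \<and> Rep_padic y = Collect (padic_rel CHAR('k) X)" for y :: "'k padic"
      using Rep_padic[of y] by simp
    show "Abs_padic (Rep_padic y) = y" for y :: "'k padic" by (rule Rep_padic_inverse)
    show "Rep_padic (Abs_padic c :: 'k padic) = c"
      if "\<exists>X. padic_rel CHAR('k) X X \<and> c = Collect (padic_rel CHAR('k) X)" for c
      using that by (intro Abs_padic_inverse) simp
    show "(Rep_padic x = Rep_padic y) = (x = y)" for x y :: "'k padic" by (rule Rep_padic_inject)
  qed
  have "padic_of = abs" and "padic_rep = rep"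
    by (auto simp: fun_eq_iff padic_of_def padic_rep_def abs_def rep_def)
  note Q = Quotient[unfolded Quotient3_def, folded \<open>padic_of = abs\<close> \<open>padic_rep = rep\<close>]
  have "cr_padic = (\<lambda>X x. padic_rel CHAR('k) X X \<and> padic_of X = (x :: 'k padic))"
    by (intro ext) (rule cr_padic_def)
  with Q show ?thesis unfolding Quotient_def by (elim conjE, intro conjI)
qed

setup_lifting Quotient_padic

instantiation padic :: (semiring_prime_char) field
begin

lift_definition zero_padic :: "'a padic" is "\<lambda>_. 0"
  by (simp add: padic_rel_def padic_Cauchy_const)

lift_definition one_padic :: "'a padic" is "\<lambda>_. 1"
  by (simp add: padic_rel_def padic_Cauchy_const)

lift_definition plus_padic :: "'a padic \<Rightarrow> 'a padic \<Rightarrow> 'a padic" is "\<lambda>X Y n. X n + Y n"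
proof -
  fix X X' Y Y' assume A: "padic_rel CHAR('a) X X'" and B: "padic_rel CHAR('a) Y Y'"
  have p: "prime CHAR('a)" by simp
  have lim: "(\<lambda>n. padic_abs CHAR('a) (X n - X' n) + padic_abs CHAR('a) (Y n - Y' n)) \<longlonglongrightarrow> 0"
    by (rule tendsto_add_zero[OF padic_relD(3)[OF A] padic_relD(3)[OF B]])
  have le: "padic_abs CHAR('a) (X n + Y n - (X' n + Y' n)) \<le> padic_abs CHAR('a) (X n - X' n) + padic_abs CHAR('a) (Y n - Y' n)" for n
    unfolding add_diff_add by (rule padic_abs_triangle[OF p])
  show "padic_rel CHAR('a) (\<lambda>n. X n + Y n) (\<lambda>n. X' n + Y' n)"
    by (rule padic_relI[OF padic_Cauchy_add[OF p padic_relD(1)[OF A] padic_relD(1)[OF B]]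
          padic_Cauchy_add[OF p padic_relD(2)[OF A] padic_relD(2)[OF B]] padic_null_le[OF p lim le]])
qed

lift_definition uminus_padic :: "'a padic \<Rightarrow> 'a padic" is "\<lambda>X n. - X n"
proof -
  fix X X' assume A: "padic_rel CHAR('a) X X'"
  have p: "prime CHAR('a)" by simp
  have eq: "padic_abs CHAR('a) (- X n - - X' n) = padic_abs CHAR('a) (X n - X' n)" for n
    unfolding minus_diff_minus by (rule padic_abs_minus[OF p])
  have lim: "(\<lambda>n. padic_abs CHAR('a) (- X n - - X' n)) \<longlonglongrightarrow> 0"
    unfolding eq by (rule padic_relD(3)[OF A])
  show "padic_rel CHAR('a) (\<lambda>n. - X n) (\<lambda>n. - X' n)"
    by (rule padic_relI[OF padic_Cauchy_minus[OF p padic_relD(1)[OF A]]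
          padic_Cauchy_minus[OF p padic_relD(2)[OF A]] lim])
qed

definition minus_padic :: "'a padic \<Rightarrow> 'a padic \<Rightarrow> 'a padic" where
  "minus_padic x y = x + (- y)"

lift_definition times_padic :: "'a padic \<Rightarrow> 'a padic \<Rightarrow> 'a padic" is "\<lambda>X Y n. X n * Y n"
proof -
  fix X X' Y Y' assume A: "padic_rel CHAR('a) X X'" and B: "padic_rel CHAR('a) Y Y'"
  let ?v = "padic_abs CHAR('a)"
  have p: "prime CHAR('a)" by simp
  obtain b where b: "b > 0" "\<And>n. ?v (X' n) \<le> b"
    using padic_Cauchy_bounded[OF p padic_relD(2)[OF A]] by blast
  obtain c where c: "c > 0" "\<And>n. ?v (Y n) \<le> c"
    using padic_Cauchy_bounded[OF p padic_relD(1)[OF B]] by blast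
  have lim: "(\<lambda>n. ?v (X n - X' n) * c + b * ?v (Y n - Y' n)) \<longlonglongrightarrow> 0"
    by (rule tendsto_add_zero[OF tendsto_mult_left_zero[OF padic_relD(3)[OF A]]
          tendsto_mult_right_zero[OF padic_relD(3)[OF B]]])
  have le: "?v (X n * Y n - X' n * Y' n) \<le> ?v (X n - X' n) * c + b * ?v (Y n - Y' n)" for n
  proof -
    have "X n * Y n - X' n * Y' n = (X n - X' n) * Y n + X' n * (Y n - Y' n)" by (simp add: algebra_simps)
    hence "?v (X n * Y n - X' n * Y' n) \<le> ?v (X n - X' n) * ?v (Y n) + ?v (X' n) * ?v (Y n - Y' n)"
      using padic_abs_triangle[OF p, of "(X n - X' n) * Y n" "X' n * (Y n - Y' n)"]
      by (simp only: padic_abs_mult[OF p])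
    also have "\<dots> \<le> ?v (X n - X' n) * c + b * ?v (Y n - Y' n)"
      by (rule add_mono[OF mult_left_mono[OF c(2) padic_abs_nonneg[OF p]]
            mult_right_mono[OF b(2) padic_abs_nonneg[OF p]]])
    finally show ?thesis .
  qed
  show "padic_rel CHAR('a) (\<lambda>n. X n * Y n) (\<lambda>n. X' n * Y' n)"
    by (rule padic_relI[OF padic_Cauchy_mult[OF p padic_relD(1)[OF A] padic_relD(1)[OF B]]
          padic_Cauchy_mult[OF p padic_relD(2)[OF A] padic_relD(2)[OF B]] padic_null_le[OF p lim le]])
qed

lift_definition inverse_padic :: "'a padic \<Rightarrow> 'a padic" is
  "\<lambda>X n. if (\<lambda>m. padic_abs CHAR('a) (X m)) \<longlonglongrightarrow> 0 then 0 else inverse (X n)"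
proof -
  fix X Y assume A: "padic_rel CHAR('a) X Y"
  have p: "prime CHAR('a)" by simp
  let ?v = "padic_abs CHAR('a)"
  have cX: "padic_Cauchy CHAR('a) X" and cY: "padic_Cauchy CHAR('a) Y"
    and d: "(\<lambda>n. ?v (X n - Y n)) \<longlonglongrightarrow> 0"
    using padic_relD[OF A] .
  have d': "(\<lambda>n. ?v (X n) - ?v (Y n)) \<longlonglongrightarrow> 0"
    by (rule Lim_null_comparison[OF always_eventually d]) (simp add: padic_abs_triangle_diff[OF p])
  have iff: "(\<lambda>n. ?v (X n)) \<longlonglongrightarrow> 0 \<longleftrightarrow> (\<lambda>n. ?v (Y n)) \<longlonglongrightarrow> 0"
  proof
    assume "(\<lambda>n. ?v (X n)) \<longlonglongrightarrow> 0"
    from tendsto_diff[OF this d'] show "(\<lambda>n. ?v (Y n)) \<longlonglongrightarrow> 0" by simp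
  next
    assume "(\<lambda>n. ?v (Y n)) \<longlonglongrightarrow> 0"
    from tendsto_add[OF this d'] show "(\<lambda>n. ?v (X n)) \<longlonglongrightarrow> 0" by simp
  qed
  show "padic_rel CHAR('a)
     (\<lambda>n. if (\<lambda>m. ?v (X m)) \<longlonglongrightarrow> 0 then 0 else inverse (X n))
     (\<lambda>n. if (\<lambda>m. ?v (Y m)) \<longlonglongrightarrow> 0 then 0 else inverse (Y n))"
  proof (cases "(\<lambda>m. ?v (X m)) \<longlonglongrightarrow> 0")
    case True
    thus ?thesis using iff by (simp add: padic_rel_def padic_Cauchy_const)
  next
    case False
    hence nY: "\<not> (\<lambda>m. ?v (Y m)) \<longlonglongrightarrow> 0" using iff by simp
    obtain b M where b: "b > 0" and M: "\<And>n. n \<ge> M \<Longrightarrow> ?v (X n) > b"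
      using padic_not_null_bound[OF p cX False] by blast
    obtain c N where c: "c > 0" and N: "\<And>n. n \<ge> N \<Longrightarrow> ?v (Y n) > c"
      using padic_not_null_bound[OF p cY nY] by blast
    have le: "?v (inverse (X n) - inverse (Y n)) \<le> ?v (X n - Y n) * inverse (b * c)" if "n \<ge> max M N" for n
    proof -
      have gt: "?v (X n) > b" "?v (Y n) > c" using M N that by auto
      hence n0: "X n \<noteq> 0" "Y n \<noteq> 0" using b c by auto
      hence "inverse (X n) - inverse (Y n) = - (X n - Y n) * inverse (X n * Y n)"
        by (simp add: field_simps)
      hence "?v (inverse (X n) - inverse (Y n)) = ?v (X n - Y n) * inverse (?v (X n) * ?v (Y n))"
        by (simp only: padic_abs_mult[OF p] padic_abs_inverse[OF p] padic_abs_minus[OF p])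
      also have "\<dots> \<le> ?v (X n - Y n) * inverse (b * c)"
        using gt b c padic_abs_nonneg[OF p]
        by (intro mult_left_mono le_imp_inverse_le mult_mono mult_pos_pos) auto
      finally show ?thesis .
    qed
    have "norm (?v (inverse (X n) - inverse (Y n))) \<le> ?v (X n - Y n) * inverse (b * c)" if "n \<ge> max M N" for n
      using le[OF that] padic_abs_nonneg[OF p, of "inverse (X n) - inverse (Y n)"] by simp
    hence "eventually (\<lambda>n. norm (?v (inverse (X n) - inverse (Y n))) \<le> ?v (X n - Y n) * inverse (b * c)) sequentially"
      unfolding eventually_sequentially by blast
    hence "(\<lambda>n. ?v (inverse (X n) - inverse (Y n))) \<longlonglongrightarrow> 0"
      by (rule Lim_null_comparison[OF _ tendsto_mult_left_zero[OF d]])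
    thus ?thesis
      unfolding if_not_P[OF False] if_not_P[OF nY]
      by (rule padic_relI[OF padic_Cauchy_inverse[OF p cX False] padic_Cauchy_inverse[OF p cY nY]])
  qed
qed

definition divide_padic :: "'a padic \<Rightarrow> 'a padic \<Rightarrow> 'a padic" where
  "divide_padic x y = x * inverse y"

instance
proof
  fix a b c :: "'a padic"
  have p: "prime CHAR('a)" by simp
  note C [simp] = padic_rel_refl padic_Cauchy_const padic_Cauchy_add[OF p] padic_Cauchy_mult[OF p]
    padic_Cauchy_minus[OF p]
  show "a + b + c = a + (b + c)" by transfer (simp add: add.assoc)
  show "a + b = b + a" by transfer (simp add: add.commute)
  show "0 + a = a" by transfer simp
  show "- a + a = 0" by transfer simp
  show "a - b = a + - b" by (rule minus_padic_def)
  show "a * b * c = a * (b * c)" by transfer (simp add: mult.assoc)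
  show "a * b = b * a" by transfer (simp add: mult.commute)
  show "1 * a = a" by transfer simp
  show "(a + b) * c = a * c + b * c" by transfer (simp add: distrib_right)
  show "(0::'a padic) \<noteq> 1"
  proof (transfer, rule notI)
    assume "padic_rel CHAR('a) (\<lambda>_. 0) (\<lambda>_. 1)"
    from padic_relD(3)[OF this] have "(\<lambda>_. 1 :: real) \<longlonglongrightarrow> 0"
      by (simp add: padic_abs_minus[OF p] padic_abs_1[OF p])
    thus False by (simp add: tendsto_const_iff)
  qed
  show "a div b = a * inverse b" by (rule divide_padic_def)
  show "inverse (0::'a padic) = 0" by transfer simp
  assume "a \<noteq> 0"
  thus "inverse a * a = 1"
  proof transfer
    fix X :: "nat \<Rightarrow> rat"
    assume X: "padic_rel CHAR('a) X X" and n: "\<not> padic_rel CHAR('a) X (\<lambda>_. 0)"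
    have cX: "padic_Cauchy CHAR('a) X" by (rule padic_relD(1)[OF X])
    have nz: "\<not> (\<lambda>n. padic_abs CHAR('a) (X n)) \<longlonglongrightarrow> 0"
      using n cX unfolding padic_rel_def by simp
    obtain b M where b: "b > 0" and M: "\<And>n. n \<ge> M \<Longrightarrow> padic_abs CHAR('a) (X n) > b"
      using padic_not_null_bound[OF p cX nz] by blast
    have "padic_abs CHAR('a) (inverse (X n) * X n - 1) = 0" if "n \<ge> M" for n
    proof -
      have "X n \<noteq> 0" using M[OF that] b by (cases "X n = 0") simp_all
      thus ?thesis by simp
    qed
    hence "eventually (\<lambda>n. padic_abs CHAR('a) (inverse (X n) * X n - 1) = 0) sequentially"
      unfolding eventually_sequentially by blast
    hence lim: "(\<lambda>n. padic_abs CHAR('a) (inverse (X n) * X n - 1)) \<longlonglongrightarrow> 0"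
      by (rule tendsto_eventually)
    show "padic_rel CHAR('a) (\<lambda>n. (if (\<lambda>m. padic_abs CHAR('a) (X m)) \<longlonglongrightarrow> 0 then 0 else inverse (X n)) * X n) (\<lambda>_. 1)"
      unfolding if_not_P[OF nz]
      by (rule padic_relI[OF padic_Cauchy_mult[OF p padic_Cauchy_inverse[OF p cX nz] cX] padic_Cauchy_const lim])
  qed
qed

end

instantiation padic :: (semiring_prime_char) "{norm, metric_space}"
begin

lift_definition norm_padic :: "'a padic \<Rightarrow> real" is "\<lambda>X. lim (\<lambda>n. padic_abs CHAR('a) (X n))"
proof -
  fix X Y assume A: "padic_rel CHAR('a) X Y"
  have p: "prime CHAR('a)" by simp
  let ?v = "padic_abs CHAR('a)"
  have d': "(\<lambda>n. ?v (X n) - ?v (Y n)) \<longlonglongrightarrow> 0"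
    by (rule Lim_null_comparison[OF always_eventually padic_relD(3)[OF A]])
      (simp add: padic_abs_triangle_diff[OF p])
  have "convergent (\<lambda>n. ?v (Y n))"
    using padic_Cauchy_Cauchy[OF p padic_relD(2)[OF A]] by (simp add: Cauchy_convergent_iff)
  then obtain L where L: "(\<lambda>n. ?v (Y n)) \<longlonglongrightarrow> L" by (auto simp: convergent_def)
  have "(\<lambda>n. ?v (X n)) \<longlonglongrightarrow> L" using tendsto_add[OF L d'] by simp
  with L show "lim (\<lambda>n. ?v (X n)) = lim (\<lambda>n. ?v (Y n))" by (simp add: limI)
qed

definition dist_padic :: "'a padic \<Rightarrow> 'a padic \<Rightarrow> real" where
  "dist_padic x y = norm (x - y)"

definition uniformity_padic :: "('a padic \<times> 'a padic) filter" where
  "uniformity_padic = (INF e\<in>{0 <..}. principal {(x, y). dist x y < e})"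

definition open_padic :: "'a padic set \<Rightarrow> bool" where
  "open_padic U = (\<forall>x\<in>U. \<forall>\<^sub>F (x', y) in uniformity. x' = x \<longrightarrow> y \<in> U)"

lemma norm_padic_LIMSEQ:
  assumes "padic_Cauchy CHAR('a::semiring_prime_char) X"
  shows "(\<lambda>n. padic_abs CHAR('a) (X n)) \<longlonglongrightarrow> lim (\<lambda>n. padic_abs CHAR('a) (X n))"
  using padic_Cauchy_Cauchy[OF CHAR_prime assms] by (simp add: Cauchy_convergent_iff convergent_LIMSEQ_iff)

lemma norm_padic_eq_0: "norm (x :: 'a padic) = 0 \<longleftrightarrow> x = 0"
proof transfer
  fix X :: "nat \<Rightarrow> rat" assume X: "padic_rel CHAR('a) X X"
  hence c: "padic_Cauchy CHAR('a) X" by (simp add: padic_rel_def)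
  have L: "(\<lambda>n. padic_abs CHAR('a) (X n)) \<longlonglongrightarrow> lim (\<lambda>n. padic_abs CHAR('a) (X n))"
    by (rule norm_padic_LIMSEQ[OF c])
  have "padic_rel CHAR('a) X (\<lambda>_. 0) \<longleftrightarrow> (\<lambda>n. padic_abs CHAR('a) (X n)) \<longlonglongrightarrow> 0"
    using c by (simp add: padic_rel_def padic_Cauchy_const)
  thus "(lim (\<lambda>n. padic_abs CHAR('a) (X n)) = 0) = padic_rel CHAR('a) X (\<lambda>_. 0)"
    using L limI by metis
qed

lemma norm_padic_minus: "norm (- x :: 'a padic) = norm x"
  by transfer (simp add: padic_abs_minus)

lemma norm_padic_ultrametric: "norm (x + y :: 'a padic) \<le> max (norm x) (norm y)"
proof transfer
  fix X Y :: "nat \<Rightarrow> rat" assume X: "padic_rel CHAR('a) X X" and Y: "padic_rel CHAR('a) Y Y"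
  hence c: "padic_Cauchy CHAR('a) X" "padic_Cauchy CHAR('a) Y" by (auto simp: padic_rel_def)
  have p: "prime CHAR('a)" by simp
  show "lim (\<lambda>n. padic_abs CHAR('a) (X n + Y n)) \<le> max (lim (\<lambda>n. padic_abs CHAR('a) (X n))) (lim (\<lambda>n. padic_abs CHAR('a) (Y n)))"
    by (rule LIMSEQ_le[OF norm_padic_LIMSEQ[OF padic_Cauchy_add[OF p c]]
          tendsto_max[OF norm_padic_LIMSEQ[OF c(1)] norm_padic_LIMSEQ[OF c(2)]]])
      (simp add: padic_abs_add[OF p])
qed

lemma norm_padic_nonneg: "norm (x :: 'a padic) \<ge> 0"
  using norm_padic_ultrametric[of x "- x"] norm_padic_minus[of x] norm_padic_eq_0[of "0 :: 'a padic"] by simp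

instance
proof
  fix x y z :: "'a padic"
  show "dist x y = 0 \<longleftrightarrow> x = y" by (simp add: dist_padic_def norm_padic_eq_0)
  show "dist x y \<le> dist x z + dist y z"
    using norm_padic_ultrametric[of "x - z" "z - y"] norm_padic_minus[of "y - z"]
      norm_padic_nonneg[of "x - z"] norm_padic_nonneg[of "y - z"]
    by (simp add: dist_padic_def)
qed (simp_all add: uniformity_padic_def open_padic_def)

end

section \<open>Compact p-adic analytic groups\<close>

text \<open>
  Points of the \<open>n\<close>-dimensional space over the \<open>p\<close>-adic numbers are the functions in
  \<open>{..<n} \<rightarrow>\<^sub>E UNIV\<close>.
\<close>

definition padic_space :: "nat \<Rightarrow> (nat \<Rightarrow> 'k :: semiring_prime_char padic) topology" where
  "padic_space n = product_topology (\<lambda>_. euclidean) {..<n}"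

text \<open>
  A map from an open subset \<open>V\<close> of \<open>m\<close>-space to \<open>n\<close>-space is analytic if around every point it is
  given by convergent power series; \<open>\<alpha>\<close> ranges over the multi-indices on \<open>{..<m}\<close>. The conjunct
  \<open>x \<in> V\<close> makes \<open>V\<close> open.
\<close>

definition padic_analytic_on ::
  "nat \<Rightarrow> nat \<Rightarrow> (nat \<Rightarrow> 'k :: semiring_prime_char padic) set \<Rightarrow>
   ((nat \<Rightarrow> 'k padic) \<Rightarrow> nat \<Rightarrow> 'k padic) \<Rightarrow> bool" where
  "padic_analytic_on m n V f \<longleftrightarrow>
     V \<subseteq> topspace (padic_space m) \<and> f \<in> V \<rightarrow> topspace (padic_space n) \<and>
     (\<forall>a\<in>V. \<exists>\<epsilon>>0. \<exists>c. \<forall>x\<in>topspace (padic_space m). (\<forall>i<m. dist (x i) (a i) < \<epsilon>) \<longrightarrow>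
        x \<in> V \<and>
        (\<forall>j<n. ((\<lambda>\<alpha>. c j \<alpha> * (\<Prod>i<m. (x i - a i) ^ \<alpha> i)) has_sum f x j)
                 {\<alpha> :: nat \<Rightarrow> nat. \<forall>i\<ge>m. \<alpha> i = 0}))"

definition padic_chart ::
  "'g topology \<Rightarrow> nat \<Rightarrow> 'g set \<Rightarrow> ('g \<Rightarrow> nat \<Rightarrow> 'k :: semiring_prime_char padic) \<Rightarrow> bool" where
  "padic_chart T d U \<phi> \<longleftrightarrow>
     openin T U \<and> openin (padic_space d) (\<phi> ` U) \<and>
     homeomorphic_map (subtopology T U) (subtopology (padic_space d) (\<phi> ` U)) \<phi>"

definition padic_atlas ::
  "'g topology \<Rightarrow> nat \<Rightarrow> ('g set \<times> ('g \<Rightarrow> nat \<Rightarrow> 'k :: semiring_prime_char padic)) set \<Rightarrow> bool" where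
  "padic_atlas T d \<A> \<longleftrightarrow>
     (\<forall>(U, \<phi>)\<in>\<A>. padic_chart T d U \<phi>) \<and>
     (\<Union>(U, \<phi>)\<in>\<A>. U) = topspace T \<and>
     (\<forall>(U, \<phi>)\<in>\<A>. \<forall>(V, \<psi>)\<in>\<A>.
        padic_analytic_on d d (\<phi> ` (U \<inter> V)) (\<lambda>z. \<psi> (inv_into U \<phi> z)))"

definition topological_group :: "('g, 'm) monoid_scheme \<Rightarrow> 'g topology \<Rightarrow> bool" where
  "topological_group G T \<longleftrightarrow>
     group G \<and> topspace T = carrier G \<and>
     continuous_map (prod_topology T T) T (\<lambda>(x, y). x \<otimes>\<^bsub>G\<^esub> y) \<and>
     continuous_map T T (\<lambda>x. inv\<^bsub>G\<^esub> x)"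

definition padic_join :: "nat \<Rightarrow> (nat \<Rightarrow> 'a) \<Rightarrow> (nat \<Rightarrow> 'a) \<Rightarrow> nat \<Rightarrow> 'a" where
  "padic_join d u v = (\<lambda>i\<in>{..<d + d}. if i < d then u i else v (i - d))"

text \<open>
  A topological group with the structure of an analytic manifold over the \<open>p\<close>-adic numbers,
  \<open>p\<close> the characteristic of \<open>'k\<close>, for which multiplication and inversion are analytic. All
  charts of the atlas have the same dimension \<open>d\<close>, as the group is homogeneous.
\<close>

definition padic_analytic_group ::
  "'k :: semiring_prime_char itself \<Rightarrow> ('g, 'm) monoid_scheme \<Rightarrow> 'g topology \<Rightarrow> bool" where
  "padic_analytic_group _ G T \<longleftrightarrow>
     topological_group G T \<and>
     (\<exists>d. \<exists>\<A> :: ('g set \<times> ('g \<Rightarrow> nat \<Rightarrow> 'k padic)) set. padic_atlas T d \<A> \<and>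
        (\<forall>(U, \<phi>)\<in>\<A>. \<forall>(V, \<psi>)\<in>\<A>. \<forall>(W, \<theta>)\<in>\<A>.
           padic_analytic_on (d + d) d
             {padic_join d (\<phi> x) (\<psi> y) | x y. x \<in> U \<and> y \<in> V \<and> x \<otimes>\<^bsub>G\<^esub> y \<in> W}
             (\<lambda>z. \<theta> (inv_into U \<phi> (\<lambda>i\<in>{..<d}. z i) \<otimes>\<^bsub>G\<^esub> inv_into V \<psi> (\<lambda>i\<in>{..<d}. z (d + i))))) \<and>
        (\<forall>(U, \<phi>)\<in>\<A>. \<forall>(V, \<psi>)\<in>\<A>.
           padic_analytic_on d d (\<phi> ` {x \<in> U. inv\<^bsub>G\<^esub> x \<in> V})
             (\<lambda>z. \<psi> (inv\<^bsub>G\<^esub> (inv_into U \<phi> z)))))"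

definition compact_padic_analytic_group ::
  "'k :: semiring_prime_char itself \<Rightarrow> ('g, 'm) monoid_scheme \<Rightarrow> 'g topology \<Rightarrow> bool" where
  "compact_padic_analytic_group K G T \<longleftrightarrow>
     padic_analytic_group K G T \<and> compact_space T \<and> Hausdorff_space T"

definition finite_radical :: "('g, 'm) monoid_scheme \<Rightarrow> 'g set" where
  "finite_radical G = {x \<in> carrier G. (\<exists>n>0. x [^]\<^bsub>G\<^esub> (n :: nat) = \<one>\<^bsub>G\<^esub>) \<and>
     finite (rcosets\<^bsub>G\<^esub> {y \<in> carrier G. x \<otimes>\<^bsub>G\<^esub> y = y \<otimes>\<^bsub>G\<^esub> x})}"

definition conj_set :: "('g, 'm) monoid_scheme \<Rightarrow> 'g set \<Rightarrow> 'g \<Rightarrow> 'g set" where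
  "conj_set G K g = (\<lambda>x. inv\<^bsub>G\<^esub> g \<otimes>\<^bsub>G\<^esub> x \<otimes>\<^bsub>G\<^esub> g) ` K"


section \<open>Completed group rings\<close>

definition group_ring :: "('g, 'm) monoid_scheme \<Rightarrow> ('g \<Rightarrow> 'k :: field) ring" where
  "group_ring G =
     \<lparr>carrier = {x. finite {a. x a \<noteq> 0} \<and> {a. x a \<noteq> 0} \<subseteq> carrier G},
      mult = (\<lambda>x y c. \<Sum>(a, b)\<in>{(a, b). x a \<noteq> 0 \<and> y b \<noteq> 0 \<and> a \<otimes>\<^bsub>G\<^esub> b = c}. x a * y b),
      one = (\<lambda>a. if a = \<one>\<^bsub>G\<^esub> then 1 else 0),
      zero = (\<lambda>_. 0),
      add = (\<lambda>x y a. x a + y a)\<rparr>"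

text \<open>The linear map between group rings induced by a map \<open>h\<close> between the groups.\<close>

definition group_ring_map :: "('a \<Rightarrow> 'b) \<Rightarrow> ('a \<Rightarrow> 'k :: field) \<Rightarrow> 'b \<Rightarrow> 'k" where
  "group_ring_map h x = (\<lambda>b. \<Sum>a | x a \<noteq> 0 \<and> h a = b. x a)"

definition open_normal_subgroups :: "('g, 'm) monoid_scheme \<Rightarrow> 'g topology \<Rightarrow> 'g set set" where
  "open_normal_subgroups G T = {N. N \<lhd> G \<and> openin T N}"

text \<open>
  The inverse limit of the group rings of the quotients by the open normal subgroups. For
  \<open>N \<subseteq> M\<close> the projection from \<open>G Mod N\<close> to \<open>G Mod M\<close> sends a coset \<open>C\<close> to \<open>C <#> M\<close>.
\<close>

definition completed_group_ring ::
  "('g, 'm) monoid_scheme \<Rightarrow> 'g topology \<Rightarrow> ('g set \<Rightarrow> 'g set \<Rightarrow> 'k :: field) ring" where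
  "completed_group_ring G T = (let \<N> = open_normal_subgroups G T in
     \<lparr>carrier = {x \<in> (\<Pi>\<^sub>E N\<in>\<N>. carrier (group_ring (G Mod N))).
                   \<forall>N\<in>\<N>. \<forall>M\<in>\<N>. N \<subseteq> M \<longrightarrow> x M = group_ring_map (\<lambda>C. C <#>\<^bsub>G\<^esub> M) (x N)},
      mult = (\<lambda>x y. \<lambda>N\<in>\<N>. x N \<otimes>\<^bsub>group_ring (G Mod N)\<^esub> y N),
      one = (\<lambda>N\<in>\<N>. \<one>\<^bsub>group_ring (G Mod N)\<^esub>),
      zero = (\<lambda>N\<in>\<N>. \<zero>\<^bsub>group_ring (G Mod N)\<^esub>),
      add = (\<lambda>x y. \<lambda>N\<in>\<N>. x N \<oplus>\<^bsub>group_ring (G Mod N)\<^esub> y N)\<rparr>)"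

definition group_elt ::
  "('g, 'm) monoid_scheme \<Rightarrow> 'g topology \<Rightarrow> 'g \<Rightarrow> 'g set \<Rightarrow> 'g set \<Rightarrow> 'k :: field" where
  "group_elt G T g = (\<lambda>N\<in>open_normal_subgroups G T. \<lambda>C. if C = N #>\<^bsub>G\<^esub> g then 1 else 0)"

text \<open>
  For a closed subgroup \<open>H\<close>, the completed group ring of \<open>H\<close> is identified with its image in that
  of \<open>G\<close>. The inclusion of \<open>H\<close> induces, for every open normal subgroup \<open>N\<close> of \<open>G\<close>, the map
  \<open>D \<mapsto> N <#> D\<close> from the quotient of \<open>H\<close> by \<open>H \<inter> N\<close> to \<open>G Mod N\<close>.
\<close>

definition completed_subring_embedding ::
  "('g, 'm) monoid_scheme \<Rightarrow> 'g topology \<Rightarrow> 'g set \<Rightarrow>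
   ('g set \<Rightarrow> 'g set \<Rightarrow> 'k :: field) \<Rightarrow> 'g set \<Rightarrow> 'g set \<Rightarrow> 'k" where
  "completed_subring_embedding G T H y =
     (\<lambda>N\<in>open_normal_subgroups G T. group_ring_map (\<lambda>D. N <#>\<^bsub>G\<^esub> D) (y (H \<inter> N)))"

definition completed_subring ::
  "('g, 'm) monoid_scheme \<Rightarrow> 'g topology \<Rightarrow> 'g set \<Rightarrow> ('g set \<Rightarrow> 'g set \<Rightarrow> 'k :: field) ring" where
  "completed_subring G T H = (completed_group_ring G T)\<lparr>carrier :=
     completed_subring_embedding G T H `
       carrier (completed_group_ring (G\<lparr>carrier := H\<rparr>) (subtopology T H))\<rparr>"


section \<open>Ideals in noncommutative rings\<close>

text \<open>
  The library predicate \<open>primeideal\<close> is restricted to commutative rings. Products of subsets are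
  formed with \<^const>\<open>ideal_prod\<close>, the set of finite sums of products.
\<close>

definition prime_ideal :: "'a set \<Rightarrow> ('a, 'b) ring_scheme \<Rightarrow> bool" where
  "prime_ideal P R \<longleftrightarrow> ideal P R \<and> P \<noteq> carrier R \<and>
     (\<forall>A B. ideal A R \<and> ideal B R \<and> ideal_prod R A B \<subseteq> P \<longrightarrow> A \<subseteq> P \<or> B \<subseteq> P)"

definition minimal_prime_ideal :: "'a set \<Rightarrow> ('a, 'b) ring_scheme \<Rightarrow> bool" where
  "minimal_prime_ideal P R \<longleftrightarrow> prime_ideal P R \<and> (\<forall>P'. prime_ideal P' R \<and> P' \<subseteq> P \<longrightarrow> P' = P)"

definition left_ideal :: "'a set \<Rightarrow> ('a, 'b) ring_scheme \<Rightarrow> bool" where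
  "left_ideal L R \<longleftrightarrow> additive_subgroup L R \<and> (\<forall>a\<in>carrier R. \<forall>x\<in>L. a \<otimes>\<^bsub>R\<^esub> x \<in> L)"

definition maximal_left_ideal :: "'a set \<Rightarrow> ('a, 'b) ring_scheme \<Rightarrow> bool" where
  "maximal_left_ideal L R \<longleftrightarrow> left_ideal L R \<and> L \<noteq> carrier R \<and>
     (\<forall>L'. left_ideal L' R \<and> L \<subseteq> L' \<longrightarrow> L' = L \<or> L' = carrier R)"

definition jacobson_radical :: "('a, 'b) ring_scheme \<Rightarrow> 'a set" where
  "jacobson_radical R = {x \<in> carrier R. \<forall>L. maximal_left_ideal L R \<longrightarrow> x \<in> L}"

definition central_idempotent :: "('a, 'b) ring_scheme \<Rightarrow> 'a \<Rightarrow> bool" where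
  "central_idempotent R e \<longleftrightarrow>
     e \<in> carrier R \<and> e \<otimes>\<^bsub>R\<^esub> e = e \<and> (\<forall>x\<in>carrier R. e \<otimes>\<^bsub>R\<^esub> x = x \<otimes>\<^bsub>R\<^esub> e)"

definition centrally_primitive_idempotent :: "('a, 'b) ring_scheme \<Rightarrow> 'a \<Rightarrow> bool" where
  "centrally_primitive_idempotent R e \<longleftrightarrow> central_idempotent R e \<and> e \<noteq> \<zero>\<^bsub>R\<^esub> \<and>
     \<not> (\<exists>a b. central_idempotent R a \<and> central_idempotent R b \<and> a \<noteq> \<zero>\<^bsub>R\<^esub> \<and> b \<noteq> \<zero>\<^bsub>R\<^esub> \<and>
            a \<otimes>\<^bsub>R\<^esub> b = \<zero>\<^bsub>R\<^esub> \<and> e = a \<oplus>\<^bsub>R\<^esub> b)"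

definition complement_part :: "('a, 'b) ring_scheme \<Rightarrow> 'a \<Rightarrow> 'a set \<Rightarrow> 'a set" where
  "complement_part R e S = (\<lambda>y. (\<one>\<^bsub>R\<^esub> \<ominus>\<^bsub>R\<^esub> e) \<otimes>\<^bsub>R\<^esub> y) ` S"

text \<open>
  Control of an ideal \<open>I\<close> of \<open>R\<close> (the completed group ring) by the subgroup whose completed
  group ring has the carrier \<open>S\<close>.
\<close>

definition controlled_by :: "('a, 'b) ring_scheme \<Rightarrow> 'a set \<Rightarrow> 'a set \<Rightarrow> bool" where
  "controlled_by R I S \<longleftrightarrow> ideal_prod R (I \<inter> S) (carrier R) = I"

text \<open>The subgroup \<open>I\<^sup>\<dagger>\<close> for an ideal \<open>I\<close> of the completed group ring of the subgroup \<open>H\<close> of \<open>G\<close>.\<close>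

definition dagger ::
  "('g, 'm) monoid_scheme \<Rightarrow> 'g topology \<Rightarrow> 'g set \<Rightarrow> ('g set \<Rightarrow> 'g set \<Rightarrow> 'k :: field) set \<Rightarrow> 'g set"
  where
  "dagger G T H I = {x \<in> H.
     group_elt G T x \<ominus>\<^bsub>completed_group_ring G T\<^esub> \<one>\<^bsub>completed_group_ring G T\<^esub> \<in> I}"


section \<open>The matrix isomorphism\<close>

text \<open>Matrices of size \<open>r\<close> (rows and columns numbered from 1) with entries in \<open>S\<close>.\<close>

definition matrices :: "nat \<Rightarrow> 'a set \<Rightarrow> (nat \<times> nat \<Rightarrow> 'a) set" where
  "matrices r S = {1..r} \<times> {1..r} \<rightarrow>\<^sub>E S"

text \<open>
  The additive map which sends \<open>x\<close> in \<open>e\<^sub>i R e\<^sub>j\<close> to the matrix whose only nonzero entry is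
  \<open>g\<^sub>i\<^sup>-\<^sup>1 x g\<^sub>j\<close> in position \<open>(i, j)\<close>; a general \<open>x\<close> is the sum of its components \<open>e\<^sub>i x e\<^sub>j\<close>.
  The arguments \<open>u\<close> and \<open>u'\<close> are the images in \<open>R\<close> of the \<open>g\<^sub>i\<close> and of their inverses.
\<close>

definition peirce_matrix ::
  "('a, 'b) ring_scheme \<Rightarrow> nat \<Rightarrow> (nat \<Rightarrow> 'a) \<Rightarrow> (nat \<Rightarrow> 'a) \<Rightarrow> (nat \<Rightarrow> 'a) \<Rightarrow> 'a \<Rightarrow> nat \<times> nat \<Rightarrow> 'a"
  where
  "peirce_matrix R r es u u' x =
     (\<lambda>(i, j)\<in>{1..r} \<times> {1..r}.
        u' i \<otimes>\<^bsub>R\<^esub> (es i \<otimes>\<^bsub>R\<^esub> x \<otimes>\<^bsub>R\<^esub> es j) \<otimes>\<^bsub>R\<^esub> u j)"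

text \<open>
  The composite isomorphism on the quotient of \<open>A\<close> by \<open>M\<close>, with \<open>J\<close> an ideal of \<open>A\<close> contained in
  \<open>M\<close> and \<open>B\<close> a subset of \<open>A\<close>. A coset of \<open>x\<close> modulo \<open>M\<close> is sent first to \<open>f x\<close> modulo \<open>J\<close>, where
  \<open>f\<close> is the sum of the \<open>e\<^sub>i\<close>, and then to the matrix of that element. The entries of the matrix
  are then transported along the inverse of \<open>y + N \<mapsto> e\<^sub>1 y\<close>: they become the full preimages in \<open>B\<close>
  of the entries under \<open>y \<mapsto> e\<^sub>1 y\<close> modulo \<open>J\<close>, and those are cosets of \<open>N\<close>. The value does not
  depend on the representative \<open>x\<close>, so all members of the union coincide.
\<close>

definition mu_tilde ::
  "('a, 'b) ring_scheme \<Rightarrow> 'a set \<Rightarrow> 'a set \<Rightarrow> nat \<Rightarrow> (nat \<Rightarrow> 'a set) \<Rightarrow> (nat \<Rightarrow> 'a set) \<Rightarrow> (nat \<Rightarrow> 'a set) \<Rightarrow>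
   'a set \<Rightarrow> nat \<times> nat \<Rightarrow> 'a set" where
  "mu_tilde A B J r es u u' C =
     (let R = A Quot J; f = (\<Oplus>\<^bsub>R\<^esub>i\<in>{1..r}. es i) in
      (\<lambda>ij\<in>{1..r} \<times> {1..r}. \<Union>x\<in>C.
        {y \<in> B. es 1 \<otimes>\<^bsub>R\<^esub> (J +>\<^bsub>A\<^esub> y) =
                peirce_matrix R r es u u' (f \<otimes>\<^bsub>R\<^esub> (J +>\<^bsub>A\<^esub> x)) ij}))"

end

theory Submission
  imports Defs "HOL-Algebra.Subrings"
begin

text \<open>
  Everything takes place in the quotient \<open>R\<close> of \<open>kG\<close> by \<open>J = J(k\<Delta>\<^sup>+) kG\<close> and rests on one orthogonality
  relation: \<open>e h e = 0\<close> for every \<open>h\<close> in \<open>G\<close> outside the stabiliser \<open>G\<^sub>1\<close> of \<open>e\<close>. It holds because \<open>e\<close> and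
  its conjugates are centrally primitive idempotents of one ring, the image of \<open>k\<Delta>\<^sup>+\<close>, so that two of
  them are equal or orthogonal (\<open>e_cj_cases\<close>, \<open>e_\<gamma>_e\<close>). Since \<open>G\<^sub>1\<close> is open, every element of \<open>kG\<close> is a
  finite sum of products \<open>s t\<close> with \<open>s\<close> in \<open>kG\<^sub>1\<close> and \<open>t\<close> running over coset representatives of \<open>G\<^sub>1\<close>
  (\<open>supp_in_split\<close>), and the relation gives \<open>e R e = e \<cdot> kG\<^sub>1\<close> (\<open>corner_S\<close>). Let \<open>f\<close> be the sum of the
  conjugates \<open>e\<^sub>i\<close> of \<open>e\<close>. As \<open>f\<close> is central and its lift is not in the prime ideal \<open>\<MM>\<close>, a lift of \<open>1 - f\<close>
  is in \<open>\<MM>\<close>, hence in \<open>P\<close> (\<open>one_minus_f_in_prime\<close>). So an element of \<open>R\<close> belongs to the image of \<open>P\<close> as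
  soon as its Peirce components \<open>e\<^sub>i x e\<^sub>j\<close> do, and conjugation by group elements moves these components
  into the corner \<open>e R e\<close>. Evaluating the matrix isomorphism at the entry \<open>(1, 1)\<close> shows that \<open>Q\<close> consists
  of the \<open>y\<close> in \<open>kG\<^sub>1\<close> for which \<open>e y\<close> is in the image of \<open>P\<close> (\<open>mem_Q_iff\<close>). After that the matrices are
  no longer needed.

  Part (i) is then a computation with elements: primeness means that \<open>a x b \<in> P\<close> for all \<open>x\<close> implies
  \<open>a \<in> P\<close> or \<open>b \<in> P\<close>, and such products are compared in the corner (\<open>prime_iff\<close>).

  For part (iii) let \<open>x - 1 \<in> P\<close>. If \<open>x\<close> were outside \<open>G\<^sub>1\<close>, then \<open>e x e = 0\<close> and \<open>e (x - 1) e = - e\<close> would be in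
  the image of \<open>P\<close>, which forces \<open>P = kG\<close>. So \<open>x\<close> and all its conjugates are in \<open>Q\<^sup>\<dagger>\<close>. Conversely
  \<open>e\<^sub>i (x - 1)\<close> is the conjugate by \<open>g\<^sub>i\<close> of \<open>e (x' - 1)\<close>, where \<open>x' = g\<^sub>i\<^sup>-\<^sup>1 x g\<^sub>i\<close> (\<open>dagger_iff\<close>).

  For part (ii) write \<open>p \<in> P \<inter> kH\<close> as a sum of products \<open>s\<^sub>t t\<close> over the cosets of \<open>G\<^sub>1\<close>. Orthogonality
  isolates each component as \<open>e s\<^sub>t = e p t\<^sup>-\<^sup>1 e\<close>, so \<open>s\<^sub>t\<close> is in \<open>Q \<inter> kH\<^sub>1\<close> (\<open>component_split\<close>). Hence control
  passes from \<open>P\<close> to \<open>Q\<close>, up to elements of \<open>kG\<^sub>1\<close> killed by \<open>e\<close>. These elements are generated by \<open>1 - e\<close>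
  and by \<open>J \<inter> kG\<^sub>1 = J(k\<Delta>\<^sup>+) kG\<^sub>1\<close> (\<open>J_stab\<close>). The other direction assembles \<open>P\<close> from its corner components
  (\<open>control_iff\<close>).

  Three facts make the above available. First, for a closed subgroup \<open>X\<close> the ring \<open>kX\<close> consists of the
  elements of \<open>kG\<close> whose support is in \<open>X\<close> (\<open>completed_subring_eq\<close>). The rules of the calculus of supports
  are the axioms of the locale \<open>support_ring\<close>. They pass to the quotient by an ideal, so that one set of
  lemmas serves both \<open>kG\<close> and \<open>R\<close>. Second, \<open>J \<subseteq> \<MM>\<close>, by Nakayama's lemma for the finite ring \<open>k\<Delta>\<^sup>+\<close>
  (\<open>jacobson_ideal_in_prime\<close>). Third, \<open>\<Delta>\<^sup>+\<close> is finite and has an open centraliser. This needs that \<open>G\<close> is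
  profinite and has an open torsion-free normal subgroup, which follows from a second-order estimate for
  the multiplication in a \<open>p\<close>-adic chart (\<open>padic_analytic_group_balls\<close>). It also needs that \<open>\<Delta>\<^sup>+\<close> is a
  subgroup, which is Dietzmann's lemma (\<open>finite_normal_torsion_set_monoid\<close>).
\<close>

section \<open>The p-adic absolute value and power series\<close>

definition pnorm :: "'a :: semiring_prime_char padic \<Rightarrow> real" where
  "pnorm x = dist x 0"

lemma dist_pnorm: "dist x y = pnorm (x - y :: 'a :: semiring_prime_char padic)"
  by (simp add: pnorm_def dist_padic_def)

lemma pnorm_eq_0: "pnorm (x :: 'a :: semiring_prime_char padic) = 0 \<longleftrightarrow> x = 0"
  by (simp add: pnorm_def)

lemma pnorm_nonneg: "pnorm (x :: 'a :: semiring_prime_char padic) \<ge> 0"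
  by (simp add: pnorm_def)

lemma pnorm_minus: "pnorm (- x :: 'a :: semiring_prime_char padic) = pnorm x"
  by (simp add: pnorm_def dist_padic_def norm_padic_minus)

lemma pnorm_ultrametric: "pnorm (x + y :: 'a :: semiring_prime_char padic) \<le> max (pnorm x) (pnorm y)"
  using norm_padic_ultrametric[of x y] by (simp add: pnorm_def dist_padic_def)

lemma pnorm_mult: "pnorm (x * y :: 'a :: semiring_prime_char padic) = pnorm x * pnorm y"
proof (simp only: pnorm_def dist_padic_def diff_0_right, transfer)
  fix X Y :: "nat \<Rightarrow> rat"
  assume "padic_rel CHAR('a) X X" "padic_rel CHAR('a) Y Y"
  hence c: "padic_Cauchy CHAR('a) X" "padic_Cauchy CHAR('a) Y" by (auto simp: padic_rel_def)
  show "lim (\<lambda>n. padic_abs CHAR('a) (X n * Y n)) =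
        lim (\<lambda>n. padic_abs CHAR('a) (X n)) * lim (\<lambda>n. padic_abs CHAR('a) (Y n))"
    unfolding padic_abs_mult[OF CHAR_prime]
    by (rule limI[OF tendsto_mult[OF norm_padic_LIMSEQ[OF c(1)] norm_padic_LIMSEQ[OF c(2)]]])
qed

lift_definition padic_const :: "rat \<Rightarrow> 'a :: semiring_prime_char padic" is "\<lambda>q _. q"
  by (simp add: padic_rel_refl padic_Cauchy_const)

lemma pnorm_const: "pnorm (padic_const q :: 'a :: semiring_prime_char padic) = padic_abs CHAR('a) q"
  by (simp only: pnorm_def dist_padic_def diff_0_right, transfer) (simp add: limI)

lemma padic_const_of_nat: "padic_const (of_nat n) = (of_nat n :: 'a :: semiring_prime_char padic)"
proof (induction n)
  case 0
  show ?case unfolding of_nat_0 by transfer (simp add: padic_rel_refl padic_Cauchy_const)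
next
  case (Suc n)
  have "padic_const (1 + q) = 1 + (padic_const q :: 'a padic)" for q
    by transfer (simp add: padic_rel_refl padic_Cauchy_const)
  with Suc show ?case by simp
qed

lemma padic_abs_of_nat:
  assumes "prime p" "n > 0"
  shows "padic_abs p (of_nat n) = (1 / real p) ^ multiplicity (int p) (int n)"
proof -
  have "padic_abs p (of_nat n) = real p powi (- int (multiplicity (int p) (int n)))"
    using padic_abs_frac[OF assms(1), of "int n" 1] assms
    by simp
  thus ?thesis using assms by (simp add: power_int_minus power_one_over inverse_eq_divide)
qed

lemma pnorm_of_nat:
  "n > 0 \<Longrightarrow> pnorm (of_nat n :: 'a :: semiring_prime_char padic) = (1 / real CHAR('a)) ^ multiplicity (int CHAR('a)) (int n)"
  using padic_abs_of_nat[of "CHAR('a)" n] by (simp add: pnorm_const flip: padic_const_of_nat)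

lemma pnorm_0 [simp]: "pnorm (0 :: 'a :: semiring_prime_char padic) = 0"
  using pnorm_eq_0 by blast

lemma pnorm_1 [simp]: "pnorm (1 :: 'a :: semiring_prime_char padic) = 1"
  using pnorm_of_nat[of 1, where 'a='a] by simp

lemma pnorm_power: "pnorm (x ^ n :: 'a :: semiring_prime_char padic) = pnorm x ^ n"
  by (induction n) (simp_all add: pnorm_mult)

lemma pnorm_prod: "pnorm (\<Prod>i\<in>I. f i :: 'a :: semiring_prime_char padic) = (\<Prod>i\<in>I. pnorm (f i))"
  by (induction I rule: infinite_finite_induct) (simp_all add: pnorm_mult)

text \<open>The absolute value of a prime number is \<open>1 / p\<close> or \<open>1\<close>. This lower bound, uniform in \<open>q\<close>, is what
  excludes torsion of every prime order \<open>q\<close> at once near the identity.\<close>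

lemma pnorm_prime:
  assumes "prime q"
  shows "pnorm (of_nat q :: 'a :: semiring_prime_char padic) \<ge> 1 / real CHAR('a)"
proof -
  let ?p = "CHAR('a)"
  have p: "prime ?p" by simp
  have "multiplicity (int ?p) (int q) \<le> 1"
    using assms p by (cases "?p = q") (auto simp: prime_multiplicity_other multiplicity_prime)
  moreover have "1 / real ?p \<le> 1" using p prime_ge_1_nat[OF p] by simp
  ultimately have "(1 / real ?p) ^ 1 \<le> (1 / real ?p) ^ multiplicity (int ?p) (int q)"
    by (intro power_decreasing) auto
  thus ?thesis using assms by (simp add: pnorm_of_nat prime_gt_0_nat)
qed

lemma pnorm_diff: "pnorm (x - y :: 'a :: semiring_prime_char padic) \<le> max (pnorm x) (pnorm y)"
  using pnorm_ultrametric[of x "- y"] by (simp add: pnorm_minus)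

lemma pnorm_add_le:
  "pnorm x \<le> K \<Longrightarrow> pnorm y \<le> K \<Longrightarrow> pnorm (x + y :: 'a :: semiring_prime_char padic) \<le> K"
  using pnorm_ultrametric[of x y] by linarith

lemma pnorm_diff_le:
  "pnorm x \<le> K \<Longrightarrow> pnorm y \<le> K \<Longrightarrow> pnorm (x - y :: 'a :: semiring_prime_char padic) \<le> K"
  using pnorm_diff[of x y] by linarith

lemma pnorm_sum_le:
  assumes "K \<ge> 0" "\<And>i. i \<in> I \<Longrightarrow> pnorm (f i) \<le> K"
  shows "pnorm (\<Sum>i\<in>I. f i :: 'a :: semiring_prime_char padic) \<le> K"
  using assms(2) by (induction I rule: infinite_finite_induct) (auto simp: assms(1) pnorm_add_le)

lemma padic_has_sum_approx:
  fixes f :: "'i \<Rightarrow> 'a :: semiring_prime_char padic"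
  assumes "(f has_sum s) A" "e > 0"
  obtains F where "finite F" "F \<subseteq> A"
    "\<And>F'. finite F' \<Longrightarrow> F \<subseteq> F' \<Longrightarrow> F' \<subseteq> A \<Longrightarrow> pnorm (sum f F' - s) < e"
proof -
  have "\<forall>\<^sub>F F in finite_subsets_at_top A. dist (sum f F) s < e"
    using assms tendstoD unfolding has_sum_def by blast
  then obtain F where "finite F" "F \<subseteq> A" "\<forall>Y. finite Y \<and> F \<subseteq> Y \<and> Y \<subseteq> A \<longrightarrow> dist (sum f Y) s < e"
    unfolding eventually_finite_subsets_at_top by (elim exE conjE)
  thus ?thesis using that[of F] by (simp add: dist_pnorm)
qed

text \<open>
  Outside a finite set each term is the difference of two partial sums within distance \<open>1\<close> of the limit.
  Applied to a power series, this bounds its coefficients.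
\<close>

lemma padic_has_sum_bounded:
  fixes f :: "'i \<Rightarrow> 'a :: semiring_prime_char padic"
  assumes "(f has_sum s) A"
  obtains K where "K > 0" "\<And>i. i \<in> A \<Longrightarrow> pnorm (f i) \<le> K"
proof -
  obtain F where F: "finite F" "F \<subseteq> A"
    "\<And>F'. finite F' \<Longrightarrow> F \<subseteq> F' \<Longrightarrow> F' \<subseteq> A \<Longrightarrow> pnorm (sum f F' - s) < 1"
    using padic_has_sum_approx[OF assms, of 1] by auto
  define K where "K = Max (insert 1 ((\<lambda>i. pnorm (f i)) ` F))"
  have K: "K \<ge> 1" "\<And>i. i \<in> F \<Longrightarrow> pnorm (f i) \<le> K" using F(1) by (auto simp: K_def)
  have "pnorm (f i) \<le> K" if "i \<in> A" for i
  proof (cases "i \<in> F")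
    case False
    have "f i = (sum f (insert i F) - s) - (sum f F - s)" using False F(1) by simp
    moreover have "pnorm (sum f (insert i F) - s) < 1" "pnorm (sum f F - s) < 1"
      by (rule F(3); use F(1,2) that in auto)+
    ultimately have "pnorm (f i) \<le> 1"
      using pnorm_diff_le[of "sum f (insert i F) - s" 1 "sum f F - s"] by simp
    thus ?thesis using K(1) by simp
  qed (use K in auto)
  thus ?thesis using that[of K] K(1) by auto
qed

text \<open>By the ultrametric inequality a termwise bound passes to the sum without any loss. The combination \<open>s1 - s2 - s3 + s4\<close> is the mixed difference of a function
  of two variables.\<close>

lemma padic_has_sum_mixed_difference:
  fixes f1 f2 f3 f4 :: "'i \<Rightarrow> 'a :: semiring_prime_char padic"
  assumes "(f1 has_sum s1) A" "(f2 has_sum s2) A" "(f3 has_sum s3) A" "(f4 has_sum s4) A"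
    and le: "\<And>i. i \<in> A \<Longrightarrow> pnorm (f1 i - f2 i - f3 i + f4 i) \<le> K" and K: "K \<ge> 0"
  shows "pnorm (s1 - s2 - s3 + s4) \<le> K"
proof (rule field_le_epsilon)
  fix e :: real assume e: "e > 0"
  obtain F1 where F1: "finite F1" "F1 \<subseteq> A"
    "\<And>F'. finite F' \<Longrightarrow> F1 \<subseteq> F' \<Longrightarrow> F' \<subseteq> A \<Longrightarrow> pnorm (sum f1 F' - s1) < e"
    using padic_has_sum_approx[OF assms(1) e] by blast
  obtain F2 where F2: "finite F2" "F2 \<subseteq> A"
    "\<And>F'. finite F' \<Longrightarrow> F2 \<subseteq> F' \<Longrightarrow> F' \<subseteq> A \<Longrightarrow> pnorm (sum f2 F' - s2) < e"
    using padic_has_sum_approx[OF assms(2) e] by blast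
  obtain F3 where F3: "finite F3" "F3 \<subseteq> A"
    "\<And>F'. finite F' \<Longrightarrow> F3 \<subseteq> F' \<Longrightarrow> F' \<subseteq> A \<Longrightarrow> pnorm (sum f3 F' - s3) < e"
    using padic_has_sum_approx[OF assms(3) e] by blast
  obtain F4 where F4: "finite F4" "F4 \<subseteq> A"
    "\<And>F'. finite F' \<Longrightarrow> F4 \<subseteq> F' \<Longrightarrow> F' \<subseteq> A \<Longrightarrow> pnorm (sum f4 F' - s4) < e"
    using padic_has_sum_approx[OF assms(4) e] by blast
  define F where "F = F1 \<union> F2 \<union> F3 \<union> F4"
  have F: "finite F" "F \<subseteq> A" using F1 F2 F3 F4 by (auto simp: F_def)
  have b: "pnorm (sum f1 F - s1) \<le> K + e" "pnorm (sum f2 F - s2) \<le> K + e"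
    "pnorm (sum f3 F - s3) \<le> K + e" "pnorm (sum f4 F - s4) \<le> K + e"
    using F1(3)[OF F(1) _ F(2)] F2(3)[OF F(1) _ F(2)] F3(3)[OF F(1) _ F(2)] F4(3)[OF F(1) _ F(2)] K
    by (force simp: F_def)+
  have "pnorm (\<Sum>i\<in>F. f1 i - f2 i - f3 i + f4 i) \<le> K + e"
  proof (intro pnorm_sum_le)
    fix i assume "i \<in> F"
    with F(2) le[of i] e show "pnorm (f1 i - f2 i - f3 i + f4 i) \<le> K + e" by auto
  qed (use K e in simp)
  moreover have "s1 - s2 - s3 + s4 = (\<Sum>i\<in>F. f1 i - f2 i - f3 i + f4 i)
      - (sum f1 F - s1) + (sum f2 F - s2) + (sum f3 F - s3) - (sum f4 F - s4)"
    by (simp add: sum.distrib sum_subtractf algebra_simps)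
  ultimately show "pnorm (s1 - s2 - s3 + s4) \<le> K + e"
    using b by (simp only: pnorm_add_le pnorm_diff_le)
qed

text \<open>A nonconstant monomial vanishes at \<open>0\<close> and has a factor \<open>x i\<close> left over, which contributes \<open>s\<close>
  instead of \<open>\<rho>\<close>; the constant monomial cancels.\<close>

lemma pnorm_monomial_diff:
  fixes x :: "nat \<Rightarrow> 'a :: semiring_prime_char padic"
  assumes x: "\<And>i. i < d \<Longrightarrow> pnorm (x i) \<le> s" and s: "0 \<le> s" "s \<le> \<rho>" and \<rho>: "\<rho> > 0"
  shows "pnorm ((\<Prod>i<d. x i ^ \<beta> i) - (\<Prod>i<d. 0 ^ \<beta> i)) \<le> s / \<rho> * \<rho> ^ (\<Sum>i<d. \<beta> i)"
proof (cases "\<forall>i<d. \<beta> i = 0")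
  case True
  hence "(\<Prod>i<d. x i ^ \<beta> i) = 1" "(\<Prod>i<d. 0 ^ \<beta> i) = (1 :: 'a padic)" by auto
  thus ?thesis using s \<rho> by simp
next
  case False
  then obtain j where j: "j < d" "\<beta> j \<noteq> 0" by auto
  have 0: "(\<Prod>i<d. 0 ^ \<beta> i) = (0 :: 'a padic)" using j by (auto simp: prod_zero_iff)
  obtain n where n: "(\<Sum>i<d. \<beta> i) = Suc n" using j
    by (metis finite_lessThan lessThan_iff not0_implies_Suc sum_eq_0_iff)
  have "pnorm (\<Prod>i<d. x i ^ \<beta> i) = (\<Prod>i<d. pnorm (x i) ^ \<beta> i)"
    by (simp add: pnorm_prod pnorm_power)
  also have "\<dots> \<le> (\<Prod>i<d. s ^ \<beta> i)"
    using x by (intro prod_mono) (auto intro: power_mono simp: pnorm_nonneg)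
  also have "\<dots> = s * s ^ n" by (simp only: n[symmetric] power_sum power_Suc[symmetric])
  also have "\<dots> \<le> s * \<rho> ^ n" using s by (intro mult_left_mono power_mono) auto
  also have "\<dots> = s / \<rho> * \<rho> ^ (\<Sum>i<d. \<beta> i)" using \<rho> n by simp
  finally show ?thesis by (simp add: 0)
qed

lemma prod_lessThan_add:
  fixes f :: "nat \<Rightarrow> 'a :: comm_monoid_mult"
  shows "(\<Prod>i<m + n. f i) = (\<Prod>i<m. f i) * (\<Prod>i<n. f (m + i))"
  by (induction n) (simp_all add: mult.assoc)

lemma sum_lessThan_add:
  fixes f :: "nat \<Rightarrow> 'a :: comm_monoid_add"
  shows "(\<Sum>i<m + n. f i) = (\<Sum>i<m. f i) + (\<Sum>i<n. f (m + i))"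
  by (induction n) (simp_all add: add.assoc)

lemma padic_small_element:
  assumes "e > 0"
  obtains z :: "'a :: semiring_prime_char padic" where "pnorm z > 0" "pnorm z < e"
proof -
  have p: "prime CHAR('a)" by simp
  have lt: "1 / real CHAR('a) < 1" using prime_gt_1_nat[OF p] by simp
  obtain n where n: "(1 / real CHAR('a)) ^ n < e" using real_arch_pow_inv[OF assms lt] by auto
  have "pnorm (of_nat CHAR('a) :: 'a padic) = 1 / real CHAR('a)"
    using pnorm_of_nat[of "CHAR('a)", where 'a='a] p prime_gt_0_nat[OF p] by simp
  thus ?thesis using that[of "of_nat CHAR('a) ^ n"] n prime_gt_0_nat[OF p]
    by (simp add: pnorm_power del: of_nat_CHAR)
qed

lemma padic_join_topspace:
  "padic_join d u v \<in> topspace (padic_space (d + d))"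
  by (auto simp: padic_space_def padic_join_def)

lemma padic_join_eqD:
  assumes "padic_join d u v = padic_join d u' v'"
    and "u \<in> extensional {..<d}" "v \<in> extensional {..<d}" "u' \<in> extensional {..<d}" "v' \<in> extensional {..<d}"
  shows "u = u'" "v = v'"
proof -
  have 1: "u i = u' i" if "i < d" for i
    using fun_cong[OF assms(1), of i] that by (simp add: padic_join_def)
  have 2: "v i = v' i" if "i < d" for i
    using fun_cong[OF assms(1), of "d + i"] that by (simp add: padic_join_def)
  show "u = u'" using assms(2,4) 1 by (intro extensionalityI) auto
  show "v = v'" using assms(3,5) 2 by (intro extensionalityI) auto
qed

text \<open>Split each monomial of the power series into a part in \<open>x\<close> and a part in \<open>y\<close>. The mixed difference
  of a product \<open>P x * P' y\<close> factors as \<open>(P x - P b) * (P' y - P' b')\<close>, and each factor is small of first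
  order. In effect \<open>f (x, y) = f (x, b') + f (b, y) - f (b, b') + O(\<bar>x - b\<bar> \<bar>y - b'\<bar>)\<close>.\<close>

lemma padic_analytic_mixed_difference:
  fixes f :: "(nat \<Rightarrow> 'a :: semiring_prime_char padic) \<Rightarrow> nat \<Rightarrow> 'a padic"
  assumes an: "padic_analytic_on (d + d) n V f" and a: "padic_join d b b' \<in> V"
  obtains \<rho> K where "\<rho> > 0" "K > 0"
    "\<forall>x y. (\<forall>i<d. dist (x i) (b i) < \<rho>) \<longrightarrow> (\<forall>i<d. dist (y i) (b' i) < \<rho>) \<longrightarrow> padic_join d x y \<in> V"
    "\<forall>x y s t j. (\<forall>i<d. dist (x i) (b i) \<le> s) \<longrightarrow> (\<forall>i<d. dist (y i) (b' i) \<le> t) \<longrightarrow>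
       0 \<le> s \<longrightarrow> s < \<rho> \<longrightarrow> 0 \<le> t \<longrightarrow> t < \<rho> \<longrightarrow> j < n \<longrightarrow>
       pnorm (f (padic_join d x y) j - f (padic_join d x b') j - f (padic_join d b y) j
             + f (padic_join d b b') j) \<le> K * s * t"
proof -
  define a where "a = padic_join d b b'"
  let ?I = "{\<alpha> :: nat \<Rightarrow> nat. \<forall>i\<ge>d+d. \<alpha> i = 0}"
  have "\<exists>e>0. \<exists>c. \<forall>x\<in>topspace (padic_space (d + d)). (\<forall>i<d+d. dist (x i) (a i) < e) \<longrightarrow>
        x \<in> V \<and> (\<forall>j<n. ((\<lambda>\<alpha>. c j \<alpha> * (\<Prod>i<d+d. (x i - a i) ^ \<alpha> i)) has_sum f x j) ?I)"
    using an a unfolding padic_analytic_on_def a_def[symmetric] by (elim conjE) (erule bspec, assumption)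
  then obtain e c where e: "e > 0" and *: "\<forall>x\<in>topspace (padic_space (d + d)). (\<forall>i<d+d. dist (x i) (a i) < e) \<longrightarrow>
        x \<in> V \<and> (\<forall>j<n. ((\<lambda>\<alpha>. c j \<alpha> * (\<Prod>i<d+d. (x i - a i) ^ \<alpha> i)) has_sum f x j) ?I)"
    by (elim exE conjE)
  have cV: "x \<in> V" if "x \<in> topspace (padic_space (d + d))" "\<forall>i<d+d. dist (x i) (a i) < e" for x
    using bspec[OF * that(1)] that(2) by (elim impE) simp_all
  have c: "((\<lambda>\<alpha>. c j \<alpha> * (\<Prod>i<d+d. (x i - a i) ^ \<alpha> i)) has_sum f x j) ?I"
    if "x \<in> topspace (padic_space (d + d))" "\<forall>i<d+d. dist (x i) (a i) < e" "j < n" for x j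
    using bspec[OF * that(1)] that(2,3) by (elim impE) simp_all
  obtain z :: "'a padic" where z: "pnorm z > 0" "pnorm z < e" using padic_small_element[OF e] .
  define \<rho> where "\<rho> = pnorm z"
  have \<rho>: "\<rho> > 0" "\<rho> < e" using z by (auto simp: \<rho>_def)
  have near: "\<forall>i<d+d. dist (padic_join d x y i) (a i) < e"
    if "\<forall>i<d. dist (x i) (b i) < e" "\<forall>i<d. dist (y i) (b' i) < e" for x y
    using that by (auto simp: padic_join_def a_def)
  \<comment> \<open>The series converges at a point all of whose coordinates have distance \<open>\<rho>\<close> from the centre.\<close>
  have "\<exists>K>0. \<forall>j<n. \<forall>\<alpha>\<in>?I. pnorm (c j \<alpha>) * \<rho> ^ (\<Sum>i<d+d. \<alpha> i) \<le> K"
  proof -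
    define w where "w = padic_join d (\<lambda>i. b i + z) (\<lambda>i. b' i + z)"
    have w: "w i - a i = z" if "i < d + d" for i using that by (auto simp: w_def a_def padic_join_def)
    have "\<forall>i<d+d. dist (w i) (a i) < e" using w z by (simp add: dist_pnorm)
    hence sums: "((\<lambda>\<alpha>. c j \<alpha> * (\<Prod>i<d+d. (w i - a i) ^ \<alpha> i)) has_sum f w j) ?I" if "j < n" for j
      by (intro c) (use that in \<open>simp_all add: w_def padic_join_topspace\<close>)
    have "\<forall>j\<in>{..<n}. \<exists>K. K > 0 \<and> (\<forall>\<alpha>\<in>?I. pnorm (c j \<alpha>) * \<rho> ^ (\<Sum>i<d+d. \<alpha> i) \<le> K)"
    proof
      fix j assume "j \<in> {..<n}"
      hence j: "j < n" by simp
      obtain K where K: "K > 0" "\<And>\<alpha>. \<alpha> \<in> ?I \<Longrightarrow> pnorm (c j \<alpha> * (\<Prod>i<d+d. (w i - a i) ^ \<alpha> i)) \<le> K"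
        using padic_has_sum_bounded[OF sums[OF j]] by blast
      have "pnorm (c j \<alpha> * (\<Prod>i<d+d. (w i - a i) ^ \<alpha> i)) = pnorm (c j \<alpha>) * \<rho> ^ (\<Sum>i<d+d. \<alpha> i)" for \<alpha>
        by (simp add: w pnorm_mult pnorm_prod pnorm_power \<rho>_def power_sum)
      thus "\<exists>K. K > 0 \<and> (\<forall>\<alpha>\<in>?I. pnorm (c j \<alpha>) * \<rho> ^ (\<Sum>i<d+d. \<alpha> i) \<le> K)"
        using K by (intro exI[of _ K]) simp
    qed
    from bchoice[OF this] obtain K where
      K: "\<forall>j\<in>{..<n}. K j > 0 \<and> (\<forall>\<alpha>\<in>?I. pnorm (c j \<alpha>) * \<rho> ^ (\<Sum>i<d+d. \<alpha> i) \<le> K j)" ..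
    define K' where "K' = Max (insert 1 (K ` {..<n}))"
    have K': "K' \<ge> 1" "\<And>j. j < n \<Longrightarrow> K j \<le> K'" by (auto simp: K'_def)
    have "pnorm (c j \<alpha>) * \<rho> ^ (\<Sum>i<d+d. \<alpha> i) \<le> K'" if "j < n" "\<alpha> \<in> ?I" for j \<alpha>
    proof (rule order.trans)
      show "pnorm (c j \<alpha>) * \<rho> ^ (\<Sum>i<d+d. \<alpha> i) \<le> K j" using bspec[OF K, of j] that by simp
      show "K j \<le> K'" by (rule K') (rule that(1))
    qed
    thus ?thesis using K'(1) by (intro exI[of _ K']) auto
  qed
  then obtain K0 where K0: "K0 > 0" "\<And>j \<alpha>. j < n \<Longrightarrow> \<alpha> \<in> ?I \<Longrightarrow> pnorm (c j \<alpha>) * \<rho> ^ (\<Sum>i<d+d. \<alpha> i) \<le> K0" by blast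
  define K where "K = K0 / (\<rho> * \<rho>)"
  have "pnorm (f (padic_join d x y) j - f (padic_join d x b') j - f (padic_join d b y) j
             + f (padic_join d b b') j) \<le> K * s * t"
    if x: "\<forall>i<d. dist (x i) (b i) \<le> s" and y: "\<forall>i<d. dist (y i) (b' i) \<le> t"
      and s: "0 \<le> s" "s < \<rho>" and t: "0 \<le> t" "t < \<rho>" and j: "j < n" for x y s t j
  proof -
    define P where "P x \<alpha> = (\<Prod>i<d. (x i - b i) ^ \<alpha> i)" for x and \<alpha> :: "nat \<Rightarrow> nat"
    define P' where "P' y \<alpha> = (\<Prod>i<d. (y i - b' i) ^ \<alpha> (d + i))" for y and \<alpha> :: "nat \<Rightarrow> nat"
    have split: "(\<Prod>i<d+d. (padic_join d x y i - a i) ^ \<alpha> i) = P x \<alpha> * P' y \<alpha>" for x y \<alpha>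
      by (simp add: prod_lessThan_add P_def P'_def padic_join_def a_def)
    have S: "((\<lambda>\<alpha>. c j \<alpha> * (P x \<alpha> * P' y \<alpha>)) has_sum f (padic_join d x y) j) ?I"
      if "\<forall>i<d. dist (x i) (b i) < e" "\<forall>i<d. dist (y i) (b' i) < e" for x y
      using c[OF padic_join_topspace near[OF that] j] by (simp only: split)
    have x': "\<forall>i<d. dist (x i) (b i) < e" and y': "\<forall>i<d. dist (y i) (b' i) < e"
      using x y s t \<rho> by (auto intro: le_less_trans)
    have b': "\<forall>i<d. dist (b i) (b i) < e" "\<forall>i<d. dist (b' i) (b' i) < e" using e by auto
    show ?thesis
    proof (rule padic_has_sum_mixed_difference[OF S[OF x' y'] S[OF x' b'(2)] S[OF b'(1) y'] S[OF b']])
      fix \<alpha> assume \<alpha>: "\<alpha> \<in> ?I"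
      have "c j \<alpha> * (P x \<alpha> * P' y \<alpha>) - c j \<alpha> * (P x \<alpha> * P' b' \<alpha>) - c j \<alpha> * (P b \<alpha> * P' y \<alpha>)
          + c j \<alpha> * (P b \<alpha> * P' b' \<alpha>) = c j \<alpha> * ((P x \<alpha> - P b \<alpha>) * (P' y \<alpha> - P' b' \<alpha>))"
        by (simp add: algebra_simps)
      hence "pnorm (c j \<alpha> * (P x \<alpha> * P' y \<alpha>) - c j \<alpha> * (P x \<alpha> * P' b' \<alpha>) - c j \<alpha> * (P b \<alpha> * P' y \<alpha>)
          + c j \<alpha> * (P b \<alpha> * P' b' \<alpha>)) = pnorm (c j \<alpha>) * (pnorm (P x \<alpha> - P b \<alpha>) * pnorm (P' y \<alpha> - P' b' \<alpha>))"
        by (simp add: pnorm_mult)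
      also have "\<dots> \<le> pnorm (c j \<alpha>) * ((s / \<rho> * \<rho> ^ (\<Sum>i<d. \<alpha> i)) * (t / \<rho> * \<rho> ^ (\<Sum>i<d. \<alpha> (d + i))))"
      proof (intro mult_left_mono mult_mono pnorm_nonneg)
        show "pnorm (P x \<alpha> - P b \<alpha>) \<le> s / \<rho> * \<rho> ^ (\<Sum>i<d. \<alpha> i)"
          using pnorm_monomial_diff[of d "\<lambda>i. x i - b i" s \<rho> \<alpha>] x s \<rho> by (simp add: P_def dist_pnorm)
        show "pnorm (P' y \<alpha> - P' b' \<alpha>) \<le> t / \<rho> * \<rho> ^ (\<Sum>i<d. \<alpha> (d + i))"
          using pnorm_monomial_diff[of d "\<lambda>i. y i - b' i" t \<rho> "\<lambda>i. \<alpha> (d + i)"] y t \<rho>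
          by (simp add: P'_def dist_pnorm)
        show "0 \<le> s / \<rho> * \<rho> ^ (\<Sum>i<d. \<alpha> i)" using s \<rho> by simp
      qed
      also have "\<dots> = pnorm (c j \<alpha>) * \<rho> ^ (\<Sum>i<d+d. \<alpha> i) * (s * t / (\<rho> * \<rho>))"
        by (simp add: sum_lessThan_add power_add)
      also have "\<dots> \<le> K0 * (s * t / (\<rho> * \<rho>))"
        using K0(2)[OF j \<alpha>] s t \<rho> by (intro mult_right_mono) auto
      also have "\<dots> = K * s * t" by (simp add: K_def)
      finally show "pnorm (c j \<alpha> * (P x \<alpha> * P' y \<alpha>) - c j \<alpha> * (P x \<alpha> * P' b' \<alpha>) - c j \<alpha> * (P b \<alpha> * P' y \<alpha>)
          + c j \<alpha> * (P b \<alpha> * P' b' \<alpha>)) \<le> K * s * t" .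
    qed (use K0 s t \<rho> in \<open>simp add: K_def\<close>)
  qed
  moreover have "padic_join d x y \<in> V"
    if "\<forall>i<d. dist (x i) (b i) < \<rho>" "\<forall>i<d. dist (y i) (b' i) < \<rho>" for x y
  proof (rule cV[OF padic_join_topspace near])
    show "\<forall>i<d. dist (x i) (b i) < e" "\<forall>i<d. dist (y i) (b' i) < e"
      using that \<rho> by (auto intro: less_trans)
  qed
  moreover have "K > 0" using K0 \<rho> by (simp add: K_def)
  ultimately show ?thesis using that[of \<rho> K] \<rho>(1) by blast
qed

section \<open>Small balls in a p-adic analytic group\<close>

text \<open>
  In a chart around the identity the multiplication is addition up to an error of second order. So a
  small ball is closed under multiplication, and \<open>u\<^sup>q\<close> has coordinates \<open>q u\<close> up to \<open>K \<bar>u\<bar>\<^sup>2\<close>. If \<open>u\<^sup>q = 1\<close>,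
  then \<open>\<bar>u\<bar> / p \<le> \<bar>q\<bar> \<bar>u\<bar> \<le> K \<bar>u\<bar>\<^sup>2\<close>, which is impossible for \<open>0 < \<bar>u\<bar> < 1 / (p K)\<close>.
\<close>

lemma padic_analytic_group_balls:
  fixes G :: "('g, 'm) monoid_scheme" (structure)
  assumes an: "padic_analytic_group TYPE('k :: semiring_prime_char) G T"
  obtains B :: "real \<Rightarrow> 'g set" and \<sigma> :: real where "\<sigma> > 0"
    "\<forall>s. 0 < s \<longrightarrow> s \<le> \<sigma> \<longrightarrow> openin T (B s) \<and> \<one> \<in> B s \<and> (\<forall>u\<in>B s. \<forall>v\<in>B s. u \<otimes> v \<in> B s)"
    "\<forall>W. openin T W \<longrightarrow> \<one> \<in> W \<longrightarrow> (\<exists>s. 0 < s \<and> s \<le> \<sigma> \<and> B s \<subseteq> W)"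
    "\<forall>u q. u \<in> B \<sigma> \<longrightarrow> prime q \<longrightarrow> u [^] (q :: nat) = \<one> \<longrightarrow> u = \<one>"
proof -
  have tg: "topological_group G T" using an by (simp add: padic_analytic_group_def)
  interpret group G using tg by (simp add: topological_group_def)
  have tT: "topspace T = carrier G" using tg by (simp add: topological_group_def)
  obtain d and \<A> :: "('g set \<times> ('g \<Rightarrow> nat \<Rightarrow> 'k padic)) set" where at: "padic_atlas T d \<A>"
    and mul: "\<forall>(U, \<phi>)\<in>\<A>. \<forall>(V, \<psi>)\<in>\<A>. \<forall>(W, \<theta>)\<in>\<A>.
           padic_analytic_on (d + d) d
             {padic_join d (\<phi> x) (\<psi> y) | x y. x \<in> U \<and> y \<in> V \<and> x \<otimes> y \<in> W}
             (\<lambda>z. \<theta> (inv_into U \<phi> (\<lambda>i\<in>{..<d}. z i) \<otimes> inv_into V \<psi> (\<lambda>i\<in>{..<d}. z (d + i))))"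
    using an unfolding padic_analytic_group_def by (elim conjE exE)
  have "\<one> \<in> (\<Union>(U, \<phi>)\<in>\<A>. U)" using at tT by (simp add: padic_atlas_def)
  then obtain U \<phi> where U\<phi>: "(U, \<phi>) \<in> \<A>" and 1: "\<one> \<in> U" by auto
  have chart: "padic_chart T d U \<phi>" using at U\<phi> by (auto simp: padic_atlas_def)
  hence oU: "openin T U" and o\<phi>: "openin (padic_space d) (\<phi> ` U)"
    and hom: "homeomorphic_map (subtopology T U) (subtopology (padic_space d) (\<phi> ` U)) \<phi>"
    by (auto simp: padic_chart_def)
  have UG: "U \<subseteq> carrier G" using openin_subset[OF oU] tT by simp
  have tU: "topspace (subtopology T U) = U" using UG tT by auto
  have inj: "inj_on \<phi> U" using homeomorphic_imp_injective_map[OF hom] tU by simp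
  have ext: "\<phi> u \<in> extensional {..<d}" if "u \<in> U" for u
    using openin_subset[OF o\<phi>] that by (auto simp: padic_space_def PiE_def)
  define b where "b = \<phi> \<one>"
  define V where "V = {padic_join d (\<phi> x) (\<phi> y) | x y. x \<in> U \<and> y \<in> U \<and> x \<otimes> y \<in> U}"
  define f where "f = (\<lambda>z. \<phi> (inv_into U \<phi> (\<lambda>i\<in>{..<d}. z i) \<otimes> inv_into U \<phi> (\<lambda>i\<in>{..<d}. z (d + i))))"
  have ana: "padic_analytic_on (d + d) d V f"
    using bspec[OF mul U\<phi>] U\<phi> unfolding V_def f_def by (auto simp only: split_conv)
  have bV: "padic_join d b b \<in> V" unfolding V_def b_def using 1 by (intro CollectI exI[of _ "\<one>"] conjI refl) auto
  obtain \<rho> K where \<rho>: "\<rho> > 0" and K: "K > 0"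
    and inV: "\<forall>x y. (\<forall>i<d. dist (x i) (b i) < \<rho>) \<longrightarrow> (\<forall>i<d. dist (y i) (b i) < \<rho>) \<longrightarrow> padic_join d x y \<in> V"
    and est: "\<forall>x y s t j. (\<forall>i<d. dist (x i) (b i) \<le> s) \<longrightarrow> (\<forall>i<d. dist (y i) (b i) \<le> t) \<longrightarrow>
       0 \<le> s \<longrightarrow> s < \<rho> \<longrightarrow> 0 \<le> t \<longrightarrow> t < \<rho> \<longrightarrow> j < d \<longrightarrow>
       pnorm (f (padic_join d x y) j - f (padic_join d x b) j - f (padic_join d b y) j
             + f (padic_join d b b) j) \<le> K * s * t"
    by (rule padic_analytic_mixed_difference[OF ana bV]) (rule that)
  have f: "f (padic_join d (\<phi> u) (\<phi> v)) = \<phi> (u \<otimes> v)" if "u \<in> U" "v \<in> U" for u v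
  proof -
    have "(\<lambda>i\<in>{..<d}. padic_join d (\<phi> u) (\<phi> v) i) = \<phi> u"
      using ext[OF that(1)] by (intro extensionalityI[of _ "{..<d}"]) (auto simp: padic_join_def)
    moreover have "(\<lambda>i\<in>{..<d}. padic_join d (\<phi> u) (\<phi> v) (d + i)) = \<phi> v"
      using ext[OF that(2)] by (intro extensionalityI[of _ "{..<d}"]) (auto simp: padic_join_def)
    ultimately show ?thesis using that inj by (simp add: f_def)
  qed
  have mulU: "u \<otimes> v \<in> U" if uv: "u \<in> U" "v \<in> U" "\<forall>i<d. dist (\<phi> u i) (b i) < \<rho>" "\<forall>i<d. dist (\<phi> v i) (b i) < \<rho>" for u v
  proof -
    obtain x y where xy: "x \<in> U" "y \<in> U" "x \<otimes> y \<in> U"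
      "padic_join d (\<phi> u) (\<phi> v) = padic_join d (\<phi> x) (\<phi> y)"
      using inV[rule_format, of "\<phi> u" "\<phi> v"] uv(3,4) by (auto simp: V_def)
    hence "\<phi> u = \<phi> x" "\<phi> v = \<phi> y" using padic_join_eqD[OF xy(4)] ext uv xy by blast+
    hence "u = x" "v = y" using inj xy uv by (auto dest: inj_onD)
    thus ?thesis using xy by simp
  qed
  have mulest: "pnorm (\<phi> (u \<otimes> v) j - \<phi> u j - \<phi> v j + b j) \<le> K * s * t"
    if "u \<in> U" "v \<in> U" "\<forall>i<d. dist (\<phi> u i) (b i) \<le> s" "\<forall>i<d. dist (\<phi> v i) (b i) \<le> t"
      "0 \<le> s" "s < \<rho>" "0 \<le> t" "t < \<rho>" "j < d" for u v s t j
  proof -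
    have uv: "u \<in> carrier G" "v \<in> carrier G" using that UG by auto
    have fb: "f (padic_join d (\<phi> u) b) = \<phi> u" "f (padic_join d b (\<phi> v)) = \<phi> v" "f (padic_join d b b) = b"
      using f[of u \<one>] f[of \<one> v] f[of \<one> \<one>] that 1 uv by (simp_all add: b_def)
    show ?thesis using est[rule_format, of "\<phi> u" s "\<phi> v" t j] that(3-9) unfolding fb f[OF that(1,2)] by blast
  qed
  define p where "p = real CHAR('k)"
  have "prime CHAR('k)" by simp
  hence p: "p > 1" unfolding p_def using prime_gt_1_nat by fastforce
  \<comment> \<open>Below this radius the error \<open>K s\<^sup>2\<close> is smaller than \<open>s\<close>, and even smaller than \<open>s / p\<close>.\<close>
  obtain \<sigma> where \<sigma>: "\<sigma> > 0" "\<sigma> < \<rho>" "\<sigma> < 1 / (p * K)"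
    using dense[of 0 "min \<rho> (1 / (p * K))"] \<rho> K p by auto
  have K\<sigma>: "K * s < 1 / p" if "s \<le> \<sigma>" for s
  proof -
    have "K * s \<le> K * \<sigma>" using that K by simp
    also have "\<dots> < K * (1 / (p * K))" using \<sigma> K by (intro mult_strict_left_mono)
    finally show ?thesis using K by simp
  qed
  have K1: "K * s < 1" if "s \<le> \<sigma>" for s
    using K\<sigma>[OF that] p by (smt (verit) divide_less_eq_1_pos)
  define B where "B s = {u \<in> U. \<forall>i<d. dist (\<phi> u i) (b i) < s}" for s
  have Bopen: "openin T (B s)" if "s > 0" for s
  proof -
    have c: "continuous_map (subtopology T U) (padic_space d) \<phi>"
      using homeomorphic_imp_continuous_map[OF hom] continuous_map_in_subtopology by blast
    have "openin (padic_space d) (Pi\<^sub>E {..<d} (\<lambda>i. ball (b i) s))"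
      unfolding padic_space_def by (intro openin_PiE_gen[THEN iffD2]) auto
    from openin_continuous_map_preimage[OF c this]
    have "openin (subtopology T U) {u \<in> U. \<phi> u \<in> Pi\<^sub>E {..<d} (\<lambda>i. ball (b i) s)}" by (simp only: tU)
    also have "{u \<in> U. \<phi> u \<in> Pi\<^sub>E {..<d} (\<lambda>i. ball (b i) s)} = B s"
      using ext by (auto simp: B_def PiE_iff dist_commute)
    finally show ?thesis using oU by (rule openin_trans_full)
  qed
  have Bmul: "u \<otimes> v \<in> B s" if s: "0 < s" "s \<le> \<sigma>" and uv: "u \<in> B s" "v \<in> B s" for s u v
  proof -
    have u: "u \<in> U" "\<forall>i<d. dist (\<phi> u i) (b i) \<le> s" and v: "v \<in> U" "\<forall>i<d. dist (\<phi> v i) (b i) \<le> s"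
      using uv by (auto simp: B_def)
    have U': "u \<otimes> v \<in> U" using mulU[of u v] u v s \<sigma> by fastforce
    have "dist (\<phi> (u \<otimes> v) j) (b j) < s" if j: "j < d" for j
    proof -
      have "pnorm (\<phi> (u \<otimes> v) j - \<phi> u j - \<phi> v j + b j) \<le> K * s * s"
        using mulest[OF u(1) v(1) u(2) v(2) _ _ _ _ j] s \<sigma> by auto
      also have "\<dots> < 1 * s" using K1[OF s(2)] s(1) by (intro mult_strict_right_mono)
      finally have e: "pnorm (\<phi> (u \<otimes> v) j - \<phi> u j - \<phi> v j + b j) < s" by simp
      have "\<phi> (u \<otimes> v) j - b j = (\<phi> (u \<otimes> v) j - \<phi> u j - \<phi> v j + b j) + ((\<phi> u j - b j) + (\<phi> v j - b j))"
        by simp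
      moreover have "pnorm (\<phi> u j - b j) < s" "pnorm (\<phi> v j - b j) < s"
        using uv j by (auto simp: B_def dist_pnorm)
      ultimately show ?thesis
        using e pnorm_ultrametric[of "\<phi> (u \<otimes> v) j - \<phi> u j - \<phi> v j + b j" "(\<phi> u j - b j) + (\<phi> v j - b j)"]
          pnorm_ultrametric[of "\<phi> u j - b j" "\<phi> v j - b j"] by (simp add: dist_pnorm)
    qed
    thus ?thesis using U' by (simp add: B_def)
  qed
  have Bbase: "\<exists>s. 0 < s \<and> s \<le> \<sigma> \<and> B s \<subseteq> W" if W: "openin T W" "\<one> \<in> W" for W
  proof -
    have "openin (subtopology T U) (U \<inter> W)" using W(1) by (auto simp: openin_subtopology Int_commute)
    hence "openin (subtopology (padic_space d) (\<phi> ` U)) (\<phi> ` (U \<inter> W))"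
      using homeomorphic_map_openness_eq[OF hom] by blast
    hence "openin (padic_space d) (\<phi> ` (U \<inter> W))" using o\<phi> by (rule openin_trans_full)
    moreover have "b \<in> \<phi> ` (U \<inter> W)" using 1 W(2) by (auto simp: b_def)
    ultimately have "\<exists>X. finite {i \<in> {..<d}. X i \<noteq> topspace (euclidean :: 'k padic topology)} \<and>
        (\<forall>i\<in>{..<d}. openin euclidean (X i)) \<and> b \<in> Pi\<^sub>E {..<d} X \<and> Pi\<^sub>E {..<d} X \<subseteq> \<phi> ` (U \<inter> W)"
      unfolding padic_space_def openin_product_topology_alt by (elim bspec)
    then obtain X where X: "\<forall>i\<in>{..<d}. open (X i)" "b \<in> Pi\<^sub>E {..<d} X" "Pi\<^sub>E {..<d} X \<subseteq> \<phi> ` (U \<inter> W)"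
      by (elim exE conjE) (simp only: open_openin)
    have "\<forall>i\<in>{..<d}. \<exists>e>0. ball (b i) e \<subseteq> X i" 
    proof
      fix i assume i: "i \<in> {..<d}"
      show "\<exists>e>0. ball (b i) e \<subseteq> X i"
        using openE[OF bspec[OF X(1) i] PiE_mem[OF X(2) i]] by blast
    qed
    from bchoice[OF this] obtain e where e: "\<forall>i\<in>{..<d}. e i > 0 \<and> ball (b i) (e i) \<subseteq> X i" by auto
    define s where "s = Min (insert \<sigma> (e ` {..<d}))"
    have s: "s > 0" "s \<le> \<sigma>" "\<And>i. i < d \<Longrightarrow> s \<le> e i" using e \<sigma> by (auto simp: s_def)
    have "B s \<subseteq> W"
    proof
      fix u assume u: "u \<in> B s"
      hence uU: "u \<in> U" by (simp add: B_def)
      have "\<phi> u \<in> Pi\<^sub>E {..<d} X"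
      proof (rule PiE_I)
        fix i assume i: "i \<in> {..<d}"
        hence "dist (\<phi> u i) (b i) < e i" using u s(3)[of i] by (force simp: B_def)
        thus "\<phi> u i \<in> X i" using bspec[OF e i] by (auto simp: dist_commute subset_iff)
      qed (use ext[OF uU] in \<open>auto simp: extensional_def\<close>)
      then obtain w where "w \<in> U" "w \<in> W" "\<phi> u = \<phi> w" using X(3) by auto
      thus "u \<in> W" using inj uU by (auto dest: inj_onD)
    qed
    thus ?thesis using s by blast
  qed
  have tors: "u = \<one>" if u: "u \<in> B \<sigma>" and q: "prime q" and uq: "u [^] q = \<one>" for u and q :: nat
  proof (rule ccontr)
    assume u1: "u \<noteq> \<one>"
    have uU: "u \<in> U" and ud: "\<And>i. i < d \<Longrightarrow> dist (\<phi> u i) (b i) < \<sigma>" using u by (auto simp: B_def)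
    have uG: "u \<in> carrier G" using uU UG by auto
    define D where "D = (\<lambda>i. dist (\<phi> u i) (b i)) ` {..<d}"
    have "\<exists>i<d. \<phi> u i \<noteq> b i"
    proof (rule ccontr)
      assume "\<not> (\<exists>i<d. \<phi> u i \<noteq> b i)"
      hence "\<phi> u = b" using ext[OF uU] ext[OF 1] by (intro extensionalityI[of _ "{..<d}"]) (auto simp: b_def)
      thus False using inj uU 1 u1 by (auto simp: b_def dest: inj_onD)
    qed
    then obtain i1 where i1: "i1 < d" "\<phi> u i1 \<noteq> b i1" by auto
    have D: "finite D" "D \<noteq> {}" using i1 by (auto simp: D_def)
    define s where "s = Max D"
    have s_le: "dist (\<phi> u i) (b i) \<le> s" if "i < d" for i
      using D that by (auto simp: s_def D_def)
    have "s \<in> D" using D by (simp add: s_def)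
    \<comment> \<open>A coordinate in which \<open>u\<close> attains its distance \<open>s\<close> from the identity; it gives the contradiction.\<close>
    then obtain i0 where i0: "i0 < d" "s = dist (\<phi> u i0) (b i0)" by (auto simp: D_def)
    have s: "0 < s" "s < \<sigma>" using s_le[OF i1(1)] i1(2) ud[OF i0(1)] i0(2)
      by (auto intro: less_le_trans[of 0 "dist (\<phi> u i1) (b i1)"])
    \<comment> \<open>Powers of \<open>u\<close> are multiples of its coordinates up to an error of second order.\<close>
    have pow: "u [^] m \<in> U \<and> (\<forall>j<d. pnorm (\<phi> (u [^] m) j - b j) \<le> s \<and>
        pnorm (\<phi> (u [^] m) j - b j - of_nat m * (\<phi> u j - b j)) \<le> K * s * s)" for m :: nat
    proof (induction m)
      case 0
      show ?case using 1 s K by (simp add: b_def)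
    next
      case (Suc m)
      have IH: "u [^] m \<in> U" "\<And>j. j < d \<Longrightarrow> pnorm (\<phi> (u [^] m) j - b j) \<le> s"
        "\<And>j. j < d \<Longrightarrow> pnorm (\<phi> (u [^] m) j - b j - of_nat m * (\<phi> u j - b j)) \<le> K * s * s"
        using Suc by auto
      have le: "\<forall>i<d. dist (\<phi> (u [^] m) i) (b i) \<le> s" "\<forall>i<d. dist (\<phi> u i) (b i) \<le> s"
        using IH(2) s_le by (auto simp: dist_pnorm)
      have U': "u [^] m \<otimes> u \<in> U" using mulU[OF IH(1) uU] le s \<sigma> by fastforce
      have *: "pnorm (\<phi> (u [^] m \<otimes> u) j - b j) \<le> s \<and>
        pnorm (\<phi> (u [^] m \<otimes> u) j - b j - of_nat (Suc m) * (\<phi> u j - b j)) \<le> K * s * s" if j: "j < d" for j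
      proof -
        let ?err = "\<phi> (u [^] m \<otimes> u) j - \<phi> (u [^] m) j - \<phi> u j + b j"
        have err: "pnorm ?err \<le> K * s * s"
          by (rule mulest[OF IH(1) uU le]) (use s \<sigma> j in auto)
        have "K * s * s \<le> 1 * s" using K1[of s] s by (intro mult_right_mono) auto
        hence err': "pnorm ?err \<le> s" using err by simp
        have ds: "pnorm (\<phi> u j - b j) \<le> s" using s_le[OF j] by (simp add: dist_pnorm)
        have "\<phi> (u [^] m \<otimes> u) j - b j = ?err + ((\<phi> (u [^] m) j - b j) + (\<phi> u j - b j))" by simp
        moreover have "pnorm (?err + ((\<phi> (u [^] m) j - b j) + (\<phi> u j - b j))) \<le> s"
          by (intro pnorm_add_le err' ds IH(2) j)
        moreover have "\<phi> (u [^] m \<otimes> u) j - b j - of_nat (Suc m) * (\<phi> u j - b j) =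
            ?err + (\<phi> (u [^] m) j - b j - of_nat m * (\<phi> u j - b j))"
          by (simp add: algebra_simps)
        moreover have "pnorm (?err + (\<phi> (u [^] m) j - b j - of_nat m * (\<phi> u j - b j))) \<le> K * s * s"
          by (intro pnorm_add_le err IH(3) j)
        ultimately show ?thesis by (simp only:)
      qed
      show ?case using U' * by simp
    qed
    have "pnorm (\<phi> (u [^] q) i0 - b i0 - of_nat q * (\<phi> u i0 - b i0)) \<le> K * s * s" using pow i0(1) by blast
    hence "pnorm (- (of_nat q * (\<phi> u i0 - b i0))) \<le> K * s * s" by (simp add: uq b_def)
    hence "pnorm (of_nat q :: 'k padic) * s \<le> K * s * s"
      by (simp only: pnorm_minus pnorm_mult i0(2) dist_pnorm)
    moreover have "(1 / p) * s \<le> pnorm (of_nat q :: 'k padic) * s"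
      using pnorm_prime[OF q, where 'a='k] s by (intro mult_right_mono) (auto simp: p_def)
    moreover have "K * s * s < (1 / p) * s" using K\<sigma>[of s] s by (intro mult_strict_right_mono) auto
    ultimately show False by linarith
  qed
  have B1: "\<one> \<in> B s" if "s > 0" for s using that 1 by (simp add: B_def b_def)
  show ?thesis
  proof (rule that[of \<sigma> B])
    show "\<sigma> > 0" by (rule \<sigma>(1))
    show "\<forall>s. 0 < s \<longrightarrow> s \<le> \<sigma> \<longrightarrow> openin T (B s) \<and> \<one> \<in> B s \<and> (\<forall>u\<in>B s. \<forall>v\<in>B s. u \<otimes> v \<in> B s)"
      using Bopen B1 Bmul by simp
  qed (use Bbase tors in auto)
qed

section \<open>The finite radical\<close>

context group
begin

lemma mult_inv_cancel [simp]:
  "x \<in> carrier G \<Longrightarrow> g \<in> carrier G \<Longrightarrow> g \<otimes> (inv g \<otimes> x) = x"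
  "x \<in> carrier G \<Longrightarrow> g \<in> carrier G \<Longrightarrow> inv g \<otimes> (g \<otimes> x) = x"
  by (simp_all flip: m_assoc)

definition conj_class :: "'a \<Rightarrow> 'a set" where
  "conj_class x = {inv g \<otimes> x \<otimes> g | g. g \<in> carrier G}"

abbreviation centralizer_of :: "'a \<Rightarrow> 'a set" where
  "centralizer_of x \<equiv> {y \<in> carrier G. x \<otimes> y = y \<otimes> x}"

lemma conj_eq_iff:
  assumes "x \<in> carrier G" "g \<in> carrier G" "h \<in> carrier G"
  shows "inv h \<otimes> x \<otimes> h = inv g \<otimes> x \<otimes> g \<longleftrightarrow> h \<otimes> inv g \<in> centralizer_of x"
proof -
  have "inv h \<otimes> x \<otimes> h = inv g \<otimes> x \<otimes> g \<longleftrightarrow> h \<otimes> (inv h \<otimes> x \<otimes> h) \<otimes> inv g = h \<otimes> (inv g \<otimes> x \<otimes> g) \<otimes> inv g"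
    using assms by simp
  also have "h \<otimes> (inv h \<otimes> x \<otimes> h) \<otimes> inv g = x \<otimes> (h \<otimes> inv g)"
    using assms by (simp add: m_assoc)
  also have "h \<otimes> (inv g \<otimes> x \<otimes> g) \<otimes> inv g = h \<otimes> inv g \<otimes> x"
    using assms by (simp add: m_assoc)
  finally show ?thesis using assms by auto
qed

lemma centralizer_subgroup: "x \<in> carrier G \<Longrightarrow> subgroup (centralizer_of x) G"
proof (unfold_locales, goal_cases)
  case (2 y z)
  thus ?case using m_assoc[of x y z] m_assoc[of y x z] m_assoc[of y z x] by auto
next
  case (4 y)
  hence y: "y \<in> carrier G" and xy: "x \<otimes> y = y \<otimes> x" by auto
  have "inv y \<otimes> (x \<otimes> y) \<otimes> inv y = inv y \<otimes> (y \<otimes> x) \<otimes> inv y" by (simp only: xy)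
  thus ?case using 4(1) y by (simp add: m_assoc)
qed auto

text \<open>Orbit and stabiliser: the conjugates of \<open>x\<close> correspond to the cosets of its centraliser.\<close>

lemma finite_rcosets_centralizer_iff:
  assumes x: "x \<in> carrier G"
  shows "finite (rcosets centralizer_of x) \<longleftrightarrow> finite (conj_class x)"
proof -
  define F where "F c = {h \<in> carrier G. inv h \<otimes> x \<otimes> h = c}" for c
  have 1: "centralizer_of x #> g = F (inv g \<otimes> x \<otimes> g)" if g: "g \<in> carrier G" for g
  proof -
    have "h \<in> centralizer_of x #> g \<longleftrightarrow> h \<in> carrier G \<and> h \<otimes> inv g \<in> centralizer_of x" for h
    proof
      assume "h \<in> carrier G \<and> h \<otimes> inv g \<in> centralizer_of x"
      moreover from this have "h = h \<otimes> inv g \<otimes> g" using g by (simp add: m_assoc)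
      ultimately show "h \<in> centralizer_of x #> g" unfolding r_coset_def by blast
    next
      assume "h \<in> centralizer_of x #> g"
      then obtain y where "y \<in> centralizer_of x" "h = y \<otimes> g" unfolding r_coset_def by blast
      thus "h \<in> carrier G \<and> h \<otimes> inv g \<in> centralizer_of x" using g by (auto simp: m_assoc)
    qed
    thus ?thesis using conj_eq_iff[OF x g] by (auto simp: F_def)
  qed
  have "rcosets centralizer_of x = F ` conj_class x"
    unfolding RCOSETS_def conj_class_def using 1 by (auto simp: image_iff)
  moreover have "inj_on F (conj_class x)"
  proof (rule inj_onI)
    fix c c' assume "c \<in> conj_class x" "F c = F c'"
    thus "c = c'" by (auto simp: conj_class_def F_def)
  qed
  ultimately show ?thesis by (simp add: finite_image_iff)
qed

lemma conj_pow:
  assumes "x \<in> carrier G" "g \<in> carrier G"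
  shows "(inv g \<otimes> x \<otimes> g) [^] (n :: nat) = inv g \<otimes> x [^] n \<otimes> g"
proof (induction n)
  case (Suc n)
  have "inv g \<otimes> x [^] n \<otimes> g \<otimes> (inv g \<otimes> x \<otimes> g) = inv g \<otimes> x [^] n \<otimes> (g \<otimes> inv g) \<otimes> x \<otimes> g"
    using assms by (simp add: m_assoc del: r_inv)
  thus ?case using Suc assms by (simp add: m_assoc)
qed (use assms in simp)

lemma conj_class_conj:
  assumes "x \<in> carrier G" "g \<in> carrier G"
  shows "conj_class (inv g \<otimes> x \<otimes> g) = conj_class x"
proof -
  have *: "inv h \<otimes> (inv g \<otimes> x \<otimes> g) \<otimes> h = inv (g \<otimes> h) \<otimes> x \<otimes> (g \<otimes> h)" if "h \<in> carrier G" for h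
    using assms that by (simp add: inv_mult_group m_assoc)
  show ?thesis
  proof
    show "conj_class (inv g \<otimes> x \<otimes> g) \<subseteq> conj_class x"
      unfolding conj_class_def using * assms by auto
    show "conj_class x \<subseteq> conj_class (inv g \<otimes> x \<otimes> g)"
    proof
      fix c assume "c \<in> conj_class x"
      then obtain h where h: "h \<in> carrier G" "c = inv h \<otimes> x \<otimes> h" by (auto simp: conj_class_def)
      have "c = inv (inv g \<otimes> h) \<otimes> (inv g \<otimes> x \<otimes> g) \<otimes> (inv g \<otimes> h)"
        using *[of "inv g \<otimes> h"] h assms by simp
      thus "c \<in> conj_class (inv g \<otimes> x \<otimes> g)" using h assms by (auto simp: conj_class_def)
    qed
  qed
qed

lemma conj_class_closed:
  assumes x: "x \<in> carrier G" and z: "z \<in> conj_class x" and g: "g \<in> carrier G"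
  shows "inv g \<otimes> z \<otimes> g \<in> conj_class x"
proof -
  obtain h where h: "h \<in> carrier G" "z = inv h \<otimes> x \<otimes> h" using z by (auto simp: conj_class_def)
  have "inv g \<otimes> z \<otimes> g = inv (h \<otimes> g) \<otimes> x \<otimes> (h \<otimes> g)"
    using x g h by (simp add: inv_mult_group m_assoc)
  thus ?thesis unfolding conj_class_def using g h(1) by blast
qed

definition word_prod :: "'a list \<Rightarrow> 'a" where
  "word_prod ws = foldr (\<otimes>) ws \<one>"

lemma word_prod_simps [simp]: "word_prod [] = \<one>" "word_prod (a # ws) = a \<otimes> word_prod ws"
  by (simp_all add: word_prod_def)

lemma word_prod_closed [simp]: "set ws \<subseteq> carrier G \<Longrightarrow> word_prod ws \<in> carrier G"
  by (induction ws) auto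

lemma word_prod_append:
  "set us \<subseteq> carrier G \<Longrightarrow> set ws \<subseteq> carrier G \<Longrightarrow> word_prod (us @ ws) = word_prod us \<otimes> word_prod ws"
  by (induction us) (auto simp: m_assoc)

lemma word_prod_replicate:
  assumes "s \<in> carrier G" shows "word_prod (replicate n s) = s [^] n"
  using assms nat_pow_Suc2[OF assms] by (induction n) simp_all

lemma word_prod_conj:
  assumes "set ws \<subseteq> carrier G" "g \<in> carrier G"
  shows "inv g \<otimes> word_prod ws \<otimes> g = word_prod (map (\<lambda>x. inv g \<otimes> x \<otimes> g) ws)"
  using assms(1)
proof (induction ws)
  case (Cons a ws)
  have "inv g \<otimes> (a \<otimes> word_prod ws) \<otimes> g = inv g \<otimes> a \<otimes> (g \<otimes> inv g) \<otimes> word_prod ws \<otimes> g"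
    using Cons.prems assms(2) by (simp add: m_assoc)
  also have "\<dots> = (inv g \<otimes> a \<otimes> g) \<otimes> (inv g \<otimes> word_prod ws \<otimes> g)"
    using Cons.prems assms(2) by (simp add: m_assoc del: r_inv)
  finally show ?case using Cons by simp
qed (use assms in simp)

text \<open>Move all occurrences of the letter \<open>s\<close> to the front. The letters that are passed get conjugated by
  powers of \<open>s\<close> and stay in \<open>S\<close>.\<close>

lemma word_collect_letter:
  assumes S: "S \<subseteq> carrier G" "\<And>x g. x \<in> S \<Longrightarrow> g \<in> carrier G \<Longrightarrow> inv g \<otimes> x \<otimes> g \<in> S"
    and s: "s \<in> S" and "set ws \<subseteq> S"
  shows "\<exists>us. set us \<subseteq> S \<and> length ws = count_list ws s + length us \<and>
              word_prod ws = s [^] count_list ws s \<otimes> word_prod us"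
  using assms(4)
proof (induction ws)
  case (Cons a ws)
  then obtain us where us: "set us \<subseteq> S" "length ws = count_list ws s + length us"
    "word_prod ws = s [^] count_list ws s \<otimes> word_prod us" by auto
  let ?c = "count_list ws s"
  have c: "s \<in> carrier G" "a \<in> carrier G" "word_prod us \<in> carrier G" using S s Cons.prems us by auto
  show ?case
  proof (cases "a = s")
    case True
    have "s \<otimes> s [^] ?c = s [^] Suc ?c" using c nat_pow_mult[of s 1 ?c] by simp
    thus ?thesis using True us c by (intro exI[of _ us]) (simp add: m_assoc[symmetric])
  next
    case False
    let ?t = "s [^] ?c"
    have "a \<otimes> (?t \<otimes> word_prod us) = ?t \<otimes> ((inv ?t \<otimes> a \<otimes> ?t) \<otimes> word_prod us)"
      using c by (simp add: m_assoc)
    moreover have "inv ?t \<otimes> a \<otimes> ?t \<in> S" using S(2) c Cons.prems by auto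
    ultimately show ?thesis using False us by (intro exI[of _ "(inv ?t \<otimes> a \<otimes> ?t) # us"]) auto
  qed
qed auto

text \<open>In a word with more than \<open>card S * n\<close> letters some letter occurs at least \<open>n\<close> times. Collect its
  occurrences and delete \<open>n\<close> of them.\<close>

lemma word_shorten:
  assumes S: "finite S" "S \<subseteq> carrier G" "\<And>x g. x \<in> S \<Longrightarrow> g \<in> carrier G \<Longrightarrow> inv g \<otimes> x \<otimes> g \<in> S"
    and n: "n > 0" "\<And>s. s \<in> S \<Longrightarrow> s [^] (n :: nat) = \<one>" and "set ws \<subseteq> S"
  shows "\<exists>us. set us \<subseteq> S \<and> length us \<le> card S * n \<and> word_prod us = word_prod ws"
  using assms(6)
proof (induction ws rule: length_induct)
  case (1 ws)
  show ?case
  proof (cases "length ws \<le> card S * n")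
    case False
    have "\<exists>s\<in>S. count_list ws s \<ge> n"
    proof (rule ccontr)
      assume "\<not> (\<exists>s\<in>S. count_list ws s \<ge> n)"
      hence "sum (count_list ws) S \<le> (\<Sum>s\<in>S. n)" by (intro sum_mono) auto
      thus False using sum_count_set[OF 1(2) S(1)] False by simp
    qed
    then obtain s where s: "s \<in> S" "count_list ws s \<ge> n" by auto
    obtain us where us: "set us \<subseteq> S" "length ws = count_list ws s + length us"
      "word_prod ws = s [^] count_list ws s \<otimes> word_prod us"
      using word_collect_letter[OF S(2,3) s(1) 1(2)] by blast
    let ?c = "count_list ws s"
    have sG: "s \<in> carrier G" using s S by auto
    have "s [^] ?c = s [^] n \<otimes> s [^] (?c - n)" using s(2) sG by (simp add: nat_pow_mult)
    hence sc: "s [^] ?c = s [^] (?c - n)" using n(2)[OF s(1)] sG by simp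
    define vs where "vs = replicate (?c - n) s @ us"
    have usG: "set us \<subseteq> carrier G" using us(1) S(2) by auto
    have "set vs \<subseteq> S" using us(1) s(1) by (auto simp: vs_def)
    moreover have "length vs < length ws" using us(2) s(2) n(1) by (simp add: vs_def)
    moreover have "word_prod vs = word_prod ws"
      unfolding vs_def us(3) sc using sG usG by (subst word_prod_append) (auto simp: word_prod_replicate)
    ultimately show ?thesis using 1(1) by metis
  qed (use 1 in blast)
qed

text \<open>
  Dietzmann's lemma: every product of elements of \<open>S\<close> is the product of a word of bounded length. As the
  elements of \<open>S\<close> are torsion, these products already form the subgroup generated by \<open>S\<close>.
\<close>

lemma finite_normal_torsion_set_monoid:
  assumes S: "finite S" "S \<subseteq> carrier G" "\<And>x g. x \<in> S \<Longrightarrow> g \<in> carrier G \<Longrightarrow> inv g \<otimes> x \<otimes> g \<in> S"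
    and n: "n > 0" "\<And>s. s \<in> S \<Longrightarrow> s [^] (n :: nat) = \<one>"
  shows "finite (word_prod ` {ws. set ws \<subseteq> S})"
proof (rule finite_subset)
  show "finite (word_prod ` {ws. set ws \<subseteq> S \<and> length ws \<le> card S * n})"
    using S(1) by (intro finite_imageI finite_lists_length_le)
  show "word_prod ` {ws. set ws \<subseteq> S} \<subseteq> word_prod ` {ws. set ws \<subseteq> S \<and> length ws \<le> card S * n}"
  proof
    fix x assume "x \<in> word_prod ` {ws. set ws \<subseteq> S}"
    then obtain ws where ws: "set ws \<subseteq> S" "x = word_prod ws" by blast
    obtain us where "set us \<subseteq> S" "length us \<le> card S * n" "word_prod us = word_prod ws"
      using word_shorten[OF S n ws(1)] by blast
    thus "x \<in> word_prod ` {ws. set ws \<subseteq> S \<and> length ws \<le> card S * n}" 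
      using ws(2) by (intro image_eqI[of _ _ us]) auto
  qed
qed

lemma finite_powers_torsion:
  assumes x: "x \<in> carrier G" and fin: "finite (range (\<lambda>n :: nat. x [^] n))"
  shows "\<exists>n>0. x [^] (n :: nat) = \<one>"
proof -
  have "\<not> inj (\<lambda>n :: nat. x [^] n)" using fin finite_imageD by auto
  then obtain i j :: nat where ij: "i < j" "x [^] i = x [^] j"
    unfolding inj_def by (metis linorder_neqE_nat)
  have "x [^] i \<otimes> x [^] (j - i) = x [^] (i + (j - i))" using x by (rule nat_pow_mult)
  hence "x [^] i \<otimes> x [^] (j - i) = x [^] i \<otimes> \<one>" using ij x by simp
  hence "x [^] (j - i) = \<one>" using x by simp
  thus ?thesis using ij(1) by (intro exI[of _ "j - i"]) simp
qed

lemma finite_radical_iff: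
  "x \<in> finite_radical G \<longleftrightarrow> x \<in> carrier G \<and> (\<exists>n>0. x [^] (n :: nat) = \<one>) \<and> finite (conj_class x)"
  using finite_rcosets_centralizer_iff by (auto simp: finite_radical_def)

lemma finite_radical_conj:
  assumes "x \<in> finite_radical G" "g \<in> carrier G"
  shows "inv g \<otimes> x \<otimes> g \<in> finite_radical G"
proof -
  have x: "x \<in> carrier G" using assms by (simp add: finite_radical_iff)
  obtain n :: nat where "n > 0" "x [^] n = \<one>" using assms(1) by (auto simp: finite_radical_iff)
  hence "(inv g \<otimes> x \<otimes> g) [^] n = \<one>" using conj_pow[OF x assms(2)] assms(2) by simp
  thus ?thesis using assms x conj_class_conj[OF x assms(2)] \<open>n > 0\<close> by (auto simp: finite_radical_iff)
qed

text \<open>Let \<open>M\<close> be the finite monoid that the conjugates of \<open>x\<close> and \<open>y\<close> generate. It contains the powers and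
  the conjugates of the product of \<open>x\<close> and \<open>y\<close>, so there are finitely many of them.\<close>

lemma finite_radical_mult:
  assumes "x \<in> finite_radical G" "y \<in> finite_radical G"
  shows "x \<otimes> y \<in> finite_radical G"
proof -
  have x: "x \<in> carrier G" and y: "y \<in> carrier G" using assms by (auto simp: finite_radical_iff)
  obtain m :: nat where m: "m > 0" "x [^] m = \<one>" using assms(1) by (auto simp: finite_radical_iff)
  obtain n :: nat where n: "n > 0" "y [^] n = \<one>" using assms(2) by (auto simp: finite_radical_iff)
  define S where "S = conj_class x \<union> conj_class y"
  have fin: "finite S" using assms by (simp add: S_def finite_radical_iff)
  have SG: "S \<subseteq> carrier G" using x y by (auto simp: S_def conj_class_def)
  have Sconj: "inv g \<otimes> z \<otimes> g \<in> S" if "z \<in> S" "g \<in> carrier G" for z g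
    using that conj_class_closed x y by (auto simp: S_def)
  have xm: "x [^] (m * n) = \<one>" using nat_pow_pow[OF x, of m n] m(2) by simp
  have "y [^] (n * m) = \<one>" using nat_pow_pow[OF y, of n m] n(2) by simp
  hence "y [^] (m * n) = \<one>" by (simp only: mult.commute)
  with xm have Sn: "z [^] (m * n) = \<one>" if "z \<in> S" for z
    using that conj_pow x y by (auto simp: S_def conj_class_def)
  define M where "M = word_prod ` {ws. set ws \<subseteq> S}"
  have M: "finite M"
    unfolding M_def using finite_normal_torsion_set_monoid[OF fin SG Sconj _ Sn] m n by simp
  have MM: "a \<otimes> b \<in> M" if ab: "a \<in> M" "b \<in> M" for a b
  proof -
    obtain us ws where "set us \<subseteq> S" "set ws \<subseteq> S" "a = word_prod us" "b = word_prod ws"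
      using ab by (auto simp: M_def)
    thus ?thesis using SG word_prod_append[of us ws] unfolding M_def
      by (intro image_eqI[of _ _ "us @ ws"]) auto
  qed
  have "z \<in> conj_class z" if "z \<in> carrier G" for z
    using that unfolding conj_class_def by (intro CollectI exI[of _ \<one>]) simp
  hence "x \<in> conj_class x" "y \<in> conj_class y" using x y by simp_all
  hence xM: "x \<otimes> y \<in> M"
    using x y unfolding M_def by (intro image_eqI[of _ _ "[x, y]"]) (auto simp: S_def)
  have "(x \<otimes> y) [^] k \<in> M" for k :: nat
  proof (induction k)
    case 0
    show ?case unfolding M_def by (intro image_eqI[of _ _ "[]"]) auto
  next
    case (Suc k)
    thus ?case using MM xM by simp
  qed
  hence "range (\<lambda>k :: nat. (x \<otimes> y) [^] k) \<subseteq> M" by blast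
  hence "finite (range (\<lambda>k :: nat. (x \<otimes> y) [^] k))" using M by (rule finite_subset)
  hence 1: "\<exists>k>0. (x \<otimes> y) [^] (k :: nat) = \<one>" using finite_powers_torsion x y by simp
  have "conj_class (x \<otimes> y) \<subseteq> M"
  proof
    fix c assume "c \<in> conj_class (x \<otimes> y)"
    then obtain g where g: "g \<in> carrier G" "c = inv g \<otimes> (x \<otimes> y) \<otimes> g" by (auto simp: conj_class_def)
    obtain ws where ws: "set ws \<subseteq> S" "x \<otimes> y = word_prod ws" using xM by (auto simp: M_def)
    have "c = word_prod (map (\<lambda>x. inv g \<otimes> x \<otimes> g) ws)"
      using word_prod_conj[of ws g] ws g SG by auto
    moreover have "set (map (\<lambda>x. inv g \<otimes> x \<otimes> g) ws) \<subseteq> S" using Sconj ws(1) g(1) by auto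
    ultimately show "c \<in> M" unfolding M_def by blast
  qed
  hence "finite (conj_class (x \<otimes> y))" using M by (rule finite_subset)
  thus ?thesis using 1 x y by (simp add: finite_radical_iff)
qed

lemma finite_radical_subgroup: "subgroup (finite_radical G) G"
proof (unfold_locales, goal_cases)
  case 1
  show ?case by (auto simp: finite_radical_iff)
next
  case (2 x y)
  thus ?case by (rule finite_radical_mult)
next
  case 3
  have "conj_class \<one> \<subseteq> {\<one>}" by (auto simp: conj_class_def)
  hence "finite (conj_class \<one>)" by (rule finite_subset) simp
  thus ?case by (auto simp: finite_radical_iff intro!: exI[of _ 1])
next
  case (4 x)
  hence x: "x \<in> carrier G" by (simp add: finite_radical_iff)
  obtain n :: nat where n: "n > 0" "x [^] n = \<one>" using 4 by (auto simp: finite_radical_iff)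
  have "conj_class (inv x) \<subseteq> m_inv G ` conj_class x"
  proof
    fix c assume "c \<in> conj_class (inv x)"
    then obtain g where g: "g \<in> carrier G" "c = inv g \<otimes> inv x \<otimes> g" by (auto simp: conj_class_def)
    hence "c = inv (inv g \<otimes> x \<otimes> g)" using x by (simp add: inv_mult_group m_assoc)
    thus "c \<in> m_inv G ` conj_class x" using g(1) by (auto simp: conj_class_def)
  qed
  moreover have "finite (conj_class x)" using 4 by (simp add: finite_radical_iff)
  ultimately have "finite (conj_class (inv x))" by (metis finite_imageI finite_subset)
  moreover have "inv x [^] n = \<one>" using n x by (simp add: nat_pow_inv)
  ultimately show ?case using x n(1) by (auto simp: finite_radical_iff)
qed

lemma finite_radical_normal: "finite_radical G \<lhd> G"
proof (rule normal_invI[OF finite_radical_subgroup])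
  fix x h assume "x \<in> carrier G" "h \<in> finite_radical G"
  thus "x \<otimes> h \<otimes> inv x \<in> finite_radical G" using finite_radical_conj[of h "inv x"] by simp
qed

end

section \<open>Compact topological groups\<close>

locale compact_top_group = group G for G :: "('g, 'm) monoid_scheme" (structure) +
  fixes T :: "'g topology"
  assumes tg: "topological_group G T" and compactT: "compact_space T"
begin

lemma topspace_T [simp]: "topspace T = carrier G"
  using tg by (simp add: topological_group_def)

lemma cont_mult:
  assumes "continuous_map X T f" "continuous_map X T g"
  shows "continuous_map X T (\<lambda>x. f x \<otimes> g x)"
proof -
  have "continuous_map (prod_topology T T) T (\<lambda>(x, y). x \<otimes> y)"
    using tg by (simp add: topological_group_def)
  from continuous_map_compose[OF _ this, of X "\<lambda>x. (f x, g x)"] show ?thesis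
    using assms by (simp add: continuous_map_pairedI o_def)
qed

lemma cont_const: "a \<in> carrier G \<Longrightarrow> continuous_map X T (\<lambda>x. a)"
  by simp

lemma cont_id: "continuous_map T T (\<lambda>x. x)"
  using continuous_map_id[unfolded id_def] .

lemma cont_inv: "continuous_map T T (\<lambda>x. inv x)"
  using tg by (simp add: topological_group_def)

lemma cont_translate:
  "a \<in> carrier G \<Longrightarrow> b \<in> carrier G \<Longrightarrow> continuous_map T T (\<lambda>x. a \<otimes> x \<otimes> b)"
  by (rule cont_mult[OF cont_mult[OF cont_const cont_id] cont_const])

lemma r_coset_eq_preimage:
  assumes S: "S \<subseteq> carrier G" and a: "a \<in> carrier G"
  shows "S #> a = {x \<in> topspace T. \<one> \<otimes> x \<otimes> inv a \<in> S}"
proof (intro equalityI subsetI)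
  fix x assume x: "x \<in> {x \<in> topspace T. \<one> \<otimes> x \<otimes> inv a \<in> S}"
  hence "x = x \<otimes> inv a \<otimes> a" using a by (simp add: m_assoc)
  thus "x \<in> S #> a" using x unfolding r_coset_def by auto
next
  fix x assume "x \<in> S #> a"
  then obtain s where s: "s \<in> S" "x = s \<otimes> a" unfolding r_coset_def by blast
  have "s \<in> carrier G" using S s(1) by auto
  thus "x \<in> {x \<in> topspace T. \<one> \<otimes> x \<otimes> inv a \<in> S}" using s a by (simp add: m_assoc)
qed

lemma openin_r_coset: "openin T S \<Longrightarrow> a \<in> carrier G \<Longrightarrow> openin T (S #> a)"
  using openin_subset[of T S] openin_continuous_map_preimage[OF cont_translate[of \<one> "inv a"], of S]
  by (simp add: r_coset_eq_preimage)

lemma closedin_r_coset: "closedin T S \<Longrightarrow> a \<in> carrier G \<Longrightarrow> closedin T (S #> a)"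
  using closedin_subset[of T S] closedin_continuous_map_preimage[OF cont_translate[of \<one> "inv a"], of S]
  by (simp add: r_coset_eq_preimage)

lemma rcoset_eqI:
  assumes "subgroup K G" "C \<in> rcosets K" "C' \<in> rcosets K" "x \<in> C" "x \<in> C'"
  shows "C = C'"
  using rcos_disjoint[OF assms(1)] assms by (fastforce simp: pairwise_def disjnt_def)

definition open_subgroup :: "'g set \<Rightarrow> bool" where
  "open_subgroup C \<longleftrightarrow> subgroup C G \<and> openin T C"

lemma open_subgroup_mono:
  assumes C: "open_subgroup C" and "C \<subseteq> K" "subgroup K G"
  shows "open_subgroup K"
proof -
  interpret K: subgroup K G by fact
  interpret C: subgroup C G using C by (simp add: open_subgroup_def)
  have "K = (\<Union>k\<in>K. C #> k)"
  proof
    show "K \<subseteq> (\<Union>k\<in>K. C #> k)" using rcos_self[OF _ C.subgroup_axioms] K.subset by blast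
    show "(\<Union>k\<in>K. C #> k) \<subseteq> K" using assms(2) unfolding r_coset_def by auto
  qed
  also have "openin T \<dots>" using C K.subset by (intro openin_Union) (auto simp: open_subgroup_def intro: openin_r_coset)
  finally show ?thesis using assms(3) by (simp add: open_subgroup_def)
qed

lemma finite_rcosets_open:
  assumes "open_subgroup C" shows "finite (rcosets C)"
proof -
  have C: "subgroup C G" "openin T C" using assms by (auto simp: open_subgroup_def)
  have op: "\<forall>U\<in>rcosets C. openin T U"
    using openin_r_coset[OF C(2)] by (auto simp: RCOSETS_def)
  have "compactin T (topspace T)" using compactT by (simp add: compact_space_def)
  moreover have "topspace T \<subseteq> \<Union>(rcosets C)" using rcosets_part_G[OF C(1)] by simp
  ultimately obtain F where F: "finite F" "F \<subseteq> rcosets C" "topspace T \<subseteq> \<Union>F"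
    using op unfolding compactin_def by meson
  have "rcosets C \<subseteq> F"
  proof
    fix U assume U: "U \<in> rcosets C"
    then obtain a where a: "a \<in> carrier G" "U = C #> a" by (auto simp: RCOSETS_def)
    have aU: "a \<in> U" using rcos_self[OF a(1) C(1)] a(2) by simp
    then obtain W where W: "W \<in> F" "a \<in> W" using F(3) a(1) by auto
    have "U = W" using rcoset_eqI[OF C(1) U _ aU W(2)] W(1) F(2) by blast
    thus "U \<in> F" using W by simp
  qed
  thus ?thesis using F(1) finite_subset by blast
qed

text \<open>The complement is a finite union of cosets.\<close>

lemma closed_finite_index_open:
  assumes K: "subgroup K G" "closedin T K" and fin: "finite (rcosets K)"
  shows "open_subgroup K"
proof -
  have K0: "K \<in> rcosets K" by (rule subgroup.subgroup_in_rcosets[OF K(1) is_group])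
  have "closedin T (\<Union>(rcosets K - {K}))"
    using fin closedin_r_coset[OF K(2)] by (intro closedin_Union) (auto simp: RCOSETS_def)
  moreover have "carrier G - \<Union>(rcosets K - {K}) = K"
  proof
    show "carrier G - \<Union>(rcosets K - {K}) \<subseteq> K" using rcosets_part_G[OF K(1)] by blast
    have "K \<inter> U = {}" if "U \<in> rcosets K - {K}" for U
      using rcoset_eqI[OF K(1) K0, of U] that by blast
    thus "K \<subseteq> carrier G - \<Union>(rcosets K - {K})" using subgroup.subset[OF K(1)] by blast
  qed
  ultimately have "openin T K" using openin_diff[OF openin_topspace, of T "\<Union>(rcosets K - {K})"] by simp
  thus ?thesis using K(1) by (simp add: open_subgroup_def)
qed

text \<open>The complement is a union of cosets.\<close>

lemma open_subgroup_closed: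
  assumes C: "open_subgroup C" shows "closedin T C"
proof -
  have K: "subgroup C G" "openin T C" using C by (auto simp: open_subgroup_def)
  have K0: "C \<in> rcosets C" by (rule subgroup.subgroup_in_rcosets[OF K(1) is_group])
  have "openin T (\<Union>(rcosets C - {C}))"
    using openin_r_coset[OF K(2)] by (intro openin_Union) (auto simp: RCOSETS_def)
  moreover have "carrier G - C = \<Union>(rcosets C - {C})"
  proof
    show "carrier G - C \<subseteq> \<Union>(rcosets C - {C})" using rcosets_part_G[OF K(1)] by blast
    have "C \<inter> U = {}" if "U \<in> rcosets C - {C}" for U
      using rcoset_eqI[OF K(1) K0, of U] that by blast
    moreover have "U \<subseteq> carrier G" if "U \<in> rcosets C - {C}" for U
      using rcosets_part_G[OF K(1)] that by blast
    ultimately show "\<Union>(rcosets C - {C}) \<subseteq> carrier G - C" by blast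
  qed
  ultimately show ?thesis using subgroup.subset[OF K(1)] by (simp add: closedin_def)
qed

text \<open>The kernel of the action on the finitely many cosets of \<open>K\<close> is a finite intersection of conjugates
  of \<open>K\<close>.\<close>

lemma normal_core:
  assumes K: "open_subgroup K"
  shows "\<exists>N\<in>open_normal_subgroups G T. N \<subseteq> K"
proof -
  have sK: "subgroup K G" and oK: "openin T K" using K by (auto simp: open_subgroup_def)
  define N where "N = {x \<in> carrier G. \<forall>C\<in>rcosets K. C #> x = C}"
  have CG: "C \<subseteq> carrier G" if "C \<in> rcosets K" for C using rcosets_part_G[OF sK] that by blast
  have Cr: "C #> x \<in> rcosets K" if "C \<in> rcosets K" "x \<in> carrier G" for C x
    using that coset_mult_assoc[OF subgroup.subset[OF sK]] by (auto simp: RCOSETS_def)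
  have sN: "subgroup N G"
  proof (unfold_locales, goal_cases)
    case (2 x y)
    thus ?case using CG by (auto simp: N_def simp flip: coset_mult_assoc)
  next
    case (4 x)
    have "C #> inv x = C" if C: "C \<in> rcosets K" for C
    proof -
      have "C #> inv x = (C #> x) #> inv x" using 4 C by (simp add: N_def)
      also have "\<dots> = C" using 4 CG[OF C] by (simp add: N_def coset_mult_assoc coset_mult_one)
      finally show ?thesis .
    qed
    thus ?case using 4 by (simp add: N_def)
  qed (auto simp: N_def CG coset_mult_one)
  have "N \<lhd> G"
  proof (rule normal_invI[OF sN])
    fix x h assume x: "x \<in> carrier G" and h: "h \<in> N"
    have hG: "h \<in> carrier G" using h by (simp add: N_def)
    have "C #> (x \<otimes> h \<otimes> inv x) = C" if C: "C \<in> rcosets K" for C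
    proof -
      have "C #> (x \<otimes> h \<otimes> inv x) = ((C #> x) #> h) #> inv x"
        using CG[OF C] x hG by (simp add: coset_mult_assoc r_coset_subset_G m_assoc)
      also have "(C #> x) #> h = C #> x" using h Cr[OF C x] by (simp add: N_def)
      finally show ?thesis using CG[OF C] x by (simp add: coset_mult_assoc coset_mult_one)
    qed
    thus "x \<otimes> h \<otimes> inv x \<in> N" using x hG by (simp add: N_def)
  qed
  moreover have "N \<subseteq> K"
  proof
    fix x assume x: "x \<in> N"
    have "K #> x = K" using x subgroup.subgroup_in_rcosets[OF sK is_group] by (simp add: N_def)
    thus "x \<in> K" using rcos_self[OF _ sK, of x] x by (simp add: N_def)
  qed
  moreover have "openin T N"
  proof -
    have stab: "{x \<in> carrier G. (K #> a) #> x = K #> a} = {x \<in> topspace T. a \<otimes> x \<otimes> inv a \<in> K}"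
      if a: "a \<in> carrier G" for a
    proof -
      have "(K #> a) #> x = K #> a \<longleftrightarrow> a \<otimes> x \<otimes> inv a \<in> K" if x: "x \<in> carrier G" for x
      proof -
        have "(K #> a) #> x = K #> a \<longleftrightarrow> K #> (a \<otimes> x) = K #> a"
          using a x subgroup.subset[OF sK] by (simp add: coset_mult_assoc)
        also have "\<dots> \<longleftrightarrow> K #> (a \<otimes> x \<otimes> inv a) = K"
          using a x subgroup.subset[OF sK] coset_mult_inv1[of K "a \<otimes> x" a] coset_mult_inv2[of K "a \<otimes> x" a]
          by auto
        also have "\<dots> \<longleftrightarrow> a \<otimes> x \<otimes> inv a \<in> K"
          using a x coset_join1[OF _ _ sK, of "a \<otimes> x \<otimes> inv a"] coset_join2[OF _ sK, of "a \<otimes> x \<otimes> inv a"] by auto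
        finally show ?thesis .
      qed
      thus ?thesis by auto
    qed
    have "openin T {x \<in> carrier G. C #> x = C}" if C: "C \<in> rcosets K" for C
    proof -
      obtain a where a: "a \<in> carrier G" "C = K #> a" using C by (auto simp: RCOSETS_def)
      show ?thesis unfolding a(2) stab[OF a(1)]
        using openin_continuous_map_preimage[OF cont_translate oK] a(1) by simp
    qed
    hence "openin T (topspace T \<inter> (\<Inter>C\<in>rcosets K. {x \<in> carrier G. C #> x = C}))"
      using finite_rcosets_open[OF K] openin_topspace[of T] by (intro openin_Int_Inter) auto
    also have "topspace T \<inter> (\<Inter>C\<in>rcosets K. {x \<in> carrier G. C #> x = C}) = N" by (auto simp: N_def)
    finally show ?thesis .
  qed
  ultimately show ?thesis by (auto simp: open_normal_subgroups_def)
qed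

text \<open>The elements of \<open>S\<close> whose inverse is in \<open>S\<close> form such a subgroup. It is applied to small balls, for
  which closure under inversion would need a separate estimate.\<close>

lemma open_submonoid_subgroup:
  assumes S: "openin T S" "\<one> \<in> S" "\<And>x y. x \<in> S \<Longrightarrow> y \<in> S \<Longrightarrow> x \<otimes> y \<in> S"
  shows "\<exists>K. open_subgroup K \<and> K \<subseteq> S"
proof -
  define K where "K = {x \<in> S. inv x \<in> S}"
  have SG: "S \<subseteq> carrier G" using openin_subset[OF S(1)] by simp
  have "subgroup K G"
    using S SG by unfold_locales (auto simp: K_def inv_mult_group subset_iff)
  moreover have "openin T K"
  proof -
    have "openin T (S \<inter> {x \<in> topspace T. inv x \<in> S})"
      using S(1) by (intro openin_Int openin_continuous_map_preimage[OF cont_inv])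
    also have "S \<inter> {x \<in> topspace T. inv x \<in> S} = K" using SG by (auto simp: K_def)
    finally show ?thesis .
  qed
  ultimately show ?thesis by (auto simp: open_subgroup_def K_def)
qed

end

text \<open>Profinite groups, in the form that the open normal subgroups are a base at the identity.\<close>

locale profinite_group = compact_top_group +
  assumes Hausdorff_T: "Hausdorff_space T"
    and base_one: "openin T W \<Longrightarrow> \<one> \<in> W \<Longrightarrow> \<exists>N\<in>open_normal_subgroups G T. N \<subseteq> W"

text \<open>The balls of \<open>padic_analytic_group_balls\<close> are a base at the identity, and each of them contains an
  open normal subgroup. In the largest ball no element has prime order; an element of finite order has a
  power of prime order, so the normal subgroup in this ball is torsion-free.\<close>

theorem compact_padic_analytic_profinite:
  fixes G :: "('g, 'm) monoid_scheme" (structure)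
  assumes "compact_padic_analytic_group TYPE('k :: semiring_prime_char) G T"
  shows "profinite_group G T"
    and "\<exists>U\<in>open_normal_subgroups G T. \<forall>u\<in>U. \<forall>n>0. u [^]\<^bsub>G\<^esub> (n :: nat) = \<one>\<^bsub>G\<^esub> \<longrightarrow> u = \<one>\<^bsub>G\<^esub>"
proof -
  have an: "padic_analytic_group TYPE('k) G T" and cp: "compact_space T" and hd: "Hausdorff_space T"
    using assms by (auto simp: compact_padic_analytic_group_def)
  have tg: "topological_group G T" using an by (simp add: padic_analytic_group_def)
  interpret group G using tg by (simp add: topological_group_def)
  interpret compact_top_group G T using tg cp by unfold_locales
  obtain B :: "real \<Rightarrow> 'g set" and \<sigma> :: real where \<sigma>: "\<sigma> > 0"
    and B: "\<forall>s. 0 < s \<longrightarrow> s \<le> \<sigma> \<longrightarrow> openin T (B s) \<and> \<one> \<in> B s \<and> (\<forall>u\<in>B s. \<forall>v\<in>B s. u \<otimes> v \<in> B s)"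
    and base: "\<forall>W. openin T W \<longrightarrow> \<one> \<in> W \<longrightarrow> (\<exists>s. 0 < s \<and> s \<le> \<sigma> \<and> B s \<subseteq> W)"
    and tors: "\<forall>u q. u \<in> B \<sigma> \<longrightarrow> prime q \<longrightarrow> u [^] (q :: nat) = \<one> \<longrightarrow> u = \<one>"
    by (rule padic_analytic_group_balls[OF an]) (rule that)
  have core: "\<exists>N\<in>open_normal_subgroups G T. N \<subseteq> B s" if s: "0 < s" "s \<le> \<sigma>" for s
  proof -
    obtain K where K: "open_subgroup K" "K \<subseteq> B s"
      using open_submonoid_subgroup[of "B s"] B s by blast
    show ?thesis using normal_core[OF K(1)] K(2) by (meson subset_trans)
  qed
  have "\<exists>N\<in>open_normal_subgroups G T. N \<subseteq> W" if W: "openin T W" "\<one> \<in> W" for W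
  proof -
    obtain s where "0 < s" "s \<le> \<sigma>" "B s \<subseteq> W" using base W by blast
    thus ?thesis using core[of s] by blast
  qed
  with hd show "profinite_group G T"
    by unfold_locales auto
  obtain U where U: "U \<in> open_normal_subgroups G T" "U \<subseteq> B \<sigma>" using core[of \<sigma>] \<sigma> by auto
  have UG: "subgroup U G" using U(1) by (simp add: open_normal_subgroups_def normal_imp_subgroup)
  have "u = \<one>" if "u \<in> U" "n > 0" "u [^] n = \<one>" for u and n :: nat
    using that
  proof (induction n rule: less_induct)
    case (less n)
    have u: "u \<in> carrier G" using less.prems subgroup.subset[OF UG] by auto
    show ?case
    proof (cases "n = 1")
      case True
      thus ?thesis using less.prems u by simp
    next
      case False
      then obtain q where q: "prime q" "q dvd n" using prime_factor_nat by blast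
      define m where "m = n div q"
      have n: "n = m * q" using q(2) by (simp add: m_def)
      have m: "m > 0" using less.prems n by (cases m) auto
      have mn: "m < n" using n m prime_gt_1_nat[OF q(1)] by simp
      have "u [^] m \<in> U" using less.prems(1) by (induction m) (auto simp: subgroup.one_closed[OF UG] subgroup.m_closed[OF UG])
      moreover have "(u [^] m) [^] q = \<one>" using nat_pow_pow[OF u, of m q] n less.prems by simp
      ultimately have "u [^] m = \<one>" using tors q(1) U(2) by blast
      thus ?thesis using less.IH[OF mn less.prems(1) m] by simp
    qed
  qed
  thus "\<exists>U\<in>open_normal_subgroups G T. \<forall>u\<in>U. \<forall>n>0. u [^] (n :: nat) = \<one> \<longrightarrow> u = \<one>"
    using U(1) by blast
qed

context compact_top_group
begin

text \<open>The finite radical is a torsion group, so it meets \<open>U\<close> trivially and embeds into the finite set of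
  cosets of \<open>U\<close>.\<close>

lemma finite_radical_finite:
  assumes U: "U \<in> open_normal_subgroups G T"
    and tf: "\<And>u n. u \<in> U \<Longrightarrow> n > 0 \<Longrightarrow> u [^] (n :: nat) = \<one> \<Longrightarrow> u = \<one>"
  shows "finite (finite_radical G)"
proof (rule inj_on_finite)
  have sU: "subgroup U G" using U by (simp add: open_normal_subgroups_def normal_imp_subgroup)
  have DG: "finite_radical G \<subseteq> carrier G" by (auto simp: finite_radical_iff)
  show "finite (rcosets U)"
    using U sU by (intro finite_rcosets_open) (simp add: open_subgroup_def open_normal_subgroups_def)
  show "(\<lambda>x. U #> x) ` finite_radical G \<subseteq> rcosets U" using DG by (auto simp: RCOSETS_def)
  show "inj_on (\<lambda>x. U #> x) (finite_radical G)"
  proof (rule inj_onI)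
    fix x y assume xy: "x \<in> finite_radical G" "y \<in> finite_radical G" "U #> x = U #> y"
    have "x \<in> carrier G" "y \<in> carrier G" using xy DG by auto
    moreover have "x \<in> U #> y" using rcos_self[OF _ sU, of x] xy calculation by simp
    ultimately have "x \<otimes> inv y \<in> U" using sU by (auto simp: r_coset_def m_assoc subgroup.mem_carrier)
    moreover have "x \<otimes> inv y \<in> finite_radical G"
      using xy finite_radical_subgroup by (simp add: subgroup.m_closed subgroup.m_inv_closed)
    ultimately have "x \<otimes> inv y = \<one>" using tf finite_radical_iff by blast
    thus "x = y" using xy DG by (metis inv_equality inv_inv inv_closed subsetD)
  qed
qed

end

context profinite_group
begin

lemma centralizer_closed:
  assumes "x \<in> carrier G" shows "closedin T (centralizer_of x)"
proof -
  have "closedin T {y \<in> topspace T. x \<otimes> y = y \<otimes> x}"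
    using assms by (intro closedin_continuous_maps_eq[OF Hausdorff_T] cont_mult cont_id cont_const)
  thus ?thesis by simp
qed

text \<open>A finite intersection of centralisers, each closed and of finite index.\<close>

lemma finite_radical_centralizer_open:
  assumes fin: "finite (finite_radical G)"
  shows "open_subgroup {y \<in> carrier G. \<forall>x\<in>finite_radical G. x \<otimes> y = y \<otimes> x}"
proof -
  let ?D = "finite_radical G"
  have DG: "?D \<subseteq> carrier G" by (auto simp: finite_radical_iff)
  have op: "open_subgroup (centralizer_of x)" if "x \<in> ?D" for x
    using that DG finite_rcosets_centralizer_iff[of x] finite_radical_iff
    by (intro closed_finite_index_open centralizer_subgroup centralizer_closed) auto
  have ne: "?D \<noteq> {}" using subgroup.one_closed[OF finite_radical_subgroup] by auto
  have eq': "{y \<in> carrier G. \<forall>x\<in>?D. x \<otimes> y = y \<otimes> x} = (\<Inter>x\<in>?D. centralizer_of x)" using ne by auto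
  have "subgroup (\<Inter>(centralizer_of ` ?D)) G"
    using ne DG by (intro subgroups_Inter) (auto intro: centralizer_subgroup)
  moreover have "openin T (\<Inter>(centralizer_of ` ?D))"
    using op fin ne by (intro openin_Inter) (auto simp: open_subgroup_def)
  ultimately show ?thesis unfolding eq' by (simp add: open_subgroup_def)
qed

end

section \<open>Group rings of finite groups\<close>

locale finite_group = group Q for Q (structure) + assumes fin: "finite (carrier Q)"
begin

lemma group_ring_carrier_iff: "x \<in> carrier (group_ring Q) \<longleftrightarrow> {a. x a \<noteq> 0} \<subseteq> carrier Q"
  using finite_subset[OF _ fin, of "{a. x a \<noteq> 0}"] by (auto simp: group_ring_def)

lemma group_ring_zero_outside: "x \<in> carrier (group_ring Q) \<Longrightarrow> a \<notin> carrier Q \<Longrightarrow> x a = 0"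
  by (auto simp: group_ring_carrier_iff)

text \<open>Elements are compared by their pairings \<open>\<Sum> x m * h m\<close> with all functions \<open>h\<close>. The pairing of a
  product is an iterated sum (\<open>group_ring_mult_pair\<close>), and the pairing of an image under a group
  homomorphism is a pairing with the pulled-back function (\<open>group_ring_map_pair\<close>). So associativity and
  multiplicativity need no manipulation of fibres of the multiplication.\<close>

lemma group_ring_eqI:
  fixes x y :: "'a \<Rightarrow> 'k :: field"
  assumes "x \<in> carrier (group_ring Q)" "y \<in> carrier (group_ring Q)"
    and eq: "\<And>h. (\<Sum>m\<in>carrier Q. x m * h m) = (\<Sum>m\<in>carrier Q. y m * h m)"
  shows "x = y"
proof
  fix a
  have *: "(\<Sum>m\<in>carrier Q. z m * (if m = a then 1 else 0)) = z a" if "a \<in> carrier Q" for z :: "'a \<Rightarrow> 'k"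
  proof -
    have "(\<Sum>m\<in>carrier Q. z m * (if m = a then 1 else 0)) = (\<Sum>m\<in>carrier Q. if m = a then z m else 0)"
      by (intro sum.cong) auto
    thus ?thesis using that fin by simp
  qed
  show "x a = y a"
  proof (cases "a \<in> carrier Q")
    case True
    thus ?thesis using eq[of "\<lambda>m. if m = a then 1 else 0"] by (simp only: *)
  qed (use assms in \<open>simp add: group_ring_zero_outside\<close>)
qed

lemma group_ring_mult_apply:
  assumes "x \<in> carrier (group_ring Q)" "y \<in> carrier (group_ring Q)"
  shows "(x \<otimes>\<^bsub>group_ring Q\<^esub> y) c = (\<Sum>a\<in>carrier Q. \<Sum>b\<in>carrier Q. if a \<otimes> b = c then x a * y b else 0)"
proof -
  have "(\<Sum>a\<in>carrier Q. \<Sum>b\<in>carrier Q. if a \<otimes> b = c then x a * y b else 0)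
      = (\<Sum>(a, b)\<in>carrier Q \<times> carrier Q. if a \<otimes> b = c then x a * y b else 0)"
    by (rule sum.cartesian_product)
  also have "\<dots> = (\<Sum>(a, b)\<in>{(a, b). x a \<noteq> 0 \<and> y b \<noteq> 0 \<and> a \<otimes> b = c}. x a * y b)"
    using fin assms by (intro sum.mono_neutral_cong_right) (auto simp: group_ring_carrier_iff split: if_splits)
  finally show ?thesis by (simp add: group_ring_def)
qed

lemma group_ring_mult_closed:
  assumes "x \<in> carrier (group_ring Q)" "y \<in> carrier (group_ring Q)"
  shows "x \<otimes>\<^bsub>group_ring Q\<^esub> y \<in> carrier (group_ring Q)"
  unfolding group_ring_carrier_iff
proof
  fix c assume "c \<in> {c. (x \<otimes>\<^bsub>group_ring Q\<^esub> y) c \<noteq> 0}"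
  hence "(\<Sum>a\<in>carrier Q. \<Sum>b\<in>carrier Q. if a \<otimes> b = c then x a * y b else 0) \<noteq> 0"
    by (simp add: group_ring_mult_apply assms)
  then obtain a where a: "a \<in> carrier Q" "(\<Sum>b\<in>carrier Q. if a \<otimes> b = c then x a * y b else 0) \<noteq> 0"
    by (rule sum.not_neutral_contains_not_neutral)
  obtain b where "b \<in> carrier Q" "(if a \<otimes> b = c then x a * y b else 0) \<noteq> 0"
    by (rule sum.not_neutral_contains_not_neutral[OF a(2)])
  thus "c \<in> carrier Q" using a by (auto split: if_splits)
qed

lemma group_ring_mult_pair:
  assumes "x \<in> carrier (group_ring Q)" "y \<in> carrier (group_ring Q)"
  shows "(\<Sum>m\<in>carrier Q. (x \<otimes>\<^bsub>group_ring Q\<^esub> y) m * h m) =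
         (\<Sum>a\<in>carrier Q. x a * (\<Sum>b\<in>carrier Q. y b * h (a \<otimes> b)))"
proof -
  have "(\<Sum>m\<in>carrier Q. (x \<otimes>\<^bsub>group_ring Q\<^esub> y) m * h m) =
        (\<Sum>m\<in>carrier Q. \<Sum>a\<in>carrier Q. \<Sum>b\<in>carrier Q. if a \<otimes> b = m then x a * y b * h m else 0)"
    by (simp add: group_ring_mult_apply assms sum_distrib_right if_distrib[of "\<lambda>z. z * h _"] cong: if_cong)
  also have "\<dots> = (\<Sum>a\<in>carrier Q. \<Sum>m\<in>carrier Q. \<Sum>b\<in>carrier Q. if a \<otimes> b = m then x a * y b * h m else 0)"
    by (rule sum.swap)
  also have "\<dots> = (\<Sum>a\<in>carrier Q. \<Sum>b\<in>carrier Q. \<Sum>m\<in>carrier Q. if a \<otimes> b = m then x a * y b * h m else 0)"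
    by (intro sum.cong refl sum.swap)
  also have "\<dots> = (\<Sum>a\<in>carrier Q. \<Sum>b\<in>carrier Q. x a * y b * h (a \<otimes> b))"
    using fin by (intro sum.cong refl) simp
  finally show ?thesis by (simp add: sum_distrib_left mult.assoc)
qed

lemma group_ring_ring: "ring (group_ring Q :: ('a \<Rightarrow> 'k :: field) ring)"
proof (rule ringI)
  let ?R = "group_ring Q :: ('a \<Rightarrow> 'k :: field) ring"
  have add: "x \<oplus>\<^bsub>?R\<^esub> y = (\<lambda>a. x a + y a)" "\<zero>\<^bsub>?R\<^esub> = (\<lambda>a. 0)" for x y by (simp_all add: group_ring_def)
  have add_closed: "x \<oplus>\<^bsub>?R\<^esub> y \<in> carrier ?R" if "x \<in> carrier ?R" "y \<in> carrier ?R" for x y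
  proof -
    have "a \<in> carrier Q" if "x a + y a \<noteq> 0" for a
    proof (rule ccontr)
      assume "a \<notin> carrier Q"
      hence "x a = 0" "y a = 0" using group_ring_zero_outside \<open>x \<in> carrier ?R\<close> \<open>y \<in> carrier ?R\<close> by blast+
      thus False using that by simp
    qed
    thus ?thesis unfolding group_ring_carrier_iff add by blast
  qed
  have one: "\<one>\<^bsub>?R\<^esub> \<in> carrier ?R" 
    unfolding group_ring_carrier_iff by (auto simp: group_ring_def split: if_splits)
  have one_pair: "(\<Sum>m\<in>carrier Q. \<one>\<^bsub>?R\<^esub> m * h m) = h \<one>" for h
  proof -
    have "(\<Sum>m\<in>carrier Q. \<one>\<^bsub>?R\<^esub> m * h m) = (\<Sum>m\<in>carrier Q. if m = \<one> then h m else 0)"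
      by (intro sum.cong) (auto simp: group_ring_def)
    thus ?thesis using fin by simp
  qed
  show "abelian_group ?R"
  proof (rule abelian_groupI)
    fix x assume x: "x \<in> carrier ?R"
    show "\<exists>y\<in>carrier ?R. y \<oplus>\<^bsub>?R\<^esub> x = \<zero>\<^bsub>?R\<^esub>"
      using x by (intro bexI[of _ "\<lambda>a. - x a"]) (simp_all add: add group_ring_carrier_iff)
  qed (simp_all add: add_closed, auto simp: add group_ring_carrier_iff algebra_simps)
  show "monoid ?R"
  proof (rule monoidI)
    fix x y z assume x: "x \<in> carrier ?R" and y: "y \<in> carrier ?R" and z: "z \<in> carrier ?R"
    show "x \<otimes>\<^bsub>?R\<^esub> y \<otimes>\<^bsub>?R\<^esub> z = x \<otimes>\<^bsub>?R\<^esub> (y \<otimes>\<^bsub>?R\<^esub> z)"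
      by (rule group_ring_eqI) (simp_all add: group_ring_mult_closed group_ring_mult_pair x y z m_assoc cong: sum.cong)
  next
    fix x assume x: "x \<in> carrier ?R"
    show "\<one>\<^bsub>?R\<^esub> \<otimes>\<^bsub>?R\<^esub> x = x"
      by (rule group_ring_eqI) (simp_all add: group_ring_mult_closed group_ring_mult_pair x one one_pair)
    show "x \<otimes>\<^bsub>?R\<^esub> \<one>\<^bsub>?R\<^esub> = x"
      by (rule group_ring_eqI) (simp_all add: group_ring_mult_closed group_ring_mult_pair x one one_pair)
  qed (simp_all add: one group_ring_mult_closed)
  fix x y z assume x: "x \<in> carrier ?R" and y: "y \<in> carrier ?R" and z: "z \<in> carrier ?R"
  have add_pair: "(\<Sum>m\<in>carrier Q. (x \<oplus>\<^bsub>?R\<^esub> y) m * h m) = (\<Sum>m\<in>carrier Q. x m * h m) + (\<Sum>m\<in>carrier Q. y m * h m)"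
    for x y h by (simp add: add algebra_simps sum.distrib)
  have add_pair': "(\<Sum>m\<in>carrier Q. (x \<oplus>\<^bsub>?R\<^esub> y) m * h m) = (\<Sum>m\<in>carrier Q. x m * h m + y m * h m)"
    for x y h by (simp add: add algebra_simps)
  show "(x \<oplus>\<^bsub>?R\<^esub> y) \<otimes>\<^bsub>?R\<^esub> z = x \<otimes>\<^bsub>?R\<^esub> z \<oplus>\<^bsub>?R\<^esub> y \<otimes>\<^bsub>?R\<^esub> z"
    by (rule group_ring_eqI) (simp_all add: group_ring_mult_closed add_closed group_ring_mult_pair add_pair x y z)
  show "z \<otimes>\<^bsub>?R\<^esub> (x \<oplus>\<^bsub>?R\<^esub> y) = z \<otimes>\<^bsub>?R\<^esub> x \<oplus>\<^bsub>?R\<^esub> z \<otimes>\<^bsub>?R\<^esub> y"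
    by (rule group_ring_eqI)
      (simp_all add: group_ring_mult_closed add_closed group_ring_mult_pair add_pair x y z distrib_left sum.distrib)
qed

lemma group_ring_map_apply:
  assumes "x \<in> carrier (group_ring Q)"
  shows "group_ring_map \<phi> x b = (\<Sum>a\<in>{a \<in> carrier Q. \<phi> a = b}. x a)"
  unfolding group_ring_map_def
  using fin assms by (intro sum.mono_neutral_left) (auto simp: group_ring_carrier_iff)

lemma group_ring_map_pair:
  assumes x: "x \<in> carrier (group_ring Q)" and \<phi>: "\<phi> \<in> carrier Q \<rightarrow> F" and F: "finite F"
  shows "(\<Sum>b\<in>F. group_ring_map \<phi> x b * h b) = (\<Sum>a\<in>carrier Q. x a * h (\<phi> a))"
proof -
  have "(\<Sum>b\<in>F. group_ring_map \<phi> x b * h b) = (\<Sum>b\<in>F. \<Sum>a\<in>{a \<in> carrier Q. \<phi> a = b}. x a * h (\<phi> a))"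
    by (simp add: group_ring_map_apply[OF x] sum_distrib_right)
  also have "\<dots> = (\<Sum>a\<in>carrier Q. x a * h (\<phi> a))"
    using fin F \<phi> by (intro sum.group) auto
  finally show ?thesis .
qed

end

lemma group_ring_map_closed:
  assumes "finite_group Q" "finite_group Q'" "x \<in> carrier (group_ring Q)" "\<phi> \<in> carrier Q \<rightarrow> carrier Q'"
  shows "group_ring_map \<phi> x \<in> carrier (group_ring Q')"
proof -
  have "b \<in> carrier Q'" if b: "group_ring_map \<phi> x b \<noteq> 0" for b
  proof -
    obtain a where "a \<in> {a \<in> carrier Q. \<phi> a = b}"
      by (rule sum.not_neutral_contains_not_neutral[OF b[unfolded finite_group.group_ring_map_apply[OF assms(1,3)]]])
    thus ?thesis using assms(4) by auto
  qed
  thus ?thesis by (auto simp: finite_group.group_ring_carrier_iff[OF assms(2)])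
qed

lemma group_ring_map_mult:
  fixes x y :: "'a \<Rightarrow> 'k :: field"
  assumes Q: "finite_group Q" and Q': "finite_group Q'"
    and x: "x \<in> carrier (group_ring Q)" and y: "y \<in> carrier (group_ring Q)" and \<phi>: "\<phi> \<in> hom Q Q'"
  shows "group_ring_map \<phi> (x \<otimes>\<^bsub>group_ring Q\<^esub> y) = group_ring_map \<phi> x \<otimes>\<^bsub>group_ring Q'\<^esub> group_ring_map \<phi> y"
proof -
  interpret Q: finite_group Q by fact
  interpret Q': finite_group Q' by fact
  have \<phi>': "\<phi> \<in> carrier Q \<rightarrow> carrier Q'" using \<phi> by (auto simp: hom_def)
  note mc = group_ring_map_closed[OF Q Q' _ \<phi>'] and mp = Q.group_ring_map_pair[OF _ \<phi>' Q'.fin]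
  have \<phi>m: "\<phi> (a \<otimes>\<^bsub>Q\<^esub> b) = \<phi> a \<otimes>\<^bsub>Q'\<^esub> \<phi> b" if "a \<in> carrier Q" "b \<in> carrier Q" for a b
    using hom_mult[OF \<phi> that] .
  show ?thesis
    by (rule Q'.group_ring_eqI)
      (simp_all add: mc mp Q.group_ring_mult_closed Q'.group_ring_mult_closed
        Q.group_ring_mult_pair Q'.group_ring_mult_pair x y \<phi>m cong: sum.cong)
qed

section \<open>Completed group rings\<close>

context compact_top_group
begin

abbreviation \<N> :: "'g set set" where "\<N> \<equiv> open_normal_subgroups G T"

abbreviation kG :: "('g set \<Rightarrow> 'g set \<Rightarrow> 'k :: field) ring" where
  "kG \<equiv> completed_group_ring G T"

lemma \<N>D: assumes "N \<in> \<N>" shows "N \<lhd> G" "subgroup N G" "openin T N" "N \<subseteq> carrier G" "open_subgroup N"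
  using assms by (auto simp: open_normal_subgroups_def normal_imp_subgroup open_subgroup_def subgroup.subset)

lemma \<N>_Int: assumes "N \<in> \<N>" "M \<in> \<N>" shows "N \<inter> M \<in> \<N>"
proof -
  have "N \<inter> M \<lhd> G"
  proof (rule normal_invI)
    show "subgroup (N \<inter> M) G" using assms by (intro subgroups_Inter_pair \<N>D)
    fix x h assume "x \<in> carrier G" "h \<in> N \<inter> M"
    thus "x \<otimes> h \<otimes> inv x \<in> N \<inter> M"
      using normal.inv_op_closed2[OF \<N>D(1)[OF assms(1)]] normal.inv_op_closed2[OF \<N>D(1)[OF assms(2)]] by auto
  qed
  thus ?thesis using assms by (auto simp: open_normal_subgroups_def)
qed

lemma carrier_Mod [simp]: "carrier (G Mod N) = rcosets N" by (simp add: FactGroup_def)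
lemma mult_Mod [simp]: "A \<otimes>\<^bsub>G Mod N\<^esub> B = A <#> B" by (simp add: FactGroup_def)
lemma one_Mod [simp]: "\<one>\<^bsub>G Mod N\<^esub> = N" by (simp add: FactGroup_def)

lemma fg: "N \<in> \<N> \<Longrightarrow> finite_group (G Mod N)"
  by (intro finite_group.intro normal.factorgroup_is_group finite_group_axioms.intro \<N>D)
    (simp_all add: finite_rcosets_open \<N>D)

lemma finite_rcosets [simp]: "N \<in> \<N> \<Longrightarrow> finite (rcosets N)"
  by (simp add: finite_rcosets_open \<N>D)

lemma rcoset_repr:
  assumes "N \<in> \<N>" "C \<in> rcosets N" "a \<in> C"
  shows "C = N #> a" "a \<in> carrier G"
proof -
  show a: "a \<in> carrier G" using rcosets_part_G[OF \<N>D(2)[OF assms(1)]] assms by blast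
  show "C = N #> a"
    using assms a by (intro rcoset_eqI[OF \<N>D(2)[OF assms(1)] assms(2) _ assms(3)] rcos_self \<N>D)
      (auto simp: RCOSETS_def)
qed

lemma rcoset_in: "a \<in> carrier G \<Longrightarrow> N #> a \<in> rcosets N" by (auto simp: RCOSETS_def)

lemma rcoset_self: "N \<in> \<N> \<Longrightarrow> a \<in> carrier G \<Longrightarrow> a \<in> N #> a"
  by (simp add: rcos_self \<N>D)

lemma rcoset_exists: "C \<in> rcosets N \<Longrightarrow> \<exists>a\<in>carrier G. C = N #> a"
  by (auto simp: RCOSETS_def)

lemma coset_mult: "N \<in> \<N> \<Longrightarrow> a \<in> carrier G \<Longrightarrow> b \<in> carrier G \<Longrightarrow> (N #> a) <#> (N #> b) = N #> (a \<otimes> b)"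
  by (rule normal.rcos_sum[OF \<N>D(1)])

lemma coset_proj:
  assumes N: "N \<in> \<N>" and M: "M \<in> \<N>" and NM: "N \<subseteq> M" and a: "a \<in> carrier G"
  shows "(N #> a) <#> M = M #> a"
proof -
  have MG: "M \<subseteq> carrier G" "N \<subseteq> carrier G" using N M \<N>D by auto
  show ?thesis
  proof (intro equalityI subsetI)
    fix x assume "x \<in> (N #> a) <#> M"
    then obtain n m where nm: "n \<in> N" "m \<in> M" "x = n \<otimes> a \<otimes> m" by (auto simp: set_mult_def r_coset_def)
    have G': "n \<in> carrier G" "m \<in> carrier G" using nm MG by auto
    have "x = (n \<otimes> (a \<otimes> m \<otimes> inv a)) \<otimes> a" using nm(3) G' a by (simp add: m_assoc)
    moreover have "a \<otimes> m \<otimes> inv a \<in> M" using normal.inv_op_closed2[OF \<N>D(1)[OF M] a nm(2)] .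
    hence "n \<otimes> (a \<otimes> m \<otimes> inv a) \<in> M"
      using subgroup.m_closed[OF \<N>D(2)[OF M], of n "a \<otimes> m \<otimes> inv a"] nm(1) NM by blast
    ultimately show "x \<in> M #> a" by (auto simp: r_coset_def)
  next
    fix x assume "x \<in> M #> a"
    then obtain m where m: "m \<in> M" "x = m \<otimes> a" by (auto simp: r_coset_def)
    have mG: "m \<in> carrier G" using m MG by auto
    have "x = (\<one> \<otimes> a) \<otimes> (inv a \<otimes> m \<otimes> a)" using m mG a by (simp add: m_assoc)
    moreover have "inv a \<otimes> m \<otimes> a \<in> M" using normal.inv_op_closed1[OF \<N>D(1)[OF M] a m(1)] .
    moreover have "\<one> \<otimes> a \<in> N #> a"
      using subgroup.one_closed[OF \<N>D(2)[OF N]] unfolding r_coset_def by blast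
    ultimately show "x \<in> (N #> a) <#> M" unfolding set_mult_def by blast
  qed
qed

lemma coset_subset_iff:
  assumes N: "N \<in> \<N>" and M: "M \<in> \<N>" and NM: "N \<subseteq> M" and C: "C \<in> rcosets N" and E: "E \<in> rcosets M"
  shows "C <#> M = E \<longleftrightarrow> C \<subseteq> E" "C \<inter> E \<noteq> {} \<longleftrightarrow> C \<subseteq> E"
proof -
  obtain a where a: "a \<in> carrier G" "C = N #> a" using C rcoset_exists by blast
  have CM: "C <#> M = M #> a" using coset_proj[OF N M NM a(1)] a(2) by simp
  have "C \<subseteq> M #> a" using a NM by (auto simp: r_coset_def)
  moreover have "a \<in> C" using rcoset_self[OF N a(1)] a(2) by simp
  moreover have "E = M #> a" if "x \<in> C" "x \<in> E" for x
    using rcoset_eqI[OF \<N>D(2)[OF M] E rcoset_in[OF a(1)], of x] that \<open>C \<subseteq> M #> a\<close> by blast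
  ultimately show "C <#> M = E \<longleftrightarrow> C \<subseteq> E" "C \<inter> E \<noteq> {} \<longleftrightarrow> C \<subseteq> E" unfolding CM by blast+
qed

lemma proj_hom:
  assumes N: "N \<in> \<N>" and M: "M \<in> \<N>" and NM: "N \<subseteq> M"
  shows "(\<lambda>C. C <#> M) \<in> hom (G Mod N) (G Mod M)"
proof (rule homI)
  fix C assume "C \<in> carrier (G Mod N)"
  then obtain a where a: "a \<in> carrier G" "C = N #> a" using rcoset_exists by auto
  thus "C <#> M \<in> carrier (G Mod M)" using coset_proj[OF N M NM] rcoset_in by simp
  fix D assume "D \<in> carrier (G Mod N)"
  then obtain b where b: "b \<in> carrier G" "D = N #> b" using rcoset_exists by auto
  show "(C \<otimes>\<^bsub>G Mod N\<^esub> D) <#> M = (C <#> M) \<otimes>\<^bsub>G Mod M\<^esub> (D <#> M)"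
    using a b N M by (simp add: coset_mult coset_proj[OF N M NM])
qed

lemma kG_carrier_iff:
  "x \<in> carrier kG \<longleftrightarrow> x \<in> extensional \<N> \<and> (\<forall>N\<in>\<N>. x N \<in> carrier (group_ring (G Mod N))) \<and>
    (\<forall>N\<in>\<N>. \<forall>M\<in>\<N>. N \<subseteq> M \<longrightarrow> x M = group_ring_map (\<lambda>C. C <#> M) (x N))"
  by (auto simp: completed_group_ring_def Let_def PiE_iff)

lemma kG_apply:
  assumes "N \<in> \<N>"
  shows "(x \<otimes>\<^bsub>kG\<^esub> y) N = x N \<otimes>\<^bsub>group_ring (G Mod N)\<^esub> y N" "(x \<oplus>\<^bsub>kG\<^esub> y) N = (\<lambda>C. x N C + y N C)"
    "\<one>\<^bsub>kG\<^esub> N = \<one>\<^bsub>group_ring (G Mod N)\<^esub>" "\<zero>\<^bsub>kG\<^esub> N = (\<lambda>C. 0)"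
  using assms by (simp_all add: completed_group_ring_def Let_def group_ring_def)

lemma kG_extensional:
  "x \<otimes>\<^bsub>kG\<^esub> y \<in> extensional \<N>" "x \<oplus>\<^bsub>kG\<^esub> y \<in> extensional \<N>"
  "\<one>\<^bsub>kG\<^esub> \<in> extensional \<N>" "\<zero>\<^bsub>kG\<^esub> \<in> extensional \<N>"
  by (simp_all add: completed_group_ring_def Let_def)

lemma kG_eqI:
  assumes "x \<in> extensional \<N>" "y \<in> extensional \<N>" "\<And>N. N \<in> \<N> \<Longrightarrow> x N = y N"
  shows "x = y"
  using extensionalityI[OF assms] .

lemma kG_D:
  assumes "x \<in> carrier kG"
  shows "x \<in> extensional \<N>" "\<And>N. N \<in> \<N> \<Longrightarrow> x N \<in> carrier (group_ring (G Mod N))"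
    "\<And>N C. N \<in> \<N> \<Longrightarrow> C \<notin> rcosets N \<Longrightarrow> x N C = 0"
    "\<And>N M. N \<in> \<N> \<Longrightarrow> M \<in> \<N> \<Longrightarrow> N \<subseteq> M \<Longrightarrow> x M = group_ring_map (\<lambda>C. C <#> M) (x N)"
proof -
  show "x \<in> extensional \<N>" and 1: "\<And>N. N \<in> \<N> \<Longrightarrow> x N \<in> carrier (group_ring (G Mod N))"
    and "\<And>N M. N \<in> \<N> \<Longrightarrow> M \<in> \<N> \<Longrightarrow> N \<subseteq> M \<Longrightarrow> x M = group_ring_map (\<lambda>C. C <#> M) (x N)"
    using assms unfolding kG_carrier_iff by blast+
  show "x N C = 0" if "N \<in> \<N>" "C \<notin> rcosets N" for N C
    using finite_group.group_ring_zero_outside[OF fg 1, of N C] that by simp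
qed

text \<open>The compatibility condition of the inverse limit, in terms of measures: an element of \<open>kG\<close> assigns a
  mass to every coset of an open normal subgroup, and the masses are additive.\<close>

lemma kG_sum:
  assumes x: "x \<in> carrier kG" and N: "N \<in> \<N>" and M: "M \<in> \<N>" and NM: "N \<subseteq> M" and E: "E \<in> rcosets M"
  shows "x M E = (\<Sum>C\<in>{C \<in> rcosets N. C \<subseteq> E}. x N C)"
proof -
  have "x M E = (\<Sum>C\<in>{C \<in> carrier (G Mod N). C <#> M = E}. x N C)"
    unfolding kG_D(4)[OF x N M NM] by (rule finite_group.group_ring_map_apply[OF fg[OF N] kG_D(2)[OF x N]])
  also have "{C \<in> carrier (G Mod N). C <#> M = E} = {C \<in> rcosets N. C \<subseteq> E}"
    using coset_subset_iff(1)[OF N M NM _ E] by auto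
  finally show ?thesis .
qed

lemma kG_carrierI:
  assumes "x \<in> extensional \<N>" "\<And>N C. N \<in> \<N> \<Longrightarrow> C \<notin> rcosets N \<Longrightarrow> x N C = 0"
    and "\<And>N M E. N \<in> \<N> \<Longrightarrow> M \<in> \<N> \<Longrightarrow> N \<subseteq> M \<Longrightarrow> E \<in> rcosets M \<Longrightarrow> x M E = (\<Sum>C\<in>{C \<in> rcosets N. C \<subseteq> E}. x N C)"
  shows "x \<in> carrier kG"
  unfolding kG_carrier_iff
proof (intro conjI ballI impI)
  show 1: "x N \<in> carrier (group_ring (G Mod N))" if N: "N \<in> \<N>" for N
    using assms(2)[OF N] by (auto simp: finite_group.group_ring_carrier_iff[OF fg[OF N]])
  fix N M assume N: "N \<in> \<N>" and M: "M \<in> \<N>" and NM: "N \<subseteq> M"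
  show "x M = group_ring_map (\<lambda>C. C <#> M) (x N)"
  proof
    fix E
    have eq: "group_ring_map (\<lambda>C. C <#> M) (x N) E = (\<Sum>C\<in>{C \<in> carrier (G Mod N). C <#> M = E}. x N C)"
      by (rule finite_group.group_ring_map_apply[OF fg[OF N] 1[OF N]])
    show "x M E = group_ring_map (\<lambda>C. C <#> M) (x N) E"
    proof (cases "E \<in> rcosets M")
      case True
      have "{C \<in> carrier (G Mod N). C <#> M = E} = {C \<in> rcosets N. C \<subseteq> E}"
        using coset_subset_iff(1)[OF N M NM _ True] by auto
      thus ?thesis using assms(3)[OF N M NM True] eq by simp
    next
      case False
      have "{C \<in> carrier (G Mod N). C <#> M = E} = {}"
        using proj_hom[OF N M NM] False by (auto simp: hom_def)
      thus ?thesis using assms(2)[OF M False] eq by (simp only: sum.empty)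
    qed
  qed
qed (rule assms(1))

lemma kG_ring: "ring (kG :: ('g set \<Rightarrow> 'g set \<Rightarrow> 'k :: field) ring)"
proof -
  let ?R = "kG :: ('g set \<Rightarrow> 'g set \<Rightarrow> 'k :: field) ring"
  have gr: "ring (group_ring (G Mod N) :: ('g set \<Rightarrow> 'k) ring)" if "N \<in> \<N>" for N
    using finite_group.group_ring_ring[OF fg[OF that]] .
  have grz: "x \<oplus>\<^bsub>group_ring (G Mod N)\<^esub> y = (\<lambda>C. x C + y C)" "\<zero>\<^bsub>group_ring (G Mod N)\<^esub> = (\<lambda>C. 0)"
    for N and x y :: "'g set \<Rightarrow> 'k" by (simp_all add: group_ring_def)
  have mc: "x \<otimes>\<^bsub>?R\<^esub> y \<in> carrier ?R" if x: "x \<in> carrier ?R" and y: "y \<in> carrier ?R" for x y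
    unfolding kG_carrier_iff
  proof (intro conjI ballI impI kG_extensional)
    show "(x \<otimes>\<^bsub>?R\<^esub> y) N \<in> carrier (group_ring (G Mod N))" if N: "N \<in> \<N>" for N
      using finite_group.group_ring_mult_closed[OF fg[OF N] kG_D(2)[OF x N] kG_D(2)[OF y N]] by (simp add: kG_apply N)
    fix N M assume N: "N \<in> \<N>" and M: "M \<in> \<N>" and NM: "N \<subseteq> M"
    show "(x \<otimes>\<^bsub>?R\<^esub> y) M = group_ring_map (\<lambda>C. C <#> M) ((x \<otimes>\<^bsub>?R\<^esub> y) N)"
      unfolding kG_apply(1)[OF N] kG_apply(1)[OF M]
      using group_ring_map_mult[OF fg[OF N] fg[OF M] kG_D(2)[OF x N] kG_D(2)[OF y N] proj_hom[OF N M NM]]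
        kG_D(4)[OF x N M NM] kG_D(4)[OF y N M NM] by simp
  qed
  have ac: "x \<oplus>\<^bsub>?R\<^esub> y \<in> carrier ?R" if x: "x \<in> carrier ?R" and y: "y \<in> carrier ?R" for x y
  proof (rule kG_carrierI[OF kG_extensional(2)])
    fix N C assume "N \<in> \<N>" "C \<notin> rcosets N"
    thus "(x \<oplus>\<^bsub>?R\<^esub> y) N C = 0" using kG_D(3)[OF x] kG_D(3)[OF y] by (simp add: kG_apply)
  next
    fix N M E assume NM: "N \<in> \<N>" "M \<in> \<N>" "N \<subseteq> M" "E \<in> rcosets M"
    thus "(x \<oplus>\<^bsub>?R\<^esub> y) M E = (\<Sum>C\<in>{C \<in> rcosets N. C \<subseteq> E}. (x \<oplus>\<^bsub>?R\<^esub> y) N C)"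
      using kG_sum[OF x NM] kG_sum[OF y NM] by (simp add: kG_apply sum.distrib)
  qed
  have nc: "(\<lambda>N\<in>\<N>. \<lambda>C. - x N C) \<in> carrier ?R" if x: "x \<in> carrier ?R" for x
  proof (rule kG_carrierI)
    fix N C assume "N \<in> \<N>" "C \<notin> rcosets N"
    thus "(\<lambda>N\<in>\<N>. \<lambda>C. - x N C) N C = 0" using kG_D(3)[OF x] by simp
  next
    fix N M E assume NM: "N \<in> \<N>" "M \<in> \<N>" "N \<subseteq> M" "E \<in> rcosets M"
    thus "(\<lambda>N\<in>\<N>. \<lambda>C. - x N C) M E = (\<Sum>C\<in>{C \<in> rcosets N. C \<subseteq> E}. (\<lambda>N\<in>\<N>. \<lambda>C. - x N C) N C)"
      using kG_sum[OF x NM] by (simp add: sum_negf)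
  qed simp
  have zc: "\<zero>\<^bsub>?R\<^esub> \<in> carrier ?R"
    by (rule kG_carrierI[OF kG_extensional(4)]) (simp_all add: kG_apply)
  have oc: "\<one>\<^bsub>?R\<^esub> \<in> carrier ?R"
  proof (rule kG_carrierI[OF kG_extensional(3)])
    fix N C assume N: "N \<in> \<N>" "C \<notin> rcosets N"
    hence "C \<noteq> N" using subgroup.subgroup_in_rcosets[OF \<N>D(2) is_group] by blast
    thus "\<one>\<^bsub>?R\<^esub> N C = 0" using N by (simp add: kG_apply) (simp add: group_ring_def)
  next
    fix N M E assume NM: "N \<in> \<N>" "M \<in> \<N>" "N \<subseteq> M" "E \<in> rcosets M"
    have NN: "N \<in> rcosets N" "M \<in> rcosets M"
      using NM subgroup.subgroup_in_rcosets[OF \<N>D(2) is_group] by blast+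
    have "N \<subseteq> E \<longleftrightarrow> M = E"
      using coset_subset_iff(1)[OF NM(1-3) NN(1) NM(4)] coset_subset_iff(1)[OF NM(1-3) NN(1) NN(2)] NM(3) by simp
    moreover have "(\<Sum>C\<in>{C \<in> rcosets N. C \<subseteq> E}. if C = N then 1 else (0 :: 'k)) = (if N \<subseteq> E then 1 else 0)"
      using NM NN by simp
    ultimately show "\<one>\<^bsub>?R\<^esub> M E = (\<Sum>C\<in>{C \<in> rcosets N. C \<subseteq> E}. \<one>\<^bsub>?R\<^esub> N C)"
      using NM(1,2) by (simp add: kG_apply) (simp add: group_ring_def)
  qed
  show ?thesis
  proof (rule ringI)
    show "abelian_group ?R"
    proof (rule abelian_groupI)
      fix x assume x: "x \<in> carrier ?R"
      show "\<exists>y\<in>carrier ?R. y \<oplus>\<^bsub>?R\<^esub> x = \<zero>\<^bsub>?R\<^esub>"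
      proof (rule bexI[OF _ nc[OF x]])
        show "(\<lambda>N\<in>\<N>. \<lambda>C. - x N C) \<oplus>\<^bsub>?R\<^esub> x = \<zero>\<^bsub>?R\<^esub>"
          by (rule kG_eqI[OF kG_extensional(2,4)]) (simp add: kG_apply)
      qed
      show "\<zero>\<^bsub>?R\<^esub> \<oplus>\<^bsub>?R\<^esub> x = x"
        by (rule kG_eqI[OF kG_extensional(2) kG_D(1)[OF x]]) (simp add: kG_apply)
    next
      fix x y z
      show "x \<oplus>\<^bsub>?R\<^esub> y \<oplus>\<^bsub>?R\<^esub> z = x \<oplus>\<^bsub>?R\<^esub> (y \<oplus>\<^bsub>?R\<^esub> z)" "x \<oplus>\<^bsub>?R\<^esub> y = y \<oplus>\<^bsub>?R\<^esub> x"
        by (rule kG_eqI[OF kG_extensional(2,2)]; simp add: kG_apply algebra_simps)+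
    qed (simp_all add: ac zc)
    show "monoid ?R"
    proof (rule monoidI)
      fix x y z assume x: "x \<in> carrier ?R" and y: "y \<in> carrier ?R" and z: "z \<in> carrier ?R"
      show "x \<otimes>\<^bsub>?R\<^esub> y \<otimes>\<^bsub>?R\<^esub> z = x \<otimes>\<^bsub>?R\<^esub> (y \<otimes>\<^bsub>?R\<^esub> z)"
      proof (rule kG_eqI[OF kG_extensional(1,1)])
        fix N assume N: "N \<in> \<N>"
        interpret gr: ring "group_ring (G Mod N) :: ('g set \<Rightarrow> 'k) ring" by (rule gr[OF N])
        show "(x \<otimes>\<^bsub>?R\<^esub> y \<otimes>\<^bsub>?R\<^esub> z) N = (x \<otimes>\<^bsub>?R\<^esub> (y \<otimes>\<^bsub>?R\<^esub> z)) N"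
          unfolding kG_apply(1)[OF N] by (rule gr.m_assoc[OF kG_D(2)[OF x N] kG_D(2)[OF y N] kG_D(2)[OF z N]])
      qed
    next
      fix x assume x: "x \<in> carrier ?R"
      show "\<one>\<^bsub>?R\<^esub> \<otimes>\<^bsub>?R\<^esub> x = x"
      proof (rule kG_eqI[OF kG_extensional(1) kG_D(1)[OF x]])
        fix N assume N: "N \<in> \<N>"
        interpret gr: ring "group_ring (G Mod N) :: ('g set \<Rightarrow> 'k) ring" by (rule gr[OF N])
        show "(\<one>\<^bsub>?R\<^esub> \<otimes>\<^bsub>?R\<^esub> x) N = x N"
          unfolding kG_apply(1,3)[OF N] by (rule gr.l_one[OF kG_D(2)[OF x N]])
      qed
      show "x \<otimes>\<^bsub>?R\<^esub> \<one>\<^bsub>?R\<^esub> = x"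
      proof (rule kG_eqI[OF kG_extensional(1) kG_D(1)[OF x]])
        fix N assume N: "N \<in> \<N>"
        interpret gr: ring "group_ring (G Mod N) :: ('g set \<Rightarrow> 'k) ring" by (rule gr[OF N])
        show "(x \<otimes>\<^bsub>?R\<^esub> \<one>\<^bsub>?R\<^esub>) N = x N"
          unfolding kG_apply(1,3)[OF N] by (rule gr.r_one[OF kG_D(2)[OF x N]])
      qed
    qed (simp_all add: mc oc)
    fix x y z assume x: "x \<in> carrier ?R" and y: "y \<in> carrier ?R" and z: "z \<in> carrier ?R"
    show "(x \<oplus>\<^bsub>?R\<^esub> y) \<otimes>\<^bsub>?R\<^esub> z = x \<otimes>\<^bsub>?R\<^esub> z \<oplus>\<^bsub>?R\<^esub> y \<otimes>\<^bsub>?R\<^esub> z"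
    proof (rule kG_eqI[OF kG_extensional(1,2)])
      fix N assume N: "N \<in> \<N>"
      interpret gr: ring "group_ring (G Mod N) :: ('g set \<Rightarrow> 'k) ring" by (rule gr[OF N])
      show "((x \<oplus>\<^bsub>?R\<^esub> y) \<otimes>\<^bsub>?R\<^esub> z) N = (x \<otimes>\<^bsub>?R\<^esub> z \<oplus>\<^bsub>?R\<^esub> y \<otimes>\<^bsub>?R\<^esub> z) N"
        unfolding kG_apply(1,2)[OF N]
        using gr.l_distr[OF kG_D(2)[OF x N] kG_D(2)[OF y N] kG_D(2)[OF z N]] by (simp add: grz)
    qed
    show "z \<otimes>\<^bsub>?R\<^esub> (x \<oplus>\<^bsub>?R\<^esub> y) = z \<otimes>\<^bsub>?R\<^esub> x \<oplus>\<^bsub>?R\<^esub> z \<otimes>\<^bsub>?R\<^esub> y"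
    proof (rule kG_eqI[OF kG_extensional(1,2)])
      fix N assume N: "N \<in> \<N>"
      interpret gr: ring "group_ring (G Mod N) :: ('g set \<Rightarrow> 'k) ring" by (rule gr[OF N])
      show "(z \<otimes>\<^bsub>?R\<^esub> (x \<oplus>\<^bsub>?R\<^esub> y)) N = (z \<otimes>\<^bsub>?R\<^esub> x \<oplus>\<^bsub>?R\<^esub> z \<otimes>\<^bsub>?R\<^esub> y) N"
        unfolding kG_apply(1,2)[OF N]
        using gr.r_distr[OF kG_D(2)[OF x N] kG_D(2)[OF y N] kG_D(2)[OF z N]] by (simp add: grz)
    qed
  qed
qed

end

context compact_top_group
begin

subsection \<open>Supports\<close>

text \<open>
  The elements of \<open>kG\<close>, viewed as measures, whose support is in the closure of \<open>X\<close>. For a closed subgroup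
  \<open>X\<close> this is the completed group ring of \<open>X\<close> (\<open>completed_subring_eq\<close>). In contrast to the embedded
  completed group ring it makes sense for arbitrary sets, which allows to speak of the components of an
  element with respect to the cosets of a subgroup.
\<close>

definition supp_in :: "'g set \<Rightarrow> ('g set \<Rightarrow> 'g set \<Rightarrow> 'k :: field) set" where
  "supp_in X = {x \<in> carrier kG. \<forall>N\<in>\<N>. \<forall>C. x N C \<noteq> 0 \<longrightarrow> C \<inter> X \<noteq> {}}"

abbreviation \<gamma> :: "'g \<Rightarrow> 'g set \<Rightarrow> 'g set \<Rightarrow> 'k :: field" where
  "\<gamma> \<equiv> group_elt G T"

lemma supp_inD: "x \<in> supp_in X \<Longrightarrow> x \<in> carrier kG"
  "x \<in> supp_in X \<Longrightarrow> N \<in> \<N> \<Longrightarrow> x N C \<noteq> 0 \<Longrightarrow> C \<inter> X \<noteq> {}"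
  by (auto simp: supp_in_def)

lemma supp_in_zero: "\<zero>\<^bsub>kG\<^esub> \<in> supp_in X"
  using ring.ring_simprules(2)[OF kG_ring] by (simp add: supp_in_def kG_apply)

lemma supp_in_empty: "supp_in {} = {\<zero>\<^bsub>kG\<^esub>}"
proof
  show "supp_in {} \<subseteq> {\<zero>\<^bsub>kG\<^esub>}"
  proof
    fix x assume x: "x \<in> supp_in {}"
    have "x = \<zero>\<^bsub>kG\<^esub>"
      by (rule kG_eqI[OF kG_D(1)[OF supp_inD(1)[OF x]] kG_extensional(4)])
        (use supp_inD(2)[OF x] in \<open>auto simp: kG_apply\<close>)
    thus "x \<in> {\<zero>\<^bsub>kG\<^esub>}" by simp
  qed
qed (use supp_in_zero in auto)

lemma supp_in_add:
  assumes "x \<in> supp_in X" "y \<in> supp_in X" shows "x \<oplus>\<^bsub>kG\<^esub> y \<in> supp_in X"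
proof -
  have "C \<inter> X \<noteq> {}" if "N \<in> \<N>" "x N C + y N C \<noteq> 0" for N C
  proof (cases "x N C = 0")
    case True
    hence "y N C \<noteq> 0" using that(2) by simp
    thus ?thesis by (rule supp_inD(2)[OF assms(2) that(1)])
  qed (rule supp_inD(2)[OF assms(1) that(1)])
  thus ?thesis using ring.ring_simprules(1)[OF kG_ring] assms by (auto simp: supp_in_def kG_apply)
qed

lemma kG_neg_apply:
  assumes x: "x \<in> carrier kG" and N: "N \<in> \<N>"
  shows "(\<ominus>\<^bsub>kG\<^esub> x) N C = - x N C"
proof -
  have "(x \<oplus>\<^bsub>kG\<^esub> \<ominus>\<^bsub>kG\<^esub> x) N C = \<zero>\<^bsub>kG\<^esub> N C" by (simp add: ring.ring_simprules(16)[OF kG_ring x])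
  thus ?thesis using N by (simp add: kG_apply eq_neg_iff_add_eq_0 add.commute)
qed

lemma supp_in_neg: "x \<in> supp_in X \<Longrightarrow> \<ominus>\<^bsub>kG\<^esub> x \<in> supp_in X"
  using ring.ring_simprules(3)[OF kG_ring] by (auto simp: supp_in_def kG_neg_apply)

lemma supp_in_mono: "X \<subseteq> Y \<Longrightarrow> supp_in X \<subseteq> supp_in Y"
  by (fastforce simp: supp_in_def)

lemma supp_in_top: "supp_in (carrier G) = carrier kG"
proof -
  have "C \<inter> carrier G \<noteq> {}" if "x \<in> carrier kG" "N \<in> \<N>" "x N C \<noteq> 0" for x :: "'g set \<Rightarrow> 'g set \<Rightarrow> 'k :: field" and N C
  proof -
    have "C \<in> rcosets N" using kG_D(3)[OF that(1,2)] that(3) by blast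
    then obtain a where "a \<in> carrier G" "C = N #> a" using rcoset_exists by blast
    thus ?thesis using rcoset_self[OF that(2)] by blast
  qed
  thus ?thesis by (auto simp: supp_in_def)
qed

lemma supp_in_rcoset:
  assumes "x \<in> supp_in X" "N \<in> \<N>" "x N C \<noteq> 0"
  obtains p where "p \<in> X" "p \<in> carrier G" "C = N #> p"
proof -
  have "C \<in> rcosets N" using kG_D(3)[OF supp_inD(1)[OF assms(1)] assms(2)] assms(3) by blast
  moreover obtain p where "p \<in> C" "p \<in> X" using supp_inD(2)[OF assms] by blast
  ultimately show ?thesis using that rcoset_repr[OF assms(2)] by blast
qed

lemma kG_mult_apply:
  assumes "N \<in> \<N>"
  shows "(x \<otimes>\<^bsub>kG\<^esub> y) N C = (\<Sum>(A, B)\<in>{(A, B). x N A \<noteq> 0 \<and> y N B \<noteq> 0 \<and> A <#> B = C}. x N A * y N B)"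
  unfolding kG_apply(1)[OF assms] by (simp add: group_ring_def)

lemma supp_in_mult:
  assumes x: "x \<in> supp_in X" and y: "y \<in> supp_in Y" and XY: "\<And>p q. p \<in> X \<Longrightarrow> q \<in> Y \<Longrightarrow> p \<otimes> q \<in> Z"
  shows "x \<otimes>\<^bsub>kG\<^esub> y \<in> supp_in Z"
proof -
  have "C \<inter> Z \<noteq> {}" if N: "N \<in> \<N>" and C: "(x \<otimes>\<^bsub>kG\<^esub> y) N C \<noteq> 0" for N C
  proof -
    obtain z where "z \<in> {(A, B). x N A \<noteq> 0 \<and> y N B \<noteq> 0 \<and> A <#> B = C}"
      by (rule sum.not_neutral_contains_not_neutral[OF C[unfolded kG_mult_apply[OF N]]])
    then obtain A B where AB: "x N A \<noteq> 0" "y N B \<noteq> 0" "A <#> B = C" by auto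
    obtain p where p: "p \<in> A" "p \<in> X" using supp_inD(2)[OF x N AB(1)] by auto
    obtain q where q: "q \<in> B" "q \<in> Y" using supp_inD(2)[OF y N AB(2)] by auto
    have "p \<otimes> q \<in> C" using AB(3) p q by (auto simp: set_mult_def)
    thus ?thesis using XY p q by auto
  qed
  thus ?thesis using ring.ring_simprules(5)[OF kG_ring] supp_inD(1)[OF x] supp_inD(1)[OF y]
    by (simp add: supp_in_def)
qed

lemma supp_in_commute:
  assumes x: "x \<in> supp_in X" and y: "y \<in> supp_in Y"
    and XY: "\<And>p q. p \<in> X \<Longrightarrow> q \<in> Y \<Longrightarrow> p \<otimes> q = q \<otimes> p"
  shows "x \<otimes>\<^bsub>kG\<^esub> y = y \<otimes>\<^bsub>kG\<^esub> x"
proof (rule kG_eqI[OF kG_extensional(1,1)])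
  fix N assume N: "N \<in> \<N>"
  have comm: "A <#> B = B <#> A" if AB: "x N A \<noteq> 0" "y N B \<noteq> 0" for A B
  proof -
    obtain p where p: "p \<in> X" "p \<in> carrier G" "A = N #> p" by (rule supp_in_rcoset[OF x N AB(1)])
    obtain q where q: "q \<in> Y" "q \<in> carrier G" "B = N #> q" by (rule supp_in_rcoset[OF y N AB(2)])
    show ?thesis using p q XY[OF p(1) q(1)] by (simp add: coset_mult N)
  qed
  show "(x \<otimes>\<^bsub>kG\<^esub> y) N = (y \<otimes>\<^bsub>kG\<^esub> x) N"
  proof
    fix C
    show "(x \<otimes>\<^bsub>kG\<^esub> y) N C = (y \<otimes>\<^bsub>kG\<^esub> x) N C"
      unfolding kG_mult_apply[OF N]
    proof (rule sum.reindex_bij_witness[of _ prod.swap prod.swap], goal_cases)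
      case (2 z)
      thus ?case using comm[of "fst z" "snd z"] by auto
    next
      case (4 z)
      thus ?case using comm[of "snd z" "fst z"] by auto
    qed (auto simp: mult.commute)
  qed
qed

lemma group_elt_apply: "N \<in> \<N> \<Longrightarrow> \<gamma> g N = (\<lambda>C. if C = N #> g then 1 else 0)"
  by (simp add: group_elt_def)

lemma group_elt_closed: assumes g: "g \<in> carrier G" shows "\<gamma> g \<in> carrier kG"
proof (rule kG_carrierI)
  fix N C assume N: "N \<in> \<N>" "C \<notin> rcosets N"
  thus "\<gamma> g N C = 0" using rcoset_in[OF g] by (auto simp: group_elt_apply)
next
  fix N M E assume NM: "N \<in> \<N>" "M \<in> \<N>" "N \<subseteq> M" "E \<in> rcosets M"
  have "N #> g \<subseteq> E \<longleftrightarrow> M #> g = E"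
    using coset_subset_iff(1)[OF NM(1-3) rcoset_in[OF g] NM(4)] coset_proj[OF NM(1-3) g] by simp
  moreover have "(\<Sum>C\<in>{C \<in> rcosets N. C \<subseteq> E}. \<gamma> g N C) = (if N #> g \<subseteq> E then 1 else 0)"
    using NM rcoset_in[OF g] by (simp add: group_elt_apply)
  ultimately show "\<gamma> g M E = (\<Sum>C\<in>{C \<in> rcosets N. C \<subseteq> E}. \<gamma> g N C)"
    using NM rcoset_in[OF g, of N] by (auto simp: group_elt_apply)
qed (simp add: group_elt_def)

lemma group_elt_supp: assumes g: "g \<in> carrier G" shows "\<gamma> g \<in> supp_in {g}"
  using group_elt_closed[OF g] rcoset_self[OF _ g]
  by (auto simp: supp_in_def group_elt_apply split: if_splits)

lemma group_elt_one: "\<gamma> \<one> = \<one>\<^bsub>kG\<^esub>"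
proof (rule kG_eqI[OF _ kG_extensional(3)])
  show "\<gamma> \<one> \<in> extensional \<N>" by (simp add: group_elt_def)
  fix N assume N: "N \<in> \<N>"
  have "N #> \<one> = N" using N by (simp add: coset_mult_one \<N>D)
  thus "\<gamma> \<one> N = \<one>\<^bsub>kG\<^esub> N" using N by (simp add: group_elt_apply kG_apply) (simp add: group_ring_def)
qed

lemma group_elt_mult:
  assumes g: "g \<in> carrier G" and h: "h \<in> carrier G"
  shows "\<gamma> g \<otimes>\<^bsub>kG\<^esub> \<gamma> h = \<gamma> (g \<otimes> h)"
proof (rule kG_eqI[OF kG_extensional(1)])
  show "\<gamma> (g \<otimes> h) \<in> extensional \<N>" by (simp add: group_elt_def)
  fix N assume N: "N \<in> \<N>"
  show "(\<gamma> g \<otimes>\<^bsub>kG\<^esub> \<gamma> h) N = \<gamma> (g \<otimes> h) N"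
  proof
    fix C
    have eq: "{(A, B). \<gamma> g N A \<noteq> 0 \<and> \<gamma> h N B \<noteq> 0 \<and> A <#> B = C}
        = (if C = N #> (g \<otimes> h) then {(N #> g, N #> h)} else {})"
      using N g h by (auto simp: group_elt_apply coset_mult split: if_splits)
    show "(\<gamma> g \<otimes>\<^bsub>kG\<^esub> \<gamma> h) N C = \<gamma> (g \<otimes> h) N C"
      unfolding kG_mult_apply[OF N] eq using N by (auto simp: group_elt_apply)
  qed
qed

subsection \<open>Restriction to a union of cosets\<close>

definition cosets_split :: "'g set \<Rightarrow> 'g set \<Rightarrow> bool" where
  "cosets_split N Y \<longleftrightarrow> (\<forall>C\<in>rcosets N. C \<subseteq> Y \<or> C \<inter> Y = {})"

lemma cosets_split_mono:
  assumes "N \<in> \<N>" "M \<in> \<N>" "N \<subseteq> M" "cosets_split M Y" shows "cosets_split N Y"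
  unfolding cosets_split_def
proof
  fix C assume C: "C \<in> rcosets N"
  obtain a where a: "a \<in> carrier G" "C = N #> a" using C rcoset_exists by blast
  have "C \<subseteq> M #> a" using a assms(3) by (auto simp: r_coset_def)
  thus "C \<subseteq> Y \<or> C \<inter> Y = {}"
    using assms(4) rcoset_in[OF a(1), of M] unfolding cosets_split_def by blast
qed

lemma cosets_split_subgroup:
  assumes N: "N \<in> \<N>" and NC: "N \<subseteq> K" and K: "subgroup K G" and Y: "Y \<in> rcosets K"
  shows "cosets_split N Y"
  unfolding cosets_split_def
proof
  fix C assume C: "C \<in> rcosets N"
  obtain a where a: "a \<in> carrier G" "C = N #> a" using C rcoset_exists by blast
  have "C \<subseteq> K #> a" using a NC by (auto simp: r_coset_def)
  moreover have "K #> a \<in> rcosets K" using a by (auto simp: RCOSETS_def)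
  ultimately show "C \<subseteq> Y \<or> C \<inter> Y = {}" using rcoset_eqI[OF K Y] by blast
qed

text \<open>
  The restriction of the measure \<open>x\<close> to \<open>Y\<close>, a union of cosets of \<open>N0\<close>. A coset \<open>C\<close> of \<open>N\<close> need not be
  contained in \<open>Y\<close> or disjoint from \<open>Y\<close>, so its mass is computed after refinement to \<open>N \<inter> N0\<close>.
\<close>

definition restr :: "'g set \<Rightarrow> 'g set \<Rightarrow> ('g set \<Rightarrow> 'g set \<Rightarrow> 'k :: field) \<Rightarrow> ('g set \<Rightarrow> 'g set \<Rightarrow> 'k)" where
  "restr N0 Y x = (\<lambda>N\<in>\<N>. \<lambda>C. if C \<in> rcosets N then
     (\<Sum>C'\<in>{C' \<in> rcosets (N \<inter> N0). C' \<subseteq> C \<and> C' \<subseteq> Y}. x (N \<inter> N0) C') else 0)"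

text \<open>A sum over cosets may be evaluated in two steps, provided that the selecting predicate depends only on
  the coarser coset.\<close>

lemma sum_cosets_nested:
  fixes f :: "'g set \<Rightarrow> 'k :: field"
  assumes N: "N \<in> \<N>" and M: "M \<in> \<N>" and NM: "N \<subseteq> M" and PQ: "\<And>C E. C \<in> rcosets N \<Longrightarrow> E \<in> rcosets M \<Longrightarrow> C \<subseteq> E \<Longrightarrow> P C \<longleftrightarrow> Q E"
  shows "(\<Sum>E\<in>{E \<in> rcosets M. Q E}. \<Sum>C\<in>{C \<in> rcosets N. C \<subseteq> E}. f C) = (\<Sum>C\<in>{C \<in> rcosets N. P C}. f C)"
proof -
  have proj: "C <#> M \<in> rcosets M" "C \<subseteq> C <#> M" if "C \<in> rcosets N" for C
  proof -
    show 1: "C <#> M \<in> rcosets M" using proj_hom[OF N M NM] that by (auto simp: hom_def)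
    show "C \<subseteq> C <#> M" using coset_subset_iff(1)[OF N M NM that 1] by simp
  qed
  have PQ': "Q (C <#> M) \<longleftrightarrow> P C" if "C \<in> rcosets N" for C
    using PQ[OF that proj[OF that]] by simp
  have "(\<Sum>C\<in>{C \<in> rcosets N. P C}. f C)
      = (\<Sum>E\<in>{E \<in> rcosets M. Q E}. \<Sum>C\<in>{C \<in> {C \<in> rcosets N. P C}. C <#> M = E}. f C)"
    using N M proj(1) PQ' by (intro sum.group[symmetric]) auto
  also have "\<dots> = (\<Sum>E\<in>{E \<in> rcosets M. Q E}. \<Sum>C\<in>{C \<in> rcosets N. C \<subseteq> E}. f C)"
    using coset_subset_iff(1)[OF N M NM] PQ by (intro sum.cong refl arg_cong2[of _ _ _ _ sum]) auto
  finally show ?thesis ..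
qed

lemma restr_closed:
  assumes x: "x \<in> carrier kG" and N0: "N0 \<in> \<N>" and Y: "cosets_split N0 Y"
  shows "restr N0 Y x \<in> carrier kG"
proof (rule kG_carrierI)
  fix N M E assume N: "N \<in> \<N>" and M: "M \<in> \<N>" and NM: "N \<subseteq> M" and E: "E \<in> rcosets M"
  have N': "N \<inter> N0 \<in> \<N>" and M': "M \<inter> N0 \<in> \<N>" using \<N>_Int N M N0 by auto
  have sp: "cosets_split (M \<inter> N0) Y" using cosets_split_mono[OF M' N0 _ Y] by auto
  have "restr N0 Y x M E = (\<Sum>C'\<in>{C' \<in> rcosets (M \<inter> N0). C' \<subseteq> E \<and> C' \<subseteq> Y}. x (M \<inter> N0) C')"
    using M E by (simp add: restr_def)
  also have "\<dots> = (\<Sum>C'\<in>{C' \<in> rcosets (M \<inter> N0). C' \<subseteq> E \<and> C' \<subseteq> Y}. \<Sum>C\<in>{C \<in> rcosets (N \<inter> N0). C \<subseteq> C'}. x (N \<inter> N0) C)"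
    using NM by (intro sum.cong refl kG_sum[OF x N' M']) auto
  also have "\<dots> = (\<Sum>C\<in>{C \<in> rcosets (N \<inter> N0). C \<subseteq> E \<and> C \<subseteq> Y}. x (N \<inter> N0) C)"
  proof (rule sum_cosets_nested[OF N' M'])
    fix C C' assume C: "C \<in> rcosets (N \<inter> N0)" and C': "C' \<in> rcosets (M \<inter> N0)" and CC: "C \<subseteq> C'"
    have ne: "C \<noteq> {}" using C rcoset_exists rcoset_self[OF N'] by blast
    have "C' \<subseteq> E" if "C \<subseteq> E"
      using coset_subset_iff(2)[OF M' M _ C' E] that ne CC by blast
    moreover have "C' \<subseteq> Y" if "C \<subseteq> Y" using sp C' that ne CC unfolding cosets_split_def by blast
    ultimately show "C \<subseteq> E \<and> C \<subseteq> Y \<longleftrightarrow> C' \<subseteq> E \<and> C' \<subseteq> Y" using CC by blast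
  qed (use NM in auto)
  also have "\<dots> = (\<Sum>C\<in>{C \<in> rcosets N. C \<subseteq> E}. \<Sum>C'\<in>{C' \<in> rcosets (N \<inter> N0). C' \<subseteq> C}. if C' \<subseteq> Y then x (N \<inter> N0) C' else 0)"
  proof -
    have "(\<Sum>C\<in>{C \<in> rcosets N. C \<subseteq> E}. \<Sum>C'\<in>{C' \<in> rcosets (N \<inter> N0). C' \<subseteq> C}. if C' \<subseteq> Y then x (N \<inter> N0) C' else 0)
        = (\<Sum>C'\<in>{C' \<in> rcosets (N \<inter> N0). C' \<subseteq> E}. if C' \<subseteq> Y then x (N \<inter> N0) C' else 0)"
    proof (rule sum_cosets_nested[OF N' N])
      fix C C' assume C: "C \<in> rcosets (N \<inter> N0)" and C': "C' \<in> rcosets N" and CC: "C \<subseteq> C'"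
      have ne: "C \<noteq> {}" using C rcoset_exists rcoset_self[OF N'] by blast
      show "C \<subseteq> E \<longleftrightarrow> C' \<subseteq> E" using coset_subset_iff(2)[OF N M NM C' E] ne CC by blast
    qed auto
    also have "\<dots> = (\<Sum>C\<in>{C \<in> rcosets (N \<inter> N0). C \<subseteq> E \<and> C \<subseteq> Y}. x (N \<inter> N0) C)"
      using N' by (intro sum.mono_neutral_cong_right) auto
    finally show ?thesis ..
  qed
  also have "\<dots> = (\<Sum>C\<in>{C \<in> rcosets N. C \<subseteq> E}. restr N0 Y x N C)"
  proof (rule sum.cong[OF refl])
    fix C assume C: "C \<in> {C \<in> rcosets N. C \<subseteq> E}"
    have "(\<Sum>C'\<in>{C' \<in> rcosets (N \<inter> N0). C' \<subseteq> C}. if C' \<subseteq> Y then x (N \<inter> N0) C' else 0)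
      = (\<Sum>C'\<in>{C' \<in> rcosets (N \<inter> N0). C' \<subseteq> C \<and> C' \<subseteq> Y}. x (N \<inter> N0) C')"
      using N' by (intro sum.mono_neutral_cong_right) auto
    thus "(\<Sum>C'\<in>{C' \<in> rcosets (N \<inter> N0). C' \<subseteq> C}. if C' \<subseteq> Y then x (N \<inter> N0) C' else 0) = restr N0 Y x N C"
      using N C by (simp add: restr_def)
  qed
  finally show "restr N0 Y x M E = (\<Sum>C\<in>{C \<in> rcosets N. C \<subseteq> E}. restr N0 Y x N C)" .
qed (simp_all add: restr_def)

lemma restr_supp:
  assumes x: "x \<in> supp_in X" and N0: "N0 \<in> \<N>" and Y: "cosets_split N0 Y"
  shows "restr N0 Y x \<in> supp_in (X \<inter> Y)"
proof -
  have "C \<inter> (X \<inter> Y) \<noteq> {}" if N: "N \<in> \<N>" and C: "restr N0 Y x N C \<noteq> 0" for N C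
  proof -
    have "(\<Sum>C'\<in>{C' \<in> rcosets (N \<inter> N0). C' \<subseteq> C \<and> C' \<subseteq> Y}. x (N \<inter> N0) C') \<noteq> 0"
      using C N by (simp add: restr_def split: if_splits)
    then obtain C' where C': "C' \<in> {C' \<in> rcosets (N \<inter> N0). C' \<subseteq> C \<and> C' \<subseteq> Y}" "x (N \<inter> N0) C' \<noteq> 0"
      by (rule sum.not_neutral_contains_not_neutral)
    have "C' \<inter> X \<noteq> {}" using supp_inD(2)[OF x \<N>_Int[OF N N0] C'(2)] .
    thus ?thesis using C' by blast
  qed
  thus ?thesis using restr_closed[OF supp_inD(1)[OF x] N0 Y] by (auto simp: supp_in_def)
qed

lemma kG_finsum_apply:
  assumes "finite I" "\<And>i. i \<in> I \<Longrightarrow> f i \<in> carrier kG" "N \<in> \<N>"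
  shows "(\<Oplus>\<^bsub>kG\<^esub>i\<in>I. f i) N C = (\<Sum>i\<in>I. f i N C)"
proof -
  interpret R: ring kG by (rule kG_ring)
  show ?thesis using assms(1,2)
  proof (induction I rule: finite_induct)
    case empty
    thus ?case using assms(3) by (simp add: kG_apply)
  next
    case (insert i I)
    hence "(\<Oplus>\<^bsub>kG\<^esub>i\<in>insert i I. f i) = f i \<oplus>\<^bsub>kG\<^esub> (\<Oplus>\<^bsub>kG\<^esub>i\<in>I. f i)"
      by (intro R.finsum_insert) auto
    thus ?case using insert assms(3) by (simp add: kG_apply)
  qed
qed

text \<open>The measure \<open>x\<close> is the sum of its restrictions to the finitely many cosets of \<open>K\<close>.\<close>

lemma supp_in_split:
  assumes C: "open_subgroup K" and x: "x \<in> supp_in X"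
  shows "\<exists>f. (\<forall>Y\<in>rcosets K. f Y \<in> supp_in (X \<inter> Y)) \<and> x = (\<Oplus>\<^bsub>kG\<^esub>Y\<in>rcosets K. f Y)"
proof -
  interpret R: ring kG by (rule kG_ring)
  have sK: "subgroup K G" using C by (simp add: open_subgroup_def)
  obtain N0 where N0: "N0 \<in> \<N>" "N0 \<subseteq> K" using normal_core[OF C] by blast
  define f where "f Y = restr N0 Y x" for Y
  have sp: "cosets_split N0 Y" if "Y \<in> rcosets K" for Y
    using cosets_split_subgroup[OF N0 sK that] .
  have f: "f Y \<in> supp_in (X \<inter> Y)" if "Y \<in> rcosets K" for Y
    unfolding f_def using restr_supp[OF x N0(1) sp[OF that]] .
  have xc: "x \<in> carrier kG" using supp_inD(1)[OF x] .
  have "x = (\<Oplus>\<^bsub>kG\<^esub>Y\<in>rcosets K. f Y)"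
  proof (rule kG_eqI[OF kG_D(1)[OF xc]])
    have fc: "f Y \<in> carrier kG" if "Y \<in> rcosets K" for Y using f[OF that] supp_inD(1) by blast
    show "(\<Oplus>\<^bsub>kG\<^esub>Y\<in>rcosets K. f Y) \<in> extensional \<N>"
      by (rule kG_D(1)) (use fc in \<open>auto intro!: R.finsum_closed\<close>)
    fix N assume N: "N \<in> \<N>"
    show "x N = (\<Oplus>\<^bsub>kG\<^esub>Y\<in>rcosets K. f Y) N"
    proof
      fix D
      have N': "N \<inter> N0 \<in> \<N>" using \<N>_Int[OF N N0(1)] .
      have sum: "(\<Oplus>\<^bsub>kG\<^esub>Y\<in>rcosets K. f Y) N D = (\<Sum>Y\<in>rcosets K. f Y N D)"
        by (rule kG_finsum_apply[OF finite_rcosets_open[OF C] fc N])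
      show "x N D = (\<Oplus>\<^bsub>kG\<^esub>Y\<in>rcosets K. f Y) N D"
      proof (cases "D \<in> rcosets N")
        case True
        have "x N D = (\<Sum>C'\<in>{C' \<in> rcosets (N \<inter> N0). C' \<subseteq> D}. x (N \<inter> N0) C')"
          by (rule kG_sum[OF xc N' N _ True]) auto
        also have "\<dots> = (\<Sum>Y\<in>rcosets K. \<Sum>C'\<in>{C' \<in> {C' \<in> rcosets (N \<inter> N0). C' \<subseteq> D}. K <#> C' = Y}. x (N \<inter> N0) C')"
        proof (rule sum.group[symmetric])
          show "(\<lambda>C'. K <#> C') ` {C' \<in> rcosets (N \<inter> N0). C' \<subseteq> D} \<subseteq> rcosets K"
          proof
            fix Z assume "Z \<in> (\<lambda>C'. K <#> C') ` {C' \<in> rcosets (N \<inter> N0). C' \<subseteq> D}"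
            then obtain C' where C': "C' \<in> rcosets (N \<inter> N0)" "Z = K <#> C'" by auto
            obtain a where a: "a \<in> carrier G" "C' = (N \<inter> N0) #> a" using C'(1) rcoset_exists by blast
            have "K <#> ((N \<inter> N0) #> a) = (K <#> (N \<inter> N0)) #> a"
              using a(1) subgroup.subset[OF sK] \<N>D(4)[OF N'] by (simp add: setmult_rcos_assoc)
            also have "K <#> (N \<inter> N0) = K"
            proof
              show "K <#> (N \<inter> N0) \<subseteq> K" using N0(2) subgroup.m_closed[OF sK] by (auto simp: set_mult_def)
              show "K \<subseteq> K <#> (N \<inter> N0)"
              proof
                fix z assume "z \<in> K"
                moreover have "z = z \<otimes> \<one>" using \<open>z \<in> K\<close> subgroup.subset[OF sK] by auto
                moreover have "\<one> \<in> N \<inter> N0" using subgroup.one_closed[OF \<N>D(2)[OF N']] .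
                ultimately show "z \<in> K <#> (N \<inter> N0)" unfolding set_mult_def by blast
              qed
            qed
            finally show "Z \<in> rcosets K" using C'(2) a by (auto simp: RCOSETS_def)
          qed
        qed (use N' finite_rcosets_open[OF C] in auto)
        also have "\<dots> = (\<Sum>Y\<in>rcosets K. f Y N D)"
        proof (rule sum.cong[OF refl])
          fix Y assume Y: "Y \<in> rcosets K"
          have "K <#> C' = Y \<longleftrightarrow> C' \<subseteq> Y" if C': "C' \<in> rcosets (N \<inter> N0)" for C'
          proof -
            obtain a where a: "a \<in> carrier G" "C' = (N \<inter> N0) #> a" using C' rcoset_exists by blast
            have aC: "a \<in> C'" using a rcoset_self[OF N'] by simp
            have sub: "C' \<subseteq> K #> a" using a(2) N0(2) by (auto simp: r_coset_def)
            have "K <#> C' = K #> a"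
            proof
              show "K <#> C' \<subseteq> K #> a"
              proof
                fix z assume "z \<in> K <#> C'"
                then obtain k n where kn: "k \<in> K" "n \<in> N0" "z = k \<otimes> (n \<otimes> a)" using a(2) by (auto simp: set_mult_def r_coset_def)
                have "k \<in> carrier G" "n \<in> carrier G" using kn subgroup.subset[OF sK] N0(2) by auto
                hence "z = (k \<otimes> n) \<otimes> a" using kn(3) a(1) by (simp add: m_assoc)
                thus "z \<in> K #> a" using kn N0(2) subgroup.m_closed[OF sK] by (auto simp: r_coset_def)
              qed
              show "K #> a \<subseteq> K <#> C'" using aC by (auto simp: set_mult_def r_coset_def)
            qed
            moreover have "K #> a \<in> rcosets K" using a(1) by (auto simp: RCOSETS_def)
            ultimately show ?thesis using sub aC rcoset_eqI[OF sK _ Y, of "K #> a" a] by blast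
          qed
          hence "{C' \<in> {C' \<in> rcosets (N \<inter> N0). C' \<subseteq> D}. K <#> C' = Y} = {C' \<in> rcosets (N \<inter> N0). C' \<subseteq> D \<and> C' \<subseteq> Y}"
            by auto
          thus "(\<Sum>C'\<in>{C' \<in> {C' \<in> rcosets (N \<inter> N0). C' \<subseteq> D}. K <#> C' = Y}. x (N \<inter> N0) C') = f Y N D"
            using N True by (simp add: f_def restr_def)
        qed
        finally show ?thesis using sum by simp
      next
        case False
        thus ?thesis using sum kG_D(3)[OF xc N False] kG_D(3)[OF fc N False] by simp
      qed
    qed
  qed
  thus ?thesis using f by blast
qed

text \<open>On a level that refines \<open>K\<close> every coset is in \<open>K\<close> or in its complement, hence has mass \<open>0\<close>.\<close>

lemma supp_in_disjoint:
  assumes K: "open_subgroup K" and x: "x \<in> supp_in K" "x \<in> supp_in (carrier G - K)"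
  shows "x = \<zero>\<^bsub>kG\<^esub>"
proof -
  have sK: "subgroup K G" using K by (simp add: open_subgroup_def)
  obtain N0 where N0: "N0 \<in> \<N>" "N0 \<subseteq> K" using normal_core[OF K] by blast
  have xc: "x \<in> carrier kG" using supp_inD(1)[OF x(1)] .
  show ?thesis
  proof (rule kG_eqI[OF kG_D(1)[OF xc] kG_extensional(4)])
    fix N assume N: "N \<in> \<N>"
    have N': "N \<inter> N0 \<in> \<N>" using \<N>_Int[OF N N0(1)] .
    have 0: "x (N \<inter> N0) C = 0" for C
    proof (rule ccontr)
      assume C: "x (N \<inter> N0) C \<noteq> 0"
      have "C \<in> rcosets (N \<inter> N0)" using kG_D(3)[OF xc N'] C by blast
      moreover have "cosets_split (N \<inter> N0) K"
        using N0 by (intro cosets_split_subgroup[OF N' _ sK]) (auto intro: subgroup.subgroup_in_rcosets[OF sK is_group])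
      ultimately show False using supp_inD(2)[OF x(1) N' C] supp_inD(2)[OF x(2) N' C]
        unfolding cosets_split_def by blast
    qed
    show "x N = \<zero>\<^bsub>kG\<^esub> N"
    proof
      fix D
      show "x N D = \<zero>\<^bsub>kG\<^esub> N D"
      proof (cases "D \<in> rcosets N")
        case True
        show ?thesis using kG_sum[OF xc N' N _ True] N by (simp add: 0 kG_apply)
      qed (use kG_D(3)[OF xc N] N in \<open>simp add: kG_apply\<close>)
    qed
  qed
qed

end

subsection \<open>Completed group rings of closed subgroups\<close>

context compact_top_group
begin

lemma compact_top_group_subgroup:
  assumes X: "subgroup X G" and cl: "closedin T X"
  shows "compact_top_group (G\<lparr>carrier := X\<rparr>) (subtopology T X)"
proof -
  let ?H = "G\<lparr>carrier := X\<rparr>" and ?TX = "subtopology T X"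
  have XG: "X \<subseteq> carrier G" using subgroup.subset[OF X] .
  have gH: "group ?H" using subgroup.subgroup_is_group[OF X is_group] .
  have tX: "topspace ?TX = X" using XG by auto
  have "continuous_map (prod_topology T T) T (\<lambda>(x, y). x \<otimes> y)"
    using tg by (simp add: topological_group_def)
  hence "continuous_map (prod_topology ?TX ?TX) T (\<lambda>(x, y). x \<otimes> y)"
    unfolding subtopology_Times[symmetric] by (rule continuous_map_from_subtopology)
  moreover have "(\<lambda>(x, y). x \<otimes> y) \<in> topspace (prod_topology ?TX ?TX) \<rightarrow> X"
    using subgroup.m_closed[OF X] by (auto simp: tX topspace_prod_topology)
  ultimately have m: "continuous_map (prod_topology ?TX ?TX) ?TX (\<lambda>(x, y). x \<otimes> y)"
    by (simp add: continuous_map_in_subtopology)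
  have "continuous_map ?TX T (\<lambda>x. inv x)" using cont_inv by (rule continuous_map_from_subtopology)
  moreover have "(\<lambda>x. inv x) \<in> topspace ?TX \<rightarrow> X" using subgroup.m_inv_closed[OF X] by (auto simp: tX)
  ultimately have "continuous_map ?TX ?TX (\<lambda>x. inv x)" by (simp add: continuous_map_in_subtopology)
  hence i: "continuous_map ?TX ?TX (\<lambda>x. inv\<^bsub>?H\<^esub> x)"
    by (rule continuous_map_eq) (simp add: tX m_inv_consistent[OF X])
  have "compact_space ?TX"
    using closedin_compact_space[OF compactT cl] compact_space_subtopology by blast
  thus ?thesis using gH m i tX
    by (intro compact_top_group.intro compact_top_group_axioms.intro) (auto simp: topological_group_def)
qed

end

locale closed_subgroup = compact_top_group +
  fixes X :: "'a set"
  assumes X: "subgroup X G" "closedin T X"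
begin

abbreviation "H \<equiv> G\<lparr>carrier := X\<rparr>"
abbreviation "TX \<equiv> subtopology T X"

sublocale H: compact_top_group "G\<lparr>carrier := X\<rparr>" "subtopology T X"
  by (rule compact_top_group_subgroup[OF X])

lemma XG: "X \<subseteq> carrier G" using subgroup.subset[OF X(1)] .

lemma r_coset_H [simp]: "M #>\<^bsub>H\<^esub> a = M #> a"
  by (simp add: r_coset_def)

lemma Int_\<N>: assumes N: "N \<in> \<N>" shows "X \<inter> N \<in> H.\<N>"
proof -
  have s: "subgroup (X \<inter> N) H"
    by (intro subgroup_incl subgroups_Inter_pair X(1) \<N>D[OF N]) auto
  have "X \<inter> N \<lhd> H"
  proof (rule H.normal_invI[OF s])
    fix x h assume x: "x \<in> carrier H" and h: "h \<in> X \<inter> N"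
    have "x \<otimes> h \<otimes> inv x \<in> N" using normal.inv_op_closed2[OF \<N>D(1)[OF N], of x h] x h XG by auto
    moreover have "x \<otimes> h \<otimes> inv x \<in> X"
      using x h by (auto intro!: subgroup.m_closed[OF X(1)] subgroup.m_inv_closed[OF X(1)])
    ultimately show "x \<otimes>\<^bsub>H\<^esub> h \<otimes>\<^bsub>H\<^esub> inv\<^bsub>H\<^esub> x \<in> X \<inter> N"
      using x m_inv_consistent[OF X(1), of x] by simp
  qed
  moreover have "openin TX (X \<inter> N)" using \<N>D(3)[OF N] by (auto simp: openin_subtopology Int_commute)
  ultimately show ?thesis by (simp add: open_normal_subgroups_def)
qed

lemma rcoset_Int:
  assumes N: "N \<in> \<N>" and x: "x \<in> X"
  shows "(N #> x) \<inter> X = (X \<inter> N) #> x" "N <#> ((X \<inter> N) #> x) = N #> x"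
proof -
  have xG: "x \<in> carrier G" using x XG by auto
  show "(N #> x) \<inter> X = (X \<inter> N) #> x"
  proof (intro equalityI subsetI)
    fix y assume y: "y \<in> (N #> x) \<inter> X"
    then obtain n where n: "n \<in> N" "y = n \<otimes> x" by (auto simp: r_coset_def)
    have nG: "n \<in> carrier G" using n \<N>D(4)[OF N] by auto
    have "n = y \<otimes> inv x" using n nG xG by (simp add: m_assoc)
    hence "n \<in> X" using y x by (auto intro!: subgroup.m_closed[OF X(1)] subgroup.m_inv_closed[OF X(1)])
    thus "y \<in> (X \<inter> N) #> x" using n by (auto simp: r_coset_def)
  next
    fix y assume "y \<in> (X \<inter> N) #> x"
    thus "y \<in> (N #> x) \<inter> X" using x subgroup.m_closed[OF X(1)] by (auto simp: r_coset_def)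
  qed
  have "N <#> ((X \<inter> N) #> x) = (N <#> (X \<inter> N)) #> x"
    using \<N>D(4)[OF N] XG xG by (intro setmult_rcos_assoc) auto
  also have "N <#> (X \<inter> N) = N"
  proof (intro equalityI subsetI)
    fix y assume "y \<in> N <#> (X \<inter> N)"
    thus "y \<in> N" using subgroup.m_closed[OF \<N>D(2)[OF N]] by (auto simp: set_mult_def)
  next
    fix y assume y: "y \<in> N"
    moreover have "y = y \<otimes> \<one>" using y \<N>D(4)[OF N] by auto
    moreover have "\<one> \<in> X \<inter> N" using subgroup.one_closed[OF X(1)] subgroup.one_closed[OF \<N>D(2)[OF N]] by simp
    ultimately show "y \<in> N <#> (X \<inter> N)" unfolding set_mult_def by blast
  qed
  finally show "N <#> ((X \<inter> N) #> x) = N #> x" .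
qed

lemma rcosets_H: "E \<in> rcosets\<^bsub>H\<^esub> M \<longleftrightarrow> (\<exists>x\<in>X. E = M #> x)"
  by (auto simp: RCOSETS_def)

text \<open>The coset \<open>C\<close> of \<open>N\<close> carries the mass of its trace on \<open>X\<close>, which is empty or a coset of \<open>X \<inter> N\<close> in \<open>X\<close>.\<close>

lemma embedding_apply:
  fixes y :: "'a set \<Rightarrow> 'a set \<Rightarrow> 'k :: field"
  assumes y: "y \<in> carrier H.kG" and N: "N \<in> \<N>"
  shows "completed_subring_embedding G T X y N C = (if C \<in> rcosets N then y (X \<inter> N) (C \<inter> X) else 0)"
proof -
  have nz: "\<exists>x\<in>X. E = (X \<inter> N) #> x" if "y (X \<inter> N) E \<noteq> 0" for E
    using H.kG_D(3)[OF y Int_\<N>[OF N], of E] that rcosets_H by blast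
  have "{E. y (X \<inter> N) E \<noteq> 0 \<and> N <#> E = C}
      = (if C \<in> rcosets N \<and> y (X \<inter> N) (C \<inter> X) \<noteq> 0 then {C \<inter> X} else {})" (is "?L = ?R")
  proof (intro equalityI subsetI)
    fix E assume "E \<in> ?L"
    moreover from this obtain x where x: "x \<in> X" "E = (X \<inter> N) #> x" using nz by blast
    ultimately have C: "C = N #> x" "y (X \<inter> N) E \<noteq> 0" using rcoset_Int(2)[OF N x(1)] by auto
    have "E = C \<inter> X" using C(1) x rcoset_Int(1)[OF N x(1)] by simp
    moreover have "C \<in> rcosets N" using C(1) x(1) XG rcoset_in by auto
    ultimately show "E \<in> ?R" using C(2) by simp
  next
    fix E assume E: "E \<in> ?R"
    hence C: "C \<in> rcosets N" "y (X \<inter> N) (C \<inter> X) \<noteq> 0" "E = C \<inter> X" by (auto split: if_splits)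
    obtain x where x: "x \<in> X" "C \<inter> X = (X \<inter> N) #> x" using nz[OF C(2)] by blast
    have xG: "x \<in> carrier G" using x(1) XG by auto
    have "x \<in> (X \<inter> N) #> x" using rcoset_Int(1)[OF N x(1)] rcoset_self[OF N xG] x(1) by auto
    hence "C = N #> x" using x rcoset_repr(1)[OF N C(1), of x] by auto
    thus "E \<in> ?L" using C rcoset_Int(2)[OF N x(1)] x(2) by simp
  qed
  thus ?thesis using N by (auto simp: completed_subring_embedding_def group_ring_map_def)
qed

lemma embedding_supp:
  fixes y :: "'a set \<Rightarrow> 'a set \<Rightarrow> 'k :: field"
  assumes y: "y \<in> carrier H.kG"
  shows "completed_subring_embedding G T X y \<in> supp_in X"
proof -
  let ?e = "completed_subring_embedding G T X y"
  have "?e \<in> carrier kG"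
  proof (rule kG_carrierI)
    show "?e \<in> extensional \<N>" by (simp add: completed_subring_embedding_def)
    fix N M E assume N: "N \<in> \<N>" and M: "M \<in> \<N>" and NM: "N \<subseteq> M" and E: "E \<in> rcosets M"
    have N': "X \<inter> N \<in> H.\<N>" and M': "X \<inter> M \<in> H.\<N>" using Int_\<N> N M by auto
    have sub: "X \<inter> N \<subseteq> X \<inter> M" using NM by auto
    have "(\<Sum>C\<in>{C \<in> rcosets N. C \<subseteq> E}. ?e N C) = (\<Sum>C\<in>{C \<in> rcosets N. C \<subseteq> E \<and> C \<inter> X \<noteq> {}}. y (X \<inter> N) (C \<inter> X))"
    proof (rule sum.mono_neutral_cong_right)
      have "y (X \<inter> N) {} = 0"
        using H.kG_D(3)[OF y N', of "{}"] H.rcoset_self[OF N'] H.rcoset_exists by fastforce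
      thus "\<forall>i\<in>{C \<in> rcosets N. C \<subseteq> E} - {C \<in> rcosets N. C \<subseteq> E \<and> C \<inter> X \<noteq> {}}. ?e N i = 0"
        by (auto simp: embedding_apply[OF y N])
    qed (use N in \<open>auto simp: embedding_apply[OF y N]\<close>)
    also have "\<dots> = (\<Sum>F\<in>{F \<in> rcosets\<^bsub>H\<^esub> (X \<inter> N). F \<subseteq> E \<inter> X}. y (X \<inter> N) F)"
    proof (rule sum.reindex_bij_witness[of _ "\<lambda>F. N <#> F" "\<lambda>C. C \<inter> X"])
      fix C assume C: "C \<in> {C \<in> rcosets N. C \<subseteq> E \<and> C \<inter> X \<noteq> {}}"
      then obtain x where x: "x \<in> C" "x \<in> X" by auto
      hence Cx: "C = N #> x" using rcoset_repr(1)[OF N] C by blast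
      show "N <#> (C \<inter> X) = C" using rcoset_Int[OF N x(2)] Cx by simp
      show "C \<inter> X \<in> {F \<in> rcosets\<^bsub>H\<^esub> (X \<inter> N). F \<subseteq> E \<inter> X}"
        using rcoset_Int(1)[OF N x(2)] Cx x C rcosets_H by auto
    next
      fix F assume F: "F \<in> {F \<in> rcosets\<^bsub>H\<^esub> (X \<inter> N). F \<subseteq> E \<inter> X}"
      then obtain x where x: "x \<in> X" "F = (X \<inter> N) #> x" using rcosets_H by auto
      have xG: "x \<in> carrier G" using x(1) XG by auto
      have NF: "N <#> F = N #> x" using rcoset_Int(2)[OF N x(1)] x(2) by simp
      show F': "(N <#> F) \<inter> X = F" using NF rcoset_Int(1)[OF N x(1)] x(2) by simp
      have xF: "x \<in> F" using F' NF rcoset_self[OF N xG] x(1) by auto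
      have "N #> x \<subseteq> E"
        using coset_subset_iff(2)[OF N M NM rcoset_in[OF xG] E] rcoset_self[OF N xG] xF F by blast
      thus "N <#> F \<in> {C \<in> rcosets N. C \<subseteq> E \<and> C \<inter> X \<noteq> {}}"
        using NF rcoset_in[OF xG] F' xF by auto
    qed auto
    also have "\<dots> = ?e M E"
    proof (cases "E \<inter> X = {}")
      case True
      have "F \<noteq> {}" if "F \<in> rcosets\<^bsub>H\<^esub> (X \<inter> N)" for F
        using that H.rcoset_exists H.rcoset_self[OF N'] by blast
      hence "{F \<in> rcosets\<^bsub>H\<^esub> (X \<inter> N). F \<subseteq> E \<inter> X} = {}" using True by auto
      moreover have "y (X \<inter> M) {} = 0"
        using H.kG_D(3)[OF y M', of "{}"] H.rcoset_self[OF M'] H.rcoset_exists by fastforce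
      ultimately show ?thesis using True by (simp only: embedding_apply[OF y M] sum.empty if_cancel)
    next
      case False
      then obtain x where x: "x \<in> E" "x \<in> X" by auto
      hence "E = M #> x" using rcoset_repr(1)[OF M E] by blast
      hence "E \<inter> X \<in> rcosets\<^bsub>H\<^esub> (X \<inter> M)" using rcoset_Int(1)[OF M x(2)] x rcosets_H by auto
      from H.kG_sum[OF y N' M' sub this] show ?thesis using E by (simp add: embedding_apply[OF y M])
    qed
    finally show "?e M E = (\<Sum>C\<in>{C \<in> rcosets N. C \<subseteq> E}. ?e N C)" ..
  qed (simp add: embedding_apply[OF y])
  moreover have "C \<inter> X \<noteq> {}" if N: "N \<in> \<N>" and C: "?e N C \<noteq> 0" for N C
  proof -
    have "y (X \<inter> N) (C \<inter> X) \<noteq> 0" using C by (simp add: embedding_apply[OF y N] split: if_splits)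
    thus ?thesis using H.kG_D(3)[OF y Int_\<N>[OF N]] H.rcoset_self[OF Int_\<N>[OF N]] H.rcoset_exists by blast
  qed
  ultimately show ?thesis by (auto simp: supp_in_def)
qed

end

locale closed_subgroup_profinite = closed_subgroup + profinite_group
begin

text \<open>
  Let \<open>x\<close> be supported on \<open>X\<close>. Its preimage in the completed group ring of \<open>X\<close> must give a coset \<open>E\<close> of
  the open normal subgroup \<open>M\<close> of \<open>X\<close> the total mass of the cosets of \<open>N\<close> that meet \<open>E\<close>, where \<open>N\<close> is an
  open normal subgroup of \<open>G\<close> with \<open>X \<inter> N \<subseteq> M\<close>. This mass does not depend on \<open>N\<close>, since cosets that do
  not meet \<open>X\<close> have mass \<open>0\<close>.
\<close>

lemma mass_independent:
  fixes x :: "'a set \<Rightarrow> 'a set \<Rightarrow> 'k :: field"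
  assumes x: "x \<in> supp_in X" and M: "M \<in> H.\<N>" and E: "E \<in> rcosets\<^bsub>H\<^esub> M"
    and N: "N \<in> \<N>" "X \<inter> N \<subseteq> M" and N': "N' \<in> \<N>" "X \<inter> N' \<subseteq> M"
  shows "(\<Sum>C\<in>{C \<in> rcosets N. C \<inter> E \<noteq> {}}. x N C) = (\<Sum>C\<in>{C \<in> rcosets N'. C \<inter> E \<noteq> {}}. x N' C)"
proof -
  have xc: "x \<in> carrier kG" using supp_inD(1)[OF x] .
  have *: "(\<Sum>C'\<in>{C \<in> rcosets N'. C \<inter> E \<noteq> {}}. x N' C') = (\<Sum>C\<in>{C \<in> rcosets N. C \<inter> E \<noteq> {}}. x N C)"
    if N: "N \<in> \<N>" and N': "N' \<in> \<N>" "X \<inter> N' \<subseteq> M" and sub: "N \<subseteq> N'" for N N'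
  proof -
    obtain a where a: "a \<in> X" "E = M #> a" using E rcosets_H by blast
    have sM: "subgroup M H" using H.\<N>D(2)[OF M] .
    have EX: "E \<subseteq> X" using H.rcosets_part_G[OF sM] E by fastforce
    have "(\<Sum>C'\<in>{C \<in> rcosets N'. C \<inter> E \<noteq> {}}. x N' C')
        = (\<Sum>C'\<in>{C \<in> rcosets N'. C \<inter> E \<noteq> {}}. \<Sum>C\<in>{C \<in> rcosets N. C \<subseteq> C'}. x N C)"
      by (intro sum.cong refl kG_sum[OF xc N N'(1) sub]) auto
    also have "\<dots> = (\<Sum>C\<in>{C \<in> rcosets N. (C <#> N') \<inter> E \<noteq> {}}. x N C)"
    proof (rule sum_cosets_nested[OF N N'(1) sub])
      fix C C' assume "C \<in> rcosets N" "C' \<in> rcosets N'" "C \<subseteq> C'"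
      hence "C <#> N' = C'" using coset_subset_iff(1)[OF N N'(1) sub] by blast
      thus "((C <#> N') \<inter> E \<noteq> {}) = (C' \<inter> E \<noteq> {})" by simp
    qed
    also have "\<dots> = (\<Sum>C\<in>{C \<in> rcosets N. C \<inter> E \<noteq> {}}. x N C)"
    proof (rule sum.mono_neutral_right)
      show "{C \<in> rcosets N. C \<inter> E \<noteq> {}} \<subseteq> {C \<in> rcosets N. (C <#> N') \<inter> E \<noteq> {}}"
      proof
        fix C assume C: "C \<in> {C \<in> rcosets N. C \<inter> E \<noteq> {}}"
        have "C <#> N' \<in> rcosets N'" using proj_hom[OF N N'(1) sub] C by (auto simp: hom_def)
        hence "C \<subseteq> C <#> N'" using coset_subset_iff(1)[OF N N'(1) sub] C by blast
        thus "C \<in> {C \<in> rcosets N. (C <#> N') \<inter> E \<noteq> {}}" using C by blast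
      qed
      show "\<forall>C\<in>{C \<in> rcosets N. (C <#> N') \<inter> E \<noteq> {}} - {C \<in> rcosets N. C \<inter> E \<noteq> {}}. x N C = 0"
      proof (rule ballI, rule ccontr)
        fix C assume C: "C \<in> {C \<in> rcosets N. (C <#> N') \<inter> E \<noteq> {}} - {C \<in> rcosets N. C \<inter> E \<noteq> {}}"
          and nz: "x N C \<noteq> 0"
        obtain w where w: "w \<in> X" "w \<in> carrier G" "C = N #> w" by (rule supp_in_rcoset[OF x N nz])
        obtain v where v: "v \<in> C <#> N'" "v \<in> E" using C by blast
        have "C <#> N' = N' #> w" using coset_proj[OF N N'(1) sub w(2)] w(3) by simp
        then obtain n where n: "n \<in> N'" "v = n \<otimes> w" using v by (auto simp: r_coset_def)
        have vX: "v \<in> X" using v(2) EX by auto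
        have nG: "n \<in> carrier G" using n \<N>D(4)[OF N'(1)] by auto
        have "n = v \<otimes> inv w" using n nG w(2) by (simp add: m_assoc)
        hence "n \<in> X" using vX w(1) by (auto intro!: subgroup.m_closed[OF X(1)] subgroup.m_inv_closed[OF X(1)])
        hence nM: "n \<in> M" using n(1) N'(2) by auto
        have "E = M #> v" using H.rcoset_repr(1)[OF M E v(2)] by simp
        moreover have "w = inv n \<otimes> v" using n(2) nG w(2) by simp
        moreover have "inv n \<in> M"
          using subgroup.m_inv_closed[OF sM nM] m_inv_consistent[OF X(1) \<open>n \<in> X\<close>] by simp
        ultimately have "w \<in> E" by (auto simp: r_coset_def)
        moreover have "w \<in> C" using w rcoset_self[OF N] by simp
        ultimately show False using C by blast
      qed
    qed (use N in simp)
    finally show ?thesis .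
  qed
  have NN: "N \<inter> N' \<in> \<N>" using \<N>_Int N(1) N'(1) by auto
  show ?thesis using *[OF NN N] *[OF NN N'] by simp
qed

text \<open>The choice of \<open>N\<close> for a given \<open>M\<close> is possible because the open normal subgroups of \<open>G\<close> are a base at
  the identity.\<close>

lemma supp_in_embedding:
  fixes x :: "'a set \<Rightarrow> 'a set \<Rightarrow> 'k :: field"
  assumes x: "x \<in> supp_in X"
  shows "x \<in> completed_subring_embedding G T X ` carrier H.kG"
proof -
  have xc: "x \<in> carrier kG" using supp_inD(1)[OF x] .
  have ex: "\<exists>N\<in>\<N>. X \<inter> N \<subseteq> M" if M: "M \<in> H.\<N>" for M
  proof -
    obtain W where W: "openin T W" "M = W \<inter> X" using H.\<N>D(3)[OF M] by (auto simp: openin_subtopology)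
    have "\<one> \<in> M" using subgroup.one_closed[OF H.\<N>D(2)[OF M]] by simp
    hence "\<one> \<in> W" using W(2) by simp
    from base_one[OF W(1) this] obtain N where "N \<in> \<N>" "N \<subseteq> W" by blast
    thus ?thesis using W(2) by (intro bexI[of _ N]) auto
  qed
  define n where "n M = (SOME N. N \<in> \<N> \<and> X \<inter> N \<subseteq> M)" for M
  have n: "n M \<in> \<N>" "X \<inter> n M \<subseteq> M" if "M \<in> H.\<N>" for M
    using someI_ex[of "\<lambda>N. N \<in> \<N> \<and> X \<inter> N \<subseteq> M"] ex[OF that] unfolding n_def by blast+
  define y where "y = (\<lambda>M\<in>H.\<N>. \<lambda>E. if E \<in> rcosets\<^bsub>H\<^esub> M then
      (\<Sum>C\<in>{C \<in> rcosets (n M). C \<inter> E \<noteq> {}}. x (n M) C) else 0)"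
  have yM: "y M E = (\<Sum>C\<in>{C \<in> rcosets N. C \<inter> E \<noteq> {}}. x N C)"
    if "M \<in> H.\<N>" "E \<in> rcosets\<^bsub>H\<^esub> M" "N \<in> \<N>" "X \<inter> N \<subseteq> M" for M E N
    using mass_independent[OF x that(1,2) n[OF that(1)] that(3,4)] that(1,2) by (simp add: y_def)
  have y: "y \<in> carrier H.kG"
  proof (rule H.kG_carrierI)
    fix M M' E assume M: "M \<in> H.\<N>" and M': "M' \<in> H.\<N>" and MM: "M \<subseteq> M'" and E: "E \<in> rcosets\<^bsub>H\<^esub> M'"
    obtain N where N: "N \<in> \<N>" "X \<inter> N \<subseteq> M" using ex[OF M] by blast
    have XN: "X \<inter> N \<in> H.\<N>" by (rule Int_\<N>[OF N(1)])
    have ne: "F \<noteq> {}" if "F \<in> rcosets\<^bsub>H\<^esub> M" for F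
      using that H.rcoset_exists H.rcoset_self[OF M] by blast
    \<comment> \<open>A coset of \<open>N\<close> meets exactly one coset of \<open>M\<close> if it meets \<open>X\<close>, and none otherwise.\<close>
    have one: "C \<inter> X \<subseteq> F" if C: "C \<in> rcosets N" and F: "F \<in> rcosets\<^bsub>H\<^esub> M" and CF: "C \<inter> F \<noteq> {}" for C F
    proof -
      obtain v where v: "v \<in> C" "v \<in> F" using CF by auto
      have Fv: "F = M #> v" "v \<in> carrier H" using H.rcoset_repr[OF M F v(2)] by simp_all
      have "C = N #> v" using rcoset_repr(1)[OF N(1) C v(1)] .
      hence "C \<inter> X = (X \<inter> N) #> v" using rcoset_Int(1)[OF N(1)] Fv(2) by simp
      thus ?thesis using Fv(1) N(2) by (auto simp: r_coset_def)
    qed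
    have "(\<Sum>F\<in>{F \<in> rcosets\<^bsub>H\<^esub> M. F \<subseteq> E}. y M F)
        = (\<Sum>F\<in>{F \<in> rcosets\<^bsub>H\<^esub> M. F \<subseteq> E}. \<Sum>C\<in>{C \<in> rcosets N. C \<inter> F \<noteq> {}}. x N C)"
      using yM[OF M _ N] by simp
    also have "\<dots> = (\<Sum>C\<in>(\<Union>F\<in>{F \<in> rcosets\<^bsub>H\<^esub> M. F \<subseteq> E}. {C \<in> rcosets N. C \<inter> F \<noteq> {}}). x N C)"
    proof (rule sum.UNION_disjoint[symmetric])
      show "finite {F \<in> rcosets\<^bsub>H\<^esub> M. F \<subseteq> E}" using H.finite_rcosets[OF M] by simp
      show "\<forall>F\<in>{F \<in> rcosets\<^bsub>H\<^esub> M. F \<subseteq> E}. finite {C \<in> rcosets N. C \<inter> F \<noteq> {}}" using N by simp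
      show "\<forall>F\<in>{F \<in> rcosets\<^bsub>H\<^esub> M. F \<subseteq> E}. \<forall>F'\<in>{F \<in> rcosets\<^bsub>H\<^esub> M. F \<subseteq> E}. F \<noteq> F' \<longrightarrow>
          {C \<in> rcosets N. C \<inter> F \<noteq> {}} \<inter> {C \<in> rcosets N. C \<inter> F' \<noteq> {}} = {}"
      proof (intro ballI impI equals0I)
        fix F F' C assume F: "F \<in> {F \<in> rcosets\<^bsub>H\<^esub> M. F \<subseteq> E}" and F': "F' \<in> {F \<in> rcosets\<^bsub>H\<^esub> M. F \<subseteq> E}"
          and FF: "F \<noteq> F'" and C: "C \<in> {C \<in> rcosets N. C \<inter> F \<noteq> {}} \<inter> {C \<in> rcosets N. C \<inter> F' \<noteq> {}}"
        obtain v where v: "v \<in> C" "v \<in> F" using C by auto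
        have "v \<in> X" using H.rcoset_repr(2)[OF M _ v(2)] F by simp
        hence "v \<in> F'" using one[of C F'] C F' v(1) by auto
        hence "F = F'" using H.rcoset_eqI[OF H.\<N>D(2)[OF M], of F F' v] F F' v(2) by simp
        thus False using FF by simp
      qed
    qed
    also have "(\<Union>F\<in>{F \<in> rcosets\<^bsub>H\<^esub> M. F \<subseteq> E}. {C \<in> rcosets N. C \<inter> F \<noteq> {}}) = {C \<in> rcosets N. C \<inter> E \<noteq> {}}"
    proof (intro equalityI subsetI)
      fix C assume C: "C \<in> {C \<in> rcosets N. C \<inter> E \<noteq> {}}"
      then obtain v where v: "v \<in> C" "v \<in> E" by auto
      have vH: "v \<in> carrier H" using H.rcoset_repr(2)[OF M' E v(2)] .
      have Fv: "M #> v \<in> rcosets\<^bsub>H\<^esub> M" "v \<in> M #> v" using H.rcoset_in[OF vH] H.rcoset_self[OF M vH] by simp_all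
      have "M #> v \<subseteq> E"
        using H.coset_subset_iff(2)[OF M M' MM Fv(1) E] Fv(2) v(2) by blast
      thus "C \<in> (\<Union>F\<in>{F \<in> rcosets\<^bsub>H\<^esub> M. F \<subseteq> E}. {C \<in> rcosets N. C \<inter> F \<noteq> {}})"
        using Fv C v(1) by blast
    qed blast
    also have "(\<Sum>C\<in>{C \<in> rcosets N. C \<inter> E \<noteq> {}}. x N C) = y M' E"
      using yM[OF M' E N(1)] N(2) MM by simp
    finally show "y M' E = (\<Sum>F\<in>{F \<in> rcosets\<^bsub>H\<^esub> M. F \<subseteq> E}. y M F)" ..
  qed (simp_all add: y_def)
  have "completed_subring_embedding G T X y = x"
  proof (rule kG_eqI[OF _ kG_D(1)[OF xc]])
    show "completed_subring_embedding G T X y \<in> extensional \<N>" by (simp add: completed_subring_embedding_def)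
    fix N assume N: "N \<in> \<N>"
    show "completed_subring_embedding G T X y N = x N"
    proof
      fix C
      show "completed_subring_embedding G T X y N C = x N C"
      proof (cases "C \<in> rcosets N \<and> C \<inter> X \<noteq> {}")
        case True
        then obtain v where v: "v \<in> C" "v \<in> X" by auto
        have Cv: "C = N #> v" using rcoset_repr(1)[OF N _ v(1)] True by blast
        have E: "C \<inter> X \<in> rcosets\<^bsub>H\<^esub> (X \<inter> N)" using rcoset_Int(1)[OF N v(2)] Cv v(2) rcosets_H by auto
        have "{C' \<in> rcosets N. C' \<inter> (C \<inter> X) \<noteq> {}} = {C}"
          using rcoset_eqI[OF \<N>D(2)[OF N]] True by blast
        thus ?thesis using yM[OF Int_\<N>[OF N] E N] True by (simp add: embedding_apply[OF y N])
      next
        case False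
        have "x N C = 0" using False supp_inD(2)[OF x N, of C] kG_D(3)[OF xc N, of C] by blast
        moreover have "y (X \<inter> N) {} = 0"
          using H.kG_D(3)[OF y Int_\<N>[OF N], of "{}"] H.rcoset_self[OF Int_\<N>[OF N]] H.rcoset_exists by fastforce
        ultimately show ?thesis using False by (auto simp: embedding_apply[OF y N])
      qed
    qed
  qed
  thus ?thesis using y by blast
qed

theorem completed_subring_eq:
  "completed_subring G T X = (kG :: ('a set \<Rightarrow> 'a set \<Rightarrow> 'k :: field) ring)\<lparr>carrier := supp_in X\<rparr>"
proof -
  have "completed_subring_embedding G T X ` carrier H.kG = (supp_in X :: ('a set \<Rightarrow> 'a set \<Rightarrow> 'k) set)"
    using embedding_supp supp_in_embedding by blast
  thus ?thesis by (simp add: completed_subring_def)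
qed

lemma finite_supp_in:
  assumes "finite X"
  shows "finite (supp_in X :: ('a set \<Rightarrow> 'a set \<Rightarrow> 'k :: finite_field) set)"
proof -
  have f\<N>: "finite H.\<N>"
    by (rule finite_subset[of _ "Pow X"]) (use H.\<N>D(4) assms in auto)
  have fg: "finite (carrier (group_ring (H Mod N)) :: ('a set \<Rightarrow> 'k) set)" if N: "N \<in> H.\<N>" for N
  proof -
    have "carrier (group_ring (H Mod N)) \<subseteq> {f. \<forall>C. (C \<in> rcosets\<^bsub>H\<^esub> N \<longrightarrow> f C \<in> (UNIV :: 'k set)) \<and> (C \<notin> rcosets\<^bsub>H\<^esub> N \<longrightarrow> f C = 0)}"
      using finite_group.group_ring_zero_outside[OF H.fg[OF N]] by auto
    thus ?thesis using finite_set_of_finite_funs[OF H.finite_rcosets[OF N], of "UNIV :: 'k set" 0]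
      by (auto intro: finite_subset)
  qed
  have "carrier H.kG \<subseteq> (\<Pi>\<^sub>E N\<in>H.\<N>. carrier (group_ring (H Mod N)) :: ('a set \<Rightarrow> 'k) set)"
  proof
    fix x :: "'a set \<Rightarrow> 'a set \<Rightarrow> 'k"
    assume x: "x \<in> carrier H.kG"
    show "x \<in> (\<Pi>\<^sub>E N\<in>H.\<N>. carrier (group_ring (H Mod N)))"
      by (rule PiE_I[OF H.kG_D(2)[OF x]]) (use H.kG_D(1)[OF x] in \<open>auto simp: extensional_def\<close>)
  qed
  hence "finite (carrier H.kG :: ('a set \<Rightarrow> 'a set \<Rightarrow> 'k) set)"
    by (rule finite_subset) (rule finite_PiE[OF f\<N> fg])
  moreover have "(supp_in X :: ('a set \<Rightarrow> 'a set \<Rightarrow> 'k) set) \<subseteq> completed_subring_embedding G T X ` carrier H.kG"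
    using supp_in_embedding by blast
  ultimately show ?thesis by (rule finite_surj)
qed

end

section \<open>Rings with supports in a group\<close>

lemma (in ring) finsum_induct_pred:
  assumes "finite I" "\<And>i. i \<in> I \<Longrightarrow> f i \<in> carrier R \<and> P (f i)" "P \<zero>"
    "\<And>x y. x \<in> carrier R \<Longrightarrow> y \<in> carrier R \<Longrightarrow> P x \<Longrightarrow> P y \<Longrightarrow> P (x \<oplus> y)"
  shows "P (\<Oplus>i\<in>I. f i)"
proof -
  have "(\<Oplus>i\<in>I. f i) \<in> carrier R \<and> P (\<Oplus>i\<in>I. f i)"
    using assms(1,2)
  proof (induction I rule: finite_induct)
    case (insert i I)
    have "(\<Oplus>i\<in>insert i I. f i) = f i \<oplus> (\<Oplus>i\<in>I. f i)"
      using insert by (intro finsum_insert) auto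
    thus ?case using insert assms(4) by simp
  qed (use assms(3) in simp)
  thus ?thesis ..
qed

text \<open>
  The calculus of supports. \<open>S X\<close> plays the role of the set of elements supported on \<open>X\<close>, \<open>\<gamma> g\<close> that of the
  group element \<open>g\<close>, and \<open>opn\<close> that of the open subgroups. The intersection of \<open>S X\<close> and \<open>S Y\<close> is not
  described: this is what allows the axioms to hold in quotient rings, where supports are not unique.
\<close>

locale support_ring = ring R + G: group G
  for R :: "('a, 'b) ring_scheme" (structure) and G :: "('g, 'm) monoid_scheme" +
  fixes \<gamma> :: "'g \<Rightarrow> 'a" and S :: "'g set \<Rightarrow> 'a set" and opn :: "'g set \<Rightarrow> bool"
  assumes S_carrier: "S X \<subseteq> carrier R"
    and S_top: "S (carrier G) = carrier R"
    and S_empty: "S {} = {\<zero>}"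
    and S_add: "x \<in> S X \<Longrightarrow> y \<in> S X \<Longrightarrow> x \<oplus> y \<in> S X"
    and S_neg: "x \<in> S X \<Longrightarrow> \<ominus> x \<in> S X"
    and S_mono: "X \<subseteq> Y \<Longrightarrow> S X \<subseteq> S Y"
    and S_mult: "x \<in> S X \<Longrightarrow> y \<in> S Y \<Longrightarrow> (\<And>p q. p \<in> X \<Longrightarrow> q \<in> Y \<Longrightarrow> p \<otimes>\<^bsub>G\<^esub> q \<in> Z) \<Longrightarrow> x \<otimes> y \<in> S Z"
    and S_commute: "x \<in> S X \<Longrightarrow> y \<in> S Y \<Longrightarrow>
      (\<And>p q. p \<in> X \<Longrightarrow> q \<in> Y \<Longrightarrow> p \<otimes>\<^bsub>G\<^esub> q = q \<otimes>\<^bsub>G\<^esub> p) \<Longrightarrow> x \<otimes> y = y \<otimes> x"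
    and \<gamma>_S: "g \<in> carrier G \<Longrightarrow> \<gamma> g \<in> S {g}"
    and \<gamma>_one: "\<gamma> \<one>\<^bsub>G\<^esub> = \<one>"
    and \<gamma>_mult: "g \<in> carrier G \<Longrightarrow> h \<in> carrier G \<Longrightarrow> \<gamma> (g \<otimes>\<^bsub>G\<^esub> h) = \<gamma> g \<otimes> \<gamma> h"
    and opn_subgroup: "opn K \<Longrightarrow> subgroup K G"
    and opn_finite: "opn K \<Longrightarrow> finite (rcosets\<^bsub>G\<^esub> K)"
    and opn_mono: "opn K \<Longrightarrow> K \<subseteq> L \<Longrightarrow> subgroup L G \<Longrightarrow> opn L"
    and S_split: "opn K \<Longrightarrow> x \<in> S X \<Longrightarrow>
      \<exists>f. (\<forall>Y\<in>rcosets\<^bsub>G\<^esub> K. f Y \<in> S (X \<inter> Y)) \<and> x = (\<Oplus>Y\<in>rcosets\<^bsub>G\<^esub> K. f Y)"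
begin

lemma S_closed: "x \<in> S X \<Longrightarrow> x \<in> carrier R" using S_carrier by blast

lemma S_zero: "\<zero> \<in> S X" using S_mono[of "{}" X] S_empty by auto

lemma \<gamma>_closed [simp]: "g \<in> carrier G \<Longrightarrow> \<gamma> g \<in> carrier R" using \<gamma>_S S_closed by blast

lemma \<gamma>_inv [simp]:
  assumes "g \<in> carrier G"
  shows "\<gamma> g \<otimes> \<gamma> (inv\<^bsub>G\<^esub> g) = \<one>" "\<gamma> (inv\<^bsub>G\<^esub> g) \<otimes> \<gamma> g = \<one>"
  using \<gamma>_mult[of g "inv\<^bsub>G\<^esub> g"] \<gamma>_mult[of "inv\<^bsub>G\<^esub> g" g] assms by (simp_all add: \<gamma>_one)

lemma \<gamma>_cancel [simp]:
  assumes "g \<in> carrier G" "x \<in> carrier R"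
  shows "\<gamma> g \<otimes> (\<gamma> (inv\<^bsub>G\<^esub> g) \<otimes> x) = x" "\<gamma> (inv\<^bsub>G\<^esub> g) \<otimes> (\<gamma> g \<otimes> x) = x"
  using assms by (simp_all add: m_assoc[symmetric])

lemma \<gamma>_in_S: "g \<in> X \<Longrightarrow> g \<in> carrier G \<Longrightarrow> \<gamma> g \<in> S X"
  using \<gamma>_S S_mono[of "{g}" X] by blast

lemma one_in_S: "\<one>\<^bsub>G\<^esub> \<in> X \<Longrightarrow> \<one> \<in> S X"
  using \<gamma>_in_S[of "\<one>\<^bsub>G\<^esub>"] by (simp add: \<gamma>_one)

lemma S_minus: "x \<in> S X \<Longrightarrow> y \<in> S X \<Longrightarrow> x \<ominus> y \<in> S X"
  by (simp add: a_minus_def S_add S_neg)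

lemma S_subgroup_mult: "subgroup X G \<Longrightarrow> x \<in> S X \<Longrightarrow> y \<in> S X \<Longrightarrow> x \<otimes> y \<in> S X"
  by (rule S_mult) (auto intro: subgroup.m_closed)

lemma S_conj:
  assumes x: "x \<in> S X" and g: "g \<in> carrier G"
    and XZ: "\<And>p. p \<in> X \<Longrightarrow> g \<otimes>\<^bsub>G\<^esub> p \<otimes>\<^bsub>G\<^esub> inv\<^bsub>G\<^esub> g \<in> Z"
  shows "\<gamma> g \<otimes> x \<otimes> \<gamma> (inv\<^bsub>G\<^esub> g) \<in> S Z"
proof -
  have "\<gamma> g \<otimes> x \<in> S ((\<lambda>p. g \<otimes>\<^bsub>G\<^esub> p) ` X)"
    by (rule S_mult[OF \<gamma>_S[OF g] x]) auto
  thus ?thesis by (rule S_mult[OF _ \<gamma>_S]) (use g XZ in auto)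
qed

text \<open>
  Each component is a multiple of a group element: \<open>f Y = (f Y \<otimes> \<gamma> (inv t)) \<otimes> \<gamma> t\<close> for \<open>t\<close> in \<open>X \<inter> Y\<close>. If
  \<open>Y\<close> does not meet \<open>X\<close>, the component is \<open>0\<close> and any element of \<open>X\<close> serves as \<open>t Y\<close>.
\<close>

lemma S_split_coset:
  assumes K: "opn K" and X: "subgroup X G" and x: "x \<in> S X"
  shows "\<exists>s t. (\<forall>Y\<in>rcosets\<^bsub>G\<^esub> K. s Y \<in> S (X \<inter> K) \<and> t Y \<in> X \<and> (t Y \<in> Y \<or> s Y = \<zero>)) \<and>
           x = (\<Oplus>Y\<in>rcosets\<^bsub>G\<^esub> K. s Y \<otimes> \<gamma> (t Y))"
proof -
  have XG: "X \<subseteq> carrier G" using subgroup.subset[OF X] .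
  have sK: "subgroup K G" by (rule opn_subgroup[OF K])
  obtain f where f: "\<And>Y. Y \<in> rcosets\<^bsub>G\<^esub> K \<Longrightarrow> f Y \<in> S (X \<inter> Y)" and xf: "x = (\<Oplus>Y\<in>rcosets\<^bsub>G\<^esub> K. f Y)"
    using S_split[OF K x] by blast
  have "\<exists>s t. s \<in> S (X \<inter> K) \<and> t \<in> X \<and> (t \<in> Y \<or> s = \<zero>) \<and> f Y = s \<otimes> \<gamma> t" if Y: "Y \<in> rcosets\<^bsub>G\<^esub> K" for Y
  proof (cases "X \<inter> Y = {}")
    case True
    hence "f Y = \<zero>" using f[OF Y] S_empty by simp
    thus ?thesis using S_zero subgroup.one_closed[OF X] by (intro exI[of _ \<zero>] exI[of _ "\<one>\<^bsub>G\<^esub>"]) simp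
  next
    case False
    then obtain t where t: "t \<in> X" "t \<in> Y" by auto
    have tG: "t \<in> carrier G" using t XG by auto
    obtain a where a: "a \<in> carrier G" "Y = K #>\<^bsub>G\<^esub> a" using Y by (auto simp: RCOSETS_def)
    have YK: "p \<otimes>\<^bsub>G\<^esub> inv\<^bsub>G\<^esub> t \<in> K" if "p \<in> Y" for p
    proof -
      obtain k l where kl: "k \<in> K" "l \<in> K" "p = k \<otimes>\<^bsub>G\<^esub> a" "t = l \<otimes>\<^bsub>G\<^esub> a"
        using t(2) \<open>p \<in> Y\<close> a(2) by (auto simp: r_coset_def)
      have "k \<in> carrier G" "l \<in> carrier G" using kl subgroup.subset[OF sK] by auto
      hence "p \<otimes>\<^bsub>G\<^esub> inv\<^bsub>G\<^esub> t = k \<otimes>\<^bsub>G\<^esub> (a \<otimes>\<^bsub>G\<^esub> inv\<^bsub>G\<^esub> a) \<otimes>\<^bsub>G\<^esub> inv\<^bsub>G\<^esub> l"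
        using kl a(1) by (simp add: G.inv_mult_group G.m_assoc del: G.r_inv)
      thus ?thesis using kl a(1) subgroup.m_closed[OF sK] subgroup.m_inv_closed[OF sK] \<open>k \<in> carrier G\<close> by simp
    qed
    have "f Y \<otimes> \<gamma> (inv\<^bsub>G\<^esub> t) \<in> S (X \<inter> K)"
      by (rule S_mult[OF f[OF Y] \<gamma>_S])
        (use tG t YK subgroup.m_closed[OF X] subgroup.m_inv_closed[OF X] in auto)
    moreover have "f Y = f Y \<otimes> \<gamma> (inv\<^bsub>G\<^esub> t) \<otimes> \<gamma> t"
      using S_closed[OF f[OF Y]] tG by (simp add: m_assoc)
    ultimately show ?thesis using t by blast
  qed
  hence "\<forall>Y\<in>rcosets\<^bsub>G\<^esub> K. \<exists>st. fst st \<in> S (X \<inter> K) \<and> snd st \<in> X \<and> (snd st \<in> Y \<or> fst st = \<zero>) \<and> f Y = fst st \<otimes> \<gamma> (snd st)"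
    by simp
  from bchoice[OF this] obtain st where st: "\<forall>Y\<in>rcosets\<^bsub>G\<^esub> K. fst (st Y) \<in> S (X \<inter> K) \<and> snd (st Y) \<in> X \<and>
      (snd (st Y) \<in> Y \<or> fst (st Y) = \<zero>) \<and> f Y = fst (st Y) \<otimes> \<gamma> (snd (st Y))" ..
  have "x = (\<Oplus>Y\<in>rcosets\<^bsub>G\<^esub> K. fst (st Y) \<otimes> \<gamma> (snd (st Y)))"
    unfolding xf using st S_closed XG by (intro finsum_cong' refl) (auto intro!: m_closed)
  thus ?thesis using st by (intro exI[of _ "\<lambda>Y. fst (st Y)"] exI[of _ "\<lambda>Y. snd (st Y)"]) auto
qed

lemma S_induct:
  assumes K: "opn K" and X: "subgroup X G" and x: "x \<in> S X"
    and zero: "P \<zero>" and add: "\<And>x y. x \<in> carrier R \<Longrightarrow> y \<in> carrier R \<Longrightarrow> P x \<Longrightarrow> P y \<Longrightarrow> P (x \<oplus> y)"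
    and step: "\<And>s t. s \<in> S (X \<inter> K) \<Longrightarrow> t \<in> X \<Longrightarrow> P (s \<otimes> \<gamma> t)"
  shows "P x"
proof -
  obtain s t where st: "\<forall>Y\<in>rcosets\<^bsub>G\<^esub> K. s Y \<in> S (X \<inter> K) \<and> t Y \<in> X \<and> (t Y \<in> Y \<or> s Y = \<zero>)"
    "x = (\<Oplus>Y\<in>rcosets\<^bsub>G\<^esub> K. s Y \<otimes> \<gamma> (t Y))" using S_split_coset[OF K X x] by blast
  show ?thesis unfolding st(2)
  proof (rule finsum_induct_pred[OF opn_finite[OF K] _ zero add])
    fix Y assume "Y \<in> rcosets\<^bsub>G\<^esub> K"
    hence "s Y \<in> S (X \<inter> K)" "t Y \<in> X" using st(1) by auto
    thus "s Y \<otimes> \<gamma> (t Y) \<in> carrier R \<and> P (s Y \<otimes> \<gamma> (t Y))"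
      using step S_closed subgroup.subset[OF X] by auto
  qed
qed

end

subsection \<open>A primitive idempotent and its conjugates\<close>

text \<open>
  In the application the ring is the quotient of \<open>kG\<close> by \<open>J\<close>, \<open>D\<close> is the finite radical, \<open>C\<close> its
  centraliser, and \<open>S D\<close> is the image of \<open>k\<Delta>\<^sup>+\<close>.
\<close>

locale conj_idempotent = support_ring +
  fixes D C :: "'c set" and e :: 'a
  assumes D: "D \<lhd> G" and C: "opn C" and CD: "\<And>c d. c \<in> C \<Longrightarrow> d \<in> D \<Longrightarrow> c \<otimes>\<^bsub>G\<^esub> d = d \<otimes>\<^bsub>G\<^esub> c"
    and e: "centrally_primitive_idempotent (R\<lparr>carrier := S D\<rparr>) e"
begin

lemma central_idempotent_S: "central_idempotent (R\<lparr>carrier := S D\<rparr>) a \<longleftrightarrow>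
    a \<in> S D \<and> a \<otimes> a = a \<and> (\<forall>x\<in>S D. a \<otimes> x = x \<otimes> a)"
  by (simp add: central_idempotent_def)

lemma primitive_S: "central_idempotent (R\<lparr>carrier := S D\<rparr>) e" "e \<noteq> \<zero>"
  "\<not> (\<exists>a b. central_idempotent (R\<lparr>carrier := S D\<rparr>) a \<and> central_idempotent (R\<lparr>carrier := S D\<rparr>) b \<and>
      a \<noteq> \<zero> \<and> b \<noteq> \<zero> \<and> a \<otimes> b = \<zero> \<and> e = a \<oplus> b)"
  using e by (simp_all add: centrally_primitive_idempotent_def)

lemma e_in: "e \<in> S D" and ee: "e \<otimes> e = e" and e_nz: "e \<noteq> \<zero>"
  and e_central: "x \<in> S D \<Longrightarrow> e \<otimes> x = x \<otimes> e"
  using primitive_S(1,2) unfolding central_idempotent_S by blast+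

lemma e_closed [simp]: "e \<in> carrier R" using e_in S_closed by blast

lemma ee' [simp]: "x \<in> carrier R \<Longrightarrow> e \<otimes> (e \<otimes> x) = e \<otimes> x"
  by (simp add: m_assoc[symmetric] ee)

lemma D_subgroup: "subgroup D G" using D by (rule normal_imp_subgroup)

lemma CG: "C \<subseteq> carrier G" using subgroup.subset[OF opn_subgroup[OF C]] .

lemma DG: "D \<subseteq> carrier G" using subgroup.subset[OF D_subgroup] .

definition cj :: "'c \<Rightarrow> 'a" where "cj h = \<gamma> h \<otimes> e \<otimes> \<gamma> (inv\<^bsub>G\<^esub> h)"

lemma conj_S_D: "x \<in> S D \<Longrightarrow> h \<in> carrier G \<Longrightarrow> \<gamma> h \<otimes> x \<otimes> \<gamma> (inv\<^bsub>G\<^esub> h) \<in> S D"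
  by (rule S_conj) (auto intro: normal.inv_op_closed2[OF D])

lemma cj_in: "h \<in> carrier G \<Longrightarrow> cj h \<in> S D"
  unfolding cj_def by (rule conj_S_D[OF e_in])

lemma cj_closed [simp]: "h \<in> carrier G \<Longrightarrow> cj h \<in> carrier R"
  using cj_in S_closed by blast

lemma cj_one [simp]: "cj \<one>\<^bsub>G\<^esub> = e" by (simp add: cj_def \<gamma>_one)

lemma cj_cj: "h \<in> carrier G \<Longrightarrow> cj h \<otimes> cj h = cj h"
  by (simp add: cj_def m_assoc)

lemma cj_conj: "g \<in> carrier G \<Longrightarrow> h \<in> carrier G \<Longrightarrow> \<gamma> g \<otimes> cj h \<otimes> \<gamma> (inv\<^bsub>G\<^esub> g) = cj (g \<otimes>\<^bsub>G\<^esub> h)"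
  by (simp add: cj_def m_assoc \<gamma>_mult G.inv_mult_group)

lemma cj_central: assumes h: "h \<in> carrier G" and x: "x \<in> S D" shows "cj h \<otimes> x = x \<otimes> cj h"
proof -
  let ?g = "inv\<^bsub>G\<^esub> h"
  have xR: "x \<in> carrier R" using x S_closed by blast
  have y: "\<gamma> ?g \<otimes> x \<otimes> \<gamma> h \<in> S D" using conj_S_D[OF x, of ?g] h by simp
  have "cj h \<otimes> x = \<gamma> h \<otimes> (e \<otimes> (\<gamma> ?g \<otimes> x \<otimes> \<gamma> h)) \<otimes> \<gamma> ?g"
    using h xR by (simp add: cj_def m_assoc)
  also have "e \<otimes> (\<gamma> ?g \<otimes> x \<otimes> \<gamma> h) = (\<gamma> ?g \<otimes> x \<otimes> \<gamma> h) \<otimes> e" by (rule e_central[OF y])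
  also have "\<gamma> h \<otimes> ((\<gamma> ?g \<otimes> x \<otimes> \<gamma> h) \<otimes> e) \<otimes> \<gamma> ?g = x \<otimes> cj h"
    using h xR by (simp add: cj_def m_assoc)
  finally show ?thesis .
qed

definition stab :: "'c set" where "stab = {h \<in> carrier G. \<gamma> h \<otimes> e = e \<otimes> \<gamma> h}"

lemma stab_iff: "h \<in> carrier G \<Longrightarrow> h \<in> stab \<longleftrightarrow> cj h = e"
proof -
  assume h: "h \<in> carrier G"
  have "cj h = e \<longleftrightarrow> cj h \<otimes> \<gamma> h = e \<otimes> \<gamma> h"
  proof
    assume "cj h \<otimes> \<gamma> h = e \<otimes> \<gamma> h"
    hence "cj h \<otimes> \<gamma> h \<otimes> \<gamma> (inv\<^bsub>G\<^esub> h) = e \<otimes> \<gamma> h \<otimes> \<gamma> (inv\<^bsub>G\<^esub> h)" by simp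
    thus "cj h = e" using h by (simp add: m_assoc)
  qed simp
  also have "cj h \<otimes> \<gamma> h = \<gamma> h \<otimes> e" using h by (simp add: cj_def m_assoc)
  finally show ?thesis using h by (simp add: stab_def)
qed

lemma stab_subgroup: "subgroup stab G"
proof (unfold_locales, goal_cases)
  case (2 x y)
  hence xy: "x \<in> carrier G" "y \<in> carrier G" "cj x = e" "cj y = e" using stab_iff by (auto simp: stab_def)
  have "cj (x \<otimes>\<^bsub>G\<^esub> y) = e" using cj_conj[of x y] xy by (simp add: cj_def)
  thus ?case using xy stab_iff by simp
next
  case (4 x)
  hence x: "x \<in> carrier G" "cj x = e" using stab_iff by (auto simp: stab_def)
  have "cj (inv\<^bsub>G\<^esub> x) = \<gamma> (inv\<^bsub>G\<^esub> x) \<otimes> cj x \<otimes> \<gamma> x" using x by (simp add: cj_def)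
  also have "\<dots> = e" using x(1) by (simp add: cj_def m_assoc)
  finally show ?case using x stab_iff by simp
qed (auto simp: stab_def \<gamma>_one)

lemma C_stab: "C \<subseteq> stab"
proof
  fix c assume c: "c \<in> C"
  have "\<gamma> c \<otimes> e = e \<otimes> \<gamma> c"
    by (rule S_commute[OF \<gamma>_S e_in]) (use c CG CD in auto)
  thus "c \<in> stab" using c CG by (auto simp: stab_def)
qed

lemma D_stab: "D \<subseteq> stab"
proof
  fix d assume d: "d \<in> D"
  have "\<gamma> d \<in> S D" using d DG by (intro \<gamma>_in_S) auto
  thus "d \<in> stab" using e_central[of "\<gamma> d"] d DG by (auto simp: stab_def)
qed

lemma stab_opn: "opn stab" by (rule opn_mono[OF C C_stab stab_subgroup])

lemma stabG: "stab \<subseteq> carrier G" by (auto simp: stab_def)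

text \<open>On the open subgroup \<open>C\<close> of \<open>stab\<close> the idempotent commutes with all elements supported there, because
  \<open>C\<close> centralises \<open>D\<close>. The rest of \<open>X\<close> is reached by finitely many group elements that fix \<open>e\<close>.\<close>

lemma e_commute:
  assumes X: "subgroup X G" "X \<subseteq> stab" and s: "s \<in> S X" shows "e \<otimes> s = s \<otimes> e"
proof (rule S_induct[OF C X(1) s])
  fix s t assume s: "s \<in> S (X \<inter> C)" and t: "t \<in> X"
  have tG: "t \<in> carrier G" using t X(2) stabG by auto
  have "e \<otimes> s = s \<otimes> e" by (rule S_commute[OF e_in s]) (use CD in auto)
  moreover have "\<gamma> t \<otimes> e = e \<otimes> \<gamma> t" using t X(2) by (auto simp: stab_def)
  ultimately show "e \<otimes> (s \<otimes> \<gamma> t) = s \<otimes> \<gamma> t \<otimes> e"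
    using S_closed[OF s] tG by (metis e_closed \<gamma>_closed m_assoc)
qed (simp_all add: l_distr r_distr)

text \<open>
  Otherwise \<open>e = e c + (e - e c)\<close>, with \<open>c\<close> the conjugate of \<open>e\<close>, would be a decomposition into two nonzero
  orthogonal central idempotents.
\<close>

lemma e_cj_cases:
  assumes h: "h \<in> carrier G" shows "e \<otimes> cj h = \<zero> \<or> e \<otimes> cj h = e"
proof (rule ccontr)
  assume ne: "\<not> (e \<otimes> cj h = \<zero> \<or> e \<otimes> cj h = e)"
  define a where "a = e \<otimes> cj h"
  define b where "b = e \<ominus> a"
  have cR: "cj h \<in> carrier R" and eR: "e \<in> carrier R" using h by simp_all
  have eD: "e \<in> S D" and cD: "cj h \<in> S D" using e_in cj_in[OF h] .
  have aD: "a \<in> S D" unfolding a_def by (rule S_subgroup_mult[OF D_subgroup eD cD])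
  have bD: "b \<in> S D" unfolding b_def by (rule S_minus[OF eD aD])
  have aR: "a \<in> carrier R" and bR: "b \<in> carrier R" using aD bD S_closed by blast+
  have ea: "e \<otimes> a = a" using cR by (simp add: a_def)
  have ae: "a \<otimes> e = a" using e_central[OF aD] ea by simp
  have aa: "a \<otimes> a = a"
  proof -
    have "a \<otimes> a = a \<otimes> e \<otimes> cj h" using aR cR by (simp add: a_def m_assoc)
    also have "\<dots> = e \<otimes> (cj h \<otimes> cj h)" using cR by (simp only: ae) (simp add: a_def m_assoc)
    also have "\<dots> = a" using cj_cj[OF h] by (simp add: a_def)
    finally show ?thesis .
  qed
  have acent: "a \<otimes> x = x \<otimes> a" if x: "x \<in> S D" for x
  proof -
    have xR: "x \<in> carrier R" using x S_closed by blast
    have "a \<otimes> x = e \<otimes> (x \<otimes> cj h)" using xR cR cj_central[OF h x] by (simp add: a_def m_assoc)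
    also have "\<dots> = x \<otimes> a" using xR cR e_central[OF x] by (simp add: a_def m_assoc[symmetric])
    finally show ?thesis .
  qed
  have ab: "a \<otimes> b = \<zero>" unfolding b_def using aR by (simp add: ae aa r_neg a_minus_def r_distr r_minus)
  have bb: "b \<otimes> b = b"
  proof -
    have "b \<otimes> b = e \<otimes> b \<ominus> a \<otimes> b" using aR bR unfolding b_def by (simp add: a_minus_def l_distr l_minus)
    also have "e \<otimes> b = b" unfolding b_def using aR by (simp add: a_minus_def r_distr r_minus ee ea)
    finally show ?thesis using ab bR by (simp add: a_minus_def)
  qed
  have bcent: "b \<otimes> x = x \<otimes> b" if x: "x \<in> S D" for x
    using S_closed[OF x] aR acent[OF x] e_central[OF x]
    by (simp add: b_def a_minus_def l_distr r_distr l_minus r_minus)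
  have eab: "e = a \<oplus> b" using aR a_lcomm[of a e "\<ominus> a"] by (simp add: b_def a_minus_def r_neg) 
  have an: "a \<noteq> \<zero>" using ne by (simp add: a_def)
  have an': "a \<noteq> e" using ne by (simp add: a_def)
  have bn: "b \<noteq> \<zero>"
  proof
    assume "b = \<zero>"
    hence "e = a" using eab r_zero[OF aR] by metis
    thus False using an' by blast
  qed
  have "central_idempotent (R\<lparr>carrier := S D\<rparr>) a"
    unfolding central_idempotent_S using aD aa acent by blast
  moreover have "central_idempotent (R\<lparr>carrier := S D\<rparr>) b"
    unfolding central_idempotent_S using bD bb bcent by blast
  ultimately show False using primitive_S(3) ab eab an bn by blast
qed

text \<open>
  If the product of \<open>e\<close> and \<open>c = h e h\<^sup>-\<^sup>1\<close> is \<open>e\<close>, the same alternative for \<open>h\<^sup>-\<^sup>1\<close> shows that it is also \<open>c\<close>,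
  so that \<open>h\<close> fixes \<open>e\<close>. Hence the product is \<open>0\<close>, and \<open>e h e = e c h\<close>.
\<close>

lemma e_\<gamma>_e:
  assumes h: "h \<in> carrier G" and hs: "h \<notin> stab" shows "e \<otimes> \<gamma> h \<otimes> e = \<zero>"
proof -
  let ?g = "inv\<^bsub>G\<^esub> h"
  have gG: "?g \<in> carrier G" using h by simp
  have "e \<otimes> cj h = \<zero>"
  proof (rule ccontr)
    assume "e \<otimes> cj h \<noteq> \<zero>"
    hence 1: "e \<otimes> cj h = e" using e_cj_cases[OF h] by blast
    have conj: "\<gamma> h \<otimes> (e \<otimes> cj ?g) \<otimes> \<gamma> ?g = cj h \<otimes> e" using h by (simp add: cj_def m_assoc)
    from e_cj_cases[OF gG] show False
    proof
      assume "e \<otimes> cj ?g = \<zero>"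
      hence "cj h \<otimes> e = \<zero>" using conj h by simp
      thus False using 1 e_nz e_central[OF cj_in[OF h]] by simp
    next
      assume "e \<otimes> cj ?g = e"
      hence "cj h \<otimes> e = cj h" using conj by (simp add: cj_def)
      thus False using 1 hs h stab_iff e_central[OF cj_in[OF h]] by simp
    qed
  qed
  moreover have "e \<otimes> \<gamma> h \<otimes> e = (e \<otimes> cj h) \<otimes> \<gamma> h" using h by (simp add: cj_def m_assoc)
  ultimately show ?thesis using h by simp
qed

text \<open>Expand \<open>x\<close> into products \<open>s t\<close> with \<open>s\<close> supported on \<open>X \<inter> stab\<close>. As \<open>e (s t) e = s (e t e)\<close>, only the
  summands with \<open>t \<in> stab\<close> survive.\<close>

lemma corner_S:
  assumes X: "subgroup X G" and x: "x \<in> S X"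
  shows "\<exists>s\<in>S (X \<inter> stab). e \<otimes> x \<otimes> e = e \<otimes> s"
proof (rule S_induct[OF stab_opn X x])
  show "\<exists>s\<in>S (X \<inter> stab). e \<otimes> \<zero> \<otimes> e = e \<otimes> s" using S_zero by (intro bexI[of _ \<zero>]) simp_all
next
  fix x y assume xy: "x \<in> carrier R" "y \<in> carrier R"
    and "\<exists>s\<in>S (X \<inter> stab). e \<otimes> x \<otimes> e = e \<otimes> s" "\<exists>s\<in>S (X \<inter> stab). e \<otimes> y \<otimes> e = e \<otimes> s"
  then obtain s s' where s: "s \<in> S (X \<inter> stab)" "s' \<in> S (X \<inter> stab)" "e \<otimes> x \<otimes> e = e \<otimes> s" "e \<otimes> y \<otimes> e = e \<otimes> s'" by blast
  have "e \<otimes> (x \<oplus> y) \<otimes> e = e \<otimes> (s \<oplus> s')"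
    using xy s S_closed[OF s(1)] S_closed[OF s(2)] by (simp add: l_distr r_distr)
  thus "\<exists>s\<in>S (X \<inter> stab). e \<otimes> (x \<oplus> y) \<otimes> e = e \<otimes> s" using S_add s by blast
next
  fix s t assume s: "s \<in> S (X \<inter> stab)" and t: "t \<in> X"
  have tG: "t \<in> carrier G" using t subgroup.subset[OF X] by auto
  have sR: "s \<in> carrier R" using s S_closed by blast
  have se: "e \<otimes> s = s \<otimes> e"
    by (rule e_commute[OF G.subgroups_Inter_pair[OF X stab_subgroup] _ s]) auto
  show "\<exists>s'\<in>S (X \<inter> stab). e \<otimes> (s \<otimes> \<gamma> t) \<otimes> e = e \<otimes> s'"
  proof (cases "t \<in> stab")
    case True
    have "e \<otimes> (s \<otimes> \<gamma> t) \<otimes> e = (e \<otimes> s) \<otimes> (\<gamma> t \<otimes> e)" using sR tG by (simp add: m_assoc)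
    also have "\<gamma> t \<otimes> e = e \<otimes> \<gamma> t" using True by (simp add: stab_def)
    also have "(e \<otimes> s) \<otimes> (e \<otimes> \<gamma> t) = e \<otimes> (s \<otimes> e) \<otimes> \<gamma> t" using sR tG by (simp add: m_assoc)
    also have "\<dots> = e \<otimes> (s \<otimes> \<gamma> t)" using sR tG by (simp add: se[symmetric] m_assoc)
    finally have "e \<otimes> (s \<otimes> \<gamma> t) \<otimes> e = e \<otimes> (s \<otimes> \<gamma> t)" .
    moreover have "s \<otimes> \<gamma> t \<in> S (X \<inter> stab)"
      by (rule S_mult[OF s \<gamma>_S[OF tG]])
        (use True t subgroup.m_closed[OF X] subgroup.m_closed[OF stab_subgroup] in auto)
    ultimately show ?thesis by blast
  next
    case False
    have "e \<otimes> (s \<otimes> \<gamma> t) \<otimes> e = (s \<otimes> e) \<otimes> \<gamma> t \<otimes> e" using sR tG by (simp add: se[symmetric] m_assoc)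
    also have "\<dots> = s \<otimes> (e \<otimes> \<gamma> t \<otimes> e)" using sR tG by (simp add: m_assoc)
    also have "\<dots> = e \<otimes> \<zero>" using e_\<gamma>_e[OF tG False] sR by simp
    finally show ?thesis using S_zero by blast
  qed
qed

text \<open>
  Multiplication with \<open>c = t\<^sup>-\<^sup>1 e\<close> on the right isolates the component that belongs to the coset of \<open>t\<close>: for
  another coset representative \<open>t'\<close> the product \<open>e t' t\<^sup>-\<^sup>1 e\<close> vanishes. So the components inherit from \<open>p\<close>
  the membership in an ideal, after multiplication by \<open>e\<close>. This is the key to control.
\<close>

lemma component_split:
  assumes X: "subgroup X G" and p: "p \<in> S X"
  shows "\<exists>s t. (\<forall>Y\<in>rcosets\<^bsub>G\<^esub> stab. s Y \<in> S (X \<inter> stab) \<and> t Y \<in> X \<and>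
             (\<exists>c\<in>carrier R. e \<otimes> s Y = e \<otimes> p \<otimes> c)) \<and> p = (\<Oplus>Y\<in>rcosets\<^bsub>G\<^esub> stab. s Y \<otimes> \<gamma> (t Y))"
proof -
  obtain s t where st: "\<forall>Y\<in>rcosets\<^bsub>G\<^esub> stab. s Y \<in> S (X \<inter> stab) \<and> t Y \<in> X \<and> (t Y \<in> Y \<or> s Y = \<zero>)"
    and pst: "p = (\<Oplus>Y\<in>rcosets\<^bsub>G\<^esub> stab. s Y \<otimes> \<gamma> (t Y))" using S_split_coset[OF stab_opn X p] by blast
  have tG: "t Y \<in> carrier G" if "Y \<in> rcosets\<^bsub>G\<^esub> stab" for Y using st that subgroup.subset[OF X] by auto
  have sR: "s Y \<in> carrier R" if "Y \<in> rcosets\<^bsub>G\<^esub> stab" for Y using st that S_closed by blast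
  have se: "e \<otimes> s Y = s Y \<otimes> e" if "Y \<in> rcosets\<^bsub>G\<^esub> stab" for Y
    by (rule e_commute[OF G.subgroups_Inter_pair[OF X stab_subgroup] _ ]) (use st that in auto)
  have "\<exists>c\<in>carrier R. e \<otimes> s Y = e \<otimes> p \<otimes> c" if Y: "Y \<in> rcosets\<^bsub>G\<^esub> stab" for Y
  proof (cases "s Y = \<zero>")
    case True
    thus ?thesis using S_closed[OF p] by (intro bexI[of _ \<zero>]) simp_all
  next
    case False
    hence tY: "t Y \<in> Y" using st Y by blast
    let ?c = "\<gamma> (inv\<^bsub>G\<^esub> (t Y)) \<otimes> e"
    have cR: "?c \<in> carrier R" using tG[OF Y] by simp
    have summand: "e \<otimes> (s Z \<otimes> \<gamma> (t Z)) \<otimes> ?c = (if Y = Z then e \<otimes> s Y else \<zero>)" if Z: "Z \<in> rcosets\<^bsub>G\<^esub> stab" for Z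
    proof -
      have tt: "t Z \<otimes>\<^bsub>G\<^esub> inv\<^bsub>G\<^esub> (t Y) \<in> carrier G" using tG[OF Y] tG[OF Z] by simp
      have "e \<otimes> (s Z \<otimes> \<gamma> (t Z)) \<otimes> ?c = s Z \<otimes> (e \<otimes> \<gamma> (t Z \<otimes>\<^bsub>G\<^esub> inv\<^bsub>G\<^esub> (t Y)) \<otimes> e)"
      proof -
        have "e \<otimes> (s Z \<otimes> \<gamma> (t Z)) \<otimes> ?c = (e \<otimes> s Z) \<otimes> (\<gamma> (t Z) \<otimes> ?c)"
          using sR[OF Z] tG[OF Y] tG[OF Z] by (simp add: m_assoc)
        thus ?thesis unfolding se[OF Z] using sR[OF Z] tG[OF Y] tG[OF Z] by (simp add: m_assoc \<gamma>_mult)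
      qed
      also have "\<dots> = (if Y = Z then e \<otimes> s Y else \<zero>)"
      proof (cases "Y = Z")
        case True
        thus ?thesis using tG[OF Z] sR[OF Z] se[OF Z] by (simp add: \<gamma>_one ee)
      next
        case YZ: False
        show ?thesis
        proof (cases "s Z = \<zero>")
          case True
          thus ?thesis using YZ tt by simp
        next
          case False
          hence tZ: "t Z \<in> Z" using st Z by blast
          have "t Z \<otimes>\<^bsub>G\<^esub> inv\<^bsub>G\<^esub> (t Y) \<notin> stab"
          proof
            assume "t Z \<otimes>\<^bsub>G\<^esub> inv\<^bsub>G\<^esub> (t Y) \<in> stab"
            moreover have "t Z = (t Z \<otimes>\<^bsub>G\<^esub> inv\<^bsub>G\<^esub> (t Y)) \<otimes>\<^bsub>G\<^esub> t Y" using tG[OF Y] tG[OF Z] by (simp add: G.m_assoc)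
            ultimately have "t Z \<in> stab #>\<^bsub>G\<^esub> t Y" unfolding r_coset_def by blast
            moreover have "Y = stab #>\<^bsub>G\<^esub> t Y"
              using G.repr_independence[OF _ _ stab_subgroup] tY Y tG[OF Y] by (auto simp: RCOSETS_def)
            ultimately have "t Z \<in> Y \<inter> Z" using tZ by simp
            thus False using YZ G.rcos_disjoint[OF stab_subgroup] Y Z
              by (auto simp: pairwise_def disjnt_def)
          qed
          thus ?thesis using e_\<gamma>_e[OF tt] YZ sR[OF Z] by simp
        qed
      qed
      finally show ?thesis .
    qed
    have cl: "(\<lambda>Z. s Z \<otimes> \<gamma> (t Z)) \<in> rcosets\<^bsub>G\<^esub> stab \<rightarrow> carrier R" using sR tG by auto
    have cl': "(\<lambda>Z. e \<otimes> (s Z \<otimes> \<gamma> (t Z))) \<in> rcosets\<^bsub>G\<^esub> stab \<rightarrow> carrier R" using sR tG by auto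
    have fin: "finite (rcosets\<^bsub>G\<^esub> stab)" by (rule opn_finite[OF stab_opn])
    have "e \<otimes> p \<otimes> ?c = (\<Oplus>Z\<in>rcosets\<^bsub>G\<^esub> stab. e \<otimes> (s Z \<otimes> \<gamma> (t Z)) \<otimes> ?c)"
      unfolding pst using cR by (simp only: finsum_rdistr[OF fin e_closed cl] finsum_ldistr[OF fin cR cl'])
    also have "\<dots> = (\<Oplus>Z\<in>rcosets\<^bsub>G\<^esub> stab. if Y = Z then e \<otimes> s Y else \<zero>)"
      using summand sR[OF Y] by (intro finsum_cong' refl) auto
    also have "\<dots> = e \<otimes> s Y"
      using add.finprod_singleton[OF Y fin, of "\<lambda>_. e \<otimes> s Y"] sR[OF Y] by simp
    finally show ?thesis using cR by metis
  qed
  thus ?thesis using st pst by blast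
qed

end

subsection \<open>The sum of the conjugates\<close>

text \<open>The conjugates of \<open>e\<close> are enumerated by \<open>es\<close>, with \<open>g i\<close> conjugating \<open>e\<close> into \<open>es i\<close>.\<close>

locale conj_orbit = conj_idempotent +
  fixes r :: nat and es :: "nat \<Rightarrow> 'a" and g :: "nat \<Rightarrow> 'c"
  assumes bij: "bij_betw es {1..r} (cj ` carrier G)" and es1: "es 1 = e"
    and gG: "i \<in> {1..r} \<Longrightarrow> g i \<in> carrier G" and es_g: "i \<in> {1..r} \<Longrightarrow> es i = cj (g i)"
begin

definition f :: 'a where "f = (\<Oplus>i\<in>{1..r}. es i)"

lemma r1: "1 \<in> {1..r}"
proof -
  have "cj ` carrier G \<noteq> {}" by auto
  hence "{1..r} \<noteq> {}" using bij by (auto simp: bij_betw_def)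
  thus ?thesis by auto
qed

lemma es_in: "i \<in> {1..r} \<Longrightarrow> es i \<in> S D" using es_g gG cj_in by simp

lemma es_closed [simp]: "i \<in> {1..r} \<Longrightarrow> es i \<in> carrier R" using es_in S_closed by blast

lemma f_in: "f \<in> S D"
  unfolding f_def by (rule finsum_induct_pred) (use es_in S_closed S_zero S_add in auto)

lemma f_closed [simp]: "f \<in> carrier R" using f_in S_closed by blast

lemma es_orth: "i \<in> {1..r} \<Longrightarrow> j \<in> {1..r} \<Longrightarrow> es i \<otimes> es j = (if i = j then es i else \<zero>)"
proof -
  assume i: "i \<in> {1..r}" and j: "j \<in> {1..r}"
  show ?thesis
  proof (cases "i = j")
    case True
    thus ?thesis using es_g[OF i] cj_cj[OF gG[OF i]] by simp
  next
    case False
    let ?h = "inv\<^bsub>G\<^esub> (g i) \<otimes>\<^bsub>G\<^esub> g j"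
    have G': "g i \<in> carrier G" "g j \<in> carrier G" using gG i j by auto
    have h: "?h \<in> carrier G" using G' by simp
    have "?h \<notin> stab"
    proof
      assume "?h \<in> stab"
      hence "cj ?h = e" using stab_iff[OF h] by simp
      hence "cj (g i \<otimes>\<^bsub>G\<^esub> ?h) = cj (g i)" using cj_conj[OF G'(1) h] by (simp add: cj_def)
      hence "es i = es j" using es_g i j G' by (simp add: G.m_assoc[symmetric])
      thus False using False bij i j by (auto simp: bij_betw_def dest: inj_onD)
    qed
    hence "e \<otimes> \<gamma> ?h \<otimes> e = \<zero>" by (rule e_\<gamma>_e[OF h])
    moreover have "es i \<otimes> es j = \<gamma> (g i) \<otimes> (e \<otimes> \<gamma> ?h \<otimes> e) \<otimes> \<gamma> (inv\<^bsub>G\<^esub> (g j))"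
      using G' es_g[OF i] es_g[OF j] by (simp add: cj_def m_assoc \<gamma>_mult)
    ultimately show ?thesis using False G' by simp
  qed
qed

lemma es_f: assumes i: "i \<in> {1..r}" shows "es i \<otimes> f = es i" "f \<otimes> es i = es i"
proof -
  have "es i \<otimes> f = (\<Oplus>j\<in>{1..r}. es i \<otimes> es j)"
    unfolding f_def by (rule finsum_rdistr) (use i in auto)
  also have "\<dots> = (\<Oplus>j\<in>{1..r}. if i = j then es i else \<zero>)"
    using i es_orth[OF i] by (intro finsum_cong' refl) auto
  also have "\<dots> = es i" using add.finprod_singleton[OF i, of "\<lambda>_. es i"] i by simp
  finally show "es i \<otimes> f = es i" .
  have "f \<otimes> es i = (\<Oplus>j\<in>{1..r}. es j \<otimes> es i)"
    unfolding f_def by (rule finsum_ldistr) (use i in auto)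
  also have "\<dots> = (\<Oplus>j\<in>{1..r}. if i = j then es i else \<zero>)"
    using i es_orth[OF _ i] by (intro finsum_cong' refl) auto
  also have "\<dots> = es i" using add.finprod_singleton[OF i, of "\<lambda>_. es i"] i by simp
  finally show "f \<otimes> es i = es i" .
qed

lemma e_f: "e \<otimes> f = e" "f \<otimes> e = e" using es_f[OF r1] es1 by simp_all

lemma ff: "f \<otimes> f = f"
proof -
  have "(\<Oplus>j\<in>{1..r}. es j) \<otimes> f = (\<Oplus>j\<in>{1..r}. es j \<otimes> f)"
    by (rule finsum_ldistr) auto
  also have "\<dots> = (\<Oplus>j\<in>{1..r}. es j)"
    using es_f by (intro finsum_cong' refl) auto
  finally show ?thesis by (simp only: f_def[symmetric])
qed

lemma f_orbit: "f = (\<Oplus>c\<in>cj ` carrier G. c)"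
proof -
  have im: "es ` {1..r} = cj ` carrier G" and inj: "inj_on es {1..r}" using bij by (auto simp: bij_betw_def)
  have "(\<Oplus>c\<in>es ` {1..r}. c) = (\<Oplus>i\<in>{1..r}. es i)"
    by (rule finsum_reindex[OF _ inj]) auto
  thus ?thesis by (simp only: f_def im)
qed

lemma f_conj: assumes h: "h \<in> carrier G" shows "\<gamma> h \<otimes> f = f \<otimes> \<gamma> h"
proof -
  let ?O = "cj ` carrier G"
  have fin: "finite ?O" using bij bij_betw_finite by blast
  have OR: "?O \<subseteq> carrier R" by auto
  define \<phi> where "\<phi> = (\<lambda>c. \<gamma> h \<otimes> c \<otimes> \<gamma> (inv\<^bsub>G\<^esub> h))"
  have inj: "inj_on \<phi> ?O"
  proof (rule inj_onI)
    fix c c' assume cc: "c \<in> ?O" "c' \<in> ?O" and eq: "\<phi> c = \<phi> c'"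
    have R': "c \<in> carrier R" "c' \<in> carrier R" using cc OR by auto
    have "\<gamma> (inv\<^bsub>G\<^esub> h) \<otimes> \<phi> c \<otimes> \<gamma> h = \<gamma> (inv\<^bsub>G\<^esub> h) \<otimes> \<phi> c' \<otimes> \<gamma> h" using eq by simp
    thus "c = c'" using h R' by (simp add: \<phi>_def m_assoc)
  qed
  have sub: "\<phi> ` ?O \<subseteq> ?O" using h cj_conj by (auto simp: \<phi>_def)
  hence im: "\<phi> ` ?O = ?O" using inj fin endo_inj_surj by blast
  have "\<phi> f = (\<Oplus>c\<in>?O. \<phi> c)"
  proof -
    have "\<phi> f = \<gamma> h \<otimes> (\<Oplus>c\<in>?O. c) \<otimes> \<gamma> (inv\<^bsub>G\<^esub> h)" unfolding \<phi>_def f_orbit ..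
    also have "\<gamma> h \<otimes> (\<Oplus>c\<in>?O. c) = (\<Oplus>c\<in>?O. \<gamma> h \<otimes> c)" using fin h by (intro finsum_rdistr) auto
    also have "\<dots> \<otimes> \<gamma> (inv\<^bsub>G\<^esub> h) = (\<Oplus>c\<in>?O. \<phi> c)" unfolding \<phi>_def using fin h by (intro finsum_ldistr) auto
    finally show ?thesis .
  qed
  also have "\<dots> = (\<Oplus>c\<in>\<phi> ` ?O. c)"
    by (rule finsum_reindex[symmetric, OF _ inj]) (use im in auto)
  also have "\<dots> = f" by (simp only: im f_orbit)
  finally have "\<phi> f \<otimes> \<gamma> h = f \<otimes> \<gamma> h" by simp
  thus ?thesis using h by (simp add: \<phi>_def m_assoc)
qed

text \<open>\<open>f\<close> commutes with group elements, since conjugation permutes the orbit, and with the elements supported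
  on the centraliser of \<open>D\<close>. These generate the ring.\<close>

lemma f_central: assumes x: "x \<in> carrier R" shows "f \<otimes> x = x \<otimes> f"
proof -
  have "x \<in> S (carrier G)" using x S_top by simp
  thus ?thesis
  proof (rule S_induct[OF C G.subgroup_self])
    fix s t assume s: "s \<in> S (carrier G \<inter> C)" and t: "t \<in> carrier G"
    have sR: "s \<in> carrier R" using s S_closed by blast
    have "f \<otimes> s = s \<otimes> f" by (rule S_commute[OF f_in s]) (use CD in auto)
    hence "f \<otimes> (s \<otimes> \<gamma> t) = s \<otimes> (f \<otimes> \<gamma> t)" using sR t by (simp add: m_assoc[symmetric])
    also have "\<dots> = s \<otimes> (\<gamma> t \<otimes> f)" using f_conj[OF t] by simp
    finally show "f \<otimes> (s \<otimes> \<gamma> t) = s \<otimes> \<gamma> t \<otimes> f" using sR t by (simp add: m_assoc)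
  qed (simp_all add: l_distr r_distr)
qed

text \<open>The Peirce decomposition \<open>x = (1 - f) x + \<Sum> e\<^sub>i x e\<^sub>j\<close>, as an induction principle.\<close>

lemma peirce:
  assumes x: "x \<in> carrier R" and zero: "P \<zero>"
    and add: "\<And>x y. x \<in> carrier R \<Longrightarrow> y \<in> carrier R \<Longrightarrow> P x \<Longrightarrow> P y \<Longrightarrow> P (x \<oplus> y)"
    and compl: "P ((\<one> \<ominus> f) \<otimes> x)"
    and comp: "\<And>i j. i \<in> {1..r} \<Longrightarrow> j \<in> {1..r} \<Longrightarrow> P (es i \<otimes> x \<otimes> es j)"
  shows "P x"
proof -
  have row: "P (es i \<otimes> x)" if i: "i \<in> {1..r}" for i
  proof -
    have "es i \<otimes> x = es i \<otimes> f \<otimes> x" using es_f[OF i] by simp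
    also have "\<dots> = es i \<otimes> x \<otimes> f" using i x by (simp add: m_assoc f_central)
    also have "\<dots> = (\<Oplus>j\<in>{1..r}. es i \<otimes> x \<otimes> es j)"
      unfolding f_def by (rule finsum_rdistr) (use i x in auto)
    also have "P \<dots>" by (rule finsum_induct_pred[OF _ _ zero add]) (use i x comp in auto)
    finally show ?thesis .
  qed
  have "f \<otimes> x = (\<Oplus>i\<in>{1..r}. es i \<otimes> x)"
    unfolding f_def by (rule finsum_ldistr) (use x in auto)
  also have "P \<dots>" by (rule finsum_induct_pred[OF _ _ zero add]) (use x row in auto)
  finally have "P (f \<otimes> x)" .
  hence "P (f \<otimes> x \<oplus> (\<one> \<ominus> f) \<otimes> x)" using x compl by (intro add) auto
  moreover have "f \<otimes> x \<oplus> (\<one> \<ominus> f) \<otimes> x = x"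
  proof -
    have "f \<otimes> x \<oplus> (\<one> \<ominus> f) \<otimes> x = (f \<oplus> (\<one> \<ominus> f)) \<otimes> x" using x by (simp add: l_distr)
    also have "f \<oplus> (\<one> \<ominus> f) = \<one>" by (simp add: a_minus_def a_lcomm r_neg)
    finally show ?thesis using x by simp
  qed
  ultimately show ?thesis by simp
qed

end

section \<open>Ideals\<close>

subsection \<open>Prime ideals and products\<close>

text \<open>For the elementwise form, let \<open>X\<close> be the set of all \<open>u\<close> with \<open>u x b \<in> P\<close> for all \<open>x\<close>, and \<open>Y\<close> the set of all \<open>v\<close>
  with \<open>u x v \<in> P\<close> for all \<open>u\<close> in \<open>X\<close> and all \<open>x\<close>. These are ideals that contain \<open>a\<close> and \<open>b\<close>, and their product is
  in \<open>P\<close>. They are easier to handle than the ideals that \<open>a\<close> and \<open>b\<close> generate.\<close>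

lemma (in ring) prime_ideal_iff:
  "prime_ideal P R \<longleftrightarrow> ideal P R \<and> P \<noteq> carrier R \<and>
     (\<forall>a\<in>carrier R. \<forall>b\<in>carrier R. (\<forall>x\<in>carrier R. a \<otimes> x \<otimes> b \<in> P) \<longrightarrow> a \<in> P \<or> b \<in> P)"
proof
  assume P: "prime_ideal P R"
  hence I: "ideal P R" and ne: "P \<noteq> carrier R"
    and pr: "\<And>A B. ideal A R \<Longrightarrow> ideal B R \<Longrightarrow> ideal_prod R A B \<subseteq> P \<Longrightarrow> A \<subseteq> P \<or> B \<subseteq> P"
    by (auto simp: prime_ideal_def)
  interpret P: ideal P R by (rule I)
  have "a \<in> P \<or> b \<in> P"
    if a: "a \<in> carrier R" and b: "b \<in> carrier R" and ab: "\<forall>x\<in>carrier R. a \<otimes> x \<otimes> b \<in> P" for a b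
  proof -
    define X where "X = {x \<in> carrier R. \<forall>c\<in>carrier R. x \<otimes> c \<otimes> b \<in> P}"
    define Y where "Y = {y \<in> carrier R. \<forall>x\<in>X. \<forall>c\<in>carrier R. x \<otimes> c \<otimes> y \<in> P}"
    have X: "ideal X R"
    proof (rule idealI[OF ring_axioms])
      show "subgroup X (add_monoid R)"
        by (unfold_locales) (auto simp: X_def b l_distr a_inv_def[symmetric] l_minus)
      fix x c assume xc: "x \<in> X" "c \<in> carrier R"
      thus "c \<otimes> x \<in> X" using b P.I_l_closed by (auto simp: X_def m_assoc)
      have "x \<otimes> c \<otimes> d \<otimes> b \<in> P" if "d \<in> carrier R" for d
      proof -
        have "x \<otimes> (c \<otimes> d) \<otimes> b \<in> P" using xc that by (simp add: X_def)
        thus ?thesis using xc that b by (simp add: X_def m_assoc)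
      qed
      thus "x \<otimes> c \<in> X" using xc by (simp add: X_def)
    qed
    have XR: "X \<subseteq> carrier R" by (auto simp: X_def)
    have Y: "ideal Y R"
    proof (rule idealI[OF ring_axioms])
      show "subgroup Y (add_monoid R)"
        using XR by (unfold_locales) (auto simp: Y_def r_distr a_inv_def[symmetric] r_minus subset_iff)
      fix y c assume yc: "y \<in> Y" "c \<in> carrier R"
      have "x \<otimes> d \<otimes> (c \<otimes> y) \<in> P" if "x \<in> X" "d \<in> carrier R" for x d
      proof -
        have "x \<otimes> (d \<otimes> c) \<otimes> y \<in> P" using yc that by (auto simp: Y_def)
        thus ?thesis using yc that XR by (auto simp: Y_def m_assoc subset_iff)
      qed
      thus "c \<otimes> y \<in> Y" using yc by (auto simp: Y_def)
      have "x \<otimes> d \<otimes> (y \<otimes> c) \<in> P" if "x \<in> X" "d \<in> carrier R" for x d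
      proof -
        have "x \<otimes> d \<otimes> y \<otimes> c \<in> P" using yc that by (auto simp: Y_def intro: P.I_r_closed)
        thus ?thesis using yc that XR by (auto simp: Y_def m_assoc subset_iff)
      qed
      thus "y \<otimes> c \<in> Y" using yc by (auto simp: Y_def)
    qed
    have "ideal_prod R X Y \<subseteq> P"
    proof
      fix z assume "z \<in> ideal_prod R X Y"
      thus "z \<in> P"
      proof (induction rule: ideal_prod.induct)
        case (prod x y)
        hence "x \<otimes> \<one> \<otimes> y \<in> P" by (auto simp: Y_def)
        thus ?case using prod XR by auto
      qed (rule P.a_closed)
    qed
    moreover have "a \<in> X" "b \<in> Y" using a b ab by (auto simp: X_def Y_def)
    ultimately show ?thesis using pr[OF X Y] by blast
  qed
  thus "ideal P R \<and> P \<noteq> carrier R \<and>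
     (\<forall>a\<in>carrier R. \<forall>b\<in>carrier R. (\<forall>x\<in>carrier R. a \<otimes> x \<otimes> b \<in> P) \<longrightarrow> a \<in> P \<or> b \<in> P)"
    using I ne by blast
next
  assume *: "ideal P R \<and> P \<noteq> carrier R \<and>
     (\<forall>a\<in>carrier R. \<forall>b\<in>carrier R. (\<forall>x\<in>carrier R. a \<otimes> x \<otimes> b \<in> P) \<longrightarrow> a \<in> P \<or> b \<in> P)"
  have "A \<subseteq> P \<or> B \<subseteq> P" if A: "ideal A R" and B: "ideal B R" and AB: "ideal_prod R A B \<subseteq> P" for A B
  proof (rule ccontr)
    assume "\<not> (A \<subseteq> P \<or> B \<subseteq> P)"
    then obtain a b where ab: "a \<in> A" "a \<notin> P" "b \<in> B" "b \<notin> P" by blast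
    have aR: "a \<in> carrier R" "b \<in> carrier R" using ab ideal.Icarr[OF A] ideal.Icarr[OF B] by auto
    have "a \<otimes> x \<otimes> b \<in> P" if "x \<in> carrier R" for x
      using ideal_prod.prod[of "a \<otimes> x" A b B R] ideal.I_r_closed[OF A ab(1) that] ab(3) AB by blast
    thus False using * aR ab by blast
  qed
  thus "prime_ideal P R" using * by (simp add: prime_ideal_def)
qed

lemma ideal_prod_carrier_update:
  "ideal_prod (R\<lparr>carrier := Z\<rparr>) I K = ideal_prod R I K"
proof
  show "ideal_prod (R\<lparr>carrier := Z\<rparr>) I K \<subseteq> ideal_prod R I K"
  proof
    fix z assume "z \<in> ideal_prod (R\<lparr>carrier := Z\<rparr>) I K"
    thus "z \<in> ideal_prod R I K"
      by (induction rule: ideal_prod.induct) (auto intro: ideal_prod.prod ideal_prod.sum)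
  qed
  show "ideal_prod R I K \<subseteq> ideal_prod (R\<lparr>carrier := Z\<rparr>) I K"
  proof
    fix z assume "z \<in> ideal_prod R I K"
    thus "z \<in> ideal_prod (R\<lparr>carrier := Z\<rparr>) I K"
    proof (induction rule: ideal_prod.induct)
      case (prod i j)
      thus ?case using ideal_prod.prod[of i I j K "R\<lparr>carrier := Z\<rparr>"] by simp
    next
      case (sum s1 s2)
      thus ?case using ideal_prod.sum[of s1 "R\<lparr>carrier := Z\<rparr>" I K s2] by simp
    qed
  qed
qed

lemma ideal_prod_mono: "I \<subseteq> I' \<Longrightarrow> K \<subseteq> K' \<Longrightarrow> ideal_prod R I K \<subseteq> ideal_prod R I' K'"
proof
  fix z assume sub: "I \<subseteq> I'" "K \<subseteq> K'" and "z \<in> ideal_prod R I K"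
  from this(3) show "z \<in> ideal_prod R I' K'"
    by (induction rule: ideal_prod.induct) (use sub in \<open>auto intro: ideal_prod.prod ideal_prod.sum\<close>)
qed

context ring
begin

lemma ip_prod: "i \<in> I \<Longrightarrow> j \<in> K \<Longrightarrow> i \<otimes> j \<in> ideal_prod R I K"
  by (rule ideal_prod.prod)

lemma ip_sum: "x \<in> ideal_prod R I K \<Longrightarrow> y \<in> ideal_prod R I K \<Longrightarrow> x \<oplus> y \<in> ideal_prod R I K"
  by (rule ideal_prod.sum)

end

context support_ring
begin

lemma S_subring: "subgroup X G \<Longrightarrow> subring (S X) R"
  by (rule subringI) (auto simp: S_carrier S_neg S_add S_subgroup_mult intro: one_in_S subgroup.one_closed)

lemma S_ring: "subgroup X G \<Longrightarrow> ring (R\<lparr>carrier := S X\<rparr>)"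
  by (rule subring_is_ring[OF S_subring])

lemma S_ring_minus:
  assumes X: "subgroup X G" and x: "x \<in> S X"
  shows "a_inv (R\<lparr>carrier := S X\<rparr>) x = \<ominus> x"
proof -
  interpret K: ring "R\<lparr>carrier := S X\<rparr>" by (rule S_ring[OF X])
  have "\<ominus> x \<oplus> x = \<zero>" using S_closed[OF x] by (rule l_neg)
  thus ?thesis using K.minus_equality[of "\<ominus> x" x] S_neg[OF x] x by simp
qed

lemma left_ideal_iff:
  assumes X: "subgroup X G"
  shows "left_ideal L (R\<lparr>carrier := S X\<rparr>) \<longleftrightarrow> L \<subseteq> S X \<and> \<zero> \<in> L \<and> (\<forall>x\<in>L. \<forall>y\<in>L. x \<oplus> y \<in> L) \<and>
     (\<forall>a\<in>S X. \<forall>x\<in>L. a \<otimes> x \<in> L)"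
proof
  assume L: "left_ideal L (R\<lparr>carrier := S X\<rparr>)"
  interpret L: additive_subgroup L "R\<lparr>carrier := S X\<rparr>" using L by (simp add: left_ideal_def)
  show "L \<subseteq> S X \<and> \<zero> \<in> L \<and> (\<forall>x\<in>L. \<forall>y\<in>L. x \<oplus> y \<in> L) \<and> (\<forall>a\<in>S X. \<forall>x\<in>L. a \<otimes> x \<in> L)"
    using L L.a_subset L.zero_closed L.a_closed by (auto simp: left_ideal_def)
next
  assume L: "L \<subseteq> S X \<and> \<zero> \<in> L \<and> (\<forall>x\<in>L. \<forall>y\<in>L. x \<oplus> y \<in> L) \<and> (\<forall>a\<in>S X. \<forall>x\<in>L. a \<otimes> x \<in> L)"
  have neg: "\<ominus> x \<in> L" if x: "x \<in> L" for x
  proof -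
    have "\<one> \<in> S X" using X by (intro one_in_S subgroup.one_closed)
    hence "(\<ominus> \<one>) \<otimes> x \<in> L" using L x S_neg by blast
    moreover have "x \<in> carrier R" using L x S_closed by blast
    ultimately show ?thesis by (simp add: l_minus)
  qed
  have "subgroup L (add_monoid (R\<lparr>carrier := S X\<rparr>))"
  proof (unfold_locales, goal_cases)
    case (4 x)
    have "inv\<^bsub>add_monoid (R\<lparr>carrier := S X\<rparr>)\<^esub> x = \<ominus> x"
      using S_ring_minus[OF X, of x] L 4 unfolding a_inv_def by auto
    thus ?case using neg[OF 4] by simp
  qed (use L in auto)
  thus "left_ideal L (R\<lparr>carrier := S X\<rparr>)" using L by (auto simp: left_ideal_def additive_subgroup_def)
qed

lemma ideal_S_D:
  assumes "ideal I (R\<lparr>carrier := S X\<rparr>)"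
  shows "I \<subseteq> S X" "\<zero> \<in> I" "x \<in> I \<Longrightarrow> y \<in> I \<Longrightarrow> x \<oplus> y \<in> I"
    "x \<in> I \<Longrightarrow> a \<in> S X \<Longrightarrow> a \<otimes> x \<in> I" "x \<in> I \<Longrightarrow> a \<in> S X \<Longrightarrow> x \<otimes> a \<in> I"
proof -
  interpret I: ideal I "R\<lparr>carrier := S X\<rparr>" by (rule assms)
  show "I \<subseteq> S X" using I.Icarr by auto
  show "\<zero> \<in> I" using additive_subgroup.zero_closed[OF ideal.axioms(1)[OF assms]] by simp
  show "x \<oplus> y \<in> I" if "x \<in> I" "y \<in> I" 
    using additive_subgroup.a_closed[OF ideal.axioms(1)[OF assms] that] by simp
  show "a \<otimes> x \<in> I" if "x \<in> I" "a \<in> S X" using I.I_l_closed that by simp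
  show "x \<otimes> a \<in> I" if "x \<in> I" "a \<in> S X" using I.I_r_closed that by simp
qed

end

subsection \<open>The ideal generated by the radical of a finite normal subgroup\<close>

locale finite_normal_support = support_ring +
  fixes D C :: "'c set"
  assumes D: "D \<lhd> G" and C: "opn C" and CD: "\<And>c d. c \<in> C \<Longrightarrow> d \<in> D \<Longrightarrow> c \<otimes>\<^bsub>G\<^esub> d = d \<otimes>\<^bsub>G\<^esub> c"
    and finite_S_D: "finite (S D)"
begin

abbreviation KD :: "('a, 'b) ring_scheme" where "KD \<equiv> R\<lparr>carrier := S D\<rparr>"

lemma DS: "subgroup D G" using D by (rule normal_imp_subgroup)

lemma one_S_D: "\<one> \<in> S D" using DS by (intro one_in_S subgroup.one_closed)

definition conj_invariant :: "'a set \<Rightarrow> bool" where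
  "conj_invariant L \<longleftrightarrow> (\<forall>h\<in>carrier G. \<forall>x\<in>L. \<gamma> h \<otimes> x \<otimes> \<gamma> (inv\<^bsub>G\<^esub> h) \<in> L)"

text \<open>Write \<open>x\<close> as a sum of products \<open>s t\<close> with \<open>s\<close> supported on the centraliser of \<open>D\<close>. Then \<open>s t l = l' s t\<close>,
  where \<open>l' = t l t\<^sup>-\<^sup>1\<close> is again in \<open>L\<close>.\<close>

lemma mult_into_ideal_prod:
  assumes L: "left_ideal L KD" and inv: "conj_invariant L" and x: "x \<in> carrier R" and l: "l \<in> L"
  shows "x \<otimes> l \<in> ideal_prod R L (carrier R)"
proof -
  have LS: "L \<subseteq> S D" and L0: "\<zero> \<in> L" using L left_ideal_iff[OF DS] by auto
  have lR: "l \<in> carrier R" using l LS S_closed by blast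
  have "x \<in> S (carrier G)" using x S_top by simp
  thus ?thesis
  proof (rule S_induct[OF C G.subgroup_self])
    show "\<zero> \<otimes> l \<in> ideal_prod R L (carrier R)"
      using ip_prod[OF L0 zero_closed] lR by simp
  next
    fix x y assume "x \<in> carrier R" "y \<in> carrier R"
      "x \<otimes> l \<in> ideal_prod R L (carrier R)" "y \<otimes> l \<in> ideal_prod R L (carrier R)"
    thus "(x \<oplus> y) \<otimes> l \<in> ideal_prod R L (carrier R)"
      using ip_sum lR by (simp add: l_distr)
  next
    fix s t assume s: "s \<in> S (carrier G \<inter> C)" and t: "t \<in> carrier G"
    define l' where "l' = \<gamma> t \<otimes> l \<otimes> \<gamma> (inv\<^bsub>G\<^esub> t)"
    have l': "l' \<in> L" using inv t l by (simp add: conj_invariant_def l'_def)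
    hence l'S: "l' \<in> S D" using LS by blast
    have R': "s \<in> carrier R" "l' \<in> carrier R" using s l'S S_closed by blast+
    have "l' \<otimes> s = s \<otimes> l'" by (rule S_commute[OF l'S s]) (use CD in auto)
    moreover have "s \<otimes> \<gamma> t \<otimes> l = s \<otimes> l' \<otimes> \<gamma> t" using R' t lR by (simp add: l'_def m_assoc)
    ultimately have "s \<otimes> \<gamma> t \<otimes> l = l' \<otimes> (s \<otimes> \<gamma> t)" using R' t by (simp add: m_assoc[symmetric])
    thus "s \<otimes> \<gamma> t \<otimes> l \<in> ideal_prod R L (carrier R)"
      using ip_prod[OF l', of "s \<otimes> \<gamma> t" "carrier R"] R' t by simp
  qed
qed

lemma ideal_prod_ideal:
  assumes L: "left_ideal L KD" and inv: "conj_invariant L"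
  shows "ideal (ideal_prod R L (carrier R)) R"
proof -
  let ?I = "ideal_prod R L (carrier R)"
  have LS: "L \<subseteq> S D" and L0: "\<zero> \<in> L" using L left_ideal_iff[OF DS] by auto
  have LR: "L \<subseteq> carrier R" using LS S_carrier by blast
  have IR: "z \<in> carrier R" if "z \<in> ?I" for z
    using that by (induction rule: ideal_prod.induct) (use LR in auto)
  have 0: "\<zero> \<in> ?I" using ip_prod[OF L0 zero_closed] by simp
  have r: "z \<otimes> a \<in> ?I" if "z \<in> ?I" "a \<in> carrier R" for z a
    using that(1)
  proof (induction rule: ideal_prod.induct)
    case (prod l b)
    hence "l \<otimes> b \<otimes> a = l \<otimes> (b \<otimes> a)" using LR that(2) by (auto intro: m_assoc)
    thus ?case using prod that(2) ip_prod[of l L "b \<otimes> a" "carrier R"] by simp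
  next
    case (sum z z')
    thus ?case using IR that(2) ip_sum by (simp add: l_distr)
  qed
  have l: "a \<otimes> z \<in> ?I" if "z \<in> ?I" "a \<in> carrier R" for z a
    using that(1)
  proof (induction rule: ideal_prod.induct)
    case (prod l b)
    hence "a \<otimes> (l \<otimes> b) = a \<otimes> l \<otimes> b" using LR that(2) by (auto intro: m_assoc[symmetric])
    thus ?case using r[OF mult_into_ideal_prod[OF L inv that(2) prod(1)] prod(2)] by simp
  next
    case (sum z z')
    thus ?case using IR that(2) ip_sum by (simp add: r_distr)
  qed
  have neg: "\<ominus> z \<in> ?I" if "z \<in> ?I" for z
    using r[OF that, of "\<ominus> \<one>"] IR[OF that] by (simp add: r_minus)
  show ?thesis
  proof (rule idealI[OF ring_axioms])
    show "subgroup ?I (add_monoid R)"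
      using 0 IR neg by unfold_locales (auto intro: ip_sum simp: a_inv_def[symmetric])
  qed (use l r in auto)
qed

lemma conj_left_ideal:
  assumes L: "left_ideal L KD" and h: "h \<in> carrier G"
  shows "left_ideal ((\<lambda>x. \<gamma> h \<otimes> x \<otimes> \<gamma> (inv\<^bsub>G\<^esub> h)) ` L) KD"
  unfolding left_ideal_iff[OF DS]
proof (intro conjI ballI)
  let ?c = "\<lambda>x. \<gamma> h \<otimes> x \<otimes> \<gamma> (inv\<^bsub>G\<^esub> h)"
  have LD: "L \<subseteq> S D" "\<zero> \<in> L" "\<And>x y. x \<in> L \<Longrightarrow> y \<in> L \<Longrightarrow> x \<oplus> y \<in> L" "\<And>a x. a \<in> S D \<Longrightarrow> x \<in> L \<Longrightarrow> a \<otimes> x \<in> L"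
    using L left_ideal_iff[OF DS] by auto
  have LR: "L \<subseteq> carrier R" using LD(1) S_carrier by blast
  have cS: "?c x \<in> S D" if "x \<in> S D" for x
    using that h by (rule S_conj) (rule normal.inv_op_closed2[OF D h])
  show "?c ` L \<subseteq> S D" using LD(1) cS by blast
  show "\<zero> \<in> ?c ` L" using LD(2) h by (intro image_eqI[of _ _ \<zero>]) simp_all
  fix x assume "x \<in> ?c ` L"
  then obtain u where u: "u \<in> L" "x = ?c u" by blast
  { fix y assume "y \<in> ?c ` L"
    then obtain v where v: "v \<in> L" "y = ?c v" by blast
    have "u \<in> carrier R" "v \<in> carrier R" using u v LR by auto
    hence "x \<oplus> y = ?c (u \<oplus> v)" using u v h by (simp add: l_distr r_distr)
    thus "x \<oplus> y \<in> ?c ` L" using LD(3) u v by blast }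
next
  let ?c = "\<lambda>x. \<gamma> h \<otimes> x \<otimes> \<gamma> (inv\<^bsub>G\<^esub> h)"
  fix a x assume a: "a \<in> S D" and "x \<in> ?c ` L"
  then obtain u where u: "u \<in> L" "x = ?c u" by blast
  have LD: "L \<subseteq> S D" "\<And>a x. a \<in> S D \<Longrightarrow> x \<in> L \<Longrightarrow> a \<otimes> x \<in> L"
    using L left_ideal_iff[OF DS] by auto
  have R': "u \<in> carrier R" "a \<in> carrier R" using u LD(1) a S_closed by blast+
  define b where "b = \<gamma> (inv\<^bsub>G\<^esub> h) \<otimes> a \<otimes> \<gamma> h"
  have "b \<in> S D" using S_conj[OF a, of "inv\<^bsub>G\<^esub> h" D] h normal.inv_op_closed1[OF D h] by (simp add: b_def)
  moreover have "a \<otimes> x = ?c (b \<otimes> u)" using R' h u(2) by (simp add: b_def m_assoc)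
  ultimately show "a \<otimes> x \<in> ?c ` L" using LD(2) u(1) by blast
qed

lemma jacobson_S_D: "jacobson_radical KD \<subseteq> S D" by (auto simp: jacobson_radical_def)

lemma jacobson_left_ideal: "left_ideal (jacobson_radical KD) KD"
proof -
  have m: "left_ideal L KD" if "maximal_left_ideal L KD" for L using that by (simp add: maximal_left_ideal_def)
  show ?thesis unfolding left_ideal_iff[OF DS]
    using m[unfolded left_ideal_iff[OF DS]] S_zero[of D] S_add[of _ D] S_subgroup_mult[OF DS]
    by (auto simp: jacobson_radical_def)
qed

text \<open>Conjugation is an automorphism of the ring of \<open>D\<close>, so it permutes the maximal left ideals.\<close>

lemma jacobson_conj_invariant: "conj_invariant (jacobson_radical KD)"
  unfolding conj_invariant_def
proof (intro ballI)
  fix h x assume h: "h \<in> carrier G" and x: "x \<in> jacobson_radical KD"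
  define c where "c k = (\<lambda>x. \<gamma> k \<otimes> x \<otimes> \<gamma> (inv\<^bsub>G\<^esub> k))" for k
  have xS: "x \<in> S D" using x jacobson_S_D by blast
  have cS: "c k y \<in> S D" if "y \<in> S D" "k \<in> carrier G" for k y
    unfolding c_def using that by (rule S_conj) (rule normal.inv_op_closed2[OF D that(2)])
  have cc: "c (inv\<^bsub>G\<^esub> h) (c h y) = y" "c h (c (inv\<^bsub>G\<^esub> h) y) = y" if "y \<in> S D" for y
    using S_closed[OF that] h by (simp_all add: c_def m_assoc)
  have "c h x \<in> L" if L: "maximal_left_ideal L KD" for L
  proof -
    have lL: "left_ideal L KD" and neL: "L \<noteq> S D"
      and mx: "\<And>L'. left_ideal L' KD \<Longrightarrow> L \<subseteq> L' \<Longrightarrow> L' = L \<or> L' = S D"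
      using L by (auto simp: maximal_left_ideal_def)
    have LS: "L \<subseteq> S D" using lL left_ideal_iff[OF DS] by auto
    let ?L = "c (inv\<^bsub>G\<^esub> h) ` L"
    have bk: "c h ` c (inv\<^bsub>G\<^esub> h) ` Z = Z" if "Z \<subseteq> S D" for Z
      using cc(2) that by (force simp: image_iff subset_iff)
    have bk': "c (inv\<^bsub>G\<^esub> h) ` c h ` Z = Z" if "Z \<subseteq> S D" for Z
      using cc(1) that by (force simp: image_iff subset_iff)
    have cSD: "c h ` S D = S D" "c (inv\<^bsub>G\<^esub> h) ` S D = S D"
    proof -
      have 1: "c h ` S D \<subseteq> S D" "c (inv\<^bsub>G\<^esub> h) ` S D \<subseteq> S D" using cS h by auto
      show "c h ` S D = S D" using image_mono[OF 1(2), of "c h"] bk[of "S D"] 1 by auto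
      show "c (inv\<^bsub>G\<^esub> h) ` S D = S D" using image_mono[OF 1(1), of "c (inv\<^bsub>G\<^esub> h)"] bk'[of "S D"] 1 by auto
    qed
    have "maximal_left_ideal ?L KD"
      unfolding maximal_left_ideal_def
    proof (intro conjI allI impI)
      show "left_ideal ?L KD" unfolding c_def using conj_left_ideal[OF lL, of "inv\<^bsub>G\<^esub> h"] h by simp
      show "?L \<noteq> carrier KD"
      proof
        assume "?L = carrier KD"
        hence "c h ` ?L = c h ` S D" by simp
        thus False using bk[OF LS] cSD neL by simp
      qed
      fix L' assume L': "left_ideal L' KD \<and> ?L \<subseteq> L'"
      have L'S: "L' \<subseteq> S D" using L' left_ideal_iff[OF DS] by auto
      have "left_ideal (c h ` L') KD" unfolding c_def using conj_left_ideal[of L' h] L' h by simp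
      moreover have "L \<subseteq> c h ` L'" using L' bk[OF LS] by (metis image_mono)
      ultimately have "c h ` L' = L \<or> c h ` L' = S D" by (rule mx)
      thus "L' = ?L \<or> L' = carrier KD" using bk'[OF L'S] cSD by auto
    qed
    hence "x \<in> ?L" using x by (auto simp: jacobson_radical_def)
    then obtain y where "y \<in> L" "x = c (inv\<^bsub>G\<^esub> h) y" by blast
    thus "c h x \<in> L" using cc(2) LS by auto
  qed
  thus "\<gamma> h \<otimes> x \<otimes> \<gamma> (inv\<^bsub>G\<^esub> h) \<in> jacobson_radical KD"
    using cS[OF xS h] by (auto simp: jacobson_radical_def c_def)
qed

text \<open>
  Nakayama's lemma. Let \<open>K\<close> be maximal among the left ideals properly contained in the finite left ideal
  \<open>L\<close>. For \<open>x\<close> in \<open>L\<close> outside \<open>K\<close> the left ideal \<open>{a. a x \<in> K}\<close> is maximal, because \<open>L / K\<close> is simple. So it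
  contains the Jacobson radical, which therefore maps \<open>L\<close> into \<open>K\<close>.
\<close>

lemma nakayama:
  assumes L: "left_ideal L KD" and ne: "L \<noteq> {\<zero>}"
  shows "ideal_prod R (jacobson_radical KD) L \<noteq> L"
proof -
  have LD: "L \<subseteq> S D" "\<zero> \<in> L" "\<And>x y. x \<in> L \<Longrightarrow> y \<in> L \<Longrightarrow> x \<oplus> y \<in> L" "\<And>a x. a \<in> S D \<Longrightarrow> x \<in> L \<Longrightarrow> a \<otimes> x \<in> L"
    using L left_ideal_iff[OF DS] by auto
  have finL: "finite L" using LD(1) finite_S_D by (rule finite_subset)
  define \<K> where "\<K> = {K. left_ideal K KD \<and> K \<subset> L}"
  have "{\<zero>} \<in> \<K>" using ne LD(1,2) S_closed S_zero by (auto simp: \<K>_def left_ideal_iff[OF DS])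
  moreover have "finite \<K>" using finL by (auto simp: \<K>_def intro: finite_subset[of _ "Pow L"])
  ultimately obtain K where K: "K \<in> \<K>" and Kmax: "\<And>K'. K' \<in> \<K> \<Longrightarrow> K \<subseteq> K' \<Longrightarrow> K = K'"
    using finite_has_maximal2[of \<K> "{\<zero>}"] by auto
  have KD': "left_ideal K KD" "K \<subset> L" using K by (auto simp: \<K>_def)
  hence KK: "K \<subseteq> S D" "\<zero> \<in> K" "\<And>x y. x \<in> K \<Longrightarrow> y \<in> K \<Longrightarrow> x \<oplus> y \<in> K" "\<And>a x. a \<in> S D \<Longrightarrow> x \<in> K \<Longrightarrow> a \<otimes> x \<in> K"
    using left_ideal_iff[OF DS] by auto
  have jx: "j \<otimes> x \<in> K" if j: "j \<in> jacobson_radical KD" and x: "x \<in> L" for j x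
  proof (cases "x \<in> K")
    case True
    thus ?thesis using KK(4) j jacobson_S_D by blast
  next
    case False
    have xS: "x \<in> S D" using x LD(1) by blast
    have xR: "x \<in> carrier R" using xS S_closed by blast
    define A where "A = {a \<in> S D. a \<otimes> x \<in> K}"
    have A: "left_ideal A KD"
      unfolding left_ideal_iff[OF DS]
    proof (intro conjI ballI)
      show "A \<subseteq> S D" by (auto simp: A_def)
      show "\<zero> \<in> A" using S_zero KK(2) xR by (simp add: A_def)
      show "a \<oplus> b \<in> A" if "a \<in> A" "b \<in> A" for a b
        using that S_add KK(3) xR S_closed by (auto simp: A_def l_distr)
      show "a \<otimes> b \<in> A" if "a \<in> S D" "b \<in> A" for a b
        using that S_subgroup_mult[OF DS] KK(4) xR S_closed by (auto simp: A_def m_assoc)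
    qed
    have "maximal_left_ideal A KD"
      unfolding maximal_left_ideal_def
    proof (intro conjI allI impI)
      show "left_ideal A KD" by (rule A)
      have "\<one> \<notin> A" using False xR by (simp add: A_def)
      thus "A \<noteq> carrier KD" using one_S_D by auto
      fix L' assume L': "left_ideal L' KD \<and> A \<subseteq> L'"
      have LL: "L' \<subseteq> S D" "\<zero> \<in> L'" "\<And>x y. x \<in> L' \<Longrightarrow> y \<in> L' \<Longrightarrow> x \<oplus> y \<in> L'" "\<And>a x. a \<in> S D \<Longrightarrow> x \<in> L' \<Longrightarrow> a \<otimes> x \<in> L'"
        using L' left_ideal_iff[OF DS] by auto
      show "L' = A \<or> L' = carrier KD"
      proof (rule disjCI)
        assume "L' \<noteq> carrier KD"
        have "b \<in> A" if b: "b \<in> L'" for b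
        proof (rule ccontr)
          assume bA: "b \<notin> A"
          have bS: "b \<in> S D" using b LL(1) by blast
          hence bK: "b \<otimes> x \<notin> K" using bA by (simp add: A_def)
          define Z where "Z = {k \<oplus> a \<otimes> x | k a. k \<in> K \<and> a \<in> L'}"
          have KR: "K \<subseteq> carrier R" "L' \<subseteq> carrier R" using KK(1) LL(1) S_carrier by blast+
          have ZL: "Z \<subseteq> L" 
          proof
            fix z assume "z \<in> Z"
            then obtain k a where *: "k \<in> K" "a \<in> L'" "z = k \<oplus> a \<otimes> x" by (auto simp: Z_def)
            have "k \<in> L" "a \<otimes> x \<in> L" using * KD'(2) LL(1) LD(4) x by blast+
            thus "z \<in> L" using *(3) LD(3) by simp
          qed
          have Z: "left_ideal Z KD"
            unfolding left_ideal_iff[OF DS]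
          proof (intro conjI ballI)
            show "Z \<subseteq> S D" using ZL LD(1) by blast
            show "\<zero> \<in> Z" unfolding Z_def using KK(2) LL(2) xR by (intro CollectI exI[of _ \<zero>] conjI) simp_all
          next
            fix y z assume "y \<in> Z" "z \<in> Z"
            then obtain k a k' a' where *: "k \<in> K" "a \<in> L'" "k' \<in> K" "a' \<in> L'" "y = k \<oplus> a \<otimes> x" "z = k' \<oplus> a' \<otimes> x"
              by (auto simp: Z_def)
            have R': "k \<in> carrier R" "a \<in> carrier R" "k' \<in> carrier R" "a' \<in> carrier R" using * KR by auto
            have "y \<oplus> z = (k \<oplus> k') \<oplus> (a \<oplus> a') \<otimes> x" using R' xR * by (simp add: l_distr a_ac)
            thus "y \<oplus> z \<in> Z" unfolding Z_def using * KK(3) LL(3) by blast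
          next
            fix c y assume c: "c \<in> S D" and "y \<in> Z"
            then obtain k a where *: "k \<in> K" "a \<in> L'" "y = k \<oplus> a \<otimes> x" by (auto simp: Z_def)
            have R': "k \<in> carrier R" "a \<in> carrier R" "c \<in> carrier R" using * KR c S_closed by auto
            have "c \<otimes> y = c \<otimes> k \<oplus> (c \<otimes> a) \<otimes> x" using R' xR * by (simp add: r_distr m_assoc)
            thus "c \<otimes> y \<in> Z" unfolding Z_def using * KK(4) LL(4) c by blast
          qed
          have KZ: "K \<subseteq> Z"
          proof
            fix k assume k: "k \<in> K"
            have "k = k \<oplus> \<zero> \<otimes> x" using k KR xR by auto
            thus "k \<in> Z" unfolding Z_def using k LL(2) by blast
          qed
          have bZ: "b \<otimes> x \<in> Z"
          proof -
            have "b \<otimes> x = \<zero> \<oplus> b \<otimes> x" using bS S_closed xR by simp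
            thus ?thesis unfolding Z_def using KK(2) b by blast
          qed
          have "Z = L"
          proof (rule ccontr)
            assume "Z \<noteq> L"
            hence "Z \<in> \<K>" using Z ZL by (auto simp: \<K>_def)
            hence "K = Z" using Kmax KZ by blast
            thus False using bZ bK by simp
          qed
          then obtain k a where ka: "k \<in> K" "a \<in> L'" "x = k \<oplus> a \<otimes> x" using x by (auto simp: Z_def)
          have R': "k \<in> carrier R" "a \<in> carrier R" using ka KR by auto
          have "(\<one> \<ominus> a) \<otimes> x = x \<ominus> a \<otimes> x" using R' xR by (simp add: a_minus_def l_distr l_minus)
          also have "\<dots> = (k \<oplus> a \<otimes> x) \<ominus> a \<otimes> x" using ka(3) by simp
          also have "\<dots> = k" using R' xR by (simp add: a_minus_def a_assoc r_neg)
          finally have "(\<one> \<ominus> a) \<otimes> x \<in> K" using ka(1) by simp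
          moreover have "\<one> \<ominus> a \<in> S D" using one_S_D ka(2) LL(1) by (intro S_minus) auto
          ultimately have "\<one> \<ominus> a \<in> L'" using L' by (auto simp: A_def)
          hence "(\<one> \<ominus> a) \<oplus> a \<in> L'" using LL(3) ka(2) by blast
          moreover have "(\<one> \<ominus> a) \<oplus> a = \<one>" using R' by (simp add: a_minus_def a_assoc l_neg)
          ultimately have "\<one> \<in> L'" by simp
          hence "S D \<subseteq> L'" using LL(4) S_closed by (metis r_one subsetI)
          thus False using LL(1) \<open>L' \<noteq> carrier KD\<close> by simp
        qed
        thus "L' = A" using L' by blast
      qed
    qed
    hence "j \<in> A" using j by (auto simp: jacobson_radical_def)
    thus ?thesis by (simp add: A_def)
  qed
  have "z \<in> K" if "z \<in> ideal_prod R (jacobson_radical KD) L" for z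
    using that by (induction rule: ideal_prod.induct) (use jx KK(3) in auto)
  thus ?thesis using KD'(2) by blast
qed

text \<open>Let \<open>j\<close> be the radical. Suppose that \<open>j R\<close> is not in \<open>M\<close>, and let \<open>L\<close> be minimal among the
  conjugation-invariant left ideals of the ring of \<open>D\<close> with \<open>L R\<close> not in \<open>M\<close>. By Nakayama's lemma \<open>j L\<close> is
  smaller, so \<open>j R L R = j L R \<subseteq> M\<close>, against primeness.\<close>

lemma jacobson_ideal_in_prime:
  assumes M: "prime_ideal M R"
  shows "ideal_prod R (jacobson_radical KD) (carrier R) \<subseteq> M"
proof (rule ccontr)
  let ?j = "jacobson_radical KD"
  assume nM: "\<not> ideal_prod R ?j (carrier R) \<subseteq> M"
  have MI: "ideal M R" and MR: "M \<noteq> carrier R"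
    and pr: "\<And>A B. ideal A R \<Longrightarrow> ideal B R \<Longrightarrow> ideal_prod R A B \<subseteq> M \<Longrightarrow> A \<subseteq> M \<or> B \<subseteq> M"
    using M by (auto simp: prime_ideal_def)
  interpret M: ideal M R by (rule MI)
  define \<L> where "\<L> = {L. left_ideal L KD \<and> conj_invariant L \<and> \<not> ideal_prod R L (carrier R) \<subseteq> M}"
  have "S D \<in> \<L>"
  proof -
    have "\<gamma> h \<otimes> x \<otimes> \<gamma> (inv\<^bsub>G\<^esub> h) \<in> S D" if "h \<in> carrier G" "x \<in> S D" for h x
      using that(2,1) by (rule S_conj) (rule normal.inv_op_closed2[OF D that(1)])
    moreover have "\<one> \<in> ideal_prod R (S D) (carrier R)"
      using ip_prod[OF one_S_D one_closed] by simp
    moreover have "\<one> \<notin> M" using MR M.one_imp_carrier by blast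
    moreover have "left_ideal (S D) KD"
      using S_zero S_add S_subgroup_mult[OF DS] by (simp add: left_ideal_iff[OF DS])
    ultimately show ?thesis by (auto simp: \<L>_def conj_invariant_def)
  qed
  moreover have fin: "finite \<L>"
    using finite_S_D by (auto simp: \<L>_def left_ideal_iff[OF DS] intro: finite_subset[of _ "Pow (S D)"])
  ultimately obtain L where L: "L \<in> \<L>" and Lmin: "\<And>L'. L' \<in> \<L> \<Longrightarrow> L' \<subseteq> L \<Longrightarrow> L = L'"
    using finite_has_minimal2[of \<L> "S D"] by auto
  have lL: "left_ideal L KD" and iL: "conj_invariant L" and nL: "\<not> ideal_prod R L (carrier R) \<subseteq> M"
    using L by (auto simp: \<L>_def)
  have LD: "L \<subseteq> S D" "\<zero> \<in> L" "\<And>x y. x \<in> L \<Longrightarrow> y \<in> L \<Longrightarrow> x \<oplus> y \<in> L" "\<And>a x. a \<in> S D \<Longrightarrow> x \<in> L \<Longrightarrow> a \<otimes> x \<in> L"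
    using lL left_ideal_iff[OF DS] by auto
  have LR: "L \<subseteq> carrier R" using LD(1) S_carrier by blast
  have jR: "?j \<subseteq> carrier R" using jacobson_S_D S_carrier by blast
  define L' where "L' = ideal_prod R ?j L"
  have L'L: "L' \<subseteq> L"
  proof
    fix z assume "z \<in> L'"
    thus "z \<in> L" unfolding L'_def
      by (induction rule: ideal_prod.induct) (use LD jacobson_S_D in auto)
  qed
  have jl: "left_ideal ?j KD" by (rule jacobson_left_ideal)
  hence j0: "\<zero> \<in> ?j" and jm: "\<And>a x. a \<in> S D \<Longrightarrow> x \<in> ?j \<Longrightarrow> a \<otimes> x \<in> ?j" using left_ideal_iff[OF DS] by auto
  have L'R: "L' \<subseteq> carrier R" using L'L LR by blast
  have lL': "left_ideal L' KD"
    unfolding left_ideal_iff[OF DS]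
  proof (intro conjI ballI)
    show "L' \<subseteq> S D" using L'L LD(1) by blast
    show "\<zero> \<in> L'" unfolding L'_def using ip_prod[OF j0 LD(2)] by simp
    show "x \<oplus> y \<in> L'" if "x \<in> L'" "y \<in> L'" for x y using that ip_sum unfolding L'_def by metis
    show "a \<otimes> x \<in> L'" if a: "a \<in> S D" and x: "x \<in> L'" for a x
      using x unfolding L'_def
    proof (induction rule: ideal_prod.induct)
      case (prod j l)
      have "a \<otimes> (j \<otimes> l) = (a \<otimes> j) \<otimes> l" using prod jR LR S_closed[OF a] by (auto intro: m_assoc[symmetric])
      thus ?case using ip_prod[OF jm[OF a prod(1)] prod(2)] by simp
    next
      case (sum x y)
      have "x \<in> carrier R" "y \<in> carrier R" using sum(1,2) L'R unfolding L'_def by auto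
      thus ?case using sum ip_sum S_closed[OF a] by (simp add: r_distr)
    qed
  qed
  have iL': "conj_invariant L'"
    unfolding conj_invariant_def
  proof (intro ballI)
    fix h x assume h: "h \<in> carrier G" and x: "x \<in> L'"
    show "\<gamma> h \<otimes> x \<otimes> \<gamma> (inv\<^bsub>G\<^esub> h) \<in> L'" using x unfolding L'_def
    proof (induction rule: ideal_prod.induct)
      case (prod j l)
      have R': "j \<in> carrier R" "l \<in> carrier R" using prod jR LR by auto
      have "\<gamma> h \<otimes> (j \<otimes> l) \<otimes> \<gamma> (inv\<^bsub>G\<^esub> h) = (\<gamma> h \<otimes> j \<otimes> \<gamma> (inv\<^bsub>G\<^esub> h)) \<otimes> (\<gamma> h \<otimes> l \<otimes> \<gamma> (inv\<^bsub>G\<^esub> h))"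
        using R' h by (simp add: m_assoc)
      moreover have "\<gamma> h \<otimes> j \<otimes> \<gamma> (inv\<^bsub>G\<^esub> h) \<in> ?j" "\<gamma> h \<otimes> l \<otimes> \<gamma> (inv\<^bsub>G\<^esub> h) \<in> L"
        using jacobson_conj_invariant iL h prod by (auto simp: conj_invariant_def)
      ultimately show ?case using ip_prod[of _ ?j _ L] by simp
    next
      case (sum x y)
      have "x \<in> carrier R" "y \<in> carrier R" using sum(1,2) L'R unfolding L'_def by auto
      thus ?case using sum ip_sum h by (simp add: l_distr r_distr)
    qed
  qed
  have "L \<noteq> {\<zero>}"
  proof
    assume L0: "L = {\<zero>}"
    have "z \<in> M" if "z \<in> ideal_prod R L (carrier R)" for z
      using that by (induction rule: ideal_prod.induct) (auto simp: L0 M.zero_closed M.a_closed)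
    thus False using nL by blast
  qed
  hence "L' \<noteq> L" using nakayama[OF lL] by (simp add: L'_def)
  hence "L' \<notin> \<L>" using Lmin L'L by blast
  hence L'M: "ideal_prod R L' (carrier R) \<subseteq> M" using lL' iL' by (auto simp: \<L>_def)
  have IL': "ideal (ideal_prod R L' (carrier R)) R" by (rule ideal_prod_ideal[OF lL' iL'])
  have Ij: "ideal (ideal_prod R ?j (carrier R)) R" by (rule ideal_prod_ideal[OF jl jacobson_conj_invariant])
  have IL: "ideal (ideal_prod R L (carrier R)) R" by (rule ideal_prod_ideal[OF lL iL])
  have jz: "j \<otimes> z \<in> ideal_prod R L' (carrier R)" if j: "j \<in> ?j" and z: "z \<in> ideal_prod R L (carrier R)" for j z
    using z
  proof (induction rule: ideal_prod.induct)
    case (prod l b)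
    have "j \<otimes> (l \<otimes> b) = (j \<otimes> l) \<otimes> b" using prod j jR LR by (auto intro: m_assoc[symmetric])
    moreover have "j \<otimes> l \<in> L'" unfolding L'_def using ip_prod[OF j prod(1)] .
    ultimately show ?case using ip_prod[of "j \<otimes> l" L' b "carrier R"] prod(2) by simp
  next
    case (sum x y)
    have "x \<in> carrier R" "y \<in> carrier R" using sum(1,2) ideal.Icarr[OF IL] by auto
    thus ?case using sum ip_sum j jR by (auto simp: r_distr)
  qed
  have "ideal_prod R (ideal_prod R ?j (carrier R)) (ideal_prod R L (carrier R)) \<subseteq> M"
  proof
    fix z assume "z \<in> ideal_prod R (ideal_prod R ?j (carrier R)) (ideal_prod R L (carrier R))"
    thus "z \<in> M"
    proof (induction rule: ideal_prod.induct)
      case (prod u v)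
      have vR: "v \<in> carrier R" using prod(2) ideal.Icarr[OF IL] by auto
      show ?case using prod(1)
      proof (induction rule: ideal_prod.induct)
        case (prod j a)
        have "j \<otimes> a \<otimes> v = j \<otimes> (a \<otimes> v)" using prod jR vR by (auto intro: m_assoc)
        moreover have "a \<otimes> v \<in> ideal_prod R L (carrier R)"
          using ideal.I_l_closed[OF IL \<open>v \<in> ideal_prod R L (carrier R)\<close> prod(2)] .
        ultimately show ?case using jz[OF prod(1)] L'M by auto
      next
        case (sum x y)
        have "x \<in> carrier R" "y \<in> carrier R" using sum(1,2) ideal.Icarr[OF Ij] by auto
        thus ?case using sum vR M.a_closed by (simp add: l_distr)
      qed
    qed (rule M.a_closed)
  qed
  hence "ideal_prod R ?j (carrier R) \<subseteq> M \<or> ideal_prod R L (carrier R) \<subseteq> M" by (rule pr[OF Ij IL])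
  thus False using nM nL by blast
qed

end

section \<open>The correspondence of ideals\<close>

lemma support_ring_quotient:
  assumes "support_ring A G \<gamma> S opn" and J: "ideal J A"
  shows "support_ring (A Quot J) G (\<lambda>h. J +>\<^bsub>A\<^esub> \<gamma> h) (\<lambda>X. (\<lambda>x. J +>\<^bsub>A\<^esub> x) ` S X) opn"
proof -
  interpret A: support_ring A G \<gamma> S opn by fact
  interpret J: ideal J A by fact
  let ?b = "\<lambda>x. J +>\<^bsub>A\<^esub> x"
  have hom: "?b \<in> ring_hom A (A Quot J)" by (rule J.rcos_ring_hom)
  interpret h: ring_hom_ring A "A Quot J" ?b by (rule J.rcos_ring_hom_ring)
  interpret Q: ring "A Quot J" by (rule J.quotient_is_ring)
  have zero: "\<zero>\<^bsub>A Quot J\<^esub> = ?b \<zero>\<^bsub>A\<^esub>" by simp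
  show ?thesis
  proof (intro support_ring.intro support_ring_axioms.intro J.quotient_is_ring A.G.group_axioms, goal_cases)
    case (1 X)
    thus ?case using A.S_closed by auto
  next
    case 2
    have "carrier (A Quot J) = (\<Union>a\<in>carrier A. {?b a})" by (simp only: FactRing_def partial_object.simps A_RCOSETS_def')
    thus ?case unfolding A.S_top by blast
  next
    case 3
    thus ?case by (simp add: A.S_empty)
  next
    case (4 x X y)
    then obtain u v where u: "u \<in> S X" "x = ?b u" and v: "v \<in> S X" "y = ?b v" by blast
    have "x \<oplus>\<^bsub>A Quot J\<^esub> y = ?b (u \<oplus>\<^bsub>A\<^esub> v)" using u v A.S_closed by simp
    thus ?case using A.S_add u v by blast
  next
    case (5 x X)
    then obtain u where u: "u \<in> S X" "x = ?b u" by blast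
    have "\<ominus>\<^bsub>A Quot J\<^esub> x = ?b (\<ominus>\<^bsub>A\<^esub> u)" using u A.S_closed by simp
    thus ?case using A.S_neg u by blast
  next
    case (6 X Y)
    thus ?case using A.S_mono by blast
  next
    case (7 x X y Y Z)
    then obtain u v where u: "u \<in> S X" "x = ?b u" and v: "v \<in> S Y" "y = ?b v" by blast
    have "x \<otimes>\<^bsub>A Quot J\<^esub> y = ?b (u \<otimes>\<^bsub>A\<^esub> v)" using u v A.S_closed by simp
    moreover have "u \<otimes>\<^bsub>A\<^esub> v \<in> S Z" using A.S_mult[OF u(1) v(1)] 7(3) by blast
    ultimately show ?case by blast
  next
    case (8 x X y Y)
    then obtain u v where u: "u \<in> S X" "x = ?b u" and v: "v \<in> S Y" "y = ?b v" by blast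
    have "u \<otimes>\<^bsub>A\<^esub> v = v \<otimes>\<^bsub>A\<^esub> u" using A.S_commute[OF u(1) v(1)] 8(3) by blast
    moreover have "x \<otimes>\<^bsub>A Quot J\<^esub> y = ?b (u \<otimes>\<^bsub>A\<^esub> v)" "y \<otimes>\<^bsub>A Quot J\<^esub> x = ?b (v \<otimes>\<^bsub>A\<^esub> u)"
      using u v A.S_closed by simp_all
    ultimately show ?case by simp
  next
    case (9 g)
    thus ?case using A.\<gamma>_S by blast
  next
    case 10
    show ?case by (simp add: A.\<gamma>_one)
  next
    case (11 g h)
    thus ?case by (simp add: A.\<gamma>_mult)
  next
    case (12 K)
    thus ?case by (rule A.opn_subgroup)
  next
    case (13 K)
    thus ?case by (rule A.opn_finite)
  next
    case (14 K L)
    thus ?case by (rule A.opn_mono)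
  next
    case (15 K x X)
    then obtain u where u: "u \<in> S X" "x = ?b u" by blast
    obtain f where f: "\<forall>Y\<in>rcosets\<^bsub>G\<^esub> K. f Y \<in> S (X \<inter> Y)" "u = (\<Oplus>\<^bsub>A\<^esub>Y\<in>rcosets\<^bsub>G\<^esub> K. f Y)"
      using A.S_split[OF 15(1) u(1)] by blast
    have "x = (\<Oplus>\<^bsub>A Quot J\<^esub>Y\<in>rcosets\<^bsub>G\<^esub> K. ?b (f Y))"
      unfolding u(2) f(2) using f(1) A.S_closed by (subst h.hom_finsum) (auto simp: o_def)
    thus ?case using f(1) by (intro exI[of _ "\<lambda>Y. ?b (f Y)"]) auto
  qed
qed

text \<open>
  In the application \<open>A\<close> is \<open>kG\<close> and \<open>j\<close> is the Jacobson radical of \<open>k\<Delta>\<^sup>+\<close>. In \<open>A\<close> itself, as opposed to its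
  quotient, the supports on a subgroup and on its complement are independent.
\<close>

locale matrix_correspondence = support_ring A G \<gamma> S opn + J: ideal J A
  for A :: "('a, 'b) ring_scheme" (structure) and G :: "('g, 'm) monoid_scheme" and \<gamma> S opn and J +
  fixes D C :: "'g set" and e :: "'a set" and r :: nat and es :: "nat \<Rightarrow> 'a set" and g :: "nat \<Rightarrow> 'g"
    and j :: "'a set"
  assumes orbit: "conj_orbit (A Quot J) G (\<lambda>h. J +> \<gamma> h) (\<lambda>X. (\<lambda>x. J +> x) ` S X) opn D C e r es g"
    and J_eq: "J = ideal_prod A j (carrier A)" and j: "j \<subseteq> S D"
    and S_disjoint: "opn K \<Longrightarrow> x \<in> S K \<Longrightarrow> x \<in> S (carrier G - K) \<Longrightarrow> x = \<zero>"
begin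

abbreviation Rb :: "'a set ring" where "Rb \<equiv> A Quot J"
abbreviation bar :: "'a \<Rightarrow> 'a set" where "bar x \<equiv> J +> x"

sublocale B: conj_orbit "A Quot J" G "\<lambda>h. J +> \<gamma> h" "\<lambda>X. (\<lambda>x. J +> x) ` S X" opn D C e r es g
  by (rule orbit)

sublocale bar: ring_hom_ring A "A Quot J" "\<lambda>x. J +> x"
  by (rule J.rcos_ring_hom_ring)

abbreviation stab :: "'g set" where "stab \<equiv> B.stab"
abbreviation A1 :: "('a, 'b) ring_scheme" where "A1 \<equiv> A\<lparr>carrier := S stab\<rparr>"

lemma A1_ring: "ring A1" by (rule S_ring[OF B.stab_subgroup])

lemma bar_eq_iff: "x \<in> carrier A \<Longrightarrow> y \<in> carrier A \<Longrightarrow> bar x = bar y \<longleftrightarrow> x \<ominus> y \<in> J"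
  using quotient_eq_iff_same_a_r_cos[OF J.ideal_axioms] by blast

lemma bar_zero_iff: assumes "x \<in> carrier A" shows "bar x = \<zero>\<^bsub>Rb\<^esub> \<longleftrightarrow> x \<in> J"
  using bar_eq_iff[OF assms zero_closed] assms by (simp add: a_minus_def)

lemma bar_surj: assumes "b \<in> carrier Rb" obtains x where "x \<in> carrier A" "b = bar x"
proof -
  have "carrier Rb = a_rcosets\<^bsub>A\<^esub> J" unfolding FactRing_def by (rule partial_object.select_convs)
  hence "b \<in> (\<Union>a\<in>carrier A. {bar a})" using assms unfolding A_RCOSETS_def' by (rule subst)
  thus ?thesis by (elim UN_E) (rule that, assumption, erule singletonD)
qed

lemma e_lift: obtains a where "a \<in> S D" "e = bar a"
  by (rule imageE[OF B.e_in]) (rule that)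

lemma f_lift: obtains a where "a \<in> S D" "B.f = bar a"
  by (rule imageE[OF B.f_in]) (rule that)

lemma e_bar: "y \<in> S stab \<Longrightarrow> e \<otimes>\<^bsub>Rb\<^esub> bar y = bar y \<otimes>\<^bsub>Rb\<^esub> e"
  by (rule B.e_commute[OF B.stab_subgroup subset_refl]) blast

lemma corner_bar:
  assumes x: "x \<in> carrier Rb"
  obtains y where "y \<in> S stab" "e \<otimes>\<^bsub>Rb\<^esub> x \<otimes>\<^bsub>Rb\<^esub> e = e \<otimes>\<^bsub>Rb\<^esub> bar y"
proof -
  have "x \<in> bar ` S (carrier G)" using x B.S_top by simp
  from B.corner_S[OF G.subgroup_self this] obtain s where
    "s \<in> bar ` S (carrier G \<inter> stab)" "e \<otimes>\<^bsub>Rb\<^esub> x \<otimes>\<^bsub>Rb\<^esub> e = e \<otimes>\<^bsub>Rb\<^esub> s" by blast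
  moreover have "carrier G \<inter> stab = stab" using B.stabG by blast
  ultimately show ?thesis using that by auto
qed

text \<open>The entry in position \<open>(i, k)\<close> of the matrix of \<open>x\<close>, represented by an element supported on \<open>stab\<close>.\<close>

lemma corner_entry:
  assumes x: "x \<in> carrier Rb" and i: "i \<in> {1..r}" and k: "k \<in> {1..r}"
  obtains y where "y \<in> S stab"
    "e \<otimes>\<^bsub>Rb\<^esub> bar y = e \<otimes>\<^bsub>Rb\<^esub> (bar (\<gamma> (inv\<^bsub>G\<^esub> (g i))) \<otimes>\<^bsub>Rb\<^esub> x \<otimes>\<^bsub>Rb\<^esub> bar (\<gamma> (g k))) \<otimes>\<^bsub>Rb\<^esub> e"
    "es i \<otimes>\<^bsub>Rb\<^esub> x \<otimes>\<^bsub>Rb\<^esub> es k = bar (\<gamma> (g i)) \<otimes>\<^bsub>Rb\<^esub> (e \<otimes>\<^bsub>Rb\<^esub> bar y) \<otimes>\<^bsub>Rb\<^esub> bar (\<gamma> (inv\<^bsub>G\<^esub> (g k)))"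
proof -
  have G': "g i \<in> carrier G" "g k \<in> carrier G" using B.gG i k by auto
  let ?x = "bar (\<gamma> (inv\<^bsub>G\<^esub> (g i))) \<otimes>\<^bsub>Rb\<^esub> x \<otimes>\<^bsub>Rb\<^esub> bar (\<gamma> (g k))"
  have "?x \<in> carrier Rb" using G' x by simp
  then obtain y where y: "y \<in> S stab" "e \<otimes>\<^bsub>Rb\<^esub> ?x \<otimes>\<^bsub>Rb\<^esub> e = e \<otimes>\<^bsub>Rb\<^esub> bar y" by (rule corner_bar)
  have "es i \<otimes>\<^bsub>Rb\<^esub> x \<otimes>\<^bsub>Rb\<^esub> es k = bar (\<gamma> (g i)) \<otimes>\<^bsub>Rb\<^esub> (e \<otimes>\<^bsub>Rb\<^esub> ?x \<otimes>\<^bsub>Rb\<^esub> e) \<otimes>\<^bsub>Rb\<^esub> bar (\<gamma> (inv\<^bsub>G\<^esub> (g k)))"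
    using G' x B.es_g[OF i] B.es_g[OF k] by (simp add: B.cj_def B.m_assoc)
  thus ?thesis using that[OF y(1)] y(2) by simp
qed

end

text \<open>
  The ideal \<open>Q\<close> is the corner of \<open>P\<close>. The condition that \<open>1 - f\<close> is in the image of \<open>P\<close> makes the passage
  to the corner lossless.
\<close>

locale ideal_correspondence = matrix_correspondence + P: ideal P A for P +
  fixes Q :: "'a set"
  assumes JP: "J \<subseteq> P" and fP: "\<one>\<^bsub>Rb\<^esub> \<ominus>\<^bsub>Rb\<^esub> B.f \<in> bar ` P"
    and Q_iff: "y \<in> Q \<longleftrightarrow> y \<in> S stab \<and> e \<otimes>\<^bsub>Rb\<^esub> bar y \<in> bar ` P"
    and Q_ideal: "ideal Q A1"
begin

abbreviation Pb :: "'a set set" where "Pb \<equiv> bar ` P"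

lemma P_carrier: "x \<in> P \<Longrightarrow> x \<in> carrier A" by (rule P.Icarr)

lemma bar_in_Pb: assumes x: "x \<in> carrier A" shows "bar x \<in> Pb \<longleftrightarrow> x \<in> P"
proof
  assume "bar x \<in> Pb"
  then obtain p where p: "p \<in> P" "bar x = bar p" by blast
  have pA: "p \<in> carrier A" using p(1) P_carrier by blast
  have "x \<ominus> p \<in> P" using bar_eq_iff[OF x pA] p JP by blast
  hence "(x \<ominus> p) \<oplus> p \<in> P" using p(1) by (rule P.a_closed)
  moreover have "(x \<ominus> p) \<oplus> p = x" using x pA by (simp add: a_minus_def a_assoc l_neg)
  ultimately show "x \<in> P" by simp
qed blast

lemma Pb_zero: "\<zero>\<^bsub>Rb\<^esub> \<in> Pb"
  using bar_in_Pb[OF zero_closed] additive_subgroup.zero_closed[OF P.is_additive_subgroup] by simp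

lemma Pb_add: assumes "u \<in> Pb" "v \<in> Pb" shows "u \<oplus>\<^bsub>Rb\<^esub> v \<in> Pb"
proof -
  obtain x y where xy: "x \<in> P" "y \<in> P" "u = bar x" "v = bar y" using assms by blast
  have "u \<oplus>\<^bsub>Rb\<^esub> v = bar (x \<oplus> y)" using xy P_carrier by simp
  thus ?thesis using P.a_closed[OF xy(1,2)] by blast
qed

lemma Pb_l: assumes "u \<in> Pb" "b \<in> carrier Rb" shows "b \<otimes>\<^bsub>Rb\<^esub> u \<in> Pb"
proof -
  obtain x where x: "x \<in> P" "u = bar x" using assms by blast
  obtain y where y: "y \<in> carrier A" "b = bar y" using assms(2) by (rule bar_surj)
  have "b \<otimes>\<^bsub>Rb\<^esub> u = bar (y \<otimes> x)" using x y P_carrier by simp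
  thus ?thesis using P.I_l_closed[OF x(1) y(1)] by blast
qed

lemma Pb_r: assumes "u \<in> Pb" "b \<in> carrier Rb" shows "u \<otimes>\<^bsub>Rb\<^esub> b \<in> Pb"
proof -
  obtain x where x: "x \<in> P" "u = bar x" using assms by blast
  obtain y where y: "y \<in> carrier A" "b = bar y" using assms(2) by (rule bar_surj)
  have "u \<otimes>\<^bsub>Rb\<^esub> b = bar (x \<otimes> y)" using x y P_carrier by simp
  thus ?thesis using P.I_r_closed[OF x(1) y(1)] by blast
qed

lemma Pb_peirce:
  assumes x: "x \<in> carrier Rb" and c: "\<And>i k. i \<in> {1..r} \<Longrightarrow> k \<in> {1..r} \<Longrightarrow> es i \<otimes>\<^bsub>Rb\<^esub> x \<otimes>\<^bsub>Rb\<^esub> es k \<in> Pb"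
  shows "x \<in> Pb"
  by (rule B.peirce[where P = "\<lambda>x. x \<in> Pb", OF x Pb_zero Pb_add Pb_r[OF fP x] c])

lemma QS: "Q \<subseteq> S stab" using Q_iff by blast

lemma one_in_Q_iff: "\<one> \<in> Q \<longleftrightarrow> P = carrier A"
proof
  assume "\<one> \<in> Q"
  hence e: "e \<in> Pb" using Q_iff by simp
  have "es i \<otimes>\<^bsub>Rb\<^esub> \<one>\<^bsub>Rb\<^esub> \<otimes>\<^bsub>Rb\<^esub> es k \<in> Pb" if i: "i \<in> {1..r}" and k: "k \<in> {1..r}" for i k
  proof -
    have gi: "g i \<in> carrier G" using B.gG i by auto
    have "es i = bar (\<gamma> (g i)) \<otimes>\<^bsub>Rb\<^esub> e \<otimes>\<^bsub>Rb\<^esub> bar (\<gamma> (inv\<^bsub>G\<^esub> (g i)))" using B.es_g[OF i] by (simp add: B.cj_def)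
    also have "\<dots> \<in> Pb" by (rule Pb_r[OF Pb_l[OF e]]) (use gi in auto)
    finally show ?thesis by (rule Pb_r[OF Pb_r]) (use k in auto)
  qed
  hence "\<one>\<^bsub>Rb\<^esub> \<in> Pb" by (rule Pb_peirce[OF B.one_closed])
  hence "\<one> \<in> P" using bar_in_Pb[OF one_closed] by simp
  thus "P = carrier A" by (rule P.one_imp_carrier)
next
  assume "P = carrier A"
  moreover obtain a0 where "a0 \<in> S D" "e = bar a0" by (rule e_lift)
  ultimately have "e \<in> Pb" using S_closed by blast
  thus "\<one> \<in> Q" using Q_iff one_in_S[OF subgroup.one_closed[OF B.stab_subgroup]] by simp
qed

lemma Q_eq_iff: "Q = S stab \<longleftrightarrow> P = carrier A"
proof -
  have "Q = S stab \<longleftrightarrow> \<one> \<in> Q"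
    using ideal.one_imp_carrier[OF Q_ideal] one_in_S[OF subgroup.one_closed[OF B.stab_subgroup]] by auto
  thus ?thesis using one_in_Q_iff by simp
qed

text \<open>
  From \<open>P\<close> to \<open>Q\<close>: apply primeness of \<open>P\<close> to lifts of \<open>e a\<close> and \<open>e b\<close>, using that \<open>e x e\<close> is in \<open>e \<cdot> kG\<^sub>1\<close>.
  From \<open>Q\<close> to \<open>P\<close>: elements outside \<open>P\<close> have Peirce components outside \<open>P\<close>, and their matrix entries \<open>y\<close>
  and \<open>z\<close> are outside \<open>Q\<close>.
\<close>

theorem prime_iff: "prime_ideal P A \<longleftrightarrow> prime_ideal Q A1"
proof -
  interpret A1: ring A1 by (rule A1_ring)
  obtain a0 where a0: "a0 \<in> S D" "e = bar a0" by (rule e_lift)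
  have a0A: "a0 \<in> carrier A" using a0 S_closed by blast
  show ?thesis unfolding prime_ideal_iff A1.prime_ideal_iff
  proof (intro iffI conjI ballI impI; (elim conjE)?)
    show "ideal Q A1" by (rule Q_ideal)
    show "ideal P A" by (rule P.ideal_axioms)
    show "Q \<noteq> carrier A1" if "P \<noteq> carrier A" using that Q_eq_iff by simp
    show "P \<noteq> carrier A" if "Q \<noteq> carrier A1" using that Q_eq_iff by simp
    fix a b
    assume pr: "\<forall>a\<in>carrier A. \<forall>b\<in>carrier A. (\<forall>x\<in>carrier A. a \<otimes> x \<otimes> b \<in> P) \<longrightarrow> a \<in> P \<or> b \<in> P"
      and a: "a \<in> carrier A1" and b: "b \<in> carrier A1" and ab: "\<forall>x\<in>carrier A1. a \<otimes>\<^bsub>A1\<^esub> x \<otimes>\<^bsub>A1\<^esub> b \<in> Q"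
    have aS: "a \<in> S stab" "b \<in> S stab" using a b by auto
    have aA: "a \<in> carrier A" "b \<in> carrier A" using aS S_closed by auto
    have "(a0 \<otimes> a) \<otimes> x \<otimes> (a0 \<otimes> b) \<in> P" if x: "x \<in> carrier A" for x
    proof -
      have "bar x \<in> carrier Rb" using x by simp
      then obtain y where y: "y \<in> S stab" "e \<otimes>\<^bsub>Rb\<^esub> bar x \<otimes>\<^bsub>Rb\<^esub> e = e \<otimes>\<^bsub>Rb\<^esub> bar y" by (rule corner_bar)
      have yA: "y \<in> carrier A" using y(1) S_closed by blast
      have "bar ((a0 \<otimes> a) \<otimes> x \<otimes> (a0 \<otimes> b)) = (e \<otimes>\<^bsub>Rb\<^esub> bar a) \<otimes>\<^bsub>Rb\<^esub> bar x \<otimes>\<^bsub>Rb\<^esub> (e \<otimes>\<^bsub>Rb\<^esub> bar b)"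
        using a0A aA x a0(2) by simp
      also have "\<dots> = bar a \<otimes>\<^bsub>Rb\<^esub> (e \<otimes>\<^bsub>Rb\<^esub> bar x \<otimes>\<^bsub>Rb\<^esub> e) \<otimes>\<^bsub>Rb\<^esub> bar b"
        unfolding e_bar[OF aS(1)] using aA x by (simp add: B.m_assoc)
      also have "\<dots> = (bar a \<otimes>\<^bsub>Rb\<^esub> e) \<otimes>\<^bsub>Rb\<^esub> bar y \<otimes>\<^bsub>Rb\<^esub> bar b"
        unfolding y(2) using aA yA by (simp add: B.m_assoc)
      also have "\<dots> = e \<otimes>\<^bsub>Rb\<^esub> bar (a \<otimes> y \<otimes> b)"
        unfolding e_bar[OF aS(1), symmetric] using aA yA by (simp add: B.m_assoc)
      also have "\<dots> \<in> Pb" using ab y(1) Q_iff by simp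
      finally show ?thesis by (rule bar_in_Pb[THEN iffD1, rotated]) (use a0A aA x in simp)
    qed
    hence "a0 \<otimes> a \<in> P \<or> a0 \<otimes> b \<in> P" using pr a0A aA by simp
    hence "e \<otimes>\<^bsub>Rb\<^esub> bar a \<in> Pb \<or> e \<otimes>\<^bsub>Rb\<^esub> bar b \<in> Pb"
      using bar_in_Pb[of "a0 \<otimes> a"] bar_in_Pb[of "a0 \<otimes> b"] a0A aA a0(2) by auto
    thus "a \<in> Q \<or> b \<in> Q" using Q_iff aS by blast
  next
    fix a b
    assume pr: "\<forall>a\<in>carrier A1. \<forall>b\<in>carrier A1. (\<forall>x\<in>carrier A1. a \<otimes>\<^bsub>A1\<^esub> x \<otimes>\<^bsub>A1\<^esub> b \<in> Q) \<longrightarrow> a \<in> Q \<or> b \<in> Q"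
      and a: "a \<in> carrier A" and b: "b \<in> carrier A" and ab: "\<forall>x\<in>carrier A. a \<otimes> x \<otimes> b \<in> P"
    show "a \<in> P \<or> b \<in> P"
    proof (rule ccontr)
      assume "\<not> (a \<in> P \<or> b \<in> P)"
      hence nP: "bar a \<notin> Pb" "bar b \<notin> Pb" using bar_in_Pb a b by auto
      have bc: "bar a \<in> carrier Rb" "bar b \<in> carrier Rb" using a b by auto
      have "\<exists>i\<in>{1..r}. \<exists>k\<in>{1..r}. es i \<otimes>\<^bsub>Rb\<^esub> bar a \<otimes>\<^bsub>Rb\<^esub> es k \<notin> Pb"
        using Pb_peirce[OF bc(1)] nP(1) by blast
      then obtain i k where ik: "i \<in> {1..r}" "k \<in> {1..r}" "es i \<otimes>\<^bsub>Rb\<^esub> bar a \<otimes>\<^bsub>Rb\<^esub> es k \<notin> Pb" by blast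
      have "\<exists>l\<in>{1..r}. \<exists>m\<in>{1..r}. es l \<otimes>\<^bsub>Rb\<^esub> bar b \<otimes>\<^bsub>Rb\<^esub> es m \<notin> Pb"
        using Pb_peirce[OF bc(2)] nP(2) by blast
      then obtain l m where lm: "l \<in> {1..r}" "m \<in> {1..r}" "es l \<otimes>\<^bsub>Rb\<^esub> bar b \<otimes>\<^bsub>Rb\<^esub> es m \<notin> Pb" by blast
      have G': "g i \<in> carrier G" "g k \<in> carrier G" "g l \<in> carrier G" "g m \<in> carrier G" using B.gG ik lm by auto
      obtain y where y: "y \<in> S stab"
        "e \<otimes>\<^bsub>Rb\<^esub> bar y = e \<otimes>\<^bsub>Rb\<^esub> (bar (\<gamma> (inv\<^bsub>G\<^esub> (g i))) \<otimes>\<^bsub>Rb\<^esub> bar a \<otimes>\<^bsub>Rb\<^esub> bar (\<gamma> (g k))) \<otimes>\<^bsub>Rb\<^esub> e"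
        "es i \<otimes>\<^bsub>Rb\<^esub> bar a \<otimes>\<^bsub>Rb\<^esub> es k = bar (\<gamma> (g i)) \<otimes>\<^bsub>Rb\<^esub> (e \<otimes>\<^bsub>Rb\<^esub> bar y) \<otimes>\<^bsub>Rb\<^esub> bar (\<gamma> (inv\<^bsub>G\<^esub> (g k)))"
        by (rule corner_entry[OF bc(1) ik(1,2)])
      obtain z where z: "z \<in> S stab"
        "e \<otimes>\<^bsub>Rb\<^esub> bar z = e \<otimes>\<^bsub>Rb\<^esub> (bar (\<gamma> (inv\<^bsub>G\<^esub> (g l))) \<otimes>\<^bsub>Rb\<^esub> bar b \<otimes>\<^bsub>Rb\<^esub> bar (\<gamma> (g m))) \<otimes>\<^bsub>Rb\<^esub> e"
        "es l \<otimes>\<^bsub>Rb\<^esub> bar b \<otimes>\<^bsub>Rb\<^esub> es m = bar (\<gamma> (g l)) \<otimes>\<^bsub>Rb\<^esub> (e \<otimes>\<^bsub>Rb\<^esub> bar z) \<otimes>\<^bsub>Rb\<^esub> bar (\<gamma> (inv\<^bsub>G\<^esub> (g m)))"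
        by (rule corner_entry[OF bc(2) lm(1,2)])
      have yz: "y \<in> carrier A" "z \<in> carrier A" using y(1) z(1) S_closed by auto
      have nQ: "y \<notin> Q" "z \<notin> Q"
      proof -
        show "y \<notin> Q"
        proof
          assume "y \<in> Q"
          hence "e \<otimes>\<^bsub>Rb\<^esub> bar y \<in> Pb" using Q_iff by blast
          hence "es i \<otimes>\<^bsub>Rb\<^esub> bar a \<otimes>\<^bsub>Rb\<^esub> es k \<in> Pb" 
            unfolding y(3) by (rule Pb_r[OF Pb_l]) (use G' in auto)
          thus False using ik(3) by blast
        qed
        show "z \<notin> Q"
        proof
          assume "z \<in> Q"
          hence "e \<otimes>\<^bsub>Rb\<^esub> bar z \<in> Pb" using Q_iff by blast
          hence "es l \<otimes>\<^bsub>Rb\<^esub> bar b \<otimes>\<^bsub>Rb\<^esub> es m \<in> Pb" 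
            unfolding z(3) by (rule Pb_r[OF Pb_l]) (use G' in auto)
          thus False using lm(3) by blast
        qed
      qed
      have "y \<otimes> x \<otimes> z \<in> Q" if x: "x \<in> S stab" for x
      proof -
        have xA: "x \<in> carrier A" using x S_closed by blast
        have yx: "y \<otimes> x \<in> S stab" by (rule S_subgroup_mult[OF B.stab_subgroup y(1) x])
        have yxz: "y \<otimes> x \<otimes> z \<in> S stab" by (rule S_subgroup_mult[OF B.stab_subgroup yx z(1)])
        have "e \<otimes>\<^bsub>Rb\<^esub> bar (y \<otimes> x \<otimes> z) = e \<otimes>\<^bsub>Rb\<^esub> (e \<otimes>\<^bsub>Rb\<^esub> bar (y \<otimes> x)) \<otimes>\<^bsub>Rb\<^esub> bar z"
          using yz xA by (simp add: B.m_assoc)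
        also have "\<dots> = (e \<otimes>\<^bsub>Rb\<^esub> bar y) \<otimes>\<^bsub>Rb\<^esub> bar x \<otimes>\<^bsub>Rb\<^esub> (e \<otimes>\<^bsub>Rb\<^esub> bar z)"
          unfolding e_bar[OF yx] using yz xA by (simp add: B.m_assoc)
        also have "\<dots> = (e \<otimes>\<^bsub>Rb\<^esub> bar (\<gamma> (inv\<^bsub>G\<^esub> (g i)))) \<otimes>\<^bsub>Rb\<^esub>
            (bar a \<otimes>\<^bsub>Rb\<^esub> (bar (\<gamma> (g k)) \<otimes>\<^bsub>Rb\<^esub> e \<otimes>\<^bsub>Rb\<^esub> bar x \<otimes>\<^bsub>Rb\<^esub> e \<otimes>\<^bsub>Rb\<^esub> bar (\<gamma> (inv\<^bsub>G\<^esub> (g l)))) \<otimes>\<^bsub>Rb\<^esub> bar b)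
            \<otimes>\<^bsub>Rb\<^esub> (bar (\<gamma> (g m)) \<otimes>\<^bsub>Rb\<^esub> e)"
          unfolding y(2) z(2) using bc G' xA by (simp add: B.m_assoc del: bar.hom_mult)
        also have "\<dots> \<in> Pb"
        proof -
          have "bar (\<gamma> (g k)) \<otimes>\<^bsub>Rb\<^esub> e \<otimes>\<^bsub>Rb\<^esub> bar x \<otimes>\<^bsub>Rb\<^esub> e \<otimes>\<^bsub>Rb\<^esub> bar (\<gamma> (inv\<^bsub>G\<^esub> (g l))) \<in> carrier Rb"
            using G' xA by simp
          then obtain w where w: "w \<in> carrier A"
            "bar (\<gamma> (g k)) \<otimes>\<^bsub>Rb\<^esub> e \<otimes>\<^bsub>Rb\<^esub> bar x \<otimes>\<^bsub>Rb\<^esub> e \<otimes>\<^bsub>Rb\<^esub> bar (\<gamma> (inv\<^bsub>G\<^esub> (g l))) = bar w" by (rule bar_surj)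
          have "bar (a \<otimes> w \<otimes> b) \<in> Pb" using ab w(1) by blast
          moreover have "bar (a \<otimes> w \<otimes> b) = bar a \<otimes>\<^bsub>Rb\<^esub> bar w \<otimes>\<^bsub>Rb\<^esub> bar b" using a b w(1) by simp
          ultimately have "bar a \<otimes>\<^bsub>Rb\<^esub> bar w \<otimes>\<^bsub>Rb\<^esub> bar b \<in> Pb" by (simp only:)
          thus ?thesis unfolding w(2) by (rule Pb_r[OF Pb_l]) (use G' in auto)
        qed
        finally show ?thesis using Q_iff yxz by blast
      qed
      hence "\<forall>x\<in>carrier A1. y \<otimes>\<^bsub>A1\<^esub> x \<otimes>\<^bsub>A1\<^esub> z \<in> Q" by simp
      hence "y \<in> Q \<or> z \<in> Q" using pr y(1) z(1) by simp
      thus False using nQ by blast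
    qed
  qed
qed

text \<open>
  The assumption that \<open>P\<close> is proper is used to see that \<open>\<gamma> x \<ominus> \<one> \<in> P\<close> forces \<open>x\<close> into \<open>stab\<close>: otherwise
  \<open>e\<close>, and with it every \<open>es i\<close>, would be in the image of \<open>P\<close>.
\<close>

theorem dagger_iff:
  assumes ne: "P \<noteq> carrier A" and x: "x \<in> carrier G"
  shows "\<gamma> x \<ominus> \<one> \<in> P \<longleftrightarrow> (\<forall>h\<in>carrier G. h \<otimes>\<^bsub>G\<^esub> x \<otimes>\<^bsub>G\<^esub> inv\<^bsub>G\<^esub> h \<in> stab \<and> \<gamma> (h \<otimes>\<^bsub>G\<^esub> x \<otimes>\<^bsub>G\<^esub> inv\<^bsub>G\<^esub> h) \<ominus> \<one> \<in> Q)"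
proof
  assume xP: "\<gamma> x \<ominus> \<one> \<in> P"
  have main: "y \<in> stab \<and> \<gamma> y \<ominus> \<one> \<in> Q" if y: "y \<in> carrier G" "\<gamma> y \<ominus> \<one> \<in> P" for y
  proof -
    have bP: "bar (\<gamma> y) \<ominus>\<^bsub>Rb\<^esub> \<one>\<^bsub>Rb\<^esub> \<in> Pb"
    proof -
      have "bar (\<gamma> y \<ominus> \<one>) = bar (\<gamma> y) \<ominus>\<^bsub>Rb\<^esub> \<one>\<^bsub>Rb\<^esub>" using y(1) by (simp add: a_minus_def)
      thus ?thesis using y(2) by (metis image_eqI)
    qed
    have ys: "y \<in> stab"
    proof (rule ccontr)
      assume "y \<notin> stab"
      hence 0: "e \<otimes>\<^bsub>Rb\<^esub> bar (\<gamma> y) \<otimes>\<^bsub>Rb\<^esub> e = \<zero>\<^bsub>Rb\<^esub>" by (rule B.e_\<gamma>_e[OF y(1)])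
      have "e \<otimes>\<^bsub>Rb\<^esub> (bar (\<gamma> y) \<ominus>\<^bsub>Rb\<^esub> \<one>\<^bsub>Rb\<^esub>) \<otimes>\<^bsub>Rb\<^esub> e = e \<otimes>\<^bsub>Rb\<^esub> bar (\<gamma> y) \<otimes>\<^bsub>Rb\<^esub> e \<oplus>\<^bsub>Rb\<^esub> \<ominus>\<^bsub>Rb\<^esub> (e \<otimes>\<^bsub>Rb\<^esub> e)"
        using y(1) by (simp add: a_minus_def B.l_distr B.r_distr B.l_minus B.r_minus)
      also have "\<dots> = \<ominus>\<^bsub>Rb\<^esub> e" by (simp add: 0 B.ee)
      finally have "e \<otimes>\<^bsub>Rb\<^esub> (bar (\<gamma> y) \<ominus>\<^bsub>Rb\<^esub> \<one>\<^bsub>Rb\<^esub>) \<otimes>\<^bsub>Rb\<^esub> e = \<ominus>\<^bsub>Rb\<^esub> e" .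
      moreover have "e \<otimes>\<^bsub>Rb\<^esub> (bar (\<gamma> y) \<ominus>\<^bsub>Rb\<^esub> \<one>\<^bsub>Rb\<^esub>) \<otimes>\<^bsub>Rb\<^esub> e \<in> Pb"
        by (rule Pb_r[OF Pb_l[OF bP]]) simp_all
      ultimately have "\<ominus>\<^bsub>Rb\<^esub> e \<in> Pb" by simp
      hence "\<ominus>\<^bsub>Rb\<^esub> e \<otimes>\<^bsub>Rb\<^esub> \<ominus>\<^bsub>Rb\<^esub> \<one>\<^bsub>Rb\<^esub> \<in> Pb" by (rule Pb_r) simp
      hence "e \<in> Pb" by (simp add: B.l_minus B.r_minus)
      hence "\<one> \<in> Q" using Q_iff one_in_S[OF subgroup.one_closed[OF B.stab_subgroup]] by simp
      thus False using ne one_in_Q_iff by blast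
    qed
    have "\<gamma> y \<ominus> \<one> \<in> S stab"
      using ys y(1) by (intro S_minus \<gamma>_in_S one_in_S subgroup.one_closed[OF B.stab_subgroup])
    moreover have "e \<otimes>\<^bsub>Rb\<^esub> bar (\<gamma> y \<ominus> \<one>) \<in> Pb" 
      by (rule Pb_l[OF imageI[where f = bar, OF y(2)]]) (rule B.e_closed)
    ultimately show ?thesis using ys Q_iff by blast
  qed
  show "\<forall>h\<in>carrier G. h \<otimes>\<^bsub>G\<^esub> x \<otimes>\<^bsub>G\<^esub> inv\<^bsub>G\<^esub> h \<in> stab \<and> \<gamma> (h \<otimes>\<^bsub>G\<^esub> x \<otimes>\<^bsub>G\<^esub> inv\<^bsub>G\<^esub> h) \<ominus> \<one> \<in> Q"
  proof
    fix h assume h: "h \<in> carrier G"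
    have "\<gamma> h \<otimes> (\<gamma> x \<ominus> \<one>) \<otimes> \<gamma> (inv\<^bsub>G\<^esub> h) \<in> P"
      using xP h by (intro P.I_r_closed P.I_l_closed) auto
    moreover have "\<gamma> h \<otimes> (\<gamma> x \<ominus> \<one>) \<otimes> \<gamma> (inv\<^bsub>G\<^esub> h) = \<gamma> (h \<otimes>\<^bsub>G\<^esub> x \<otimes>\<^bsub>G\<^esub> inv\<^bsub>G\<^esub> h) \<ominus> \<one>"
      using h x by (simp add: a_minus_def l_distr r_distr l_minus r_minus \<gamma>_mult m_assoc)
    ultimately show "h \<otimes>\<^bsub>G\<^esub> x \<otimes>\<^bsub>G\<^esub> inv\<^bsub>G\<^esub> h \<in> stab \<and> \<gamma> (h \<otimes>\<^bsub>G\<^esub> x \<otimes>\<^bsub>G\<^esub> inv\<^bsub>G\<^esub> h) \<ominus> \<one> \<in> Q"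
      using h x by (intro main) auto
  qed
next
  assume *: "\<forall>h\<in>carrier G. h \<otimes>\<^bsub>G\<^esub> x \<otimes>\<^bsub>G\<^esub> inv\<^bsub>G\<^esub> h \<in> stab \<and> \<gamma> (h \<otimes>\<^bsub>G\<^esub> x \<otimes>\<^bsub>G\<^esub> inv\<^bsub>G\<^esub> h) \<ominus> \<one> \<in> Q"
  let ?u = "\<gamma> x \<ominus> \<one>"
  have uA: "?u \<in> carrier A" using x by simp
  have "bar ?u \<in> Pb"
  proof (rule Pb_peirce)
    show "bar ?u \<in> carrier Rb" using uA by simp
    fix i k assume i: "i \<in> {1..r}" and k: "k \<in> {1..r}"
    have gi: "g i \<in> carrier G" using B.gG i by auto
    define y where "y = inv\<^bsub>G\<^esub> (g i) \<otimes>\<^bsub>G\<^esub> x \<otimes>\<^bsub>G\<^esub> g i"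
    have yG: "y \<in> carrier G" using gi x by (simp add: y_def)
    have "\<gamma> y \<ominus> \<one> \<in> Q" using bspec[OF *, of "inv\<^bsub>G\<^esub> (g i)"] gi by (simp add: y_def)
    hence yP: "e \<otimes>\<^bsub>Rb\<^esub> bar (\<gamma> y \<ominus> \<one>) \<in> Pb" using Q_iff by blast
    have conj: "\<gamma> (inv\<^bsub>G\<^esub> (g i)) \<otimes> ?u = (\<gamma> y \<ominus> \<one>) \<otimes> \<gamma> (inv\<^bsub>G\<^esub> (g i))"
      using gi x by (simp add: y_def a_minus_def l_distr r_distr l_minus r_minus \<gamma>_mult m_assoc)
    have "es i \<otimes>\<^bsub>Rb\<^esub> bar ?u = bar (\<gamma> (g i)) \<otimes>\<^bsub>Rb\<^esub> (e \<otimes>\<^bsub>Rb\<^esub> bar (\<gamma> (inv\<^bsub>G\<^esub> (g i)) \<otimes> ?u))"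
      using gi uA B.es_g[OF i] by (simp add: B.cj_def B.m_assoc)
    also have "\<dots> = bar (\<gamma> (g i)) \<otimes>\<^bsub>Rb\<^esub> (e \<otimes>\<^bsub>Rb\<^esub> bar (\<gamma> y \<ominus> \<one>) \<otimes>\<^bsub>Rb\<^esub> bar (\<gamma> (inv\<^bsub>G\<^esub> (g i))))"
    proof -
      have "\<gamma> y \<ominus> \<one> \<in> carrier A" using yG by simp
      thus ?thesis unfolding conj using gi by (simp add: B.m_assoc)
    qed
    also have "\<dots> \<in> Pb" by (rule Pb_l[OF Pb_r[OF yP]]) (use gi in auto)
    finally show "es i \<otimes>\<^bsub>Rb\<^esub> bar ?u \<otimes>\<^bsub>Rb\<^esub> es k \<in> Pb" by (rule Pb_r) (use k in auto)
  qed
  thus "?u \<in> P" using bar_in_Pb[OF uA] by simp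
qed

end

context ideal_correspondence
begin

subsection \<open>Control\<close>

lemma stab_split:
  assumes a: "a \<in> carrier A"
  shows "\<exists>a1\<in>S stab. \<exists>a2\<in>S (carrier G - stab). a = a1 \<oplus> a2"
proof -
  have "a \<in> S (carrier G)" using a S_top by simp
  then obtain f where f: "\<forall>Y\<in>rcosets\<^bsub>G\<^esub> stab. f Y \<in> S (carrier G \<inter> Y)" "a = (\<Oplus>Y\<in>rcosets\<^bsub>G\<^esub> stab. f Y)"
    using S_split[OF B.stab_opn] by blast
  show ?thesis unfolding f(2)
  proof (rule finsum_induct_pred[OF opn_finite[OF B.stab_opn]])
    fix Y assume Y: "Y \<in> rcosets\<^bsub>G\<^esub> stab"
    have fY: "f Y \<in> S (carrier G \<inter> Y)" using f(1) Y by blast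
    have fA: "f Y \<in> carrier A" using fY S_closed by blast
    have "\<exists>a1\<in>S stab. \<exists>a2\<in>S (carrier G - stab). f Y = a1 \<oplus> a2"
    proof (cases "Y = stab")
      case True
      hence "f Y \<in> S stab" using fY S_mono[of "carrier G \<inter> Y" stab] by blast
      moreover have "f Y = f Y \<oplus> \<zero>" using fA by simp
      ultimately show ?thesis using S_zero by blast
    next
      case False
      have "stab \<in> rcosets\<^bsub>G\<^esub> stab" by (rule subgroup.subgroup_in_rcosets[OF B.stab_subgroup G.is_group])
      hence "Y \<inter> stab = {}" using False Y G.rcos_disjoint[OF B.stab_subgroup] by (auto simp: pairwise_def disjnt_def)
      hence "f Y \<in> S (carrier G - stab)" using fY S_mono[of "carrier G \<inter> Y" "carrier G - stab"] by blast
      moreover have "f Y = \<zero> \<oplus> f Y" using fA by simp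
      ultimately show ?thesis using S_zero by blast
    qed
    thus "f Y \<in> carrier A \<and> (\<exists>a1\<in>S stab. \<exists>a2\<in>S (carrier G - stab). f Y = a1 \<oplus> a2)" using fA by blast
  next
    show "\<exists>a1\<in>S stab. \<exists>a2\<in>S (carrier G - stab). \<zero> = a1 \<oplus> a2"
    proof -
      have "\<zero> = \<zero> \<oplus> \<zero>" by simp
      thus ?thesis using S_zero by blast
    qed
  next
    fix x y assume "\<exists>a1\<in>S stab. \<exists>a2\<in>S (carrier G - stab). x = a1 \<oplus> a2"
      and "\<exists>a1\<in>S stab. \<exists>a2\<in>S (carrier G - stab). y = a1 \<oplus> a2"
    then obtain a1 a2 b1 b2 where *: "a1 \<in> S stab" "b1 \<in> S stab" "a2 \<in> S (carrier G - stab)" "b2 \<in> S (carrier G - stab)"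
      "x = a1 \<oplus> a2" "y = b1 \<oplus> b2" by blast
    have "a1 \<in> carrier A" "a2 \<in> carrier A" "b1 \<in> carrier A" "b2 \<in> carrier A" using * S_closed by blast+
    hence "x \<oplus> y = (a1 \<oplus> b1) \<oplus> (a2 \<oplus> b2)" using * by (simp add: a_ac)
    thus "\<exists>a1\<in>S stab. \<exists>a2\<in>S (carrier G - stab). x \<oplus> y = a1 \<oplus> a2" using * S_add by blast
  qed
qed

text \<open>
  Split the coefficients of an element of \<open>j A\<close> into parts supported on \<open>stab\<close> and on its complement.
  Left multiplication by elements of \<open>S D\<close> respects the splitting, so for an element supported on \<open>stab\<close>
  the second part cancels.
\<close>

lemma J_stab:
  assumes u: "u \<in> J" "u \<in> S stab"
  shows "u \<in> ideal_prod A j (S stab)"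
proof -
  have jA: "j \<subseteq> carrier A" using j S_carrier by blast
  have jst: "j \<subseteq> S stab" using j S_mono[OF B.D_stab] by blast
  have IS: "w \<in> S stab" if "w \<in> ideal_prod A j (S stab)" for w
    using that by (induction rule: ideal_prod.induct) (use jst S_subgroup_mult[OF B.stab_subgroup] S_add in auto)
  have uJ: "u \<in> ideal_prod A j (carrier A)" using u(1) by (rule subst[OF J_eq])
  have "\<exists>w\<in>ideal_prod A j (S stab). \<exists>v\<in>S (carrier G - stab). u = w \<oplus> v"
    using uJ
  proof (induction rule: ideal_prod.induct)
    case (prod i a)
    obtain a1 a2 where a: "a1 \<in> S stab" "a2 \<in> S (carrier G - stab)" "a = a1 \<oplus> a2"
      using stab_split[OF prod(2)] by blast
    have iD: "i \<in> S D" using prod(1) j by blast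
    have R': "i \<in> carrier A" "a1 \<in> carrier A" "a2 \<in> carrier A" using a iD S_closed by blast+
    have "i \<otimes> a2 \<in> S (carrier G - stab)"
    proof (rule S_mult[OF iD a(2)])
      fix p q assume p: "p \<in> D" and q: "q \<in> carrier G - stab"
      have ps: "p \<in> stab" using p B.D_stab by blast
      have pG: "p \<in> carrier G" using p B.DG by blast
      have "p \<otimes>\<^bsub>G\<^esub> q \<notin> stab"
      proof
        assume "p \<otimes>\<^bsub>G\<^esub> q \<in> stab"
        hence "inv\<^bsub>G\<^esub> p \<otimes>\<^bsub>G\<^esub> (p \<otimes>\<^bsub>G\<^esub> q) \<in> stab"
          by (rule subgroup.m_closed[OF B.stab_subgroup subgroup.m_inv_closed[OF B.stab_subgroup ps]])
        thus False using q pG by simp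
      qed
      thus "p \<otimes>\<^bsub>G\<^esub> q \<in> carrier G - stab" using pG q by simp
    qed
    moreover have "i \<otimes> a = i \<otimes> a1 \<oplus> i \<otimes> a2" using R' a(3) by (simp add: r_distr)
    moreover have "i \<otimes> a1 \<in> ideal_prod A j (S stab)" by (rule ip_prod[OF prod(1) a(1)])
    ultimately show ?case by (intro bexI) assumption+
  next
    case (sum x y)
    then obtain w w' v v' where *: "w \<in> ideal_prod A j (S stab)" "w' \<in> ideal_prod A j (S stab)"
      "v \<in> S (carrier G - stab)" "v' \<in> S (carrier G - stab)" "x = w \<oplus> v" "y = w' \<oplus> v'" by blast
    have "w \<in> carrier A" "w' \<in> carrier A" "v \<in> carrier A" "v' \<in> carrier A" using * IS S_closed by blast+
    hence "x \<oplus> y = (w \<oplus> w') \<oplus> (v \<oplus> v')" using * by (simp add: a_ac)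
    thus ?case using * ip_sum S_add by blast
  qed
  then obtain w v where wv: "w \<in> ideal_prod A j (S stab)" "v \<in> S (carrier G - stab)" "u = w \<oplus> v" by blast
  have R': "w \<in> carrier A" "v \<in> carrier A" using wv IS S_closed by blast+
  have "v = u \<ominus> w" using R' wv(3) by (simp add: a_minus_def a_ac r_neg)
  hence "v \<in> S stab" using u(2) IS[OF wv(1)] S_minus by simp
  hence "v = \<zero>" using S_disjoint[OF B.stab_opn _ wv(2)] by blast
  thus ?thesis using wv R' by simp
qed

text \<open>
  \<open>W\<close> and \<open>K\<close> are the parts of \<open>P\<close> and \<open>Q\<close> generated by the elements supported on \<open>X\<close> and \<open>X \<inter> stab\<close>. If
  \<open>W = P\<close>, the components of the generators of \<open>P\<close> are in \<open>Q\<close> by \<open>component_split\<close>, so the corner of \<open>W\<close> is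
  \<open>e K\<close>. If \<open>K = Q\<close>, the Peirce components of the elements of \<open>P\<close> are translates of elements of \<open>e Q\<close>,
  which are in the image of \<open>W\<close> because \<open>X\<close> is normal.
\<close>

theorem control_iff:
  assumes X: "X \<lhd> G" and DX: "D \<subseteq> X"
  shows "controlled_by A P (S X) \<longleftrightarrow> controlled_by A1 Q (S (X \<inter> stab))"
proof -
  let ?X1 = "X \<inter> stab"
  define K where "K = ideal_prod A (Q \<inter> S ?X1) (S stab)"
  define W where "W = ideal_prod A (P \<inter> S X) (carrier A)"
  have sX: "subgroup X G" by (rule normal_imp_subgroup[OF X])
  have sX1: "subgroup ?X1 G" by (rule G.subgroups_Inter_pair[OF sX B.stab_subgroup])
  have SDX: "S D \<subseteq> S X" "S D \<subseteq> S ?X1" "S ?X1 \<subseteq> S X" "S ?X1 \<subseteq> S stab"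
    using DX B.D_stab by (auto intro!: S_mono)
  obtain a0 where a0: "a0 \<in> S D" "e = bar a0" by (rule e_lift)
  obtain f0 where f0: "f0 \<in> S D" "B.f = bar f0" by (rule f_lift)
  have aA: "a0 \<in> carrier A" "f0 \<in> carrier A" using a0 f0 S_closed by blast+
  have one_D: "\<one> \<in> S D" by (rule one_in_S[OF subgroup.one_closed[OF B.D_subgroup]])
  have one_st: "\<one> \<in> S stab" by (rule one_in_S[OF subgroup.one_closed[OF B.stab_subgroup]])
  have jJ: "j \<subseteq> J"
  proof
    fix i assume i: "i \<in> j"
    have "i \<otimes> \<one> \<in> J" unfolding J_eq by (rule ip_prod[OF i one_closed])
    thus "i \<in> J" using i j S_closed by (metis r_one subsetD)
  qed
  have Q_of_zero: "y \<in> Q" if "y \<in> S stab" "e \<otimes>\<^bsub>Rb\<^esub> bar y = \<zero>\<^bsub>Rb\<^esub>" for y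
    using that Q_iff Pb_zero by simp
  have jQ: "j \<subseteq> Q \<inter> S ?X1"
  proof
    fix i assume i: "i \<in> j"
    have iS: "i \<in> S ?X1" "i \<in> S stab" using i j SDX by blast+
    have "bar i = \<zero>\<^bsub>Rb\<^esub>" using bar_zero_iff[OF S_closed[OF iS(1)]] i jJ by blast
    hence "i \<in> Q" using iS(2) by (intro Q_of_zero) simp_all
    thus "i \<in> Q \<inter> S ?X1" using iS by blast
  qed
  have jP: "j \<subseteq> P \<inter> S X" using j jJ JP SDX by blast
  note Qi = ideal_S_D[OF Q_ideal]
  have KQ: "K \<subseteq> Q"
  proof
    fix z assume "z \<in> K"
    thus "z \<in> Q" unfolding K_def by (induction rule: ideal_prod.induct) (use Qi(3,5) in auto)
  qed
  have WP: "W \<subseteq> P"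
  proof
    fix z assume "z \<in> W"
    thus "z \<in> P" unfolding W_def by (induction rule: ideal_prod.induct) (auto intro: P.I_r_closed P.a_closed)
  qed
  have KA: "K \<subseteq> carrier A" using KQ QS S_carrier by blast
  have WA: "W \<subseteq> carrier A" using WP P_carrier by blast
  have K0: "\<zero> \<in> K"
    using ip_prod[of \<zero> "Q \<inter> S ?X1" \<one> "S stab"] Qi(2) S_zero one_st by (simp add: K_def)
  have W0: "\<zero> \<in> W"
    using ip_prod[of \<zero> "P \<inter> S X" \<one> "carrier A"] additive_subgroup.zero_closed[OF P.is_additive_subgroup] S_zero
    by (simp add: W_def)
  have Kadd: "x \<oplus> y \<in> K" if "x \<in> K" "y \<in> K" for x y using that unfolding K_def by (rule ip_sum)
  have Wadd: "x \<oplus> y \<in> W" if "x \<in> W" "y \<in> W" for x y using that unfolding W_def by (rule ip_sum)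
  have ctl: "controlled_by A P (S X) \<longleftrightarrow> W = P" "controlled_by A1 Q (S ?X1) \<longleftrightarrow> K = Q"
    by (simp_all add: controlled_by_def W_def K_def ideal_prod_carrier_update)
  \<comment> \<open>Write \<open>z = (1 - e) z + e z\<close> with lifts: \<open>1 - e\<close> is a generator in \<open>Q\<close>, and \<open>e z\<close> is in \<open>J\<close>.\<close>
  have NK: "z \<in> K" if z: "z \<in> S stab" and ez: "e \<otimes>\<^bsub>Rb\<^esub> bar z = \<zero>\<^bsub>Rb\<^esub>" for z
  proof -
    have zA: "z \<in> carrier A" using z S_closed by blast
    have "\<one> \<ominus> a0 \<in> S D" by (rule S_minus[OF one_D a0(1)])
    hence c: "\<one> \<ominus> a0 \<in> S ?X1" "\<one> \<ominus> a0 \<in> S stab" using SDX by blast+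
    have "e \<otimes>\<^bsub>Rb\<^esub> bar (\<one> \<ominus> a0) = \<zero>\<^bsub>Rb\<^esub>"
      using aA by (simp add: a_minus_def B.r_distr B.r_minus B.ee B.r_neg flip: a0(2))
    hence "\<one> \<ominus> a0 \<in> Q \<inter> S ?X1" using c Q_of_zero by blast
    hence 1: "(\<one> \<ominus> a0) \<otimes> z \<in> K" unfolding K_def using z by (rule ip_prod)
    have "a0 \<otimes> z \<in> S stab" using a0(1) SDX z by (intro S_subgroup_mult[OF B.stab_subgroup]) auto
    moreover have "a0 \<otimes> z \<in> J" using bar_zero_iff[of "a0 \<otimes> z"] ez a0(2) aA zA by simp
    ultimately have "a0 \<otimes> z \<in> ideal_prod A j (S stab)" by (intro J_stab)
    hence 2: "a0 \<otimes> z \<in> K" unfolding K_def using ideal_prod_mono[OF jQ subset_refl] by blast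
    have "z = (\<one> \<ominus> a0) \<otimes> z \<oplus> a0 \<otimes> z"
      using aA zA by (simp add: a_minus_def l_distr l_minus a_assoc l_neg)
    thus ?thesis using Kadd[OF 1 2] by simp
  qed
  show ?thesis unfolding ctl
  proof
    assume W: "W = P"
    have corner: "\<exists>w\<in>K. e \<otimes>\<^bsub>Rb\<^esub> bar z \<otimes>\<^bsub>Rb\<^esub> e = e \<otimes>\<^bsub>Rb\<^esub> bar w" if "z \<in> W" for z
      using that unfolding W_def
    proof (induction rule: ideal_prod.induct)
      case (prod p a)
      have p: "p \<in> P" "p \<in> S X" using prod(1) by auto
      have pA: "p \<in> carrier A" using p P_carrier by blast
      have aA': "a \<in> carrier A" by (rule prod(2))
      have "bar p \<in> bar ` S X" using p(2) by blast
      from B.component_split[OF sX this] obtain s t where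
        st: "\<forall>Y\<in>rcosets\<^bsub>G\<^esub> stab. s Y \<in> bar ` S ?X1 \<and> t Y \<in> X \<and> (\<exists>c\<in>carrier Rb. e \<otimes>\<^bsub>Rb\<^esub> s Y = e \<otimes>\<^bsub>Rb\<^esub> bar p \<otimes>\<^bsub>Rb\<^esub> c)"
        and pst: "bar p = (\<Oplus>\<^bsub>Rb\<^esub>Y\<in>rcosets\<^bsub>G\<^esub> stab. s Y \<otimes>\<^bsub>Rb\<^esub> bar (\<gamma> (t Y)))" by blast
      have "\<exists>w\<in>K. e \<otimes>\<^bsub>Rb\<^esub> bar p \<otimes>\<^bsub>Rb\<^esub> bar a \<otimes>\<^bsub>Rb\<^esub> e = e \<otimes>\<^bsub>Rb\<^esub> bar w"
        unfolding pst
      proof (rule B.finsum_induct_pred[OF opn_finite[OF B.stab_opn]])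
        show "\<exists>w\<in>K. e \<otimes>\<^bsub>Rb\<^esub> \<zero>\<^bsub>Rb\<^esub> \<otimes>\<^bsub>Rb\<^esub> bar a \<otimes>\<^bsub>Rb\<^esub> e = e \<otimes>\<^bsub>Rb\<^esub> bar w"
          using K0 aA' by (intro bexI[of _ \<zero>]) simp_all
      next
        fix x y assume xy: "x \<in> carrier Rb" "y \<in> carrier Rb"
          and "\<exists>w\<in>K. e \<otimes>\<^bsub>Rb\<^esub> x \<otimes>\<^bsub>Rb\<^esub> bar a \<otimes>\<^bsub>Rb\<^esub> e = e \<otimes>\<^bsub>Rb\<^esub> bar w"
            "\<exists>w\<in>K. e \<otimes>\<^bsub>Rb\<^esub> y \<otimes>\<^bsub>Rb\<^esub> bar a \<otimes>\<^bsub>Rb\<^esub> e = e \<otimes>\<^bsub>Rb\<^esub> bar w"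
        then obtain w w' where w: "w \<in> K" "w' \<in> K" "e \<otimes>\<^bsub>Rb\<^esub> x \<otimes>\<^bsub>Rb\<^esub> bar a \<otimes>\<^bsub>Rb\<^esub> e = e \<otimes>\<^bsub>Rb\<^esub> bar w"
          "e \<otimes>\<^bsub>Rb\<^esub> y \<otimes>\<^bsub>Rb\<^esub> bar a \<otimes>\<^bsub>Rb\<^esub> e = e \<otimes>\<^bsub>Rb\<^esub> bar w'" by blast
        have wA: "w \<in> carrier A" "w' \<in> carrier A" using w KA by auto
        have "e \<otimes>\<^bsub>Rb\<^esub> (x \<oplus>\<^bsub>Rb\<^esub> y) \<otimes>\<^bsub>Rb\<^esub> bar a \<otimes>\<^bsub>Rb\<^esub> e = e \<otimes>\<^bsub>Rb\<^esub> bar (w \<oplus> w')"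
          using xy w(3,4) wA aA' by (simp add: B.l_distr B.r_distr)
        thus "\<exists>w\<in>K. e \<otimes>\<^bsub>Rb\<^esub> (x \<oplus>\<^bsub>Rb\<^esub> y) \<otimes>\<^bsub>Rb\<^esub> bar a \<otimes>\<^bsub>Rb\<^esub> e = e \<otimes>\<^bsub>Rb\<^esub> bar w"
          using Kadd[OF w(1,2)] by blast
      next
        fix Y assume Y: "Y \<in> rcosets\<^bsub>G\<^esub> stab"
        obtain q where q: "q \<in> S ?X1" "s Y = bar q" using st Y by blast
        obtain c where c: "c \<in> carrier Rb" "e \<otimes>\<^bsub>Rb\<^esub> s Y = e \<otimes>\<^bsub>Rb\<^esub> bar p \<otimes>\<^bsub>Rb\<^esub> c" using st Y by blast
        have tG: "t Y \<in> carrier G" using st Y subgroup.subset[OF sX] by blast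
        have qs: "q \<in> S stab" using q(1) SDX by blast
        have qA: "q \<in> carrier A" using qs S_closed by blast
        have "e \<otimes>\<^bsub>Rb\<^esub> bar q \<in> Pb" 
          unfolding q(2)[symmetric] c(2) by (rule Pb_r[OF Pb_l[OF imageI[OF p(1)]] c(1)]) simp
        hence qQ: "q \<in> Q \<inter> S ?X1" using Q_iff qs q(1) by blast
        have "bar (\<gamma> (t Y)) \<otimes>\<^bsub>Rb\<^esub> bar a \<in> carrier Rb" using tG aA' by simp
        then obtain y where y: "y \<in> S stab"
          "e \<otimes>\<^bsub>Rb\<^esub> (bar (\<gamma> (t Y)) \<otimes>\<^bsub>Rb\<^esub> bar a) \<otimes>\<^bsub>Rb\<^esub> e = e \<otimes>\<^bsub>Rb\<^esub> bar y" by (rule corner_bar)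
        have yA: "y \<in> carrier A" using y(1) S_closed by blast
        have E: "e \<otimes>\<^bsub>Rb\<^esub> bar q \<otimes>\<^bsub>Rb\<^esub> e = e \<otimes>\<^bsub>Rb\<^esub> bar q"
          unfolding e_bar[OF qs] using qA by (simp add: B.m_assoc B.ee)
        have "e \<otimes>\<^bsub>Rb\<^esub> (s Y \<otimes>\<^bsub>Rb\<^esub> bar (\<gamma> (t Y))) \<otimes>\<^bsub>Rb\<^esub> bar a \<otimes>\<^bsub>Rb\<^esub> e
            = (e \<otimes>\<^bsub>Rb\<^esub> bar q) \<otimes>\<^bsub>Rb\<^esub> (bar (\<gamma> (t Y)) \<otimes>\<^bsub>Rb\<^esub> bar a) \<otimes>\<^bsub>Rb\<^esub> e"
          using q(2) qA tG aA' by (simp add: B.m_assoc)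
        also have "\<dots> = (e \<otimes>\<^bsub>Rb\<^esub> bar q \<otimes>\<^bsub>Rb\<^esub> e) \<otimes>\<^bsub>Rb\<^esub> (bar (\<gamma> (t Y)) \<otimes>\<^bsub>Rb\<^esub> bar a) \<otimes>\<^bsub>Rb\<^esub> e" unfolding E ..
        also have "\<dots> = (e \<otimes>\<^bsub>Rb\<^esub> bar q) \<otimes>\<^bsub>Rb\<^esub> (e \<otimes>\<^bsub>Rb\<^esub> (bar (\<gamma> (t Y)) \<otimes>\<^bsub>Rb\<^esub> bar a) \<otimes>\<^bsub>Rb\<^esub> e)" using qA tG aA' by (simp add: B.m_assoc)
        also have "\<dots> = (e \<otimes>\<^bsub>Rb\<^esub> bar q \<otimes>\<^bsub>Rb\<^esub> e) \<otimes>\<^bsub>Rb\<^esub> bar y" unfolding y(2) using qA yA by (simp add: B.m_assoc)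
        also have "\<dots> = e \<otimes>\<^bsub>Rb\<^esub> bar (q \<otimes> y)" unfolding E using qA yA by (simp add: B.m_assoc)
        finally have eq: "e \<otimes>\<^bsub>Rb\<^esub> (s Y \<otimes>\<^bsub>Rb\<^esub> bar (\<gamma> (t Y))) \<otimes>\<^bsub>Rb\<^esub> bar a \<otimes>\<^bsub>Rb\<^esub> e = e \<otimes>\<^bsub>Rb\<^esub> bar (q \<otimes> y)" .
        have "q \<otimes> y \<in> K" unfolding K_def by (rule ip_prod[OF qQ y(1)])
        thus "s Y \<otimes>\<^bsub>Rb\<^esub> bar (\<gamma> (t Y)) \<in> carrier Rb \<and>
            (\<exists>w\<in>K. e \<otimes>\<^bsub>Rb\<^esub> (s Y \<otimes>\<^bsub>Rb\<^esub> bar (\<gamma> (t Y))) \<otimes>\<^bsub>Rb\<^esub> bar a \<otimes>\<^bsub>Rb\<^esub> e = e \<otimes>\<^bsub>Rb\<^esub> bar w)"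
          using eq q(2) qA tG by auto
      qed
      thus ?case using pA aA' by (simp add: B.m_assoc)
    next
      case (sum x y)
      then obtain w w' where w: "w \<in> K" "w' \<in> K" "e \<otimes>\<^bsub>Rb\<^esub> bar x \<otimes>\<^bsub>Rb\<^esub> e = e \<otimes>\<^bsub>Rb\<^esub> bar w"
        "e \<otimes>\<^bsub>Rb\<^esub> bar y \<otimes>\<^bsub>Rb\<^esub> e = e \<otimes>\<^bsub>Rb\<^esub> bar w'" by blast
      have A': "w \<in> carrier A" "w' \<in> carrier A" "x \<in> carrier A" "y \<in> carrier A"
        using w KA sum(1,2) WA unfolding W_def by auto
      have "e \<otimes>\<^bsub>Rb\<^esub> bar (x \<oplus> y) \<otimes>\<^bsub>Rb\<^esub> e = e \<otimes>\<^bsub>Rb\<^esub> bar (w \<oplus> w')"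
        using w(3,4) A' by (simp add: B.l_distr B.r_distr)
      thus ?case using Kadd[OF w(1,2)] by blast
    qed
    have "y \<in> K" if y: "y \<in> Q" for y
    proof -
      have yS: "y \<in> S stab" using y QS by blast
      have yA: "y \<in> carrier A" using yS S_closed by blast
      have "bar (a0 \<otimes> y) \<in> Pb" using y Q_iff a0(2) aA yA by simp
      hence "a0 \<otimes> y \<in> W" using bar_in_Pb[of "a0 \<otimes> y"] aA yA W by simp
      then obtain w where w: "w \<in> K" "e \<otimes>\<^bsub>Rb\<^esub> bar (a0 \<otimes> y) \<otimes>\<^bsub>Rb\<^esub> e = e \<otimes>\<^bsub>Rb\<^esub> bar w" using corner by blast
      have wS: "w \<in> S stab" using w(1) KQ QS by blast
      have wA: "w \<in> carrier A" using wS S_closed by blast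
      have "e \<otimes>\<^bsub>Rb\<^esub> bar (a0 \<otimes> y) \<otimes>\<^bsub>Rb\<^esub> e = (e \<otimes>\<^bsub>Rb\<^esub> bar y) \<otimes>\<^bsub>Rb\<^esub> e"
        using aA yA by (simp flip: a0(2))
      also have "\<dots> = e \<otimes>\<^bsub>Rb\<^esub> bar y" unfolding e_bar[OF yS] using yA by (simp add: B.m_assoc B.ee)
      finally have eq: "e \<otimes>\<^bsub>Rb\<^esub> bar y = e \<otimes>\<^bsub>Rb\<^esub> bar w" using w(2) by simp
      have "e \<otimes>\<^bsub>Rb\<^esub> bar (y \<ominus> w) = \<zero>\<^bsub>Rb\<^esub>"
        using yA wA eq by (simp add: a_minus_def B.r_distr B.r_minus B.r_neg)
      hence "y \<ominus> w \<in> K" by (intro NK S_minus yS wS)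
      hence "(y \<ominus> w) \<oplus> w \<in> K" using w(1) by (rule Kadd)
      thus ?thesis using yA wA by (simp add: a_minus_def a_assoc l_neg)
    qed
    thus "K = Q" using KQ by blast
  next
    assume K: "K = Q"
    have JW: "J \<subseteq> W" unfolding J_eq W_def by (rule ideal_prod_mono[OF jP subset_refl])
    have barW: "x \<in> W" if x: "x \<in> carrier A" and bx: "bar x \<in> bar ` W" for x
    proof -
      obtain w where w: "w \<in> W" "bar x = bar w" using bx by blast
      have wA: "w \<in> carrier A" using w(1) WA by blast
      have "x \<ominus> w \<in> W" using bar_eq_iff[OF x wA] w(2) JW by blast
      hence "(x \<ominus> w) \<oplus> w \<in> W" using w(1) by (rule Wadd)
      thus ?thesis using x wA by (simp add: a_minus_def a_assoc l_neg)
    qed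
    have bar_add: "u \<oplus>\<^bsub>Rb\<^esub> v \<in> bar ` W" if uv: "u \<in> bar ` W" "v \<in> bar ` W" for u v
    proof -
      obtain x y where xy: "x \<in> W" "y \<in> W" "u = bar x" "v = bar y" using uv by blast
      have "x \<in> carrier A" "y \<in> carrier A" using xy WA by auto
      hence "u \<oplus>\<^bsub>Rb\<^esub> v = bar (x \<oplus> y)" using xy by simp
      thus ?thesis using Wadd[OF xy(1,2)] by blast
    qed
    have "x \<in> W" if x: "x \<in> P" for x
    proof -
      have xA: "x \<in> carrier A" using x P_carrier by blast
      have bx: "bar x \<in> carrier Rb" using xA by simp
      have "bar x \<in> bar ` W"
      proof (rule B.peirce[where P = "\<lambda>b. b \<in> bar ` W", OF bx])
        show "\<zero>\<^bsub>Rb\<^esub> \<in> bar ` W" using W0 by (intro image_eqI[of _ _ \<zero>]) simp_all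
        show "u \<oplus>\<^bsub>Rb\<^esub> v \<in> bar ` W" if "u \<in> bar ` W" "v \<in> bar ` W" for u v by (rule bar_add[OF that])
        have "bar (\<one> \<ominus> f0) \<in> Pb" using fP aA by (simp add: a_minus_def f0(2))
        hence "\<one> \<ominus> f0 \<in> P" using bar_in_Pb aA by simp
        moreover have "\<one> \<ominus> f0 \<in> S X" using S_minus[OF one_D f0(1)] SDX by blast
        ultimately have "(\<one> \<ominus> f0) \<otimes> x \<in> W" unfolding W_def using xA by (intro ip_prod) auto
        moreover have "(\<one>\<^bsub>Rb\<^esub> \<ominus>\<^bsub>Rb\<^esub> B.f) \<otimes>\<^bsub>Rb\<^esub> bar x = bar ((\<one> \<ominus> f0) \<otimes> x)"
          using aA xA by (simp add: a_minus_def f0(2))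
        ultimately show "(\<one>\<^bsub>Rb\<^esub> \<ominus>\<^bsub>Rb\<^esub> B.f) \<otimes>\<^bsub>Rb\<^esub> bar x \<in> bar ` W" by blast
      next
        fix i k assume i: "i \<in> {1..r}" and k: "k \<in> {1..r}"
        have G': "g i \<in> carrier G" "g k \<in> carrier G" using B.gG i k by auto
        obtain y where y: "y \<in> S stab"
          "e \<otimes>\<^bsub>Rb\<^esub> bar y = e \<otimes>\<^bsub>Rb\<^esub> (bar (\<gamma> (inv\<^bsub>G\<^esub> (g i))) \<otimes>\<^bsub>Rb\<^esub> bar x \<otimes>\<^bsub>Rb\<^esub> bar (\<gamma> (g k))) \<otimes>\<^bsub>Rb\<^esub> e"
          "es i \<otimes>\<^bsub>Rb\<^esub> bar x \<otimes>\<^bsub>Rb\<^esub> es k = bar (\<gamma> (g i)) \<otimes>\<^bsub>Rb\<^esub> (e \<otimes>\<^bsub>Rb\<^esub> bar y) \<otimes>\<^bsub>Rb\<^esub> bar (\<gamma> (inv\<^bsub>G\<^esub> (g k)))"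
          by (rule corner_entry[OF bx i k])
        have bP: "bar x \<in> Pb" using x by blast
        have "e \<otimes>\<^bsub>Rb\<^esub> bar y \<in> Pb" unfolding y(2)
          by (rule Pb_r[OF Pb_l[OF Pb_r[OF Pb_l[OF bP]]]]) (use G' in auto)
        hence "y \<in> K" using K Q_iff y(1) by blast
        hence "bar (\<gamma> (g i)) \<otimes>\<^bsub>Rb\<^esub> (e \<otimes>\<^bsub>Rb\<^esub> bar y) \<otimes>\<^bsub>Rb\<^esub> bar (\<gamma> (inv\<^bsub>G\<^esub> (g k))) \<in> bar ` W"
          unfolding K_def
        proof (induction rule: ideal_prod.induct)
          case (prod q b)
          have q: "q \<in> S X" "q \<in> S stab" "q \<in> Q" using prod(1) SDX by blast+
          have A': "q \<in> carrier A" "b \<in> carrier A" using q prod(2) S_closed by blast+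
          define u where "u = \<gamma> (g i) \<otimes> (a0 \<otimes> q) \<otimes> \<gamma> (inv\<^bsub>G\<^esub> (g i))"
          define v where "v = \<gamma> (g i) \<otimes> b \<otimes> \<gamma> (inv\<^bsub>G\<^esub> (g k))"
          have uvA: "u \<in> carrier A" "v \<in> carrier A" using A' aA G' by (simp_all add: u_def v_def)
          have bu: "bar u = bar (\<gamma> (g i)) \<otimes>\<^bsub>Rb\<^esub> (e \<otimes>\<^bsub>Rb\<^esub> bar q) \<otimes>\<^bsub>Rb\<^esub> bar (\<gamma> (inv\<^bsub>G\<^esub> (g i)))"
            using A' aA G' by (simp add: u_def a0(2))
          have eq: "e \<otimes>\<^bsub>Rb\<^esub> bar q \<in> Pb" using q(3) Q_iff by blast
          have "bar u \<in> Pb" unfolding bu by (rule Pb_r[OF Pb_l[OF eq]]) (use G' in auto)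
          hence "u \<in> P" using bar_in_Pb[OF uvA(1)] by blast
          moreover have "u \<in> S X" unfolding u_def
            using a0(1) SDX q(1) by (intro S_conj[OF S_subgroup_mult[OF sX]] normal.inv_op_closed2[OF X] G') auto
          ultimately have "u \<otimes> v \<in> W" unfolding W_def using uvA(2) by (intro ip_prod) auto
          moreover have "bar (\<gamma> (g i)) \<otimes>\<^bsub>Rb\<^esub> (e \<otimes>\<^bsub>Rb\<^esub> bar (q \<otimes> b)) \<otimes>\<^bsub>Rb\<^esub> bar (\<gamma> (inv\<^bsub>G\<^esub> (g k))) = bar (u \<otimes> v)"
          proof -
            have "bar (u \<otimes> v) = bar u \<otimes>\<^bsub>Rb\<^esub> bar v" using uvA by simp
            also have "bar v = bar (\<gamma> (g i)) \<otimes>\<^bsub>Rb\<^esub> bar b \<otimes>\<^bsub>Rb\<^esub> bar (\<gamma> (inv\<^bsub>G\<^esub> (g k)))"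
              using A' G' by (simp add: v_def)
            finally show ?thesis unfolding bu using A' G' by (simp add: B.m_assoc)
          qed
          ultimately show ?case by (metis image_eqI)
        next
          case (sum y z)
          have A': "y \<in> carrier A" "z \<in> carrier A" using sum(1,2) KA unfolding K_def by auto
          have "bar (\<gamma> (g i)) \<otimes>\<^bsub>Rb\<^esub> (e \<otimes>\<^bsub>Rb\<^esub> bar (y \<oplus> z)) \<otimes>\<^bsub>Rb\<^esub> bar (\<gamma> (inv\<^bsub>G\<^esub> (g k)))
            = bar (\<gamma> (g i)) \<otimes>\<^bsub>Rb\<^esub> (e \<otimes>\<^bsub>Rb\<^esub> bar y) \<otimes>\<^bsub>Rb\<^esub> bar (\<gamma> (inv\<^bsub>G\<^esub> (g k))) \<oplus>\<^bsub>Rb\<^esub>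
              bar (\<gamma> (g i)) \<otimes>\<^bsub>Rb\<^esub> (e \<otimes>\<^bsub>Rb\<^esub> bar z) \<otimes>\<^bsub>Rb\<^esub> bar (\<gamma> (inv\<^bsub>G\<^esub> (g k)))"
            using A' G' by (simp add: B.l_distr B.r_distr)
          thus ?case using bar_add[OF sum(3,4)] by simp
        qed
        thus "es i \<otimes>\<^bsub>Rb\<^esub> bar x \<otimes>\<^bsub>Rb\<^esub> es k \<in> bar ` W" unfolding y(3) .
      qed
      thus ?thesis by (rule barW[OF xA])
    qed
    thus "W = P" using WP by blast
  qed
qed

end

section \<open>Reading the corner off the matrix isomorphism\<close>

context matrix_correspondence
begin

text \<open>
  This describes \<open>\<pp>\<close> and \<open>\<NN>\<close>, taking \<open>X\<close> to be \<open>D\<close> and \<open>stab\<close>, as sets of elements killed by \<open>e\<close>.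
\<close>

lemma complement_part_iff:
  assumes X: "D \<subseteq> X" and x: "x \<in> S X"
  shows "bar x \<in> complement_part Rb e (bar ` S X) \<longleftrightarrow> e \<otimes>\<^bsub>Rb\<^esub> bar x = \<zero>\<^bsub>Rb\<^esub>"
proof
  assume "bar x \<in> complement_part Rb e (bar ` S X)"
  then obtain y where y: "y \<in> S X" "bar x = (\<one>\<^bsub>Rb\<^esub> \<ominus>\<^bsub>Rb\<^esub> e) \<otimes>\<^bsub>Rb\<^esub> bar y"
    by (auto simp: complement_part_def)
  have yA: "y \<in> carrier A" using y(1) S_closed by blast
  have "e \<otimes>\<^bsub>Rb\<^esub> bar x = (e \<otimes>\<^bsub>Rb\<^esub> (\<one>\<^bsub>Rb\<^esub> \<ominus>\<^bsub>Rb\<^esub> e)) \<otimes>\<^bsub>Rb\<^esub> bar y"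
    unfolding y(2) using yA by (simp add: B.m_assoc)
  also have "e \<otimes>\<^bsub>Rb\<^esub> (\<one>\<^bsub>Rb\<^esub> \<ominus>\<^bsub>Rb\<^esub> e) = \<zero>\<^bsub>Rb\<^esub>"
    by (simp add: a_minus_def B.r_distr B.r_minus B.ee B.r_neg)
  finally show "e \<otimes>\<^bsub>Rb\<^esub> bar x = \<zero>\<^bsub>Rb\<^esub>" using yA by simp
next
  assume 0: "e \<otimes>\<^bsub>Rb\<^esub> bar x = \<zero>\<^bsub>Rb\<^esub>"
  have xA: "x \<in> carrier A" using x S_closed by blast
  have "(\<one>\<^bsub>Rb\<^esub> \<ominus>\<^bsub>Rb\<^esub> e) \<otimes>\<^bsub>Rb\<^esub> bar x = bar x"
    using xA by (simp add: a_minus_def B.l_distr B.l_minus 0)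
  thus "bar x \<in> complement_part Rb e (bar ` S X)"
    unfolding complement_part_def using x by (intro image_eqI[of _ _ "bar x"]) simp_all
qed

lemma one_minus_e_lift:
  obtains a where "a \<in> S D" "bar a = \<one>\<^bsub>Rb\<^esub> \<ominus>\<^bsub>Rb\<^esub> e" "e \<otimes>\<^bsub>Rb\<^esub> bar a = \<zero>\<^bsub>Rb\<^esub>"
proof -
  obtain a0 where a0: "a0 \<in> S D" "e = bar a0" by (rule e_lift)
  have aA: "a0 \<in> carrier A" using a0 S_closed by blast
  have 1: "\<one> \<ominus> a0 \<in> S D" by (rule S_minus[OF one_in_S[OF subgroup.one_closed[OF B.D_subgroup]] a0(1)])
  have 2: "bar (\<one> \<ominus> a0) = \<one>\<^bsub>Rb\<^esub> \<ominus>\<^bsub>Rb\<^esub> e" using aA by (simp add: a_minus_def a0(2))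
  have 3: "e \<otimes>\<^bsub>Rb\<^esub> (\<one>\<^bsub>Rb\<^esub> \<ominus>\<^bsub>Rb\<^esub> e) = \<zero>\<^bsub>Rb\<^esub>"
    by (simp add: a_minus_def B.r_distr B.r_minus B.ee B.r_neg)
  show ?thesis by (rule that[OF 1 2]) (simp only: 2 3)
qed

text \<open>
  If \<open>h\<close> stabilises \<open>\<pp>\<close>, the conjugates of the element \<open>1 - e\<close> of \<open>\<pp>\<close> by \<open>h\<close> and \<open>h\<^sup>-\<^sup>1\<close> are killed by \<open>e\<close>. So
  \<open>e = e c\<close> for the conjugates \<open>c\<close> of \<open>e\<close> by \<open>h\<close> and by \<open>h\<^sup>-\<^sup>1\<close>; conjugating the latter equation back gives
  \<open>c = c e\<close> for the conjugate by \<open>h\<close>.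
\<close>

lemma stabilizer_eq_stab:
  assumes p: "\<pp> = {x \<in> S D. e \<otimes>\<^bsub>Rb\<^esub> bar x = \<zero>\<^bsub>Rb\<^esub>}"
  shows "{h \<in> carrier G. (\<lambda>x. \<gamma> (inv\<^bsub>G\<^esub> h) \<otimes> x \<otimes> \<gamma> h) ` \<pp> = \<pp>} = stab"
proof (intro equalityI subsetI)
  fix h assume "h \<in> {h \<in> carrier G. (\<lambda>x. \<gamma> (inv\<^bsub>G\<^esub> h) \<otimes> x \<otimes> \<gamma> h) ` \<pp> = \<pp>}"
  hence h: "h \<in> carrier G" and im: "(\<lambda>x. \<gamma> (inv\<^bsub>G\<^esub> h) \<otimes> x \<otimes> \<gamma> h) ` \<pp> = \<pp>" by blast+
  obtain a where a: "a \<in> S D" "bar a = \<one>\<^bsub>Rb\<^esub> \<ominus>\<^bsub>Rb\<^esub> e" "e \<otimes>\<^bsub>Rb\<^esub> bar a = \<zero>\<^bsub>Rb\<^esub>" by (rule one_minus_e_lift)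
  have aA: "a \<in> carrier A" using a(1) S_closed by blast
  have ap: "a \<in> \<pp>" using a p by blast
  have ih: "inv\<^bsub>G\<^esub> h \<in> carrier G" using h by simp
  have cancel: "e = e \<otimes>\<^bsub>Rb\<^esub> B.cj k" if k: "k \<in> carrier G" and 0: "e \<otimes>\<^bsub>Rb\<^esub> (bar (\<gamma> k) \<otimes>\<^bsub>Rb\<^esub> bar a \<otimes>\<^bsub>Rb\<^esub> bar (\<gamma> (inv\<^bsub>G\<^esub> k))) = \<zero>\<^bsub>Rb\<^esub>" for k
  proof -
    have "bar (\<gamma> k) \<otimes>\<^bsub>Rb\<^esub> bar a \<otimes>\<^bsub>Rb\<^esub> bar (\<gamma> (inv\<^bsub>G\<^esub> k)) = \<one>\<^bsub>Rb\<^esub> \<ominus>\<^bsub>Rb\<^esub> B.cj k"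
      unfolding a(2) using k by (simp add: a_minus_def B.cj_def B.l_distr B.r_distr B.l_minus B.r_minus)
    hence "e \<otimes>\<^bsub>Rb\<^esub> (\<one>\<^bsub>Rb\<^esub> \<ominus>\<^bsub>Rb\<^esub> B.cj k) = \<zero>\<^bsub>Rb\<^esub>" using 0 by simp
    moreover have "e \<otimes>\<^bsub>Rb\<^esub> (\<one>\<^bsub>Rb\<^esub> \<ominus>\<^bsub>Rb\<^esub> B.cj k) = e \<ominus>\<^bsub>Rb\<^esub> e \<otimes>\<^bsub>Rb\<^esub> B.cj k"
      using k by (simp add: a_minus_def B.r_distr B.r_minus)
    ultimately have "e \<ominus>\<^bsub>Rb\<^esub> e \<otimes>\<^bsub>Rb\<^esub> B.cj k = \<zero>\<^bsub>Rb\<^esub>" by simp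
    thus ?thesis using k by (subst (asm) B.r_right_minus_eq) simp_all
  qed
  have 1: "e = e \<otimes>\<^bsub>Rb\<^esub> B.cj (inv\<^bsub>G\<^esub> h)"
  proof (rule cancel[OF ih])
    have "(\<lambda>x. \<gamma> (inv\<^bsub>G\<^esub> h) \<otimes> x \<otimes> \<gamma> h) a \<in> (\<lambda>x. \<gamma> (inv\<^bsub>G\<^esub> h) \<otimes> x \<otimes> \<gamma> h) ` \<pp>" by (rule imageI[OF ap])
    hence "\<gamma> (inv\<^bsub>G\<^esub> h) \<otimes> a \<otimes> \<gamma> h \<in> \<pp>" unfolding im .
    hence "e \<otimes>\<^bsub>Rb\<^esub> bar (\<gamma> (inv\<^bsub>G\<^esub> h) \<otimes> a \<otimes> \<gamma> h) = \<zero>\<^bsub>Rb\<^esub>" using p by blast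
    thus "e \<otimes>\<^bsub>Rb\<^esub> (bar (\<gamma> (inv\<^bsub>G\<^esub> h)) \<otimes>\<^bsub>Rb\<^esub> bar a \<otimes>\<^bsub>Rb\<^esub> bar (\<gamma> (inv\<^bsub>G\<^esub> (inv\<^bsub>G\<^esub> h)))) = \<zero>\<^bsub>Rb\<^esub>"
      using h aA by simp
  qed
  have 2: "e = e \<otimes>\<^bsub>Rb\<^esub> B.cj h"
  proof (rule cancel[OF h])
    have "a \<in> (\<lambda>x. \<gamma> (inv\<^bsub>G\<^esub> h) \<otimes> x \<otimes> \<gamma> h) ` \<pp>" unfolding im by (rule ap)
    then obtain x where x: "x \<in> \<pp>" "a = \<gamma> (inv\<^bsub>G\<^esub> h) \<otimes> x \<otimes> \<gamma> h" by (rule imageE) (rule that)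
    have xA: "x \<in> carrier A" using x(1) p S_closed by blast
    have "bar (\<gamma> h) \<otimes>\<^bsub>Rb\<^esub> bar a \<otimes>\<^bsub>Rb\<^esub> bar (\<gamma> (inv\<^bsub>G\<^esub> h)) = bar x"
      using h xA by (simp add: x(2) B.m_assoc)
    thus "e \<otimes>\<^bsub>Rb\<^esub> (bar (\<gamma> h) \<otimes>\<^bsub>Rb\<^esub> bar a \<otimes>\<^bsub>Rb\<^esub> bar (\<gamma> (inv\<^bsub>G\<^esub> h))) = \<zero>\<^bsub>Rb\<^esub>" using x(1) p by simp
  qed
  have "B.cj h = bar (\<gamma> h) \<otimes>\<^bsub>Rb\<^esub> (e \<otimes>\<^bsub>Rb\<^esub> B.cj (inv\<^bsub>G\<^esub> h)) \<otimes>\<^bsub>Rb\<^esub> bar (\<gamma> (inv\<^bsub>G\<^esub> h))"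
    unfolding B.cj_def[of h] 1[symmetric] ..
  also have "\<dots> = B.cj h \<otimes>\<^bsub>Rb\<^esub> e" using h by (simp add: B.cj_def B.m_assoc)
  also have "\<dots> = e \<otimes>\<^bsub>Rb\<^esub> B.cj h" by (rule B.cj_central[OF h B.e_in])
  finally have "B.cj h = e" using 2 by simp
  thus "h \<in> stab" using B.stab_iff[OF h] by simp
next
  fix h assume hs: "h \<in> stab"
  have h: "h \<in> carrier G" using hs B.stabG by blast
  have into: "\<gamma> (inv\<^bsub>G\<^esub> k) \<otimes> x \<otimes> \<gamma> k \<in> \<pp>" if k: "k \<in> stab" and x: "x \<in> \<pp>" for k x
  proof -
    have kG: "k \<in> carrier G" using k B.stabG by blast
    have xD: "x \<in> S D" and x0: "e \<otimes>\<^bsub>Rb\<^esub> bar x = \<zero>\<^bsub>Rb\<^esub>" using x p by blast+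
    have xA: "x \<in> carrier A" using xD S_closed by blast
    have "\<gamma> (inv\<^bsub>G\<^esub> k) \<otimes> x \<otimes> \<gamma> (inv\<^bsub>G\<^esub> (inv\<^bsub>G\<^esub> k)) \<in> S D"
      by (rule S_conj[OF xD]) (use kG normal.inv_op_closed2[OF B.D, of "inv\<^bsub>G\<^esub> k"] in auto)
    hence D': "\<gamma> (inv\<^bsub>G\<^esub> k) \<otimes> x \<otimes> \<gamma> k \<in> S D" using kG by simp
    have "inv\<^bsub>G\<^esub> k \<in> stab" by (rule subgroup.m_inv_closed[OF B.stab_subgroup k])
    hence c: "bar (\<gamma> (inv\<^bsub>G\<^esub> k)) \<otimes>\<^bsub>Rb\<^esub> e = e \<otimes>\<^bsub>Rb\<^esub> bar (\<gamma> (inv\<^bsub>G\<^esub> k))" by (simp add: B.stab_def)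
    have "e \<otimes>\<^bsub>Rb\<^esub> bar (\<gamma> (inv\<^bsub>G\<^esub> k) \<otimes> x \<otimes> \<gamma> k) = (e \<otimes>\<^bsub>Rb\<^esub> bar (\<gamma> (inv\<^bsub>G\<^esub> k))) \<otimes>\<^bsub>Rb\<^esub> bar x \<otimes>\<^bsub>Rb\<^esub> bar (\<gamma> k)"
      using kG xA by (simp add: B.m_assoc)
    also have "\<dots> = bar (\<gamma> (inv\<^bsub>G\<^esub> k)) \<otimes>\<^bsub>Rb\<^esub> (e \<otimes>\<^bsub>Rb\<^esub> bar x) \<otimes>\<^bsub>Rb\<^esub> bar (\<gamma> k)"
      unfolding c[symmetric] using kG xA by (simp add: B.m_assoc)
    also have "\<dots> = \<zero>\<^bsub>Rb\<^esub>" unfolding x0 using kG by simp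
    finally show ?thesis using D' p by blast
  qed
  have "\<pp> \<subseteq> (\<lambda>x. \<gamma> (inv\<^bsub>G\<^esub> h) \<otimes> x \<otimes> \<gamma> h) ` \<pp>"
  proof
    fix x assume x: "x \<in> \<pp>"
    have xA: "x \<in> carrier A" using x p S_closed by blast
    have "\<gamma> (inv\<^bsub>G\<^esub> (inv\<^bsub>G\<^esub> h)) \<otimes> x \<otimes> \<gamma> (inv\<^bsub>G\<^esub> h) \<in> \<pp>"
      by (rule into[OF subgroup.m_inv_closed[OF B.stab_subgroup hs] x])
    hence "\<gamma> h \<otimes> x \<otimes> \<gamma> (inv\<^bsub>G\<^esub> h) \<in> \<pp>" using h by simp
    moreover have "x = \<gamma> (inv\<^bsub>G\<^esub> h) \<otimes> (\<gamma> h \<otimes> x \<otimes> \<gamma> (inv\<^bsub>G\<^esub> h)) \<otimes> \<gamma> h"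
      using h xA by (simp add: m_assoc)
    ultimately show "x \<in> (\<lambda>x. \<gamma> (inv\<^bsub>G\<^esub> h) \<otimes> x \<otimes> \<gamma> h) ` \<pp>" by (intro image_eqI)
  qed
  thus "h \<in> {h \<in> carrier G. (\<lambda>x. \<gamma> (inv\<^bsub>G\<^esub> h) \<otimes> x \<otimes> \<gamma> h) ` \<pp> = \<pp>}"
    using into[OF hs] h by blast
qed

text \<open>
  As \<open>f\<close> is a central idempotent, \<open>f R (1 - f) = 0\<close>, and one of the two lifts is in the prime ideal. It is not
  the lift of \<open>f\<close>, because \<open>e f = e \<noteq> 0\<close>.
\<close>

lemma one_minus_f_in_prime:
  assumes M: "prime_ideal M A" and JM: "J \<subseteq> M"
    and MD: "\<And>x. x \<in> M \<Longrightarrow> x \<in> S D \<Longrightarrow> e \<otimes>\<^bsub>Rb\<^esub> bar x = \<zero>\<^bsub>Rb\<^esub>"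
  shows "\<one>\<^bsub>Rb\<^esub> \<ominus>\<^bsub>Rb\<^esub> B.f \<in> bar ` M"
proof -
  obtain f0 where f0: "f0 \<in> S D" "B.f = bar f0" by (rule f_lift)
  have fA: "f0 \<in> carrier A" using f0 S_closed by blast
  have gA: "\<one> \<ominus> f0 \<in> carrier A" using fA by simp
  have bg: "bar (\<one> \<ominus> f0) = \<one>\<^bsub>Rb\<^esub> \<ominus>\<^bsub>Rb\<^esub> B.f" using fA by (simp add: a_minus_def f0(2))
  have pr: "\<forall>a\<in>carrier A. \<forall>b\<in>carrier A. (\<forall>x\<in>carrier A. a \<otimes> x \<otimes> b \<in> M) \<longrightarrow> a \<in> M \<or> b \<in> M"
    using M prime_ideal_iff[of M] by (simp add: prime_ideal_def)
  have "\<forall>x\<in>carrier A. f0 \<otimes> x \<otimes> (\<one> \<ominus> f0) \<in> M"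
  proof
    fix x assume x: "x \<in> carrier A"
    have bx: "bar x \<in> carrier Rb" using x by simp
    have "bar (f0 \<otimes> x \<otimes> (\<one> \<ominus> f0)) = (B.f \<otimes>\<^bsub>Rb\<^esub> bar x) \<otimes>\<^bsub>Rb\<^esub> (\<one>\<^bsub>Rb\<^esub> \<ominus>\<^bsub>Rb\<^esub> B.f)"
      using x fA gA bg f0(2) by simp
    also have "\<dots> = bar x \<otimes>\<^bsub>Rb\<^esub> (B.f \<otimes>\<^bsub>Rb\<^esub> (\<one>\<^bsub>Rb\<^esub> \<ominus>\<^bsub>Rb\<^esub> B.f))"
      unfolding B.f_central[OF bx] using bx by (simp add: B.m_assoc)
    also have "\<dots> = \<zero>\<^bsub>Rb\<^esub>"
      using bx by (simp add: a_minus_def B.r_distr B.r_minus B.ff B.r_neg)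
    finally have "f0 \<otimes> x \<otimes> (\<one> \<ominus> f0) \<in> J" by (subst (asm) bar_zero_iff) (use x fA gA in auto)
    thus "f0 \<otimes> x \<otimes> (\<one> \<ominus> f0) \<in> M" using JM by blast
  qed
  hence "f0 \<in> M \<or> \<one> \<ominus> f0 \<in> M" using bspec[OF bspec[OF pr fA] gA] by blast
  moreover have "f0 \<notin> M"
  proof
    assume "f0 \<in> M"
    hence "e \<otimes>\<^bsub>Rb\<^esub> B.f = \<zero>\<^bsub>Rb\<^esub>" using MD[OF _ f0(1)] f0(2) by simp
    thus False using B.e_f(1) B.e_nz by simp
  qed
  ultimately show ?thesis using bg by (metis image_eqI)
qed

lemma mu_tilde_entry:
  assumes g1: "g 1 = \<one>\<^bsub>G\<^esub>"
  shows "mu_tilde A (S stab) J r es (\<lambda>i. bar (\<gamma> (g i))) (\<lambda>i. bar (\<gamma> (inv\<^bsub>G\<^esub> (g i)))) K (1, 1) =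
    (\<Union>x\<in>K. {y \<in> S stab. e \<otimes>\<^bsub>Rb\<^esub> bar y =
       bar (\<gamma> \<one>\<^bsub>G\<^esub>) \<otimes>\<^bsub>Rb\<^esub> (e \<otimes>\<^bsub>Rb\<^esub> (B.f \<otimes>\<^bsub>Rb\<^esub> bar x) \<otimes>\<^bsub>Rb\<^esub> e) \<otimes>\<^bsub>Rb\<^esub> bar (\<gamma> \<one>\<^bsub>G\<^esub>)})"
  using B.r1 g1 B.es1 by (simp add: mu_tilde_def Let_def peirce_matrix_def B.f_def)

text \<open>
  For \<open>y\<close> in \<open>Q\<close> the matrix with all entries \<open>\<NN> + y\<close> is the image of some \<open>\<MM> + x\<close> with \<open>x \<in> P\<close>; its entry
  \<open>(1, 1)\<close> gives \<open>e y = e x' e\<close> for some \<open>x'\<close> in \<open>\<MM> + x\<close>. Conversely, if \<open>e y\<close> is the image of \<open>x \<in> P\<close>, then \<open>y\<close> is in the entry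
  \<open>(1, 1)\<close> of the image of \<open>\<MM> + x\<close>, which is a coset \<open>\<NN> + z\<close> with \<open>z \<in> Q\<close>.
\<close>

lemma mem_Q_iff:
  assumes P: "ideal P A" and M: "ideal M A" "M \<subseteq> P" and JP: "J \<subseteq> P"
    and Q: "ideal Q A1" and NQ: "\<NN> \<subseteq> Q" and N0: "\<zero> \<in> \<NN>" and g1: "g 1 = \<one>\<^bsub>G\<^esub>"
    and mu: "mu_tilde A (S stab) J r es (\<lambda>i. bar (\<gamma> (g i))) (\<lambda>i. bar (\<gamma> (inv\<^bsub>G\<^esub> (g i)))) ` {M +> x | x. x \<in> P}
      = matrices r {\<NN> +>\<^bsub>A1\<^esub> y | y. y \<in> Q}" (is "?m ` _ = _")
  shows "y \<in> Q \<longleftrightarrow> y \<in> S stab \<and> e \<otimes>\<^bsub>Rb\<^esub> bar y \<in> bar ` P"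
proof -
  interpret P: ideal P A by fact
  interpret M: ideal M A by fact
  have QS: "Q \<subseteq> S stab" by (rule ideal_S_D(1)[OF Q])
  have M0: "\<zero> \<in> M" by (rule additive_subgroup.zero_closed[OF M.is_additive_subgroup])
  obtain a0 where a0: "a0 \<in> S D" "e = bar a0" by (rule e_lift)
  obtain f0 where f0: "f0 \<in> S D" "B.f = bar f0" by (rule f_lift)
  have aA: "a0 \<in> carrier A" "f0 \<in> carrier A" using a0 f0 S_closed by blast+
  have cos: "\<NN> +>\<^bsub>A1\<^esub> z = {n \<oplus> z | n. n \<in> \<NN>}" for z
    by (auto simp: a_r_coset_def')
  have cosM: "M +> z = {n \<oplus> z | n. n \<in> M}" for z
    by (auto simp: a_r_coset_def')
  show ?thesis
  proof
    assume y: "y \<in> Q"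
    have yS: "y \<in> S stab" using y QS by blast
    have yA: "y \<in> carrier A" using yS S_closed by blast
    let ?A = "\<lambda>ij\<in>{1..r} \<times> {1..r}. \<NN> +>\<^bsub>A1\<^esub> y"
    have "?A \<in> matrices r {\<NN> +>\<^bsub>A1\<^esub> y | y. y \<in> Q}" using y by (auto simp: matrices_def)
    hence "?A \<in> ?m ` {M +> x | x. x \<in> P}" unfolding mu .
    then obtain x where x: "x \<in> P" "?A = ?m (M +> x)" by blast
    have "?m (M +> x) (1, 1) = \<NN> +>\<^bsub>A1\<^esub> y" unfolding x(2)[symmetric] using B.r1 by simp
    moreover have "y = \<zero> \<oplus> y" using yA by simp
    hence "y \<in> \<NN> +>\<^bsub>A1\<^esub> y" unfolding cos using N0 by blast
    ultimately have "y \<in> ?m (M +> x) (1, 1)" by simp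
    then obtain x' where x': "x' \<in> M +> x" "e \<otimes>\<^bsub>Rb\<^esub> bar y =
       bar (\<gamma> \<one>\<^bsub>G\<^esub>) \<otimes>\<^bsub>Rb\<^esub> (e \<otimes>\<^bsub>Rb\<^esub> (B.f \<otimes>\<^bsub>Rb\<^esub> bar x') \<otimes>\<^bsub>Rb\<^esub> e) \<otimes>\<^bsub>Rb\<^esub> bar (\<gamma> \<one>\<^bsub>G\<^esub>)"
      unfolding mu_tilde_entry[OF g1] by blast
    have x'P: "x' \<in> P" using x'(1) M(2) x(1) P.a_closed unfolding cosM by blast
    have x'A: "x' \<in> carrier A" using x'P by (rule P.Icarr)
    have "e \<otimes>\<^bsub>Rb\<^esub> bar y = bar (a0 \<otimes> (f0 \<otimes> x') \<otimes> a0)"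
      using x'(2) x'A aA a0(2) f0(2) by (simp add: \<gamma>_one)
    moreover have "a0 \<otimes> (f0 \<otimes> x') \<otimes> a0 \<in> P" using x'P aA by (intro P.I_r_closed P.I_l_closed)
    ultimately show "y \<in> S stab \<and> e \<otimes>\<^bsub>Rb\<^esub> bar y \<in> bar ` P" using yS by blast
  next
    assume "y \<in> S stab \<and> e \<otimes>\<^bsub>Rb\<^esub> bar y \<in> bar ` P"
    then obtain x where y: "y \<in> S stab" and x: "x \<in> P" "e \<otimes>\<^bsub>Rb\<^esub> bar y = bar x" by blast
    have xA: "x \<in> carrier A" using x(1) by (rule P.Icarr)
    have yA: "y \<in> carrier A" using y S_closed by blast
    have "?m (M +> x) \<in> matrices r {\<NN> +>\<^bsub>A1\<^esub> y | y. y \<in> Q}" unfolding mu[symmetric] using x(1) by blast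
    hence "?m (M +> x) (1, 1) \<in> {\<NN> +>\<^bsub>A1\<^esub> y | y. y \<in> Q}"
      unfolding matrices_def by (rule PiE_mem) (use B.r1 in simp)
    then obtain z where z: "?m (M +> x) (1, 1) = \<NN> +>\<^bsub>A1\<^esub> z" "z \<in> Q"
      by (elim CollectE exE conjE) (rule that)
    have "x = \<zero> \<oplus> x" using xA by simp
    hence "x \<in> M +> x" unfolding cosM using M0 by blast
    moreover have "e \<otimes>\<^bsub>Rb\<^esub> bar y =
       bar (\<gamma> \<one>\<^bsub>G\<^esub>) \<otimes>\<^bsub>Rb\<^esub> (e \<otimes>\<^bsub>Rb\<^esub> (B.f \<otimes>\<^bsub>Rb\<^esub> bar x) \<otimes>\<^bsub>Rb\<^esub> e) \<otimes>\<^bsub>Rb\<^esub> bar (\<gamma> \<one>\<^bsub>G\<^esub>)"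
    proof -
      have "e \<otimes>\<^bsub>Rb\<^esub> (B.f \<otimes>\<^bsub>Rb\<^esub> bar x) \<otimes>\<^bsub>Rb\<^esub> e = (e \<otimes>\<^bsub>Rb\<^esub> B.f) \<otimes>\<^bsub>Rb\<^esub> (e \<otimes>\<^bsub>Rb\<^esub> bar y) \<otimes>\<^bsub>Rb\<^esub> e"
        unfolding x(2) using xA by (simp add: B.m_assoc)
      also have "\<dots> = (e \<otimes>\<^bsub>Rb\<^esub> bar y) \<otimes>\<^bsub>Rb\<^esub> e" unfolding B.e_f using yA by simp
      also have "\<dots> = e \<otimes>\<^bsub>Rb\<^esub> bar y" unfolding e_bar[OF y] using yA by (simp add: B.m_assoc B.ee)
      finally show ?thesis using xA x(2) by (simp add: \<gamma>_one)
    qed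
    ultimately have "y \<in> ?m (M +> x) (1, 1)" unfolding mu_tilde_entry[OF g1] using y by blast
    then obtain n where n: "n \<in> \<NN>" "y = n \<oplus> z" unfolding z(1) cos by blast
    thus "y \<in> Q" using NQ z(2) ideal_S_D(3)[OF Q] by blast
  qed
qed

end

section \<open>Minimal primes of completed group rings\<close>

lemma (in compact_top_group) support_ring_kG:
  "support_ring (kG :: ('g set \<Rightarrow> 'g set \<Rightarrow> 'k :: field) ring) G \<gamma> supp_in open_subgroup"
proof (intro support_ring.intro support_ring_axioms.intro kG_ring is_group)
  show "supp_in X \<subseteq> carrier kG" for X by (auto dest: supp_inD)
  show "x \<oplus>\<^bsub>kG\<^esub> y \<in> supp_in X" if "x \<in> supp_in X" "y \<in> supp_in X" for x y :: "'g set \<Rightarrow> 'g set \<Rightarrow> 'k" and X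
    by (rule supp_in_add[OF that])
  show "x \<otimes>\<^bsub>kG\<^esub> y \<in> supp_in Z" if "x \<in> supp_in X" "y \<in> supp_in Y" "\<And>p q. p \<in> X \<Longrightarrow> q \<in> Y \<Longrightarrow> p \<otimes> q \<in> Z"
    for x y :: "'g set \<Rightarrow> 'g set \<Rightarrow> 'k" and X Y Z
    by (rule supp_in_mult[OF that])
  show "x \<otimes>\<^bsub>kG\<^esub> y = y \<otimes>\<^bsub>kG\<^esub> x" if "x \<in> supp_in X" "y \<in> supp_in Y" "\<And>p q. p \<in> X \<Longrightarrow> q \<in> Y \<Longrightarrow> p \<otimes> q = q \<otimes> p"
    for x y :: "'g set \<Rightarrow> 'g set \<Rightarrow> 'k" and X Y
    by (rule supp_in_commute[OF that])
  show "open_subgroup L" if "open_subgroup K" "K \<subseteq> L" "subgroup L G" for K L by (rule open_subgroup_mono[OF that])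
qed (auto simp: supp_in_top supp_in_empty supp_in_neg group_elt_supp group_elt_one group_elt_mult
  finite_rcosets_open supp_in_split open_subgroup_def dest: supp_in_mono)

context profinite_group
begin

lemma closed_subgroup_profiniteI:
  "subgroup X G \<Longrightarrow> closedin T X \<Longrightarrow> closed_subgroup_profinite G T X"
  by (intro closed_subgroup_profinite.intro closed_subgroup.intro closed_subgroup_axioms.intro
      compact_top_group_axioms profinite_group_axioms)

lemmas completed_subring_supp = closed_subgroup_profinite.completed_subring_eq[OF closed_subgroup_profiniteI]

lemmas finite_supp_in_closed = closed_subgroup_profinite.finite_supp_in[OF closed_subgroup_profiniteI]

end

theorem theoremE:
  fixes G :: "('g, 'm) monoid_scheme" and T :: "'g topology" and p :: nat
    and kG kG1 kD :: "('g set \<Rightarrow> 'g set \<Rightarrow> 'k :: finite_field) ring"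
    and \<MM> \<pp> \<NN> J P Q :: "('g set \<Rightarrow> 'g set \<Rightarrow> 'k) set"
    and D G1 H H1 :: "'g set"
    and R :: "('g set \<Rightarrow> 'g set \<Rightarrow> 'k) set ring"
    and bar :: "('g set \<Rightarrow> 'g set \<Rightarrow> 'k) \<Rightarrow> ('g set \<Rightarrow> 'g set \<Rightarrow> 'k) set"
    and \<gamma> :: "'g \<Rightarrow> 'g set \<Rightarrow> 'g set \<Rightarrow> 'k"
    and e :: "('g set \<Rightarrow> 'g set \<Rightarrow> 'k) set"
    and es :: "nat \<Rightarrow> ('g set \<Rightarrow> 'g set \<Rightarrow> 'k) set"
    and r :: nat and g :: "nat \<Rightarrow> 'g"
  assumes "CHAR('k) = p"
    and "compact_padic_analytic_group TYPE('k) G T"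
    and "D = finite_radical G"
    and "kG = completed_group_ring G T"
    and "kD = completed_subring G T D"
    and "\<gamma> = group_elt G T"
    and "minimal_prime_ideal \<MM> kG"
    and "minimal_prime_ideal \<pp> kD" and "\<MM> \<inter> carrier kD \<subseteq> \<pp>"
    and "G1 = {h \<in> carrier G. (\<lambda>x. \<gamma> (inv\<^bsub>G\<^esub> h) \<otimes>\<^bsub>kG\<^esub> x \<otimes>\<^bsub>kG\<^esub> \<gamma> h) ` \<pp> = \<pp>}"
    and "kG1 = completed_subring G T G1"
    and "J = ideal_prod kG (jacobson_radical kD) (carrier kG)"
    and "R = kG Quot J"
    and "bar = (\<lambda>x. J +>\<^bsub>kG\<^esub> x)"
    and "centrally_primitive_idempotent (R\<lparr>carrier := bar ` carrier kD\<rparr>) e"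
    and "\<pp> = {x \<in> carrier kD. bar x \<in> complement_part R e (bar ` carrier kD)}"
    and "bij_betw es {1..r}
           {bar (\<gamma> h) \<otimes>\<^bsub>R\<^esub> e \<otimes>\<^bsub>R\<^esub> bar (\<gamma> (inv\<^bsub>G\<^esub> h)) | h. h \<in> carrier G}"
    and "es 1 = e" and "g \<in> {1..r} \<rightarrow> carrier G" and "g 1 = \<one>\<^bsub>G\<^esub>"
    and "\<And>i. i \<in> {1..r} \<Longrightarrow> bar (\<gamma> (g i)) \<otimes>\<^bsub>R\<^esub> e = es i \<otimes>\<^bsub>R\<^esub> bar (\<gamma> (g i))"
    and "\<NN> = {x \<in> carrier kG1. bar x \<in> complement_part R e (bar ` carrier kG1)}"
    and "ideal P kG" and "\<MM> \<subseteq> P"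
    and "ideal Q kG1" and "\<NN> \<subseteq> Q"
    and "mu_tilde kG (carrier kG1) J r es
           (\<lambda>i. bar (\<gamma> (g i))) (\<lambda>i. bar (\<gamma> (inv\<^bsub>G\<^esub> (g i)))) ` {\<MM> +>\<^bsub>kG\<^esub> x | x. x \<in> P}
         = matrices r {\<NN> +>\<^bsub>kG1\<^esub> y | y. y \<in> Q}"
    and "H \<lhd> G" and "closedin T H" and "D \<subseteq> H"
    and "H1 = H \<inter> G1"
  shows "(prime_ideal P kG \<longleftrightarrow> prime_ideal Q kG1) \<and>
    (controlled_by kG P (carrier (completed_subring G T H)) \<longleftrightarrow>
       controlled_by kG1 Q (carrier (completed_subring G T H1))) \<and>
    (P \<noteq> carrier kG \<longrightarrow>
       dagger G T (carrier G) P = (\<Inter>h\<in>carrier G. conj_set G (dagger G T G1 Q) h))"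
proof -
  interpret G: profinite_group G T by (rule compact_padic_analytic_profinite(1)[OF assms(2)])
  obtain U where U: "U \<in> open_normal_subgroups G T" "\<forall>u\<in>U. \<forall>n>0. u [^]\<^bsub>G\<^esub> (n :: nat) = \<one>\<^bsub>G\<^esub> \<longrightarrow> u = \<one>\<^bsub>G\<^esub>"
    using compact_padic_analytic_profinite(2)[OF assms(2)] by (elim bexE) (rule that)
  have finD: "finite D" unfolding assms(3) by (rule G.finite_radical_finite[OF U(1)]) (use U(2) in blast)
  have nD: "D \<lhd> G" unfolding assms(3) by (rule G.finite_radical_normal)
  have sD: "subgroup D G" by (rule normal_imp_subgroup[OF nD])
  have clD: "closedin T D"
    using Hausdorff_imp_t1_space[OF G.Hausdorff_T] finD subgroup.subset[OF sD] by (simp add: t1_space_closedin_finite)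
  define C where "C = {y \<in> carrier G. \<forall>x\<in>D. x \<otimes>\<^bsub>G\<^esub> y = y \<otimes>\<^bsub>G\<^esub> x}"
  have C: "G.open_subgroup C" unfolding C_def assms(3)
    by (rule G.finite_radical_centralizer_open[OF finD[unfolded assms(3)]])
  have kD: "kD = kG\<lparr>carrier := G.supp_in D\<rparr>"
    unfolding assms(4,5) by (rule G.completed_subring_supp[OF sD clD])
  have bar_kD: "bar ` carrier kD = (\<lambda>x. J +>\<^bsub>kG\<^esub> x) ` G.supp_in D" by (simp add: kD assms(14))
  interpret A: finite_normal_support kG G \<gamma> G.supp_in G.open_subgroup D C
  proof (intro finite_normal_support.intro finite_normal_support_axioms.intro)
    show "support_ring kG G \<gamma> G.supp_in G.open_subgroup" unfolding assms(4,6) by (rule G.support_ring_kG)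
    show "finite (G.supp_in D :: ('g set \<Rightarrow> 'g set \<Rightarrow> 'k) set)" by (rule G.finite_supp_in_closed[OF sD clD finD])
  qed (use nD C in \<open>auto simp: C_def\<close>)
  define j where "j = jacobson_radical kD"
  have jD: "j \<subseteq> G.supp_in D" unfolding j_def kD by (rule A.jacobson_S_D)
  have J: "J = ideal_prod kG j (carrier kG)" by (simp add: j_def assms(12))
  have JI: "ideal J kG" unfolding J j_def kD
    by (rule A.ideal_prod_ideal[OF A.jacobson_left_ideal A.jacobson_conj_invariant])
  have M: "prime_ideal \<MM> kG" using assms(7) by (simp add: minimal_prime_ideal_def)
  have MI: "ideal \<MM> kG" using M by (simp add: prime_ideal_def)
  have JM: "J \<subseteq> \<MM>" unfolding J j_def kD by (rule A.jacobson_ideal_in_prime[OF M])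
  interpret J: ideal J kG by (rule JI)
  let ?b = "\<lambda>x. J +>\<^bsub>kG\<^esub> x"
  have b: "bar x = J +>\<^bsub>kG\<^esub> x" for x by (simp add: assms(14))
  interpret B: conj_idempotent "kG Quot J" G "\<lambda>h. ?b (\<gamma> h)" "\<lambda>X. ?b ` G.supp_in X" G.open_subgroup D C e
  proof (intro conj_idempotent.intro conj_idempotent_axioms.intro)
    show "support_ring (kG Quot J) G (\<lambda>h. ?b (\<gamma> h)) (\<lambda>X. ?b ` G.supp_in X) G.open_subgroup"
      by (rule support_ring_quotient[OF A.support_ring_axioms JI])
    show "centrally_primitive_idempotent ((kG Quot J)\<lparr>carrier := ?b ` G.supp_in D\<rparr>) e"
      using assms(15) unfolding bar_kD assms(13) .
  qed (use nD C A.CD in auto)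
  have orbit: "{bar (\<gamma> h) \<otimes>\<^bsub>R\<^esub> e \<otimes>\<^bsub>R\<^esub> bar (\<gamma> (inv\<^bsub>G\<^esub> h)) | h. h \<in> carrier G} = B.cj ` carrier G"
    unfolding b assms(13) B.cj_def by (simp only: setcompr_eq_image Collect_mem_eq)
  have bij: "bij_betw es {1..r} (B.cj ` carrier G)" using assms(17) unfolding orbit .
  have orb: "conj_orbit (kG Quot J) G (\<lambda>h. ?b (\<gamma> h)) (\<lambda>X. ?b ` G.supp_in X) G.open_subgroup D C e r es g"
  proof (intro conj_orbit.intro conj_orbit_axioms.intro B.conj_idempotent_axioms)
    show "bij_betw es {1..r} (B.cj ` carrier G)" by (rule bij)
    show "es 1 = e" by (rule assms(18))
    fix i assume i: "i \<in> {1..r}"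
    show gi: "g i \<in> carrier G" using assms(19) i by blast
    have "es i \<in> B.cj ` carrier G" by (rule bij_betwE[OF bij, THEN bspec, OF i])
    hence es: "es i \<in> carrier (kG Quot J)" by (elim imageE) (simp only: B.cj_closed)
    have "?b (\<gamma> (g i)) \<otimes>\<^bsub>kG Quot J\<^esub> e = es i \<otimes>\<^bsub>kG Quot J\<^esub> ?b (\<gamma> (g i))"
      using assms(21)[OF i] unfolding b assms(13) .
    hence "B.cj (g i) = es i \<otimes>\<^bsub>kG Quot J\<^esub> ?b (\<gamma> (g i)) \<otimes>\<^bsub>kG Quot J\<^esub> ?b (\<gamma> (inv\<^bsub>G\<^esub> (g i)))"
      by (simp only: B.cj_def)
    also have "\<dots> = es i" using es gi by (simp add: B.m_assoc)
    finally show "es i = B.cj (g i)" by (rule sym)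
  qed
  interpret MC: matrix_correspondence kG G \<gamma> G.supp_in G.open_subgroup J D C e r es g j
    by (intro matrix_correspondence.intro matrix_correspondence_axioms.intro A.support_ring_axioms JI orb J jD)
      (unfold assms(4), rule G.supp_in_disjoint)
  have p: "\<pp> = {x \<in> G.supp_in D. e \<otimes>\<^bsub>kG Quot J\<^esub> ?b x = \<zero>\<^bsub>kG Quot J\<^esub>}"
    unfolding assms(16) bar_kD b assms(13) using MC.complement_part_iff[OF subset_refl] by (auto simp: kD)
  have G1: "G1 = MC.stab" unfolding assms(10) by (rule MC.stabilizer_eq_stab[OF p])
  have sG1: "subgroup G1 G" unfolding G1 by (rule B.stab_subgroup)
  have clG1: "closedin T G1" unfolding G1 by (rule G.open_subgroup_closed[OF B.stab_opn])
  have "completed_subring G T G1 = kG\<lparr>carrier := G.supp_in G1\<rparr>"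
    unfolding assms(4) by (rule G.completed_subring_supp[OF sG1 clG1])
  hence kG1: "kG1 = kG\<lparr>carrier := G.supp_in MC.stab\<rparr>" by (simp only: assms(11) G1)
  have bar_kG1: "bar ` carrier kG1 = ?b ` G.supp_in MC.stab" by (simp add: kG1 b)
  have N0: "\<zero>\<^bsub>kG\<^esub> \<in> \<NN>"
    unfolding assms(22) bar_kG1 b assms(13)
    using MC.complement_part_iff[OF B.D_stab A.S_zero] A.S_zero by (simp add: kG1)
  have Q: "ideal Q (kG\<lparr>carrier := G.supp_in MC.stab\<rparr>)" using assms(25) unfolding kG1 .
  have JP: "J \<subseteq> P" using JM assms(24) by blast
  have mu: "mu_tilde kG (G.supp_in MC.stab) J r es (\<lambda>i. ?b (\<gamma> (g i))) (\<lambda>i. ?b (\<gamma> (inv\<^bsub>G\<^esub> (g i)))) `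
      {\<MM> +>\<^bsub>kG\<^esub> x | x. x \<in> P} = matrices r {\<NN> +>\<^bsub>kG\<lparr>carrier := G.supp_in MC.stab\<rparr>\<^esub> y | y. y \<in> Q}"
    using assms(27) unfolding b kG1 by simp
  interpret IC: ideal_correspondence kG G \<gamma> G.supp_in G.open_subgroup J D C e r es g j P Q
  proof (intro ideal_correspondence.intro ideal_correspondence_axioms.intro MC.matrix_correspondence_axioms assms(23) JP Q)
    have "e \<otimes>\<^bsub>kG Quot J\<^esub> ?b x = \<zero>\<^bsub>kG Quot J\<^esub>" if "x \<in> \<MM>" "x \<in> G.supp_in D" for x
    proof -
      have "x \<in> \<pp>" using assms(9) that by (auto simp: kD)
      thus ?thesis using p by blast
    qed
    hence "\<one>\<^bsub>kG Quot J\<^esub> \<ominus>\<^bsub>kG Quot J\<^esub> MC.B.f \<in> ?b ` \<MM>"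
      by (rule MC.one_minus_f_in_prime[OF M JM])
    thus "\<one>\<^bsub>kG Quot J\<^esub> \<ominus>\<^bsub>kG Quot J\<^esub> MC.B.f \<in> ?b ` P"
      by (rule subsetD[OF image_mono[OF assms(24)]])
    show "y \<in> Q \<longleftrightarrow> y \<in> G.supp_in MC.stab \<and> e \<otimes>\<^bsub>kG Quot J\<^esub> ?b y \<in> ?b ` P" for y
      by (rule MC.mem_Q_iff[OF assms(23) MI assms(24) JP Q assms(26) N0 assms(20) mu])
  qed
  have sH: "subgroup H G" by (rule normal_imp_subgroup[OF assms(28)])
  have H1: "H1 = H \<inter> MC.stab" by (simp add: assms(31) G1)
  have sH1: "subgroup H1 G" unfolding assms(31) by (rule G.subgroups_Inter_pair[OF sH sG1])
  have clH1: "closedin T H1" unfolding assms(31) by (rule closedin_Int[OF assms(29) clG1])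
  have cH: "carrier (completed_subring G T H) = (G.supp_in H :: ('g set \<Rightarrow> 'g set \<Rightarrow> 'k) set)"
    by (simp add: G.completed_subring_supp[OF sH assms(29)])
  have cH1: "carrier (completed_subring G T H1) = (G.supp_in (H \<inter> MC.stab) :: ('g set \<Rightarrow> 'g set \<Rightarrow> 'k) set)"
    unfolding H1[symmetric]
    by (simp add: G.completed_subring_supp[OF sH1 clH1])
  have "prime_ideal P kG \<longleftrightarrow> prime_ideal Q kG1" unfolding kG1 by (rule IC.prime_iff)
  moreover have "controlled_by kG P (carrier (completed_subring G T H)) \<longleftrightarrow>
      controlled_by kG1 Q (carrier (completed_subring G T H1))"
    unfolding cH cH1 kG1 by (rule IC.control_iff[OF assms(28,30)])
  moreover have "dagger G T (carrier G) P = (\<Inter>h\<in>carrier G. conj_set G (dagger G T G1 Q) h)" if ne: "P \<noteq> carrier kG"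
  proof -
    have dP: "dagger G T (carrier G) P = {x \<in> carrier G. \<gamma> x \<ominus>\<^bsub>kG\<^esub> \<one>\<^bsub>kG\<^esub> \<in> P}"
      and dQ: "dagger G T G1 Q = {x \<in> MC.stab. \<gamma> x \<ominus>\<^bsub>kG\<^esub> \<one>\<^bsub>kG\<^esub> \<in> Q}" (is "_ = ?Q")
      by (simp_all only: dagger_def assms(4,6) G1)
    have cs: "x \<in> conj_set G ?Q h \<longleftrightarrow> x \<in> carrier G \<and> h \<otimes>\<^bsub>G\<^esub> x \<otimes>\<^bsub>G\<^esub> inv\<^bsub>G\<^esub> h \<in> ?Q" if h: "h \<in> carrier G" for x h
    proof
      assume "x \<in> conj_set G ?Q h"
      then obtain k where k: "k \<in> ?Q" "x = inv\<^bsub>G\<^esub> h \<otimes>\<^bsub>G\<^esub> k \<otimes>\<^bsub>G\<^esub> h" unfolding conj_set_def by (rule imageE) (rule that)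
      have kG: "k \<in> carrier G" using k(1) B.stabG by blast
      have "h \<otimes>\<^bsub>G\<^esub> x \<otimes>\<^bsub>G\<^esub> inv\<^bsub>G\<^esub> h = k" using h kG by (simp add: k(2) G.m_assoc)
      thus "x \<in> carrier G \<and> h \<otimes>\<^bsub>G\<^esub> x \<otimes>\<^bsub>G\<^esub> inv\<^bsub>G\<^esub> h \<in> ?Q" using k h kG by simp
    next
      assume x: "x \<in> carrier G \<and> h \<otimes>\<^bsub>G\<^esub> x \<otimes>\<^bsub>G\<^esub> inv\<^bsub>G\<^esub> h \<in> ?Q"
      hence "x = inv\<^bsub>G\<^esub> h \<otimes>\<^bsub>G\<^esub> (h \<otimes>\<^bsub>G\<^esub> x \<otimes>\<^bsub>G\<^esub> inv\<^bsub>G\<^esub> h) \<otimes>\<^bsub>G\<^esub> h" using h by (simp add: G.m_assoc)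
      thus "x \<in> conj_set G ?Q h" unfolding conj_set_def by (rule image_eqI) (use x in blast)
    qed
    show ?thesis
    proof (rule Set.set_eqI)
      fix x
      have "x \<in> dagger G T (carrier G) P \<longleftrightarrow> x \<in> carrier G \<and> (\<forall>h\<in>carrier G. h \<otimes>\<^bsub>G\<^esub> x \<otimes>\<^bsub>G\<^esub> inv\<^bsub>G\<^esub> h \<in> ?Q)"
        unfolding dP using IC.dagger_iff[OF ne, of x] by blast
      also have "\<dots> \<longleftrightarrow> (\<forall>h\<in>carrier G. x \<in> carrier G \<and> h \<otimes>\<^bsub>G\<^esub> x \<otimes>\<^bsub>G\<^esub> inv\<^bsub>G\<^esub> h \<in> ?Q)"
        using G.one_closed by blast
      also have "\<dots> \<longleftrightarrow> x \<in> (\<Inter>h\<in>carrier G. conj_set G (dagger G T G1 Q) h)"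
        unfolding dQ using cs by blast
      finally show "x \<in> dagger G T (carrier G) P \<longleftrightarrow> x \<in> (\<Inter>h\<in>carrier G. conj_set G (dagger G T G1 Q) h)" .
    qed
  qed
  ultimately show ?thesis by blast
qed

end
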